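(* Let $X$ be an integral regular projective curve of genus $g$ over a finite field $\mathbb{F}_q$, let $n\ge1$ and $Q=q^n$. Assume the rank $n$ Riemann hypothesis for $X/\mathbb{F}_q$. Then the following hold. (1) $(Q+1)-2g\sqrt Q\ \le\ \alpha'_{X,\mathbb{F}_q;n}(n)\ \le\ (Q+1)+2g\sqrt Q.$ (2) For $2\le m\le g-1$, $$\left|\alpha'_{X,\mathbb{F}_q;n}(mn)-\left(Q^m+\dots+Q^2+Q+1\right)\right|\ \le\ \sum_{k=3}^{m+1}Q^{k-3}\sum_{i=1}^{k}\binom{2g}{i-1}Q^{(i-1)/2}+2g\,Q^{m-1}\sqrt Q.$$ (3) $$\left|(Q-1)\,\beta'_{X,\mathbb{F}_q;n}(0)-\left(Q^g+\dots+Q^2+Q+1\right)\right|\ \le\ \sum_{k=3}^{g+1}Q^{k-3}\sum_{i=1}^{k}\binom{2g}{i-1}Q^{(i-1)/2}+2g\,Q^{g-1}\sqrt Q.$$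
   Context: $X$ is an integral regular projective curve over $\mathbb{F}_q$ with $H^0(X,\mathcal{O}_X)=\mathbb{F}_q$. For $d\in\mathbb{Z}$ put $$\alpha_{X,\mathbb{F}_q;n}(d)=\sum_{\mathcal{E}}\frac{q^{h^0(X,\mathcal{E})}-1}{\#\mathrm{Aut}(\mathcal{E})},\qquad \beta_{X,\mathbb{F}_q;n}(d)=\sum_{\mathcal{E}}\frac{1}{\#\mathrm{Aut}(\mathcal{E})},$$ both sums over isomorphism classes of semi-stable vector bundles $\mathcal{E}$ on $X$ (over $\mathbb{F}_q$) of rank $n$ and degree $d$. One has $\alpha_{X,\mathbb{F}_q;n}(0)>0$; put $$\alpha'_{X,\mathbb{F}_q;n}(mn)=\frac{\alpha_{X,\mathbb{F}_q;n}(mn)}{\alpha_{X,\mathbb{F}_q;n}(0)},\qquad \beta'_{X,\mathbb{F}_q;n}(0)=\frac{\beta_{X,\mathbb{F}_q;n}(0)}{\alpha_{X,\mathbb{F}_q;n}(0)}.$$ The rank $n$ zeta function is, with $T=q^{-ns}$, $\widehat\zeta_{X,\mathbb{F}_q;n}(s)=\widehat Z_{X,\mathbb{F}_q;n}(T)=\sum_{m\ge0}\alpha_{X,\mathbb{F}_q;n}(mn)T^{m-(g-1)}$. It is a rational function of $T$, and $P_{X,\mathbb{F}_q;n}(T):=T^{g-1}(1-T)(1-QT)\widehat Z_{X,\mathbb{F}_q;n}(T)$ is a polynomial of degree $2g$ with real coefficients. The rank $n$ Riemann hypothesis for $X/\mathbb{F}_q$ is the statement that all complex roots of $P_{X,\mathbb{F}_q;n}(T)$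 have absolute value $Q^{-1/2}$ (equivalently all zeros $s$ of $\widehat\zeta_{X,\mathbb{F}_q;n}(s)$ have $\Re(s)=\frac12$). Empty sums (such as $\sum_{k=3}^{2}$) are $0$. *)

theory Defs
  imports
    "HOL-Analysis.Analysis"
    "HOL-Library.Function_Algebras"
    "HOL-Computational_Algebra.Computational_Algebra"
begin

text \<open>
  Integral projective schemes are described as projective models (Zariski--Samuel, vol. II, ch. VI,
  par. 17; EGA I, par. 8): such a scheme over \<open>k\<close> is identified with the set of its local rings, viewed as
  subrings of the function field \<open>K\<close>.  The finite base field \<open>k = F_q\<close> is the type \<open>'k\<close>, the
  function field is the type \<open>'a\<close>, the structure morphism is an embedding \<open>\<iota> :: 'k \<Rightarrow> 'a\<close>, and a
  curve \<open>X\<close> is a set of subrings of \<open>'a\<close>.  A point \<open>R \<in> X\<close> is its own local ring; the generic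
  point is \<open>UNIV\<close>.
\<close>

section \<open>Integral regular projective curves\<close>

definition field_embedding :: "('k::field \<Rightarrow> 'a::field) \<Rightarrow> bool" where
  "field_embedding \<iota> \<longleftrightarrow>
     \<iota> 1 = 1 \<and> (\<forall>a b. \<iota> (a + b) = \<iota> a + \<iota> b) \<and> (\<forall>a b. \<iota> (a * b) = \<iota> a * \<iota> b)"

definition is_subring :: "'a::field set \<Rightarrow> bool" where
  "is_subring R \<longleftrightarrow> 0 \<in> R \<and> 1 \<in> R \<and> (\<forall>a\<in>R. \<forall>b\<in>R. a - b \<in> R \<and> a * b \<in> R)"

definition adjoin :: "('k::field \<Rightarrow> 'a::field) \<Rightarrow> 'a set \<Rightarrow> 'a set" where
  "adjoin \<iota> S = \<Inter>{R. is_subring R \<and> range \<iota> \<subseteq> R \<and> S \<subseteq> R}"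

definition prime_ideal_of :: "'a::field set \<Rightarrow> 'a set \<Rightarrow> bool" where
  "prime_ideal_of A p \<longleftrightarrow>
     p \<subseteq> A \<and> 0 \<in> p \<and> (\<forall>a\<in>p. \<forall>b\<in>p. a + b \<in> p) \<and> (\<forall>a\<in>A. \<forall>b\<in>p. a * b \<in> p) \<and>
     1 \<notin> p \<and> (\<forall>a\<in>A. \<forall>b\<in>A. a * b \<in> p \<longrightarrow> a \<in> p \<or> b \<in> p)"

definition localization_at :: "'a::field set \<Rightarrow> 'a set \<Rightarrow> 'a set" where
  "localization_at A p = {a / s | a s. a \<in> A \<and> s \<in> A - p}"

text \<open>
  For homogeneous coordinates \<open>x 0, \<dots>, x N\<close> (the images in \<open>K\<close>, up to a common factor, of the
  coordinates of \<open>P^N\<close>), \<open>chart \<iota> N x i\<close> is the coordinate ring \<open>k[x 0 / x i, \<dots>, x N / x i]\<close> of the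
  intersection of the scheme with the standard affine open set where the \<open>i\<close>-th coordinate does
  not vanish.
\<close>

definition chart :: "('k::field \<Rightarrow> 'a::field) \<Rightarrow> nat \<Rightarrow> (nat \<Rightarrow> 'a) \<Rightarrow> nat \<Rightarrow> 'a set" where
  "chart \<iota> N x i = adjoin \<iota> ((\<lambda>j. x j / x i) ` {..N})"

definition projective_model :: "('k::field \<Rightarrow> 'a::field) \<Rightarrow> nat \<Rightarrow> (nat \<Rightarrow> 'a) \<Rightarrow> 'a set set" where
  "projective_model \<iota> N x =
     {localization_at (chart \<iota> N x i) p | i p.
        i \<le> N \<and> x i \<noteq> 0 \<and> prime_ideal_of (chart \<iota> N x i) p}"

definition integral_projective :: "('k::field \<Rightarrow> 'a::field) \<Rightarrow> 'a set set \<Rightarrow> bool" where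
  "integral_projective \<iota> X \<longleftrightarrow>
     (\<exists>N x. (\<exists>i\<le>N. x i \<noteq> 0) \<and>
            (\<forall>i\<le>N. x i \<noteq> 0 \<longrightarrow>
               (\<forall>y. \<exists>a\<in>chart \<iota> N x i. \<exists>b\<in>chart \<iota> N x i. b \<noteq> 0 \<and> y = a / b)) \<and>
            X = projective_model \<iota> N x)"

text \<open>The dimension of an integral scheme of finite type over a field is the transcendence degree
  of its function field; the second clause says that every \<open>y\<close> is algebraic over \<open>k(t)\<close>.\<close>

definition transcendence_degree_one :: "('k::field \<Rightarrow> 'a::field) \<Rightarrow> bool" where
  "transcendence_degree_one \<iota> \<longleftrightarrow>
     (\<exists>t. (\<forall>p::'k poly. p \<noteq> 0 \<longrightarrow> poly (map_poly \<iota> p) t \<noteq> 0) \<and>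
          (\<forall>y. \<exists>P::'k poly poly. P \<noteq> 0 \<and>
             poly (map_poly (\<lambda>p. poly (map_poly \<iota> p) t) P) y = 0))"

definition max_ideal :: "'a::field set \<Rightarrow> 'a set" where
  "max_ideal R = {a \<in> R. a = 0 \<or> inverse a \<notin> R}"

definition uniformizer :: "'a::field set \<Rightarrow> 'a \<Rightarrow> bool" where
  "uniformizer R t \<longleftrightarrow> max_ideal R = (\<lambda>a. a * t) ` R"

text \<open>All local rings of a curve are Noetherian of dimension at most one, so such a ring is regular
  iff its maximal ideal is principal (for the generic point, take \<open>t = 0\<close>).\<close>

definition regular_model :: "'a::field set set \<Rightarrow> bool" where
  "regular_model X \<longleftrightarrow> (\<forall>R\<in>X. \<exists>t. uniformizer R t)"

definition regular_projective_curve :: "('k::field \<Rightarrow> 'a::field) \<Rightarrow> 'a set set \<Rightarrow> bool" where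
  "regular_projective_curve \<iota> X \<longleftrightarrow>
     field_embedding \<iota> \<and> integral_projective \<iota> X \<and> transcendence_degree_one \<iota> \<and> regular_model X"

text \<open>A rational function is regular at a point iff it lies in the local ring, and the domains of
  definition of rational functions generate the Zariski topology.\<close>

definition zariski :: "'a::field set set \<Rightarrow> 'a set topology" where
  "zariski X = topology_generated_by (range (\<lambda>y. {R \<in> X. y \<in> R}))"

definition opens :: "'a::field set set \<Rightarrow> 'a set set set" where
  "opens X = {U. openin (zariski X) U \<and> U \<noteq> {}}"

text \<open>The structure sheaf; used for non-empty open sets \<open>U\<close> only.\<close>

definition struct_sheaf :: "'a::field set set \<Rightarrow> 'a set" where
  "struct_sheaf U = \<Inter>U"

definition closed_points :: "'a::field set set \<Rightarrow> 'a set set" where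
  "closed_points X = X - {UNIV}"

definition ord_at :: "'a::field set \<Rightarrow> 'a \<Rightarrow> int" where
  "ord_at R f =
     (THE m. \<exists>t u. uniformizer R t \<and> u \<in> R - max_ideal R \<and> f = u * t powi m)"

text \<open>\<open>dim (A / B)\<close> for subspaces \<open>B \<subseteq> A\<close>, computed on a complement of \<open>B\<close> in \<open>A\<close>.\<close>

definition quotient_dim ::
  "('k::field \<Rightarrow> 'v::ab_group_add \<Rightarrow> 'v) \<Rightarrow> 'v set \<Rightarrow> 'v set \<Rightarrow> nat" where
  "quotient_dim smul A B =
     vector_space.dim smul
       (SOME C. module.subspace smul C \<and> C \<inter> B = {0} \<and> A = {c + b | c b. c \<in> C \<and> b \<in> B})"

definition residue_degree :: "('k::field \<Rightarrow> 'a::field) \<Rightarrow> 'a set \<Rightarrow> nat" where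
  "residue_degree \<iota> R = quotient_dim (\<lambda>c a. \<iota> c * a) R (max_ideal R)"

text \<open>
  The genus is \<open>dim H^1(X, O_X)\<close>.  The constant sheaf \<open>K\<close> is flasque, so \<open>H^1(X, O_X)\<close> is the
  cokernel of \<open>K \<rightarrow> H^0(X, K / O_X)\<close>.  A section of \<open>K / O_X\<close> is a family \<open>s R mod R\<close>, for \<open>R \<in> X\<close>,
  which is locally induced by a single rational function.
\<close>

definition principal_parts :: "'a::field set set \<Rightarrow> ('a set \<Rightarrow> 'a) set" where
  "principal_parts X =
     {s. \<forall>R\<in>X. \<exists>U\<in>opens X. R \<in> U \<and> (\<exists>f. \<forall>S\<in>U. s S - f \<in> S)}"

definition trivial_principal_parts :: "'a::field set set \<Rightarrow> ('a set \<Rightarrow> 'a) set" where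
  "trivial_principal_parts X = {s. \<exists>f. \<forall>R\<in>X. s R - f \<in> R}"

definition genus :: "('k::field \<Rightarrow> 'a::field) \<Rightarrow> 'a set set \<Rightarrow> nat" where
  "genus \<iota> X =
     quotient_dim (\<lambda>c s R. \<iota> c * s R) (principal_parts X) (trivial_principal_parts X)"


section \<open>Vector bundles\<close>

text \<open>
  A torsion-free sheaf embeds in the constant sheaf given by its generic stalk.  Choosing an
  embedding of the generic stalk in some \<open>K^n\<close>, vector bundles are therefore (up to isomorphism) the
  locally free \<open>O_X\<close>-submodules of the constant sheaf \<open>K^n\<close>; those with generic stalk \<open>K^n\<close>
  represent all bundles of rank \<open>n\<close>, and their subbundles are again of this form, with smaller
  rank.  The section functor \<open>E\<close> is only relevant on non-empty open sets; restriction maps are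
  inclusions.  Any two non-empty open sets meet, so a compatible family of sections is just a
  common element and gluing reads \<open>E (\<Union>\<U>) = (\<Inter>U\<in>\<U>. E U)\<close>.
\<close>

type_synonym ('a, 'n) subsheaf = "'a set set \<Rightarrow> ('a ^ 'n) set"

definition module_subsheaf :: "'a::field set set \<Rightarrow> ('a, 'n::finite) subsheaf \<Rightarrow> bool" where
  "module_subsheaf X E \<longleftrightarrow>
     (\<forall>U\<in>opens X. 0 \<in> E U \<and> (\<forall>v\<in>E U. \<forall>w\<in>E U. v + w \<in> E U) \<and>
        (\<forall>a\<in>struct_sheaf U. \<forall>v\<in>E U. a *s v \<in> E U)) \<and>
     (\<forall>\<U>. \<U> \<subseteq> opens X \<and> \<U> \<noteq> {} \<longrightarrow> E (\<Union>\<U>) = (\<Inter>U\<in>\<U>. E U))"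

definition lin_indep :: "nat \<Rightarrow> (nat \<Rightarrow> 'a::field ^ 'n::finite) \<Rightarrow> bool" where
  "lin_indep r b \<longleftrightarrow> (\<forall>c. (\<Sum>i<r. c i *s b i) = 0 \<longrightarrow> (\<forall>i<r. c i = 0))"

definition local_frame ::
  "'a::field set set \<Rightarrow> nat \<Rightarrow> ('a, 'n::finite) subsheaf \<Rightarrow> 'a set set \<Rightarrow> (nat \<Rightarrow> 'a ^ 'n) \<Rightarrow> bool" where
  "local_frame X r E U b \<longleftrightarrow> lin_indep r b \<and>
     (\<forall>W\<in>opens X. W \<subseteq> U \<longrightarrow> E W = {\<Sum>i<r. c i *s b i | c. \<forall>i<r. c i \<in> struct_sheaf W})"

definition vector_bundle :: "'a::field set set \<Rightarrow> nat \<Rightarrow> ('a, 'n::finite) subsheaf \<Rightarrow> bool" where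
  "vector_bundle X r E \<longleftrightarrow> module_subsheaf X E \<and>
     (\<forall>R\<in>X. \<exists>U\<in>opens X. R \<in> U \<and> (\<exists>b. local_frame X r E U b))"

text \<open>The degree is \<open>deg E = deg (det E)\<close>: for rational sections \<open>e 0, \<dots>, e (r - 1)\<close> of \<open>E\<close> forming
  a basis of the generic stalk, it is the degree of the divisor of the rational section
  \<open>e 0 \<and> \<dots> \<and> e (r - 1)\<close> of \<open>det E\<close>.  The order of that section at a point is the order of the
  determinant expressing \<open>e\<close> in a local frame.  The ranks of subbundles are numbers, not
  types, hence the Leibniz formula.\<close>

definition leibniz_det :: "nat \<Rightarrow> (nat \<Rightarrow> nat \<Rightarrow> 'a::field) \<Rightarrow> 'a" where
  "leibniz_det r M = (\<Sum>p | p permutes {..<r}. of_int (sign p) * (\<Prod>i<r. M i (p i)))"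

definition rational_frame ::
  "'a::field set set \<Rightarrow> nat \<Rightarrow> ('a, 'n::finite) subsheaf \<Rightarrow> (nat \<Rightarrow> 'a ^ 'n) \<Rightarrow> bool" where
  "rational_frame X r E e \<longleftrightarrow> lin_indep r e \<and> (\<forall>i<r. e i \<in> (\<Union>U\<in>opens X. E U))"

definition frame_ord ::
  "'a::field set set \<Rightarrow> nat \<Rightarrow> ('a, 'n::finite) subsheaf \<Rightarrow> (nat \<Rightarrow> 'a ^ 'n) \<Rightarrow> 'a set \<Rightarrow> int" where
  "frame_ord X r E e R =
     (THE m. \<exists>U\<in>opens X. \<exists>b M. R \<in> U \<and> local_frame X r E U b \<and>
        (\<forall>i<r. e i = (\<Sum>j<r. M i j *s b j)) \<and> m = ord_at R (leibniz_det r M))"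

definition bundle_degree ::
  "('k::field \<Rightarrow> 'a::field) \<Rightarrow> 'a set set \<Rightarrow> nat \<Rightarrow> ('a, 'n::finite) subsheaf \<Rightarrow> int" where
  "bundle_degree \<iota> X r E =
     (let e = (SOME e. rational_frame X r E e) in
      (\<Sum>R | R \<in> closed_points X \<and> frame_ord X r E e R \<noteq> 0.
         int (residue_degree \<iota> R) * frame_ord X r E e R))"

definition semistable ::
  "('k::field \<Rightarrow> 'a::field) \<Rightarrow> 'a set set \<Rightarrow> nat \<Rightarrow> ('a, 'n::finite) subsheaf \<Rightarrow> bool" where
  "semistable \<iota> X r E \<longleftrightarrow> vector_bundle X r E \<and>
     (\<forall>s F. 0 < s \<and> vector_bundle X s F \<and> (\<forall>U\<in>opens X. F U \<subseteq> E U) \<longrightarrow>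
        real_of_int (bundle_degree \<iota> X s F) / real s \<le> real_of_int (bundle_degree \<iota> X r E) / real r)"

text \<open>Since restriction maps are inclusions, a compatible family of maps \<open>E U \<rightarrow> E' U\<close> is a single
  map on \<open>\<Union>U. E U\<close>, the generic stalk.  For a bundle of rank \<open>CARD('n)\<close> this is all of \<open>'a ^ 'n\<close>, so
  distinct functions below are distinct isomorphisms.\<close>

definition bundle_iso ::
  "'a::field set set \<Rightarrow> ('a, 'n::finite) subsheaf \<Rightarrow> ('a, 'n) subsheaf \<Rightarrow> ('a ^ 'n \<Rightarrow> 'a ^ 'n) \<Rightarrow> bool" where
  "bundle_iso X E E' \<phi> \<longleftrightarrow>
     (\<forall>U\<in>opens X. bij_betw \<phi> (E U) (E' U) \<and>
        (\<forall>v\<in>E U. \<forall>w\<in>E U. \<phi> (v + w) = \<phi> v + \<phi> w) \<and>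
        (\<forall>a\<in>struct_sheaf U. \<forall>v\<in>E U. \<phi> (a *s v) = a *s \<phi> v))"

definition Aut :: "'a::field set set \<Rightarrow> ('a, 'n::finite) subsheaf \<Rightarrow> ('a ^ 'n \<Rightarrow> 'a ^ 'n) set" where
  "Aut X E = {\<phi>. bundle_iso X E E \<phi>}"

definition h0 :: "('k::field \<Rightarrow> 'a::field) \<Rightarrow> 'a set set \<Rightarrow> ('a, 'n::finite) subsheaf \<Rightarrow> nat" where
  "h0 \<iota> X E = vector_space.dim (\<lambda>c v. \<iota> c *s v) (E X)"


section \<open>The rank n zeta function\<close>

text \<open>The rank is \<open>n = CARD('n)\<close>, and \<open>q = CARD('k)\<close>.\<close>

definition semistable_bundles ::
  "('k::field \<Rightarrow> 'a::field) \<Rightarrow> 'a set set \<Rightarrow> int \<Rightarrow> ('a, 'n::finite) subsheaf set" where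
  "semistable_bundles \<iota> X d =
     {E. semistable \<iota> X CARD('n) E \<and> bundle_degree \<iota> X CARD('n) E = d}"

definition semistable_classes ::
  "('k::field \<Rightarrow> 'a::field) \<Rightarrow> 'a set set \<Rightarrow> int \<Rightarrow> ('a, 'n::finite) subsheaf set set" where
  "semistable_classes \<iota> X d =
     semistable_bundles \<iota> X d //
       {(E, E'). E \<in> semistable_bundles \<iota> X d \<and> E' \<in> semistable_bundles \<iota> X d \<and>
                 (\<exists>\<phi>. bundle_iso X E E' \<phi>)}"

text \<open>The type argument fixes the rank.  The summands do not depend on the representative of the
  isomorphism class.\<close>

definition \<alpha> ::
  "'n::finite itself \<Rightarrow> ('k::{field,finite} \<Rightarrow> 'a::field) \<Rightarrow> 'a set set \<Rightarrow> int \<Rightarrow> real" where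
  "\<alpha> _ \<iota> X d =
     (\<Sum>\<^sub>\<infinity>c \<in> (semistable_classes \<iota> X d :: ('a, 'n) subsheaf set set).
        let E = (SOME E. E \<in> c) in
        (real CARD('k) ^ h0 \<iota> X E - 1) / real (card (Aut X E)))"

definition \<beta> ::
  "'n::finite itself \<Rightarrow> ('k::{field,finite} \<Rightarrow> 'a::field) \<Rightarrow> 'a set set \<Rightarrow> int \<Rightarrow> real" where
  "\<beta> _ \<iota> X d =
     (\<Sum>\<^sub>\<infinity>c \<in> (semistable_classes \<iota> X d :: ('a, 'n) subsheaf set set).
        let E = (SOME E. E \<in> c) in 1 / real (card (Aut X E)))"

definition \<alpha>' ::
  "'n::finite itself \<Rightarrow> ('k::{field,finite} \<Rightarrow> 'a::field) \<Rightarrow> 'a set set \<Rightarrow> int \<Rightarrow> real" where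
  "\<alpha>' n \<iota> X d = \<alpha> n \<iota> X d / \<alpha> n \<iota> X 0"

definition \<beta>' ::
  "'n::finite itself \<Rightarrow> ('k::{field,finite} \<Rightarrow> 'a::field) \<Rightarrow> 'a set set \<Rightarrow> int \<Rightarrow> real" where
  "\<beta>' n \<iota> X d = \<beta> n \<iota> X d / \<alpha> n \<iota> X 0"

text \<open>The zeta function as a Laurent series in \<open>T\<close>; \<open>fls_shift (g - 1)\<close> multiplies by
  \<open>T^(-(g - 1))\<close>.\<close>

definition Z_hat ::
  "'n::finite itself \<Rightarrow> ('k::{field,finite} \<Rightarrow> 'a::field) \<Rightarrow> 'a set set \<Rightarrow> real fls" where
  "Z_hat n \<iota> X =
     fls_shift (int (genus \<iota> X) - 1)
       (fps_to_fls (Abs_fps (\<lambda>m. \<alpha> n \<iota> X (int m * int CARD('n)))))"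

definition P_series ::
  "'n::finite itself \<Rightarrow> ('k::{field,finite} \<Rightarrow> 'a::field) \<Rightarrow> 'a set set \<Rightarrow> real fls" where
  "P_series n \<iota> X =
     fls_X_intpow (int (genus \<iota> X) - 1) * (1 - fls_X) *
       (1 - fls_const (real CARD('k) ^ CARD('n)) * fls_X) * Z_hat n \<iota> X"

text \<open>The roots make sense because \<open>P_series\<close> is a polynomial, necessarily unique.\<close>

definition rank_riemann_hypothesis ::
  "'n::finite itself \<Rightarrow> ('k::{field,finite} \<Rightarrow> 'a::field) \<Rightarrow> 'a set set \<Rightarrow> bool" where
  "rank_riemann_hypothesis n \<iota> X \<longleftrightarrow>
     (\<exists>P :: real poly. fps_to_fls (fps_of_poly P) = P_series n \<iota> X \<and>
        (\<forall>z::complex. poly (map_poly complex_of_real P) z = 0 \<longrightarrow>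
           cmod z = (real CARD('k) ^ CARD('n)) powr (- 1 / 2)))"

end

theory Submission
  imports Defs "Jordan_Normal_Form.Determinant"
begin

text \<open>
  Only two facts about the curve are needed: with \<open>P = (1 - T) (1 - Q T) \<Sum>m. \<alpha>(m n) T^m\<close>,
  one has \<open>P(1) = (Q - 1) \<beta>(0)\<close> and \<open>P(1) = Q^g P(1 / Q)\<close>.  Both follow from
  \<open>\<alpha>(m n) = (Q^(m + 1 - g) - 1) \<beta>(0)\<close> for two large values of \<open>m\<close>.  For a semistable bundle \<open>E\<close>
  of large slope, \<open>h0(E) = deg E + n (1 - g)\<close>: the generic stalk has a flag for which all graded
  pieces of \<open>E\<close> are divisors with vanishing \<open>H^1\<close>, constructed step by step, since by semistability the
  quotient of \<open>E\<close> by a step of the flag has large degree and hence, by Riemann's inequality, enough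
  sections.  All dimensions are computed by counting elements of groups, the base field being
  finite.  Twisting by multiples of the polar divisor of a function, of degree \<open>\<delta>\<close>, then gives
  \<open>\<beta>(k \<delta> n) = \<beta>(0)\<close>; no divisor of degree one is needed.

  Since all roots of \<open>P\<close> lie on the circle of radius \<open>Q^(-1/2)\<close>, the second fact forces
  \<open>deg P = 2 g\<close> and the functional equation.  For \<open>x j = coeff P j / coeff P 0\<close> this gives
  \<open>\<bar>x j\<bar> \<le> (2 g choose j) Q^(j/2)\<close>, and the invariants are \<open>\<alpha>'(m n) = \<Sum>j\<le>m. x j (1 + \<dots> + Q^(m - j))\<close>
  and \<open>(Q - 1) \<beta>'(0) = \<Sum>j\<le>2 g. x j\<close>.
\<close>

section \<open>Cosets in abelian groups\<close>

text \<open>For \<open>m\<close> at least the degree of \<open>P\<close>, the coefficient of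
  \<open>T^m\<close> in \<open>P / ((1 - T) (1 - Q T))\<close> gives
  \<open>(Q - 1) \<alpha>(m n) = Q^(m + 1) P(1 / Q) - P(1)\<close>. Comparison with
  \<open>(Q - 1) (Q^(m + 1 - g) - 1) \<beta>(0)\<close> for two values of \<open>m\<close> with
  distinct powers of \<open>Q\<close> identifies both \<open>Q^g P(1 / Q)\<close> and
  \<open>P(1)\<close> with \<open>(Q - 1) \<beta>(0)\<close>. On the other hand, inverse roots
  \<open>w\<close> of absolute value \<open>sqrt Q\<close> satisfy \<open>Q / w = cnj w\<close>, so
  a real polynomial of degree \<open>D\<close> with such roots fulfils
  \<open>Q^D P(1 / Q) = x D * P(1)\<close>, where \<open>\<bar>x D\<bar> = Q^(D / 2)\<close>. Hence
  \<open>Q^D = x D * Q^g\<close>, which leaves only \<open>D = 2 g\<close> and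
  \<open>x D = Q^g\<close>. On the curve everything depends on a bound for
  \<open>deg D - dim L(D)\<close>. It comes from the inequality that a quotient of polynomials in
  \<open>t\<close> of degree at most \<open>d\<close> has zeros of total degree at most
  \<open>[K : k(t)] d\<close>, proved by counting adic expansions. A divisor \<open>D0\<close> where
  the maximum is attained is the threshold: \<open>H^1(D) = 0\<close> for \<open>D \<ge> D0\<close>,
  and large slopes are large relative to \<open>D0\<close>.\<close>

definition add_subgroup :: "'g::ab_group_add set \<Rightarrow> bool" where
  "add_subgroup H \<longleftrightarrow> 0 \<in> H \<and> (\<forall>x\<in>H. \<forall>y\<in>H. x - y \<in> H)"

definition cosets :: "'g::ab_group_add set \<Rightarrow> 'g set \<Rightarrow> 'g set set" where
  "cosets G H = (\<lambda>x. (+) x ` H) ` G"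

text \<open>\<open>card\<close> makes the index \<open>0\<close> when there are infinitely many
  cosets. With this convention multiplicativity holds throughout, and finiteness of the set of
  cosets is carried along as a separate conclusion.\<close>

definition index :: "'g::ab_group_add set \<Rightarrow> 'g set \<Rightarrow> nat" where
  "index G H = card (cosets G H)"

lemma add_subgroupD:
  assumes "add_subgroup H"
  shows "0 \<in> H" "x \<in> H \<Longrightarrow> y \<in> H \<Longrightarrow> x - y \<in> H" "x \<in> H \<Longrightarrow> - x \<in> H"
    "x \<in> H \<Longrightarrow> y \<in> H \<Longrightarrow> x + y \<in> H"
proof -
  show 0: "0 \<in> H" and d: "x \<in> H \<Longrightarrow> y \<in> H \<Longrightarrow> x - y \<in> H" for x y
    using assms by (auto simp: add_subgroup_def)
  show n: "x \<in> H \<Longrightarrow> - x \<in> H" for x using d[OF 0, of x] by simp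
  show "x \<in> H \<Longrightarrow> y \<in> H \<Longrightarrow> x + y \<in> H" using d[of x "- y"] n[of y] by simp
qed

lemma add_subgroup_diff_commute: "add_subgroup H \<Longrightarrow> x - y \<in> H \<longleftrightarrow> y - x \<in> H"
  using add_subgroupD(3)[of H "x - y"] add_subgroupD(3)[of H "y - x"] by auto

lemma add_subgroup_sum: "add_subgroup H \<Longrightarrow> (\<And>i. i \<in> A \<Longrightarrow> f i \<in> H) \<Longrightarrow> sum f A \<in> H"
  by (induction A rule: infinite_finite_induct) (auto simp: add_subgroupD)

lemma add_subgroup_Int: "add_subgroup H \<Longrightarrow> add_subgroup K \<Longrightarrow> add_subgroup (H \<inter> K)"
  by (auto simp: add_subgroup_def)

lemma add_subgroup_setsum:
  assumes "add_subgroup H" "add_subgroup K"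
  shows "add_subgroup {h + k | h k. h \<in> H \<and> k \<in> K}"
proof -
  have "\<exists>h k. a + b - (c + d) = h + k \<and> h \<in> H \<and> k \<in> K"
    if "a \<in> H" "b \<in> K" "c \<in> H" "d \<in> K" for a b c d
    by (rule exI[of _ "a - c"], rule exI[of _ "b - d"]) (use that assms in \<open>auto simp: add_subgroupD\<close>)
  moreover have "\<exists>h k. 0 = h + k \<and> h \<in> H \<and> k \<in> K"
    by (rule exI[of _ 0], rule exI[of _ 0]) (use assms in \<open>auto simp: add_subgroupD\<close>)
  ultimately show ?thesis unfolding add_subgroup_def by blast
qed

lemma coset_eq_iff:
  assumes "add_subgroup H"
  shows "(+) x ` H = (+) y ` H \<longleftrightarrow> x - y \<in> H"
proof
  assume "(+) x ` H = (+) y ` H"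
  moreover have "x \<in> (+) x ` H" using add_subgroupD(1)[OF assms] by (auto intro: image_eqI[of _ _ 0])
  ultimately obtain h where "h \<in> H" "x = y + h" by auto
  then show "x - y \<in> H" by simp
next
  have *: "(+) a ` H \<subseteq> (+) b ` H" if "a - b \<in> H" for a b
  proof
    fix z assume "z \<in> (+) a ` H"
    then obtain h where h: "h \<in> H" "z = a + h" by auto
    then have "z = b + ((a - b) + h)" by simp
    then show "z \<in> (+) b ` H" using that h assms by (blast intro: add_subgroupD)
  qed
  assume "x - y \<in> H"
  then show "(+) x ` H = (+) y ` H"
    using *[of x y] *[of y x] add_subgroup_diff_commute[OF assms] by blast
qed

lemma bij_betw_cosets:
  assumes H: "add_subgroup H" and f: "\<And>x y. x \<in> G \<Longrightarrow> y \<in> G \<Longrightarrow> f x = f y \<longleftrightarrow> x - y \<in> H"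
  shows "\<exists>g. bij_betw g (cosets G H) (f ` G)"
proof -
  define g where "g C = f (SOME x. x \<in> G \<and> C = (+) x ` H)" for C
  have g: "g ((+) x ` H) = f x" if "x \<in> G" for x
  proof -
    let ?y = "SOME y. y \<in> G \<and> (+) x ` H = (+) y ` H"
    have "?y \<in> G \<and> (+) x ` H = (+) ?y ` H" by (rule someI[of _ x]) (use that in simp)
    then have "f x = f ?y" using f that coset_eq_iff[OF H] by blast
    then show ?thesis by (simp add: g_def)
  qed
  have "bij_betw g (cosets G H) (f ` G)"
    unfolding bij_betw_def
  proof
    show "inj_on g (cosets G H)"
      unfolding cosets_def inj_on_def using g f coset_eq_iff[OF H] by auto
    show "g ` cosets G H = f ` G" unfolding cosets_def using g by (auto simp: image_image)
  qed
  then show ?thesis by blast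
qed

text \<open>The working tool for index computations: cosets are identified with the values of a map
  whose fibres they are. The map \<open>f\<close> may be any function, which allows values assembled
  from chosen representatives as in \<open>index_tower\<close>.\<close>

lemma index_eq_card_image:
  assumes "add_subgroup H" "\<And>x y. x \<in> G \<Longrightarrow> y \<in> G \<Longrightarrow> f x = f y \<longleftrightarrow> x - y \<in> H"
  shows "index G H = card (f ` G)" "finite (cosets G H) \<longleftrightarrow> finite (f ` G)"
proof -
  obtain g where "bij_betw g (cosets G H) (f ` G)"
    using bij_betw_cosets[OF assms(1), of G f] assms(2) by blast
  then show "index G H = card (f ` G)" "finite (cosets G H) \<longleftrightarrow> finite (f ` G)"
    by (auto simp: index_def dest: bij_betw_same_card bij_betw_finite)
qed

lemma index_tower:
  assumes H: "add_subgroup H" and K: "add_subgroup K" and G: "add_subgroup G" and "K \<subseteq> H" "H \<subseteq> G"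
  shows "index G K = index G H * index H K"
    "finite (cosets G K) \<longleftrightarrow> finite (cosets G H) \<and> finite (cosets H K)"
proof -
  \<comment> \<open>With one representative \<open>\<rho> x\<close> for every coset of
    \<open>H\<close>, an element is recorded by its coset modulo \<open>H\<close> and by the coset
    modulo \<open>K\<close> of its difference from the representative. The tower thereby becomes a
    product of sets.\<close>
  define \<rho> where "\<rho> x = (SOME y. y \<in> (+) x ` H)" for x
  have \<rho>: "\<rho> x - x \<in> H" for x
  proof -
    have "x \<in> (+) x ` H" using add_subgroupD(1)[OF H] by (auto intro: image_eqI[of _ _ 0])
    then have "\<rho> x \<in> (+) x ` H" unfolding \<rho>_def by (rule someI)
    then show ?thesis by auto
  qed
  have \<rho>_eq: "\<rho> x = \<rho> y" if "x - y \<in> H" for x y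
    using that coset_eq_iff[OF H, of x y] by (simp add: \<rho>_def)
  define f where "f x = ((+) x ` H, (+) (x - \<rho> x) ` K)" for x
  have f: "f x = f y \<longleftrightarrow> x - y \<in> K" for x y
    using \<rho>_eq[of x y] \<open>K \<subseteq> H\<close> by (auto simp: f_def coset_eq_iff H K)
  have "f ` G = cosets G H \<times> cosets H K"
  proof (intro equalityI subsetI)
    fix p assume "p \<in> f ` G"
    then obtain x where "x \<in> G" "p = f x" by auto
    then show "p \<in> cosets G H \<times> cosets H K"
      using \<rho>[of x] add_subgroup_diff_commute[OF H] by (auto simp: f_def cosets_def)
  next
    fix p assume "p \<in> cosets G H \<times> cosets H K"
    then obtain x h where x: "x \<in> G" "h \<in> H" and p: "p = ((+) x ` H, (+) h ` K)"
      by (auto simp: cosets_def)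
    define z where "z = \<rho> x + h"
    have zx: "z - x \<in> H" using \<rho>[of x] x add_subgroupD(4)[OF H, of "\<rho> x - x" h]
      by (simp add: z_def algebra_simps)
    then have "z \<in> G" using x \<open>H \<subseteq> G\<close> add_subgroupD(4)[OF G, of "z - x" x] by auto
    moreover have "f z = p" using \<rho>_eq[OF zx] zx by (simp add: f_def p coset_eq_iff[OF H] z_def)
    ultimately show "p \<in> f ` G" by blast
  qed
  then show "index G K = index G H * index H K"
    "finite (cosets G K) \<longleftrightarrow> finite (cosets G H) \<and> finite (cosets H K)"
    using index_eq_card_image[of K G f, OF K f] add_subgroupD(1)[OF G] add_subgroupD(1)[OF H]
    by (auto simp: card_cartesian_product index_def finite_cartesian_product_iff cosets_def)
qed

lemma index_second_iso:
  assumes M: "add_subgroup M" and H: "add_subgroup H"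
  shows "index {h + m | h m. h \<in> H \<and> m \<in> M} H = index M (M \<inter> H)"
    "finite (cosets {h + m | h m. h \<in> H \<and> m \<in> M} H) \<longleftrightarrow> finite (cosets M (M \<inter> H))"
proof -
  let ?S = "{h + m | h m. h \<in> H \<and> m \<in> M}"
  have "(\<lambda>x. (+) x ` H) ` M = cosets ?S H"
  proof (intro equalityI subsetI)
    fix C assume "C \<in> (\<lambda>x. (+) x ` H) ` M"
    then obtain m where "m \<in> M" "C = (+) m ` H" by auto
    moreover from this have "m \<in> ?S" using add_subgroupD(1)[OF H] by force
    ultimately show "C \<in> cosets ?S H" by (auto simp: cosets_def)
  next
    fix C assume "C \<in> cosets ?S H"
    then obtain h m where "h \<in> H" "m \<in> M" "C = (+) (h + m) ` H" by (auto simp: cosets_def)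
    moreover from this have "(+) (h + m) ` H = (+) m ` H" by (simp add: coset_eq_iff[OF H])
    ultimately show "C \<in> (\<lambda>x. (+) x ` H) ` M" by auto
  qed
  moreover have "((+) x ` H = (+) y ` H) \<longleftrightarrow> x - y \<in> M \<inter> H" if "x \<in> M" "y \<in> M" for x y
    using that by (auto simp: coset_eq_iff[OF H] add_subgroupD[OF M])
  ultimately show "index ?S H = index M (M \<inter> H)" "finite (cosets ?S H) \<longleftrightarrow> finite (cosets M (M \<inter> H))"
    using index_eq_card_image[of "M \<inter> H" M "\<lambda>x. (+) x ` H", OF add_subgroup_Int[OF M H]]
    by (auto simp: index_def)
qed

lemma index_split:
  assumes G: "add_subgroup G" and H: "add_subgroup H" and M: "add_subgroup M" and "H \<subseteq> G" "M \<subseteq> G"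
  shows "index G H = index G {h + m | h m. h \<in> H \<and> m \<in> M} * index M (M \<inter> H)"
    "finite (cosets G H) \<longleftrightarrow>
       finite (cosets G {h + m | h m. h \<in> H \<and> m \<in> M}) \<and> finite (cosets M (M \<inter> H))"
proof -
  let ?S = "{h + m | h m. h \<in> H \<and> m \<in> M}"
  have "H \<subseteq> ?S" using add_subgroupD(1)[OF M] by force
  moreover have "?S \<subseteq> G" using assms add_subgroupD(4)[OF G] by blast
  ultimately show "index G H = index G ?S * index M (M \<inter> H)"
    "finite (cosets G H) \<longleftrightarrow> finite (cosets G ?S) \<and> finite (cosets M (M \<inter> H))"
    using index_tower[OF add_subgroup_setsum[OF H M] H G] index_second_iso[OF M H] by auto
qed

lemma index_Int_le:
  assumes H: "add_subgroup H" and G: "add_subgroup G'" and "G' \<subseteq> G" and fin: "finite (cosets G H)"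
  shows "index G' (G' \<inter> H) \<le> index G H" "finite (cosets G' (G' \<inter> H))"
proof -
  have *: "(\<lambda>x. (+) x ` H) ` G' \<subseteq> cosets G H" using \<open>G' \<subseteq> G\<close> by (auto simp: cosets_def)
  have **: "((+) x ` H = (+) y ` H) \<longleftrightarrow> x - y \<in> G' \<inter> H" if "x \<in> G'" "y \<in> G'" for x y
    using that by (auto simp: coset_eq_iff[OF H] add_subgroupD[OF G])
  note i = index_eq_card_image[of "G' \<inter> H" G' "\<lambda>x. (+) x ` H", OF add_subgroup_Int[OF G H] **]
  show "finite (cosets G' (G' \<inter> H))" using finite_subset[OF * fin[unfolded cosets_def[symmetric]]] i(2) by blast
  show "index G' (G' \<inter> H) \<le> index G H" using card_mono[OF fin *] i(1) by (simp add: index_def)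
qed

text \<open>\<open>G / (H + ker p)\<close> is the quotient of the images, and what remains is the
  quotient of the kernels. With \<open>p\<close> a coordinate function this peels one step off a
  flag.\<close>

lemma index_hom:
  assumes G: "add_subgroup G" and H: "add_subgroup H" and "H \<subseteq> G"
    and p: "\<And>x y. x \<in> G \<Longrightarrow> y \<in> G \<Longrightarrow> p (x - y) = p x - p y"
  shows "index G H = index (p ` G) (p ` H) * index {x\<in>G. p x = 0} {x\<in>H. p x = 0}"
    "finite (cosets G H) \<longleftrightarrow>
       finite (cosets (p ` G) (p ` H)) \<and> finite (cosets {x\<in>G. p x = 0} {x\<in>H. p x = 0})"
proof -
  let ?M = "{x\<in>G. p x = 0}" let ?S = "{h + m | h m. h \<in> H \<and> m \<in> ?M}"
  have p0: "p 0 = 0" using p[of 0 0] add_subgroupD(1)[OF G] by simp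
  have M: "add_subgroup ?M" using G p0 p by (auto simp: add_subgroup_def)
  have pH: "add_subgroup (p ` H)"
    unfolding add_subgroup_def
  proof (intro conjI ballI)
    show "0 \<in> p ` H" using p0 add_subgroupD(1)[OF H] by (metis imageI)
    fix a b assume "a \<in> p ` H" "b \<in> p ` H"
    then obtain x y where "x \<in> H" "y \<in> H" "a = p x" "b = p y" by auto
    moreover from this have "x - y \<in> H" using add_subgroupD(2)[OF H] by blast
    ultimately show "a - b \<in> p ` H" using p[of x y] \<open>H \<subseteq> G\<close> by (metis imageI subsetD)
  qed
  have MH: "?M \<inter> H = {x\<in>H. p x = 0}" using \<open>H \<subseteq> G\<close> by auto
  have S: "add_subgroup ?S" by (rule add_subgroup_setsum[OF H M])
  define f where "f x = (+) (p x) ` (p ` H)" for x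
  have f: "f x = f y \<longleftrightarrow> x - y \<in> ?S" if xy: "x \<in> G" "y \<in> G" for x y
  proof -
    have "f x = f y \<longleftrightarrow> p (x - y) \<in> p ` H" using xy by (simp add: f_def coset_eq_iff[OF pH] p)
    also have "\<dots> \<longleftrightarrow> x - y \<in> ?S"
    proof
      assume "p (x - y) \<in> p ` H"
      then obtain h where h: "h \<in> H" "p (x - y) = p h" by auto
      have "x - y \<in> G" using xy add_subgroupD(2)[OF G] by auto
      moreover have "h \<in> G" using h \<open>H \<subseteq> G\<close> by auto
      ultimately have "x - y - h \<in> ?M" using p[of "x - y" h] h add_subgroupD(2)[OF G] by auto
      moreover have "x - y = h + (x - y - h)" by simp
      ultimately show "x - y \<in> ?S" using h(1) by blast
    next
      assume "x - y \<in> ?S"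
      then obtain h m where hm: "h \<in> H" "m \<in> ?M" "x - y = h + m" by auto
      have "x - y \<in> G" using xy add_subgroupD(2)[OF G] by auto
      then have "p (x - y - m) = p (x - y) - p m" using hm by (intro p) auto
      then have "p (x - y) = p h" using hm by simp
      then show "p (x - y) \<in> p ` H" using hm by auto
    qed
    finally show ?thesis .
  qed
  have "f ` G = cosets (p ` G) (p ` H)" by (auto simp: f_def cosets_def image_image)
  then have "index G ?S = index (p ` G) (p ` H)" "finite (cosets G ?S) = finite (cosets (p ` G) (p ` H))"
    using index_eq_card_image[of ?S G f, OF S f] by (auto simp: index_def)
  with index_split[OF G H M \<open>H \<subseteq> G\<close>] MH
  show "index G H = index (p ` G) (p ` H) * index ?M {x\<in>H. p x = 0}"
    "finite (cosets G H) \<longleftrightarrow>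
       finite (cosets (p ` G) (p ` H)) \<and> finite (cosets ?M {x\<in>H. p x = 0})"
    by auto
qed

text \<open>By the modular law \<open>(H + K) \<inter> G = H + (K \<inter> G)\<close>, the index
  splits along \<open>K\<close>. For adeles and \<open>K\<close> the diagonally embedded field, the
  first factor measures the change of \<open>H^1\<close> and the second the change of
  \<open>H^0\<close>.\<close>

lemma index_sum_Int:
  assumes G: "add_subgroup G" and H: "add_subgroup H" and "H \<subseteq> G" and K: "add_subgroup K"
  shows "index G H = index {g + k | g k. g \<in> G \<and> k \<in> K} {h + k | h k. h \<in> H \<and> k \<in> K}
      * index (G \<inter> K) (H \<inter> K)"
    "finite (cosets G H) \<longleftrightarrow>
      finite (cosets {g + k | g k. g \<in> G \<and> k \<in> K} {h + k | h k. h \<in> H \<and> k \<in> K})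
      \<and> finite (cosets (G \<inter> K) (H \<inter> K))"
proof -
  let ?GK = "{g + k | g k. g \<in> G \<and> k \<in> K}" and ?HK = "{h + k | h k. h \<in> H \<and> k \<in> K}"
  let ?M = "G \<inter> K" let ?S = "{h + m | h m. h \<in> H \<and> m \<in> ?M}"
  have M: "add_subgroup ?M" using G K by (rule add_subgroup_Int)
  have HK: "add_subgroup ?HK" by (rule add_subgroup_setsum[OF H K])
  have MH: "?M \<inter> H = H \<inter> K" using \<open>H \<subseteq> G\<close> by auto
  have S: "add_subgroup ?S" by (rule add_subgroup_setsum[OF H M])
  define f where "f x = (+) x ` ?HK" for x
  have f: "f x = f y \<longleftrightarrow> x - y \<in> ?S" if xy: "x \<in> G" "y \<in> G" for x y
  proof -
    have d: "x - y \<in> G" using xy add_subgroupD(2)[OF G] by auto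
    have "f x = f y \<longleftrightarrow> x - y \<in> ?HK" by (simp add: f_def coset_eq_iff[OF HK])
    also have "\<dots> \<longleftrightarrow> x - y \<in> ?S"
    proof
      assume "x - y \<in> ?HK"
      then obtain h k where hk: "h \<in> H" "k \<in> K" "x - y = h + k" by auto
      then have "k = x - y - h" by simp
      then have "k \<in> G" using d hk(1) \<open>H \<subseteq> G\<close> add_subgroupD(2)[OF G] by blast
      then show "x - y \<in> ?S" using hk by blast
    qed blast
    finally show ?thesis .
  qed
  have "f ` G = cosets ?GK ?HK"
  proof (intro equalityI subsetI)
    fix C assume "C \<in> f ` G"
    then obtain x where "x \<in> G" "C = f x" by auto
    moreover from this have "x \<in> ?GK" using add_subgroupD(1)[OF K] by force
    ultimately show "C \<in> cosets ?GK ?HK" by (auto simp: cosets_def f_def)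
  next
    fix C assume "C \<in> cosets ?GK ?HK"
    then obtain g k where gk: "g \<in> G" "k \<in> K" "C = (+) (g + k) ` ?HK" by (auto simp: cosets_def)
    have "k \<in> ?HK" using gk(2) add_subgroupD(1)[OF H] by force
    then have "(+) (g + k) ` ?HK = (+) g ` ?HK" by (simp add: coset_eq_iff[OF HK])
    then show "C \<in> f ` G" using gk by (auto simp: f_def)
  qed
  then have "index G ?S = index ?GK ?HK" "finite (cosets G ?S) = finite (cosets ?GK ?HK)"
    using index_eq_card_image[of ?S G f, OF S f] by (auto simp: index_def)
  with index_split[OF G H M \<open>H \<subseteq> G\<close>] MH
  show "index G H = index ?GK ?HK * index ?M (H \<inter> K)"
    "finite (cosets G H) \<longleftrightarrow> finite (cosets ?GK ?HK) \<and> finite (cosets ?M (H \<inter> K))"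
    by auto
qed

lemma index_zero: "index G {0} = card G" "finite (cosets G {0}) \<longleftrightarrow> finite G"
proof -
  have "add_subgroup {0::'a}" by (simp add: add_subgroup_def)
  from index_eq_card_image[OF this, of G "\<lambda>x. x"]
  show "index G {0} = card G" "finite (cosets G {0}) \<longleftrightarrow> finite G" by auto
qed

lemma index_self: "add_subgroup G \<Longrightarrow> index G G = 1 \<and> finite (cosets G G)"
proof -
  assume G: "add_subgroup G"
  have "cosets G G = {(+) 0 ` G}"
  proof -
    have "(+) x ` G = (+) 0 ` G" if "x \<in> G" for x using coset_eq_iff[OF G, of x 0] that by simp
    then show ?thesis using add_subgroupD(1)[OF G] unfolding cosets_def by blast
  qed
  then show ?thesis by (simp add: index_def)
qed

lemma index_pos: "finite (cosets G H) \<Longrightarrow> G \<noteq> {} \<Longrightarrow> index G H > 0"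
  by (auto simp: index_def card_gt_0_iff cosets_def)

lemma card_eq_index_times:
  assumes "add_subgroup G" "add_subgroup H" "H \<subseteq> G"
  shows "card G = index G H * card H" "finite G \<longleftrightarrow> finite (cosets G H) \<and> finite H"
proof -
  have "add_subgroup {0::'a}" "{0} \<subseteq> H" using assms(2) by (auto simp: add_subgroup_def)
  from index_tower[OF assms(2) this(1) assms(1) this(2) assms(3)]
  show "card G = index G H * card H" "finite G \<longleftrightarrow> finite (cosets G H) \<and> finite H"
    by (simp_all only: index_zero)
qed

text \<open>Outside \<open>S\<close> the two families of conditions agree, so the cosets at the
  indices in \<open>S\<close> determine a family modulo the smaller group. Applied to adelic groups
  that differ at finitely many places.\<close>

lemma index_family:
  fixes G H :: "'i \<Rightarrow> 'g::ab_group_add set"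
  assumes G: "\<And>i. add_subgroup (G i)" and H: "\<And>i. add_subgroup (H i)" and HG: "\<And>i. H i \<subseteq> G i"
    and S: "finite S" "\<And>i. i \<notin> S \<Longrightarrow> G i = H i"
  shows "index {s. \<forall>i. s i \<in> G i} {s. \<forall>i. s i \<in> H i} = (\<Prod>i\<in>S. index (G i) (H i))"
    "(\<And>i. i \<in> S \<Longrightarrow> finite (cosets (G i) (H i))) \<Longrightarrow>
       finite (cosets {s. \<forall>i. s i \<in> G i} {s. \<forall>i. s i \<in> H i})"
proof -
  let ?G = "{s. \<forall>i. s i \<in> G i}" and ?H = "{s. \<forall>i. s i \<in> H i}"
  define f where "f s = restrict (\<lambda>i. (+) (s i) ` H i) S" for s
  have sH: "add_subgroup ?H" using H by (auto simp: add_subgroup_def)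
  have f: "f x = f y \<longleftrightarrow> x - y \<in> ?H" if "x \<in> ?G" "y \<in> ?G" for x y
  proof -
    have "f x = f y \<longleftrightarrow> (\<forall>i\<in>S. x i - y i \<in> H i)"
      by (auto simp: f_def fun_eq_iff restrict_def coset_eq_iff[OF H])
    also have "\<dots> \<longleftrightarrow> (\<forall>i. x i - y i \<in> H i)"
    proof -
      have "x i - y i \<in> H i" if "i \<notin> S" for i
      proof -
        have "x i \<in> H i" "y i \<in> H i" using \<open>x \<in> ?G\<close> \<open>y \<in> ?G\<close> S(2)[OF that] by auto
        then show ?thesis by (rule add_subgroupD(2)[OF H[of i]])
      qed
      then show ?thesis by blast
    qed
    also have "\<dots> \<longleftrightarrow> x - y \<in> ?H" by simp
    finally show ?thesis .
  qed
  have im: "f ` ?G = (\<Pi>\<^sub>E i\<in>S. cosets (G i) (H i))"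
  proof (intro equalityI subsetI)
    fix s assume "s \<in> f ` ?G"
    then show "s \<in> (\<Pi>\<^sub>E i\<in>S. cosets (G i) (H i))" by (auto simp: f_def cosets_def)
  next
    fix p assume p: "p \<in> (\<Pi>\<^sub>E i\<in>S. cosets (G i) (H i))"
    then have "\<forall>i. \<exists>x. i \<in> S \<longrightarrow> x \<in> G i \<and> p i = (+) x ` H i" by (fastforce simp: cosets_def PiE_def Pi_def)
    then obtain x where x: "\<And>i. i \<in> S \<Longrightarrow> x i \<in> G i \<and> p i = (+) (x i) ` H i" by metis
    define s where "s i = (if i \<in> S then x i else 0)" for i
    have "s \<in> ?G" using x G by (auto simp: s_def add_subgroupD)
    moreover have "p = f s"
    proof
      fix i show "p i = f s i" using x p by (cases "i \<in> S") (auto simp: f_def s_def PiE_def extensional_def)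
    qed
    ultimately show "p \<in> f ` ?G" by blast
  qed
  show "index ?G ?H = (\<Prod>i\<in>S. index (G i) (H i))"
    using index_eq_card_image(1)[of ?H ?G f, OF sH f] im S(1) by (simp add: card_PiE index_def)
  show "(\<And>i. i \<in> S \<Longrightarrow> finite (cosets (G i) (H i))) \<Longrightarrow> finite (cosets ?G ?H)"
    using index_eq_card_image(2)[of ?H ?G f, OF sH f] im S(1) by (simp add: finite_PiE)
qed

lemma index_additive_image:
  assumes "add_subgroup G" "add_subgroup H" "H \<subseteq> G" and p: "\<And>x y. p (x - y) = p x - p y" and inj: "inj p"
  shows "index (p ` G) (p ` H) = index G H" "finite (cosets (p ` G) (p ` H)) = finite (cosets G H)"
proof -
  have "p x = 0 \<longleftrightarrow> x = 0" for x using p[of x x] inj by (metis injD diff_self)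
  then have "{x\<in>G. p x = 0} = {0}" "{x\<in>H. p x = 0} = {0}" using assms by (auto simp: add_subgroupD)
  then show "index (p ` G) (p ` H) = index G H" "finite (cosets (p ` G) (p ` H)) = finite (cosets G H)"
    using index_hom[of G H p] assms by (auto simp: index_zero)
qed

section \<open>Subspaces over a finite field\<close>

context vector_space
begin

lemma add_subgroup_subspace: "subspace S \<Longrightarrow> add_subgroup S"
  by (simp add: add_subgroup_def subspace_0 subspace_diff)

lemma card_subspace:
  assumes fin: "finite (UNIV :: 'a set)" and S: "subspace S" "finite S"
  shows "card S = CARD('a) ^ dim S"
proof -
  obtain B where B: "B \<subseteq> S" "independent B" "S \<subseteq> span B" "card B = dim S"
    using basis_exists by blast
  have "finite B" using B(1) S(2) finite_subset by blast
  have SB: "S = span B" using B S(1) span_minimal by blast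
  define f where "f c = (\<Sum>b\<in>B. c b *s b)" for c
  have "inj_on f (B \<rightarrow>\<^sub>E UNIV)"
  proof (rule inj_onI)
    fix c d assume cd: "c \<in> B \<rightarrow>\<^sub>E UNIV" "d \<in> B \<rightarrow>\<^sub>E UNIV" "f c = f d"
    then have "(\<Sum>b\<in>B. (c b - d b) *s b) = 0"
      unfolding scale_left_diff_distrib sum_subtractf f_def[symmetric] by simp
    then have "c b - d b = 0" if "b \<in> B" for b
      by (rule independentD[OF B(2) \<open>finite B\<close> subset_refl _ that])
    then have "c b = d b" if "b \<in> B" for b using that by simp
    then show "c = d" by (rule PiE_ext[OF cd(1,2)])
  qed
  moreover have "f ` (B \<rightarrow>\<^sub>E UNIV) = S"
  proof -
    have "f u \<in> f ` (B \<rightarrow>\<^sub>E UNIV)" for u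
      by (rule image_eqI[of _ _ "restrict u B"]) (auto simp: f_def)
    then have "f ` (B \<rightarrow>\<^sub>E UNIV) = range f" by blast
    also have "\<dots> = S" unfolding SB span_finite[OF \<open>finite B\<close>] by (simp add: f_def)
    finally show ?thesis by simp
  qed
  ultimately have "card S = card (B \<rightarrow>\<^sub>E (UNIV :: 'a set))" using card_image by fastforce
  then show ?thesis using \<open>finite B\<close> B(4) by (simp add: card_PiE)
qed

text \<open>\<open>quotient_dim\<close> takes the dimension of an arbitrarily chosen complement. Any
  complement is a system of representatives for the cosets, so the choice does not affect its size;
  existence follows by extending a basis of \<open>B\<close> to one of \<open>A\<close>.\<close>

lemma card_quotient_dim:
  assumes fin: "finite (UNIV :: 'a set)" and A: "subspace A" and B: "subspace B" and "B \<subseteq> A"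
    and "finite (cosets A B)"
  shows "CARD('a) ^ quotient_dim scale A B = index A B"
proof -
  let ?P = "\<lambda>C. subspace C \<and> C \<inter> B = {0} \<and> A = {c + b | c b. c \<in> C \<and> b \<in> B}"
  have "\<exists>C. ?P C"
  proof -
    obtain b where b: "b \<subseteq> B" "independent b" "B \<subseteq> span b" by (rule basis_exists[of B])
    have "b \<subseteq> A" using b(1) \<open>B \<subseteq> A\<close> by (rule subset_trans)
    then obtain a where a: "b \<subseteq> a" "a \<subseteq> A" "independent a" "A \<subseteq> span a"
      using maximal_independent_subset_extend[OF _ b(2)] by metis
    have sb: "span b = B" using b B span_minimal by blast
    have sa: "span a = A" using a A span_minimal by blast
    let ?C = "span (a - b)"
    have "x = 0" if "x \<in> ?C" "x \<in> B" for x
    proof -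
      have xa: "x \<in> span a" using that span_mono[of "a - b" a] by blast
      have "representation a x = representation b x"
        by (rule representation_extend[OF a(3)]) (use that sb a in auto)
      moreover have "representation a x = representation (a - b) x"
        by (rule representation_extend[OF a(3)]) (use that in auto)
      ultimately have "representation a x y = 0" for y
        using representation_ne_zero[of b x y] representation_ne_zero[of "a - b" x y] by force
      then show "x = 0" using sum_nonzero_representation_eq[OF a(3) xa] by simp
    qed
    moreover have "A = {c + b | c b. c \<in> ?C \<and> b \<in> B}"
    proof -
      have "a = (a - b) \<union> b" using a by blast
      then have "span a = {c + d | c d. c \<in> ?C \<and> d \<in> span b}" using span_Un[of "a - b" b] by simp
      then show ?thesis using sa sb by simp
    qed
    moreover have "0 \<in> ?C \<inter> B" using subspace_0 B span_0 by auto
    ultimately have "?P ?C" by (intro conjI subspace_span) auto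
    then show ?thesis by (rule exI)
  qed
  then have C: "?P (SOME C. ?P C)" by (rule someI_ex)
  define C where "C = (SOME C. ?P C)"
  have P: "?P C" using C by (simp add: C_def)
  have AC: "A = {h + m |h m. h \<in> B \<and> m \<in> C}"
  proof -
    have "{c + b | c b. c \<in> C \<and> b \<in> B} = {h + m |h m. h \<in> B \<and> m \<in> C}"
      by (rule Collect_cong) (metis add.commute)
    then show ?thesis using P by blast
  qed
  have CS: "subspace C" "C \<inter> B = {0}" using P by blast+
  have "index A B = card C" "finite C"
    using index_second_iso[OF add_subgroup_subspace[OF CS(1)] add_subgroup_subspace[OF B]] assms(5)
    unfolding AC[symmetric] CS(2) index_zero by simp_all
  moreover have "quotient_dim scale A B = dim C" by (simp only: quotient_dim_def C_def)
  ultimately show ?thesis using card_subspace[OF fin CS(1)] by simp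
qed

end

section \<open>Discrete valuation rings\<close>

text \<open>The factorisation \<open>u * t powi m\<close> of every non-zero \<open>x\<close> of the
  field contains both that the field is the fraction field of \<open>R\<close> and that the value
  group is the group of integers. For the local rings of the curve it is established in
  \<open>is_dvrI\<close>.\<close>

definition is_dvr :: "'a::field set \<Rightarrow> bool" where
  "is_dvr R \<longleftrightarrow> is_subring R \<and>
     (\<exists>t. uniformizer R t \<and> t \<noteq> 0 \<and> (\<forall>x. x \<noteq> 0 \<longrightarrow> (\<exists>u m. u \<in> R - max_ideal R \<and> x = u * t powi m)))"

lemma is_subringD:
  assumes "is_subring R"
  shows "0 \<in> R" "1 \<in> R" "a \<in> R \<Longrightarrow> b \<in> R \<Longrightarrow> a - b \<in> R" "a \<in> R \<Longrightarrow> b \<in> R \<Longrightarrow> a * b \<in> R"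
    "a \<in> R \<Longrightarrow> - a \<in> R" "a \<in> R \<Longrightarrow> b \<in> R \<Longrightarrow> a + b \<in> R" "a \<in> R \<Longrightarrow> a ^ n \<in> R"
proof -
  show 0: "0 \<in> R" and 1: "1 \<in> R" and d: "a \<in> R \<Longrightarrow> b \<in> R \<Longrightarrow> a - b \<in> R"
    and m: "a \<in> R \<Longrightarrow> b \<in> R \<Longrightarrow> a * b \<in> R" for a b using assms by (auto simp: is_subring_def)
  show n: "a \<in> R \<Longrightarrow> - a \<in> R" for a using d[OF 0, of a] by simp
  show "a \<in> R \<Longrightarrow> b \<in> R \<Longrightarrow> a + b \<in> R" using d[of a "- b"] n by simp
  show "a \<in> R \<Longrightarrow> a ^ n \<in> R" by (induction n) (auto simp: 1 m)
qed

lemma is_subring_add_subgroup: "is_subring R \<Longrightarrow> add_subgroup R"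
  by (simp add: is_subring_def add_subgroup_def)

lemma is_subring_sum: "is_subring R \<Longrightarrow> (\<And>i. i \<in> A \<Longrightarrow> f i \<in> R) \<Longrightarrow> sum f A \<in> R"
  by (rule add_subgroup_sum[OF is_subring_add_subgroup])

lemma unit_iff: "u \<in> R - max_ideal R \<longleftrightarrow> u \<in> R \<and> u \<noteq> 0 \<and> inverse u \<in> R"
  by (auto simp: max_ideal_def)

lemma unit_mult:
  "is_subring R \<Longrightarrow> u \<in> R - max_ideal R \<Longrightarrow> v \<in> R - max_ideal R \<Longrightarrow> u * v \<in> R - max_ideal R"
  unfolding unit_iff by (simp add: is_subringD)

lemma unit_inverse: "u \<in> R - max_ideal R \<Longrightarrow> inverse u \<in> R - max_ideal R"
  unfolding unit_iff by simp

lemma unit_power: "is_subring R \<Longrightarrow> u \<in> R - max_ideal R \<Longrightarrow> u ^ n \<in> R - max_ideal R"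
  unfolding unit_iff by (simp add: is_subringD power_inverse[symmetric])

lemma unit_powi: "is_subring R \<Longrightarrow> u \<in> R - max_ideal R \<Longrightarrow> u powi m \<in> R - max_ideal R"
  unfolding power_int_def using unit_power[of R u] unit_power[of R "inverse u"] unit_inverse by auto

lemma one_unit: "is_subring R \<Longrightarrow> 1 \<in> R - max_ideal R"
  by (simp add: max_ideal_def is_subringD)

lemma uniformizer_mem: "uniformizer R t \<Longrightarrow> is_subring R \<Longrightarrow> t \<in> max_ideal R"
  unfolding uniformizer_def using is_subringD(2) by force

lemma uniformizer_powi_mem_iff:
  assumes R: "is_subring R" and t: "uniformizer R t" "t \<noteq> 0"
  shows "t powi m \<in> R \<longleftrightarrow> 0 \<le> m"
proof
  have tR: "t \<in> R" "inverse t \<notin> R" using uniformizer_mem[OF t(1) R] t(2) by (auto simp: max_ideal_def)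
  show "t powi m \<in> R" if "0 \<le> m" using that tR R by (simp add: power_int_nonneg_exp is_subringD)
  show "0 \<le> m" if m: "t powi m \<in> R"
  proof (rule ccontr)
    assume "\<not> 0 \<le> m"
    then have "t powi (- m - 1) \<in> R" using tR R by (simp add: power_int_nonneg_exp is_subringD)
    then have "t powi m * t powi (- m - 1) \<in> R" using m R is_subringD by blast
    moreover have "t powi m * t powi (- m - 1) = inverse t"
      by (subst power_int_add[symmetric]) (use t in \<open>auto simp: power_int_minus\<close>)
    ultimately show False using tR by simp
  qed
qed

lemma uniformizer_associated:
  assumes R: "is_subring R" and t: "uniformizer R t" "t \<noteq> 0" and s: "uniformizer R s"
  shows "\<exists>u\<in>R - max_ideal R. s = u * t"
proof -
  have "s \<in> (\<lambda>a. a * t) ` R" using uniformizer_mem[OF s R] t by (simp add: uniformizer_def)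
  then obtain a where a: "a \<in> R" "s = a * t" by auto
  have "t \<in> (\<lambda>a. a * s) ` R" using uniformizer_mem[OF t(1) R] s by (simp add: uniformizer_def)
  then obtain b where b: "b \<in> R" "t = b * s" by auto
  have "(b * a) * t = 1 * t" using a(2) b(2) by (simp add: mult.assoc)
  then have "b * a = 1" using t(2) by (metis mult_right_cancel)
  then have "inverse a = b" "a \<noteq> 0" by (auto simp: inverse_unique mult.commute)
  then have "a \<in> R - max_ideal R" using a(1) b(1) unfolding unit_iff by simp
  then show ?thesis using a(2) by blast
qed

text \<open>\<open>ord_at\<close> quantifies over all uniformizers, so uniqueness has to compare two
  of them. They differ by a unit, which makes a power of \<open>t\<close> a unit, and only the
  exponent zero allows that.\<close>

lemma ord_at_eqI:
  assumes R: "is_subring R" and t: "uniformizer R t" "t \<noteq> 0" and u: "u \<in> R - max_ideal R"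
  shows "ord_at R (u * t powi m) = m"
  unfolding ord_at_def
proof (rule the_equality)
  show "\<exists>t' u'. uniformizer R t' \<and> u' \<in> R - max_ideal R \<and> u * t powi m = u' * t' powi m" using t u by blast
  fix k assume "\<exists>t' u'. uniformizer R t' \<and> u' \<in> R - max_ideal R \<and> u * t powi m = u' * t' powi k"
  then obtain s v where s: "uniformizer R s" "v \<in> R - max_ideal R" "u * t powi m = v * s powi k" by blast
  obtain w where w: "w \<in> R - max_ideal R" "s = w * t" using uniformizer_associated[OF R t s(1)] by blast
  define a where "a = v * w powi k * inverse u"
  have a: "a \<in> R - max_ideal R"
    unfolding a_def by (intro unit_mult unit_powi unit_inverse s u w R)
  have u0: "u \<noteq> 0" using u unit_iff by blast
  have "t powi m = a * t powi k"
    using s(3) u0 unfolding w a_def by (simp add: power_int_mult_distrib field_simps)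
  then have 1: "t powi (m - k) = a" using t(2) by (simp add: power_int_diff)
  then have 2: "t powi (k - m) = inverse a"
    using power_int_minus[of t "m - k"] by simp
  have "0 \<le> m - k" "0 \<le> k - m"
    using uniformizer_powi_mem_iff[OF R t, of "m - k"] uniformizer_powi_mem_iff[OF R t, of "k - m"]
      a 1 2 unfolding unit_iff by auto
  then show "k = m" by simp
qed

text \<open>The powers of the maximal ideal, for all integers \<open>m\<close>. Zero is added by
  hand because \<open>ord_at R 0\<close> has no prescribed value.\<close>

definition fideal :: "'a::field set \<Rightarrow> int \<Rightarrow> 'a set" where
  "fideal R m = {x. x = 0 \<or> m \<le> ord_at R x}"

locale dvr =
  fixes R :: "'a::field set"
  assumes dvr: "is_dvr R"
begin

lemma subring: "is_subring R"
  using dvr by (simp add: is_dvr_def)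

definition \<pi> where
  "\<pi> = (SOME t. uniformizer R t \<and> t \<noteq> 0 \<and> (\<forall>x. x \<noteq> 0 \<longrightarrow> (\<exists>u m. u \<in> R - max_ideal R \<and> x = u * t powi m)))"

lemma \<pi>: "uniformizer R \<pi>" "\<pi> \<noteq> 0"
  and ex_unit_powi: "x \<noteq> 0 \<Longrightarrow> \<exists>u m. u \<in> R - max_ideal R \<and> x = u * \<pi> powi m"
proof -
  have "uniformizer R \<pi> \<and> \<pi> \<noteq> 0 \<and> (\<forall>x. x \<noteq> 0 \<longrightarrow> (\<exists>u m. u \<in> R - max_ideal R \<and> x = u * \<pi> powi m))"
    unfolding \<pi>_def by (rule someI_ex) (use dvr in \<open>simp add: is_dvr_def\<close>)
  then show "uniformizer R \<pi>" "\<pi> \<noteq> 0" "x \<noteq> 0 \<Longrightarrow> \<exists>u m. u \<in> R - max_ideal R \<and> x = u * \<pi> powi m" by auto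
qed

lemma ord_unit_powi: "u \<in> R - max_ideal R \<Longrightarrow> ord_at R (u * \<pi> powi m) = m"
  by (rule ord_at_eqI[OF subring \<pi>])

lemma unit_ord:
  assumes "x \<noteq> 0"
  obtains u where "u \<in> R - max_ideal R" "x = u * \<pi> powi (ord_at R x)"
  using ex_unit_powi[OF assms] ord_unit_powi by metis

lemma ord_mult: "x \<noteq> 0 \<Longrightarrow> y \<noteq> 0 \<Longrightarrow> ord_at R (x * y) = ord_at R x + ord_at R y"
proof -
  assume x: "x \<noteq> 0" and y: "y \<noteq> 0"
  obtain u where u: "u \<in> R - max_ideal R" "x = u * \<pi> powi (ord_at R x)" using unit_ord[OF x] by blast
  obtain v where v: "v \<in> R - max_ideal R" "y = v * \<pi> powi (ord_at R y)" using unit_ord[OF y] by blast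
  have "x * y = u * v * \<pi> powi (ord_at R x + ord_at R y)"
    by (subst u(2), subst v(2)) (use \<pi>(2) in \<open>simp add: power_int_add algebra_simps\<close>)
  then show ?thesis using ord_unit_powi[OF unit_mult[OF subring u(1) v(1)]] by simp
qed

lemma ord_1 [simp]: "ord_at R 1 = 0"
  using ord_unit_powi[OF one_unit[OF subring], of 0] by simp

lemma ord_unit: "u \<in> R - max_ideal R \<Longrightarrow> ord_at R u = 0"
  using ord_unit_powi[of u 0] by simp

lemma ord_\<pi>_powi: "ord_at R (\<pi> powi m) = m"
  using ord_unit_powi[OF one_unit[OF subring], of m] by simp

lemma ord_inverse: "x \<noteq> 0 \<Longrightarrow> ord_at R (inverse x) = - ord_at R x"
  using ord_mult[of x "inverse x"] by simp

lemma ord_divide: "x \<noteq> 0 \<Longrightarrow> y \<noteq> 0 \<Longrightarrow> ord_at R (x / y) = ord_at R x - ord_at R y"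
  by (simp add: divide_inverse ord_mult ord_inverse)

lemma ord_power: "x \<noteq> 0 \<Longrightarrow> ord_at R (x ^ n) = int n * ord_at R x"
  by (induction n) (simp_all add: ord_mult algebra_simps)

lemma ord_powi: "x \<noteq> 0 \<Longrightarrow> ord_at R (x powi m) = m * ord_at R x"
  by (cases "m \<ge> 0") (simp_all add: power_int_def ord_power ord_inverse)

lemma ord_minus: "ord_at R (- x) = ord_at R x"
proof (cases "x = 0")
  case False
  have "ord_at R (-1) + ord_at R (-1) = 0" using ord_mult[of "-1" "-1"] by simp
  then show ?thesis using ord_mult[of "-1" x] False by simp
qed simp

lemma mem_iff_ord: "x \<in> R \<longleftrightarrow> x = 0 \<or> ord_at R x \<ge> 0"
proof (cases "x = 0")
  case False
  obtain u where u: "u \<in> R - max_ideal R" "x = u * \<pi> powi (ord_at R x)" using unit_ord[OF False] by blast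
  have u': "u \<in> R" "inverse u \<in> R" "u \<noteq> 0" using u unit_iff by auto
  have "x \<in> R \<longleftrightarrow> \<pi> powi (ord_at R x) \<in> R"
  proof
    assume "x \<in> R"
    then have "inverse u * x \<in> R" using u' subring is_subringD by blast
    moreover have "inverse u * x = \<pi> powi (ord_at R x)" by (subst u(2)) (use u'(3) in simp)
    ultimately show "\<pi> powi (ord_at R x) \<in> R" by simp
  next
    assume "\<pi> powi (ord_at R x) \<in> R"
    then show "x \<in> R" using u(2) u' subring is_subringD(4) by metis
  qed
  then show ?thesis using uniformizer_powi_mem_iff[OF subring \<pi>] False by simp
qed (simp add: subring is_subringD)

lemma mem_max_ideal_iff_ord: "x \<in> max_ideal R \<longleftrightarrow> x = 0 \<or> ord_at R x \<ge> 1"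
  by (cases "x = 0") (auto simp: max_ideal_def mem_iff_ord ord_inverse)

lemma ord_add_ge: "x + y \<noteq> 0 \<Longrightarrow> (x = 0 \<or> m \<le> ord_at R x) \<Longrightarrow> (y = 0 \<or> m \<le> ord_at R y) \<Longrightarrow> m \<le> ord_at R (x + y)"
proof -
  assume xy: "x + y \<noteq> 0" "x = 0 \<or> m \<le> ord_at R x" "y = 0 \<or> m \<le> ord_at R y"
  have *: "z * \<pi> powi (- m) \<in> R" if "z = 0 \<or> m \<le> ord_at R z" for z
    using that \<pi>(2) by (cases "z = 0") (auto simp: mem_iff_ord ord_mult ord_\<pi>_powi)
  have "(x + y) * \<pi> powi (- m) \<in> R"
    using is_subringD(6)[OF subring *[OF xy(2)] *[OF xy(3)]] by (simp add: algebra_simps)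
  then show ?thesis using xy(1) \<pi>(2) by (simp add: mem_iff_ord ord_mult ord_\<pi>_powi)
qed

lemma ord_add_eq:
  assumes "x \<noteq> 0" "y = 0 \<or> ord_at R x < ord_at R y"
  shows "x + y \<noteq> 0" "ord_at R (x + y) = ord_at R x"
proof -
  show ne: "x + y \<noteq> 0"
  proof
    assume "x + y = 0"
    then have "y = - x" by (simp add: add_eq_0_iff)
    then show False using assms by (simp add: ord_minus)
  qed
  have "ord_at R x \<le> ord_at R (x + y)" by (rule ord_add_ge[OF ne]) (use assms in auto)
  moreover have "\<not> ord_at R x + 1 \<le> ord_at R (x + y)"
  proof
    assume "ord_at R x + 1 \<le> ord_at R (x + y)"
    then have "ord_at R x + 1 \<le> ord_at R ((x + y) + (- y))"
      by (intro ord_add_ge) (use assms in \<open>auto simp: ord_minus\<close>)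
    then show False by simp
  qed
  ultimately show "ord_at R (x + y) = ord_at R x" by simp
qed

lemma fideal_subgroup: "add_subgroup (fideal R m)"
  unfolding add_subgroup_def fideal_def using ord_add_ge[of _ "- _" m] by (auto simp: ord_minus)

lemma fideal_antimono: "m \<le> m' \<Longrightarrow> fideal R m' \<subseteq> fideal R m"
  by (auto simp: fideal_def)

lemma fideal_mult: "x \<in> fideal R a \<Longrightarrow> y \<in> fideal R b \<Longrightarrow> x * y \<in> fideal R (a + b)"
  by (cases "x = 0"; cases "y = 0") (auto simp: fideal_def ord_mult)

lemma fideal_0: "fideal R 0 = R"
  by (auto simp: fideal_def mem_iff_ord)

lemma fideal_1: "fideal R 1 = max_ideal R"
  by (auto simp: fideal_def mem_max_ideal_iff_ord)

lemma fideal_scale: "c \<noteq> 0 \<Longrightarrow> (*) c ` fideal R m = fideal R (m + ord_at R c)"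
proof (intro equalityI subsetI)
  fix x assume "c \<noteq> 0" "x \<in> fideal R (m + ord_at R c)"
  then show "x \<in> (*) c ` fideal R m"
    by (cases "x = 0"; intro image_eqI[of _ _ "x / c"]) (auto simp: fideal_def ord_divide)
next
  fix x assume "c \<noteq> 0" "x \<in> (*) c ` fideal R m"
  then obtain y where "x = c * y" "y \<in> fideal R m" by blast
  then show "x \<in> fideal R (m + ord_at R c)"
    using fideal_mult[of c "ord_at R c" y m] by (simp add: fideal_def add.commute)
qed

lemma index_fideal_Suc:
  "index (fideal R m) (fideal R (m + 1)) = index R (max_ideal R)"
  "finite (cosets (fideal R m) (fideal R (m + 1))) = finite (cosets R (max_ideal R))"
proof -
  let ?c = "\<pi> powi m"
  have c: "?c \<noteq> 0" using \<pi>(2) by simp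
  have "fideal R m = (*) ?c ` R" "fideal R (m + 1) = (*) ?c ` max_ideal R"
    using fideal_scale[OF c, of 0] fideal_scale[OF c, of 1] by (simp_all add: ord_\<pi>_powi fideal_0 fideal_1 add.commute)
  moreover have "inj ((*) ?c)" using c by (metis injI mult_left_cancel)
  ultimately show "index (fideal R m) (fideal R (m + 1)) = index R (max_ideal R)"
    "finite (cosets (fideal R m) (fideal R (m + 1))) = finite (cosets R (max_ideal R))"
    using index_additive_image[of R "max_ideal R" "(*) ?c"] fideal_subgroup[of 0] fideal_subgroup[of 1]
      fideal_antimono[of 0 1]
    by (auto simp: fideal_0 fideal_1 right_diff_distrib)
qed

lemma index_fideal:
  assumes "finite (cosets R (max_ideal R))"
  shows "index (fideal R m) (fideal R (m + int d)) = index R (max_ideal R) ^ d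
    \<and> finite (cosets (fideal R m) (fideal R (m + int d)))"
proof (induction d)
  case 0 show ?case using index_self[OF fideal_subgroup] by simp
next
  case (Suc d)
  have sub: "fideal R (m + int d + 1) \<subseteq> fideal R (m + int d)" "fideal R (m + int d) \<subseteq> fideal R m"
    by (simp_all add: fideal_antimono)
  note t = index_tower[OF fideal_subgroup fideal_subgroup fideal_subgroup sub]
  have e: "m + int (Suc d) = m + int d + 1" by simp
  show ?case unfolding e using Suc t index_fideal_Suc[of "m + int d"] assms by simp
qed

text \<open>An element \<open>x\<close> of negative order absorbs every pole:
  \<open>y / x ^ n\<close> lies in \<open>R\<close> as soon as \<open>n\<close> is at least the
  absolute value of the order of \<open>y\<close>.\<close>

lemma maximal_subring:
  assumes S: "is_subring S" "R \<subseteq> S" "S \<noteq> UNIV"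
  shows "S = R"
proof (rule ccontr)
  assume "S \<noteq> R"
  then obtain x where x: "x \<in> S" "x \<notin> R" using S by blast
  then have x0: "x \<noteq> 0" "ord_at R x < 0" by (auto simp: mem_iff_ord)
  have "y \<in> S" for y
  proof (cases "y = 0")
    case False
    define n where "n = nat (\<bar>ord_at R y\<bar>)"
    have "ord_at R (y / x ^ n) \<ge> 0"
    proof -
      have "int n * (- ord_at R x) \<ge> int n * 1" using x0(2) by (intro mult_left_mono) auto
      then show ?thesis using x0 False by (simp add: ord_divide ord_power n_def)
    qed
    then have "y / x ^ n \<in> R" by (simp add: mem_iff_ord)
    then have "y / x ^ n * x ^ n \<in> S"
      using is_subringD(4)[OF S(1)] is_subringD(7)[OF S(1) x(1)] S(2) by blast
    then show ?thesis using x0 by simp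
  qed (use S is_subringD in auto)
  then show False using S by blast
qed

lemma not_UNIV: "R \<noteq> UNIV"
proof
  assume "R = UNIV"
  then have "inverse \<pi> \<in> R" by simp
  moreover have "ord_at R \<pi> = 1" using ord_\<pi>_powi[of 1] by simp
  ultimately show False using \<pi>(2) by (simp add: mem_iff_ord ord_inverse)
qed

end

section \<open>Independence of finitely many valuations and weak approximation\<close>

lemma ord_separating_pair:
  assumes "is_dvr R" "is_dvr S" "R \<noteq> S"
  shows "\<exists>z. z \<noteq> 0 \<and> ord_at R z > 0 \<and> ord_at S z < 0"
proof -
  interpret R: dvr R by unfold_locales fact
  interpret S: dvr S by unfold_locales fact
  \<comment> \<open>Valuation rings are maximal proper subrings, so neither contains the other; the
    quotient of witnesses for the two non-inclusions has a zero at \<open>R\<close> and a pole at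
    \<open>S\<close>.\<close>
  have "\<not> R \<subseteq> S" using R.maximal_subring[OF S.subring _ S.not_UNIV] assms by blast
  then obtain x where x: "x \<in> R" "x \<notin> S" by blast
  have "\<not> S \<subseteq> R" using S.maximal_subring[OF R.subring _ R.not_UNIV] assms by blast
  then obtain y where y: "y \<in> S" "y \<notin> R" by blast
  have "x \<noteq> 0" "y \<noteq> 0" using x y R.subring S.subring is_subringD(1) by auto
  then show ?thesis
    using x y by (intro exI[of _ "x / y"]) (auto simp: R.mem_iff_ord S.mem_iff_ord R.ord_divide S.ord_divide)
qed

lemma ord_separating:
  assumes "finite T" "\<And>S. S \<in> T \<Longrightarrow> is_dvr S" "is_dvr R" "R \<notin> T"
  shows "\<exists>z. z \<noteq> 0 \<and> ord_at R z > 0 \<and> (\<forall>S\<in>T. ord_at S z < 0)"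
  using assms
proof (induction T rule: finite_induct)
  case empty
  interpret R: dvr R by unfold_locales fact
  have "ord_at R R.\<pi> > 0" using R.ord_\<pi>_powi[of 1] by simp
  then show ?case using R.\<pi> by blast
next
  case (insert S T)
  interpret R: dvr R by unfold_locales fact
  interpret S: dvr S using insert by unfold_locales auto
  have "\<exists>z. z \<noteq> 0 \<and> ord_at R z > 0 \<and> (\<forall>S\<in>T. ord_at S z < 0)"
    using insert.prems by (intro insert.IH) auto
  then obtain z where z: "z \<noteq> 0" "ord_at R z > 0" "\<And>U. U \<in> T \<Longrightarrow> ord_at U z < 0"
    by blast
  obtain y where y: "y \<noteq> 0" "ord_at R y > 0" "ord_at S y < 0"
    using ord_separating_pair[of R S] insert by auto
  show ?case
  proof (cases "ord_at S z < 0")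
    case True
    then show ?thesis using z by blast
  next
    case False
    \<comment> \<open>The exponent exceeds every \<open>\<bar>ord_at U z\<bar>\<close>, so
      \<open>z\<close> and \<open>y ^ r\<close> have different orders at each \<open>U\<close> in
      \<open>T\<close>. Nothing cancels in \<open>z + y ^ r\<close>, which keeps the old poles and
      acquires one at \<open>S\<close>.\<close>
    obtain r :: nat where r: "r > 0" "\<And>U. U \<in> T \<Longrightarrow> int r * ord_at U y \<noteq> ord_at U z"
    proof -
      define b where "b = (\<Sum>U\<in>T. nat \<bar>ord_at U z\<bar>) + 1"
      have "int b * ord_at U y \<noteq> ord_at U z" if U: "U \<in> T" for U
      proof
        assume e: "int b * ord_at U y = ord_at U z"
        then have "ord_at U y \<noteq> 0" using z(3)[OF U] by auto
        then have "int b * 1 \<le> int b * \<bar>ord_at U y\<bar>" by (intro mult_left_mono) auto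
        also have "\<dots> = \<bar>ord_at U z\<bar>" using e by (metis abs_mult abs_of_nat)
        finally have "b \<le> nat \<bar>ord_at U z\<bar>" by simp
        moreover have "nat \<bar>ord_at U z\<bar> \<le> (\<Sum>U\<in>T. nat \<bar>ord_at U z\<bar>)"
          by (rule member_le_sum) (use U insert in auto)
        ultimately show False by (simp add: b_def)
      qed
      then show ?thesis using that[of b] by (simp add: b_def)
    qed
    have yr: "y ^ r \<noteq> 0" using y by simp
    define w where "w = z + y ^ r"
    have wU: "w \<noteq> 0 \<and> ord_at U w < 0" if U: "U \<in> T" for U
    proof -
      interpret U: dvr U using insert U by unfold_locales auto
      have ne: "ord_at U (y ^ r) \<noteq> ord_at U z" using r(2)[OF U] y by (simp add: U.ord_power)
      show ?thesis
      proof (cases "ord_at U z < ord_at U (y ^ r)")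
        case True
        then show ?thesis using U.ord_add_eq[OF z(1)] z(3)[OF U] by (simp add: w_def)
      next
        case False
        then show ?thesis using U.ord_add_eq[OF yr, of z] z(3)[OF U] ne by (simp add: w_def add.commute)
      qed
    qed
    have "int r * ord_at S y < 0" using y(3) r(1) by (simp add: mult_less_0_iff)
    then have S: "w \<noteq> 0" "ord_at S w < 0"
      using S.ord_add_eq[OF yr, of z] False y by (auto simp: w_def add.commute S.ord_power)
    have "1 \<le> ord_at R w"
      unfolding w_def by (rule R.ord_add_ge) (use S z y r in \<open>auto simp: w_def R.ord_power int_one_le_iff_zero_less\<close>)
    then show ?thesis using S wU by (intro exI[of _ w]) auto
  qed
qed

text \<open>If \<open>z\<close> vanishes at \<open>R\<close> and has poles at the other places, then
  \<open>1 / (1 + z ^ n)\<close> is close to \<open>1\<close> at \<open>R\<close> and close to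
  \<open>0\<close> elsewhere.\<close>

lemma weak_approximation_idempotent:
  assumes "finite T" "\<And>S. S \<in> T \<Longrightarrow> is_dvr S" "R \<in> T"
  shows "\<exists>e. e - 1 \<in> fideal R (int M) \<and> (\<forall>S\<in>T - {R}. e \<in> fideal S (int M))"
proof -
  interpret R: dvr R using assms by unfold_locales auto
  obtain z where z: "z \<noteq> 0" "ord_at R z > 0" "\<And>S. S \<in> T - {R} \<Longrightarrow> ord_at S z < 0"
    using ord_separating[of "T - {R}" R] assms by auto
  define n where "n = Suc M"
  have n: "z ^ n \<noteq> 0" using z by simp
  have n0: "int M \<le> int n * k" if "k > 0" for k
  proof -
    have "int M \<le> int n * 1" by (simp add: n_def)
    also have "\<dots> \<le> int n * k" using that by (intro mult_left_mono) auto
    finally show ?thesis .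
  qed
  have npos: "0 < n" by (simp add: n_def)
  have "0 < ord_at R (z ^ n)" using z npos by (simp add: R.ord_power)
  then have R: "1 + z ^ n \<noteq> 0" "ord_at R (1 + z ^ n) = 0"
    using R.ord_add_eq[of 1 "z ^ n"] by auto
  define e where "e = inverse (1 + z ^ n)"
  have "e - 1 = - (z ^ n / (1 + z ^ n))" using R by (simp add: e_def field_simps)
  moreover have "ord_at R (- (z ^ n / (1 + z ^ n))) \<ge> int M"
    using n0[OF z(2)] R z by (simp add: R.ord_minus R.ord_divide[OF n R(1)] R.ord_power)
  ultimately have "e - 1 \<in> fideal R (int M)" by (simp add: fideal_def)
  moreover have "e \<in> fideal S (int M)" if S: "S \<in> T - {R}" for S
  proof -
    interpret S: dvr S using assms S by unfold_locales auto
    have "ord_at S (z ^ n + 1) = int n * ord_at S z"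
      using S.ord_add_eq(2)[of "z ^ n" 1] z(1) z(3)[OF S] npos by (simp add: S.ord_power mult_less_0_iff)
    then have "ord_at S e = int n * (- ord_at S z)"
      using S.ord_inverse[OF R(1)] by (simp add: e_def add.commute)
    then show ?thesis using n0[of "- ord_at S z"] z(3)[OF S] by (simp add: fideal_def)
  qed
  ultimately show ?thesis by blast
qed

theorem weak_approximation:
  assumes T: "finite T" "\<And>S. S \<in> T \<Longrightarrow> is_dvr S"
  shows "\<exists>y. \<forall>S\<in>T. y - x S \<in> fideal S m"
proof -
  \<comment> \<open>The approximate idempotents are going to be multiplied by the
    \<open>x U\<close>; the extra precision in \<open>M\<close> compensates the poles of all
    \<open>x U\<close> at all places of \<open>T\<close>.\<close>
  define M where "M = nat (\<bar>m\<bar> + (\<Sum>S\<in>T. \<Sum>U\<in>T. \<bar>ord_at S (x U)\<bar>))"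
  have M: "m \<le> int M + ord_at S (x U)" if "S \<in> T" "U \<in> T" for S U
  proof -
    have "\<bar>ord_at S (x U)\<bar> \<le> (\<Sum>U\<in>T. \<bar>ord_at S (x U)\<bar>)"
      by (rule member_le_sum) (use that T in auto)
    also have "\<dots> \<le> (\<Sum>S\<in>T. \<Sum>U\<in>T. \<bar>ord_at S (x U)\<bar>)"
      by (rule member_le_sum[of S T "\<lambda>S. \<Sum>U\<in>T. \<bar>ord_at S (x U)\<bar>"]) (use that T in \<open>auto intro: sum_nonneg\<close>)
    finally have "\<bar>m\<bar> + \<bar>ord_at S (x U)\<bar> \<le> int M" by (simp add: M_def)
    then show ?thesis by linarith
  qed
  have "\<forall>R\<in>T. \<exists>e. e - 1 \<in> fideal R (int M) \<and> (\<forall>S\<in>T - {R}. e \<in> fideal S (int M))"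
    using weak_approximation_idempotent[OF T] by blast
  then obtain e where e: "\<And>R. R \<in> T \<Longrightarrow> e R - 1 \<in> fideal R (int M)"
    "\<And>R S. R \<in> T \<Longrightarrow> S \<in> T - {R} \<Longrightarrow> e R \<in> fideal S (int M)" by metis
  define y where "y = (\<Sum>R\<in>T. x R * e R)"
  have "y - x S \<in> fideal S m" if S: "S \<in> T" for S
  proof -
    interpret S: dvr S using T S by unfold_locales auto
    have 1: "x U * a \<in> fideal S m" if "U \<in> T" "a \<in> fideal S (int M)" for U a
    proof (cases "x U = 0")
      case False
      then have "x U \<in> fideal S (ord_at S (x U))" by (simp add: fideal_def)
      from S.fideal_mult[OF this that(2)] show ?thesis
        using S.fideal_antimono[of m "ord_at S (x U) + int M"] M[OF S that(1)] by (auto simp: add.commute)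
    qed (simp add: fideal_def)
    have "y - x S = x S * (e S - 1) + (\<Sum>R\<in>T - {S}. x R * e R)"
      unfolding y_def by (subst sum.remove[OF T(1) S]) (simp add: algebra_simps)
    moreover have "x S * (e S - 1) \<in> fideal S m" using 1 e(1) S by blast
    moreover have "(\<Sum>R\<in>T - {S}. x R * e R) \<in> fideal S m"
      by (rule add_subgroup_sum[OF S.fideal_subgroup]) (use 1 e(2) S in auto)
    ultimately show ?thesis using add_subgroupD(4)[OF S.fideal_subgroup] by metis
  qed
  then show ?thesis by blast
qed

section \<open>Counting elements of a function field\<close>

definition ev :: "('k::field \<Rightarrow> 'a::field) \<Rightarrow> 'a \<Rightarrow> 'k poly \<Rightarrow> 'a" where
  "ev \<iota> t p = poly (map_poly \<iota> p) t"

lemma field_embeddingD: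
  assumes "field_embedding \<iota>"
  shows "\<iota> 0 = 0" "\<iota> 1 = 1" "\<iota> (a + b) = \<iota> a + \<iota> b" "\<iota> (a * b) = \<iota> a * \<iota> b" "\<iota> (- a) = - \<iota> a"
    "\<iota> (a - b) = \<iota> a - \<iota> b" "\<iota> a = 0 \<longleftrightarrow> a = 0" "inj \<iota>" "\<iota> (inverse a) = inverse (\<iota> a)"
proof -
  show 1: "\<iota> 1 = 1" and a: "\<iota> (a + b) = \<iota> a + \<iota> b" and m: "\<iota> (a * b) = \<iota> a * \<iota> b" for a b
    using assms by (auto simp: field_embedding_def)
  show 0: "\<iota> 0 = 0" using a[of 0 0] by (metis add_cancel_right_right add_0)
  show n: "\<iota> (- a) = - \<iota> a" for a using a[of a "- a"] 0 by (simp add: eq_neg_iff_add_eq_0 add.commute)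
  show d: "\<iota> (a - b) = \<iota> a - \<iota> b" for a b using a[of a "- b"] n by simp
  show z: "\<iota> a = 0 \<longleftrightarrow> a = 0" for a
    using m[of a "inverse a"] 1 0 by (cases "a = 0") auto
  show "inj \<iota>" unfolding inj_def using d z by (metis eq_iff_diff_eq_0)
  show "\<iota> (inverse a) = inverse (\<iota> a)"
    using m[of a "inverse a"] 1 0 by (cases "a = 0") (auto simp: inverse_unique)
qed

locale embedding =
  fixes \<iota> :: "'k::field \<Rightarrow> 'a::field"
  assumes embedding: "field_embedding \<iota>"
begin

lemmas emb = field_embeddingD[OF embedding]

lemma ev_0 [simp]: "ev \<iota> t 0 = 0"
  by (simp add: ev_def)

lemma ev_pCons: "ev \<iota> t (pCons a p) = \<iota> a + t * ev \<iota> t p"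
  by (cases "a = 0 \<and> p = 0") (auto simp: ev_def map_poly_pCons emb)

lemma ev_add: "ev \<iota> t (p + q) = ev \<iota> t p + ev \<iota> t q"
  by (induction p q rule: poly_induct2) (simp_all add: ev_pCons emb algebra_simps)

lemma ev_minus: "ev \<iota> t (- p) = - ev \<iota> t p"
  using ev_add[of t p "- p"] by (simp add: eq_neg_iff_add_eq_0 add.commute)

lemma ev_diff: "ev \<iota> t (p - q) = ev \<iota> t p - ev \<iota> t q"
  using ev_add[of t p "- q"] by (simp add: ev_minus)

lemma ev_smult: "ev \<iota> t (Polynomial.smult a p) = \<iota> a * ev \<iota> t p"
  by (induction p) (simp_all add: ev_pCons emb algebra_simps)

lemma ev_mult: "ev \<iota> t (p * q) = ev \<iota> t p * ev \<iota> t q"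
  by (induction p) (simp_all add: ev_pCons ev_add ev_smult emb algebra_simps)

lemma ev_1 [simp]: "ev \<iota> t 1 = 1"
  by (simp add: one_pCons ev_pCons emb)

lemma ev_power: "ev \<iota> t (p ^ n) = ev \<iota> t p ^ n"
  by (induction n) (simp_all add: ev_mult)

lemma ev_X [simp]: "ev \<iota> t [:0, 1:] = t"
  by (simp add: ev_pCons emb)

lemma ev_mem: "is_subring R \<Longrightarrow> range \<iota> \<subseteq> R \<Longrightarrow> t \<in> R \<Longrightarrow> ev \<iota> t p \<in> R"
proof (induction p)
  case (pCons a p)
  have "\<iota> a \<in> R" using pCons.prems(2) by blast
  then show ?case using pCons by (simp add: ev_pCons is_subringD)
qed (simp add: is_subringD)

text \<open>Cancelling the lowest power of \<open>y\<close> in an algebraic equation leaves a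
  non-zero constant term, so \<open>y\<close> divides a non-zero polynomial in \<open>t\<close>.
  This bounds the zeros of \<open>y\<close> by zeros of polynomials and provides inverses in rings
  finite over \<open>k(t)\<close>.\<close>

lemma ex_multiple_ev:
  assumes y: "y \<noteq> 0" and P: "P \<noteq> 0" "poly (map_poly (ev \<iota> t) P) y = 0"
  shows "\<exists>h b n. h \<noteq> 0 \<and> ev \<iota> t h = y * (\<Sum>i<n. ev \<iota> t (b i) * y ^ i)"
proof -
  have deg: "degree (map_poly (ev \<iota> t) P) \<le> degree P" by (rule map_poly_degree_leq)
  have "(\<Sum>i\<le>degree P. ev \<iota> t (coeff P i) * y ^ i) = poly (map_poly (ev \<iota> t) P) y"
    unfolding poly_altdef
    by (rule sum.mono_neutral_cong_right) (use deg in \<open>auto simp: coeff_map_poly intro!: le_degree\<close>)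
  then have 0: "(\<Sum>i\<le>degree P. ev \<iota> t (coeff P i) * y ^ i) = 0" using P(2) by simp
  define k where "k = (LEAST i. coeff P i \<noteq> 0)"
  have k: "coeff P k \<noteq> 0" unfolding k_def by (rule LeastI[of _ "degree P"]) (use P(1) in simp)
  have kz: "coeff P i = 0" if "i < k" for i using not_less_Least that unfolding k_def by blast
  have kd: "k \<le> degree P" using k le_degree by blast
  have "(\<Sum>i\<le>degree P. ev \<iota> t (coeff P i) * y ^ i)
      = ev \<iota> t (coeff P k) * y ^ k + (\<Sum>i=Suc k..<Suc k + (degree P - k). ev \<iota> t (coeff P i) * y ^ i)"
  proof -
    have "(\<Sum>i\<le>degree P. ev \<iota> t (coeff P i) * y ^ i)
        = (\<Sum>i=k..<Suc k + (degree P - k). ev \<iota> t (coeff P i) * y ^ i)"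
      by (rule sum.mono_neutral_right) (use kd kz in auto)
    then show ?thesis by (simp add: sum.atLeast_Suc_lessThan)
  qed
  also have "(\<Sum>i=Suc k..<Suc k + (degree P - k). ev \<iota> t (coeff P i) * y ^ i)
      = (\<Sum>i<degree P - k. ev \<iota> t (coeff P (i + Suc k)) * y ^ (i + Suc k))"
    using sum.shift_bounds_nat_ivl[of "\<lambda>i. ev \<iota> t (coeff P i) * y ^ i" 0 "Suc k" "degree P - k"]
    by (simp add: add.commute atLeast0LessThan)
  also have "\<dots> = y ^ k * (y * (\<Sum>i<degree P - k. ev \<iota> t (coeff P (i + Suc k)) * y ^ i))"
    by (simp add: sum_distrib_left power_add algebra_simps)
  finally have "y ^ k * (ev \<iota> t (coeff P k) + y * (\<Sum>i<degree P - k. ev \<iota> t (coeff P (i + Suc k)) * y ^ i)) = 0"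
    using 0 by (simp add: algebra_simps)
  then have "ev \<iota> t (coeff P k) = - (y * (\<Sum>i<degree P - k. ev \<iota> t (coeff P (i + Suc k)) * y ^ i))"
    using y by (simp add: eq_neg_iff_add_eq_0)
  then have "ev \<iota> t (- coeff P k) = y * (\<Sum>i<degree P - k. ev \<iota> t (coeff P (i + Suc k)) * y ^ i)"
    by (simp add: ev_minus)
  then show ?thesis using k
    by (intro exI[of _ "- coeff P k"] exI[of _ "\<lambda>i. coeff P (i + Suc k)"] exI[of _ "degree P - k"]) simp
qed

end

text \<open>Reduction modulo \<open>h\<close> determines the digit with index zero, and cancelling
  \<open>h\<close> shifts the expansion. \<open>Y\<close> is a partial system of representatives
  modulo \<open>h\<close>.\<close>

lemma digits_unique:
  fixes h :: "'a::field"
  assumes B: "is_subring B" and h: "h \<in> B" "h \<noteq> 0" and "Y \<subseteq> B"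
    and Y: "\<And>y y'. y \<in> Y \<Longrightarrow> y' \<in> Y \<Longrightarrow> y - y' \<in> (*) h ` B \<Longrightarrow> y = y'"
  shows "(\<forall>a<A. s a \<in> Y \<and> s' a \<in> Y) \<Longrightarrow> (\<Sum>a<A. s a * h ^ a) = (\<Sum>a<A. s' a * h ^ a) \<Longrightarrow> \<forall>a<A. s a = s' a"
proof (induction A arbitrary: s s')
  case (Suc A)
  define r where "r s = (\<Sum>a<A. s (Suc a) * h ^ a)" for s :: "nat \<Rightarrow> 'a"
  have e: "(\<Sum>a<Suc A. s a * h ^ a) = s 0 + h * r s" for s
    by (subst sum.lessThan_Suc_shift) (simp add: r_def sum_distrib_left algebra_simps)
  have mem: "r s \<in> B" if "\<forall>a<Suc A. s a \<in> Y" for s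
    unfolding r_def using that \<open>Y \<subseteq> B\<close> h(1) by (auto intro!: is_subring_sum[OF B] is_subringD[OF B])
  have eq: "s 0 + h * r s = s' 0 + h * r s'" using Suc.prems(2) by (simp only: e)
  then have "s 0 - s' 0 = h * (r s' - r s)" by (simp add: algebra_simps)
  moreover have "r s' \<in> B" "r s \<in> B" using Suc.prems(1) by (auto intro!: mem)
  ultimately have "s 0 - s' 0 \<in> (*) h ` B" using is_subringD(3)[OF B] by auto
  then have 0: "s 0 = s' 0" using Suc.prems(1) by (intro Y) auto
  then have "r s = r s'" using eq h(2) by simp
  then have "\<forall>a<A. s (Suc a) = s' (Suc a)"
    using Suc.prems(1) unfolding r_def by (intro Suc.IH) auto
  then show ?case using 0 by (auto simp: less_Suc_eq_0_disj)
qed simp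

text \<open>Passing to high powers removes the constant lost in a comparison of sizes.\<close>

lemma le_of_power_le_const_mult_power:
  fixes x y C :: nat
  assumes "\<And>n. x ^ n \<le> C * y ^ n"
  shows "x \<le> y"
proof (rule ccontr)
  assume "\<not> x \<le> y"
  then have xy: "y < x" by simp
  show False
  proof (cases "y = 0")
    case True
    then show ?thesis using assms[of 1] xy by simp
  next
    case False
    then have "1 < real x / real y" using xy by simp
    then obtain n where n: "real C < (real x / real y) ^ n" using real_arch_pow by blast
    have "real (x ^ n) \<le> real (C * y ^ n)" using assms[of n] of_nat_le_iff by blast
    then have "(real x / real y) ^ n \<le> real C" using False by (simp add: power_divide field_simps)
    then show False using n by simp
  qed
qed

text \<open>The \<open>u i\<close> span the field over \<open>k(t)\<close>, with denominators
  cleared so that only polynomials in \<open>t\<close> occur.\<close>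

definition fin_spans :: "('k::field \<Rightarrow> 'a::field) \<Rightarrow> 'a \<Rightarrow> nat \<Rightarrow> (nat \<Rightarrow> 'a) \<Rightarrow> bool" where
  "fin_spans \<iota> t N u \<longleftrightarrow> (\<forall>y. \<exists>c p. c \<noteq> 0 \<and> ev \<iota> t c * y = (\<Sum>i<N. ev \<iota> t (p i) * u i))"

locale field_extension = embedding \<iota>
  for \<iota> :: "'k::{field,finite} \<Rightarrow> 'a::field" +
  fixes t :: 'a and N :: nat and u :: "nat \<Rightarrow> 'a"
  assumes transcendental: "p \<noteq> 0 \<Longrightarrow> ev \<iota> t p \<noteq> 0"
    and spans: "fin_spans \<iota> t N u"
begin

text \<open>A box has at most \<open>q^(N (b + 1))\<close> elements, and multiplication by a
  polynomial in \<open>t\<close> of degree \<open>d\<close> raises \<open>b\<close> by at most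
  \<open>d\<close>. These two facts turn the number \<open>N\<close> of spanning elements into an
  upper bound for degrees.\<close>

definition box :: "nat \<Rightarrow> 'a set" where
  "box b = {\<Sum>i<N. ev \<iota> t (p i) * u i | p. \<forall>i<N. degree (p i) \<le> b}"

lemma card_polys: "finite {p::'k poly. degree p \<le> b}" "card {p::'k poly. degree p \<le> b} \<le> CARD('k) ^ (b + 1)"
proof -
  let ?f = "\<lambda>c::nat \<Rightarrow> 'k. \<Sum>i\<le>b. monom (c i) i"
  have "{p::'k poly. degree p \<le> b} \<subseteq> ?f ` ({..b} \<rightarrow>\<^sub>E UNIV)"
  proof
    fix p :: "'k poly" assume "p \<in> {p. degree p \<le> b}"
    then have "p = (\<Sum>i\<le>b. monom (coeff p i) i)" by (simp add: poly_as_sum_of_monoms')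
    moreover have "?f (restrict (coeff p) {..b}) = (\<Sum>i\<le>b. monom (coeff p i) i)" by (rule sum.cong) auto
    ultimately have "p = ?f (restrict (coeff p) {..b})" by simp
    then show "p \<in> ?f ` ({..b} \<rightarrow>\<^sub>E UNIV)" by (rule image_eqI[of _ ?f "restrict (coeff p) {..b}"]) simp
  qed
  moreover have "finite ({..b} \<rightarrow>\<^sub>E (UNIV :: 'k set))" by (simp add: finite_PiE)
  moreover have "card ({..b} \<rightarrow>\<^sub>E (UNIV :: 'k set)) = CARD('k) ^ (b + 1)" by (simp add: card_PiE)
  ultimately show "finite {p::'k poly. degree p \<le> b}" "card {p::'k poly. degree p \<le> b} \<le> CARD('k) ^ (b + 1)"
    using surj_card_le[of "{..b} \<rightarrow>\<^sub>E UNIV" "{p::'k poly. degree p \<le> b}" ?f]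
      finite_surj[of "{..b} \<rightarrow>\<^sub>E UNIV" "{p::'k poly. degree p \<le> b}" ?f] by simp_all
qed

lemma box_finite: "finite (box b)" and card_box: "card (box b) \<le> CARD('k) ^ (N * (b + 1))"
proof -
  let ?P = "{p::'k poly. degree p \<le> b}"
  let ?f = "\<lambda>p. \<Sum>i<N. ev \<iota> t (p i) * u i"
  have sub: "box b \<subseteq> ?f ` ({..<N} \<rightarrow>\<^sub>E ?P)"
  proof
    fix z assume "z \<in> box b"
    then obtain p where p: "\<forall>i<N. degree (p i) \<le> b" "z = ?f p" by (auto simp: box_def)
    moreover have "?f (restrict p {..<N}) = ?f p" by (rule sum.cong) auto
    ultimately have "z = ?f (restrict p {..<N})" by simp
    moreover have "restrict p {..<N} \<in> {..<N} \<rightarrow>\<^sub>E ?P" using p(1) by (intro restrict_PiE_iff[THEN iffD2]) auto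
    ultimately show "z \<in> ?f ` ({..<N} \<rightarrow>\<^sub>E ?P)" by (rule image_eqI)
  qed
  have fin: "finite ({..<N} \<rightarrow>\<^sub>E ?P)" by (simp add: finite_PiE card_polys)
  show "finite (box b)" using sub fin by (rule finite_surj[rotated])
  have "card (box b) \<le> card ({..<N} \<rightarrow>\<^sub>E ?P)" using surj_card_le[OF fin sub] .
  also have "\<dots> = card ?P ^ N" by (simp add: card_PiE)
  also have "\<dots> \<le> (CARD('k) ^ (b + 1)) ^ N" by (rule power_mono[OF card_polys(2)]) simp
  also have "\<dots> = CARD('k) ^ (N * (b + 1))" by (simp only: power_mult[symmetric] mult.commute)
  finally show "card (box b) \<le> CARD('k) ^ (N * (b + 1))" .
qed

lemma box_mono: "b \<le> b' \<Longrightarrow> box b \<subseteq> box b'"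
proof
  fix z assume "b \<le> b'" "z \<in> box b"
  then obtain p where "\<forall>i<N. degree (p i) \<le> b" "z = (\<Sum>i<N. ev \<iota> t (p i) * u i)" by (auto simp: box_def)
  with \<open>b \<le> b'\<close> show "z \<in> box b'" unfolding box_def by (intro CollectI exI[of _ p]) auto
qed

lemma box_0 [simp]: "0 \<in> box b"
  unfolding box_def by (rule CollectI, rule exI[of _ "\<lambda>_. 0"]) simp

lemma box_add: "x \<in> box b \<Longrightarrow> y \<in> box b \<Longrightarrow> x + y \<in> box b"
proof -
  assume "x \<in> box b" "y \<in> box b"
  then obtain p p' where "\<forall>i<N. degree (p i) \<le> b" "\<forall>i<N. degree (p' i) \<le> b"
    "x = (\<Sum>i<N. ev \<iota> t (p i) * u i)" "y = (\<Sum>i<N. ev \<iota> t (p' i) * u i)" by (auto simp: box_def)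
  then show "x + y \<in> box b" unfolding box_def
    by (intro CollectI exI[of _ "\<lambda>i. p i + p' i"]) (simp add: degree_add_le ev_add sum.distrib algebra_simps)
qed

lemma box_sum: "(\<And>i. i \<in> A \<Longrightarrow> f i \<in> box b) \<Longrightarrow> sum f A \<in> box b"
  by (induction A rule: infinite_finite_induct) (auto intro: box_add)

lemma box_mult: "x \<in> box b \<Longrightarrow> degree h \<le> d \<Longrightarrow> ev \<iota> t h * x \<in> box (b + d)"
proof -
  assume x: "x \<in> box b" and h: "degree h \<le> d"
  then obtain p where p: "\<forall>i<N. degree (p i) \<le> b" "x = (\<Sum>i<N. ev \<iota> t (p i) * u i)" by (auto simp: box_def)
  have "degree (h * p i) \<le> b + d" if "i < N" for i
    using degree_mult_le[of h "p i"] p(1) h that by (metis add.commute add_mono order_trans)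
  then show ?thesis using p(2) unfolding box_def
    by (intro CollectI exI[of _ "\<lambda>i. h * p i"]) (simp add: ev_mult sum_distrib_left algebra_simps)
qed

lemma finite_subset_box:
  assumes "finite Y"
  shows "\<exists>c b. c \<noteq> 0 \<and> (\<forall>y\<in>Y. ev \<iota> t c * y \<in> box b)"
  using assms
proof (induction Y rule: finite_induct)
  case empty
  show ?case by (rule exI[of _ 1]) simp
next
  case (insert y Y)
  then obtain c b where c: "c \<noteq> 0" "\<And>y. y \<in> Y \<Longrightarrow> ev \<iota> t c * y \<in> box b" by blast
  obtain c' p where p: "c' \<noteq> 0" "ev \<iota> t c' * y = (\<Sum>i<N. ev \<iota> t (p i) * u i)"
    using spans unfolding fin_spans_def by blast
  define b' where "b' = (\<Sum>i<N. degree (p i))"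
  have "ev \<iota> t c' * y \<in> box b'"
    unfolding box_def p(2) b'_def by (intro CollectI exI[of _ p]) (auto intro: member_le_sum)
  from box_mult[OF this order_refl, of c] have "ev \<iota> t (c * c') * y \<in> box (b' + degree c)"
    by (simp add: ev_mult algebra_simps)
  moreover have "ev \<iota> t (c * c') * z \<in> box (b + degree c')" if "z \<in> Y" for z
    using box_mult[OF c(2)[OF that] order_refl, of c'] by (simp add: ev_mult algebra_simps)
  ultimately have "\<forall>z\<in>insert y Y. ev \<iota> t (c * c') * z \<in> box (b + b' + degree c + degree c')"
    using box_mono[of "b' + degree c" "b + b' + degree c + degree c'"]
      box_mono[of "b + degree c'" "b + b' + degree c + degree c'"] by auto
  then show ?case using c(1) p(1) by (metis mult_eq_0_iff)
qed

text \<open>Comparing the number of \<open>h\<close>-adic expansions with \<open>n\<close> digits in \<open>Y\<close> with the size of a box,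
  as \<open>n\<close> grows.\<close>

lemma card_incongruent_le:
  assumes B: "is_subring B" and h: "h = ev \<iota> t h1 / ev \<iota> t h2" "h \<in> B" "h1 \<noteq> 0" "h2 \<noteq> 0"
    and deg: "degree h1 \<le> d" "degree h2 \<le> d"
    and Y: "Y \<subseteq> B" "finite Y" "\<And>y y'. y \<in> Y \<Longrightarrow> y' \<in> Y \<Longrightarrow> y - y' \<in> (*) h ` B \<Longrightarrow> y = y'"
  shows "card Y \<le> CARD('k) ^ (N * d)"
proof -
  obtain c b where c: "c \<noteq> 0" "\<And>y. y \<in> Y \<Longrightarrow> ev \<iota> t c * y \<in> box b" using finite_subset_box[OF Y(2)] by blast
  have nz: "ev \<iota> t c \<noteq> 0" "ev \<iota> t h1 \<noteq> 0" "ev \<iota> t h2 \<noteq> 0" using transcendental c(1) h by auto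
  then have h0: "h \<noteq> 0" using h by simp
  have "card Y ^ n \<le> CARD('k) ^ (N * (b + 1)) * (CARD('k) ^ (N * d)) ^ n" for n
  proof -
    \<comment> \<open>The factor \<open>ev \<iota> t h2 ^ n\<close> clears the denominators of all
      \<open>h ^ a\<close> with \<open>a < n\<close>, and \<open>ev \<iota> t c\<close> moves the
      digits into a box that does not depend on \<open>n\<close>.\<close>
    define f where "f s = ev \<iota> t c * ev \<iota> t h2 ^ n * (\<Sum>a<n. s a * h ^ a)" for s :: "nat \<Rightarrow> 'a"
    have inj: "inj_on f ({..<n} \<rightarrow>\<^sub>E Y)"
    proof (rule inj_onI)
      fix s s' assume s: "s \<in> {..<n} \<rightarrow>\<^sub>E Y" "s' \<in> {..<n} \<rightarrow>\<^sub>E Y" "f s = f s'"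
      then have "(\<Sum>a<n. s a * h ^ a) = (\<Sum>a<n. s' a * h ^ a)" using nz by (simp add: f_def)
      moreover have "\<forall>a<n. s a \<in> Y \<and> s' a \<in> Y" using s by auto
      ultimately have "\<forall>a<n. s a = s' a" using digits_unique[OF B h(2) h0 Y(1,3)] by blast
      then show "s = s'" by (intro PiE_ext[OF s(1,2)]) auto
    qed
    have sub: "f ` ({..<n} \<rightarrow>\<^sub>E Y) \<subseteq> box (b + n * d)"
    proof
      fix z assume "z \<in> f ` ({..<n} \<rightarrow>\<^sub>E Y)"
      then obtain s where s: "s \<in> {..<n} \<rightarrow>\<^sub>E Y" "z = f s" by blast
      have "z = (\<Sum>a<n. ev \<iota> t (h1 ^ a * h2 ^ (n - a)) * (ev \<iota> t c * s a))"
        unfolding s(2) f_def sum_distrib_left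
      proof (rule sum.cong)
        fix a assume "a \<in> {..<n}"
        then have "ev \<iota> t h2 ^ n = ev \<iota> t h2 ^ a * ev \<iota> t h2 ^ (n - a)" by (simp add: power_add[symmetric])
        then show "ev \<iota> t c * ev \<iota> t h2 ^ n * (s a * h ^ a) = ev \<iota> t (h1 ^ a * h2 ^ (n - a)) * (ev \<iota> t c * s a)"
          using nz by (simp add: h(1) ev_mult ev_power power_divide)
      qed simp
      moreover have "ev \<iota> t (h1 ^ a * h2 ^ (n - a)) * (ev \<iota> t c * s a) \<in> box (b + n * d)" if "a < n" for a
      proof (rule box_mult)
        show "ev \<iota> t c * s a \<in> box b" using c(2) s(1) that by auto
        have pw: "degree (p ^ k) \<le> k * d" if "degree p \<le> d" for p :: "'k poly" and k
          using order_trans[OF degree_power_le[of p k] mult_le_mono1[OF that, of k]] by (simp add: mult.commute)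
        have "degree (h1 ^ a) \<le> a * d" "degree (h2 ^ (n - a)) \<le> (n - a) * d"
          using pw deg by blast+
        then have "degree (h1 ^ a * h2 ^ (n - a)) \<le> a * d + (n - a) * d"
          using degree_mult_le[of "h1 ^ a" "h2 ^ (n - a)"] by linarith
        then show "degree (h1 ^ a * h2 ^ (n - a)) \<le> n * d"
          using that by (simp add: add_mult_distrib[symmetric])
      qed
      ultimately show "z \<in> box (b + n * d)" by (auto intro: box_sum)
    qed
    have "card Y ^ n = card ({..<n} \<rightarrow>\<^sub>E Y)" by (simp add: card_PiE)
    also have "\<dots> \<le> card (box (b + n * d))" by (rule card_inj_on_le[OF inj sub box_finite])
    also have "\<dots> \<le> CARD('k) ^ (N * (b + n * d + 1))" by (rule card_box)
    also have "\<dots> = CARD('k) ^ (N * (b + 1)) * (CARD('k) ^ (N * d)) ^ n"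
      by (simp add: power_add[symmetric] power_mult[symmetric] algebra_simps)
    finally show ?thesis .
  qed
  then show ?thesis by (rule le_of_power_le_const_mult_power)
qed

text \<open>A Chinese remainder argument: weak approximation merges the choices at the individual
  places into elements of the ring \<open>\<Inter>T\<close>, and different choices stay incongruent
  modulo \<open>h\<close>. The bound for a single ring then applies.\<close>

lemma prod_card_incongruent_le:
  assumes h: "h = ev \<iota> t h1 / ev \<iota> t h2" "h1 \<noteq> 0" "h2 \<noteq> 0" "degree h1 \<le> d" "degree h2 \<le> d"
    and T: "finite T" "\<And>R. R \<in> T \<Longrightarrow> is_dvr R" "\<And>R. R \<in> T \<Longrightarrow> 0 \<le> ord_at R h"
    and Y: "\<And>R. R \<in> T \<Longrightarrow> Y R \<subseteq> R" "\<And>R. R \<in> T \<Longrightarrow> finite (Y R)"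
      "\<And>R y y'. R \<in> T \<Longrightarrow> y \<in> Y R \<Longrightarrow> y' \<in> Y R \<Longrightarrow> y - y' \<in> fideal R (ord_at R h) \<Longrightarrow> y = y'"
  shows "(\<Prod>R\<in>T. card (Y R)) \<le> CARD('k) ^ (N * d)"
proof -
  have h0: "h \<noteq> 0" using h transcendental by auto
  \<comment> \<open>All orders are non-negative, so their sum bounds each of them and approximation
    to precision \<open>M\<close> decides congruence modulo \<open>h\<close> at every place.\<close>
  define M where "M = (\<Sum>R\<in>T. ord_at R h)"
  have M: "ord_at R h \<le> M" if "R \<in> T" for R
    unfolding M_def by (rule member_le_sum) (use that T in auto)
  have "\<forall>s. \<exists>x. \<forall>R\<in>T. x - s R \<in> fideal R M" using weak_approximation[OF T(1,2)] by blast
  then obtain f where f: "\<And>s R. R \<in> T \<Longrightarrow> f s - s R \<in> fideal R M" by metis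
  have fcong: "s R - s' R \<in> fideal R (ord_at R h)"
    if R: "R \<in> T" and ff: "f s - f s' \<in> fideal R (ord_at R h)" for s s' R
  proof -
    interpret R: dvr R using T R by unfold_locales auto
    have *: "f s - s R \<in> fideal R (ord_at R h)" for s
      using f[OF R, of s] R.fideal_antimono[OF M[OF R]] by blast
    have "s R - s' R = (f s - f s') - (f s - s R) + (f s' - s' R)" by simp
    then show ?thesis using * ff add_subgroupD[OF R.fideal_subgroup] by metis
  qed
  define B where "B = \<Inter>T"
  have sub: "\<And>R. R \<in> T \<Longrightarrow> is_subring R" using T(2) by (simp add: is_dvr_def)
  have B: "is_subring B" unfolding B_def is_subring_def using is_subringD[OF sub] by auto
  have hR: "(*) h ` R = fideal R (ord_at R h)" "h \<in> R" if "R \<in> T" for R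
  proof -
    interpret R: dvr R using T that by unfold_locales auto
    show "(*) h ` R = fideal R (ord_at R h)" using R.fideal_scale[OF h0, of 0] by (simp add: R.fideal_0)
    show "h \<in> R" using T(3)[OF that] by (simp add: R.mem_iff_ord)
  qed
  have hB: "h \<in> B" using hR by (simp add: B_def)
  have eq: "s = s'" if s: "s \<in> Pi\<^sub>E T Y" "s' \<in> Pi\<^sub>E T Y" and ss: "f s - f s' \<in> (*) h ` B" for s s'
  proof (rule PiE_ext[OF s])
    fix R assume R: "R \<in> T"
    have "f s - f s' \<in> fideal R (ord_at R h)" using ss hR[OF R] R unfolding B_def by blast
    then show "s R = s' R" using Y(3)[OF R] fcong[OF R] s R by (metis PiE_mem)
  qed
  have "0 \<in> (*) h ` B" using is_subringD(1)[OF B] by (auto intro: image_eqI[of _ _ 0])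
  then have inj: "inj_on f (Pi\<^sub>E T Y)" using eq by (auto intro!: inj_onI)
  have "card (f ` Pi\<^sub>E T Y) \<le> CARD('k) ^ (N * d)"
  proof (rule card_incongruent_le[OF B h(1) hB h(2-5)])
    show "f ` Pi\<^sub>E T Y \<subseteq> B"
    proof (clarsimp simp: B_def)
      fix s R assume s: "s \<in> Pi\<^sub>E T Y" and R: "R \<in> T"
      interpret R: dvr R using T R by unfold_locales auto
      have "fideal R M \<subseteq> R"
        using R.fideal_antimono[of 0 M] order_trans[OF T(3)[OF R] M[OF R]] by (simp add: R.fideal_0)
      then have "f s - s R \<in> R" using f[OF R, of s] by blast
      moreover have "s R \<in> R" using s Y(1)[OF R] R by auto
      ultimately have "f s - s R + s R \<in> R" using is_subringD(6)[OF R.subring] by blast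
      then show "f s \<in> R" by simp
    qed
    show "finite (f ` Pi\<^sub>E T Y)" using T(1) Y(2) by (simp add: finite_PiE)
    show "y = y'" if "y \<in> f ` Pi\<^sub>E T Y" "y' \<in> f ` Pi\<^sub>E T Y" "y - y' \<in> (*) h ` B" for y y'
      using that eq by blast
  qed
  moreover have "card (f ` Pi\<^sub>E T Y) = (\<Prod>R\<in>T. card (Y R))"
    using T(1) by (simp add: card_image[OF inj] card_PiE)
  ultimately show ?thesis by simp
qed

text \<open>In multiplicative form, zeros of \<open>h\<close> have total degree at most
  \<open>N * d\<close>. Finiteness of the quotients is settled at one place at a time, since
  infinitely many cosets would supply more incongruent elements than the bound admits; then full
  systems of representatives are used at all places of \<open>T\<close> together.\<close>

lemma
  assumes h: "h = ev \<iota> t h1 / ev \<iota> t h2" "h1 \<noteq> 0" "h2 \<noteq> 0" "degree h1 \<le> d" "degree h2 \<le> d"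
    and T: "finite T" "\<And>R. R \<in> T \<Longrightarrow> is_dvr R" "\<And>R. R \<in> T \<Longrightarrow> 0 \<le> ord_at R h"
  shows prod_index_fideal_le: "(\<Prod>R\<in>T. index R (fideal R (ord_at R h))) \<le> CARD('k) ^ (N * d)"
    and finite_cosets_fideal: "\<And>R. R \<in> T \<Longrightarrow> finite (cosets R (fideal R (ord_at R h)))"
proof -
  have reps: "\<exists>Y\<subseteq>R. finite Y \<and> card Y = card C \<and> (\<forall>y\<in>Y. \<forall>y'\<in>Y. y - y' \<in> fideal R (ord_at R h) \<longrightarrow> y = y')"
    if R: "R \<in> T" and C: "C \<subseteq> cosets R (fideal R (ord_at R h))" "finite C" for C R
  proof -
    interpret R: dvr R using T R by unfold_locales auto
    obtain Y where Y: "Y \<subseteq> R" "inj_on (\<lambda>x. (+) x ` fideal R (ord_at R h)) Y"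
      "C = (\<lambda>x. (+) x ` fideal R (ord_at R h)) ` Y"
      using C(1) unfolding cosets_def subset_image_inj by blast
    then show ?thesis using C(2) coset_eq_iff[OF R.fideal_subgroup]
      by (intro exI[of _ Y]) (auto simp: card_image finite_image_iff inj_on_def)
  qed
  show fin: "finite (cosets R (fideal R (ord_at R h)))" if R: "R \<in> T" for R
  proof (rule ccontr)
    assume "infinite (cosets R (fideal R (ord_at R h)))"
    then obtain C where C: "C \<subseteq> cosets R (fideal R (ord_at R h))" "finite C" "card C = Suc (CARD('k) ^ (N * d))"
      using infinite_arbitrarily_large by blast
    obtain Y where Y: "Y \<subseteq> R" "finite Y" "card Y = card C"
      "\<And>y y'. y \<in> Y \<Longrightarrow> y' \<in> Y \<Longrightarrow> y - y' \<in> fideal R (ord_at R h) \<Longrightarrow> y = y'"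
      using reps[OF R C(1,2)] by blast
    have "(\<Prod>R\<in>{R}. card Y) \<le> CARD('k) ^ (N * d)"
      by (rule prod_card_incongruent_le[OF h]) (use R T Y in auto)
    then show False using C(3) Y(3) by simp
  qed
  have "\<forall>R. \<exists>Y. R \<in> T \<longrightarrow> Y \<subseteq> R \<and> finite Y \<and> card Y = index R (fideal R (ord_at R h)) \<and>
      (\<forall>y\<in>Y. \<forall>y'\<in>Y. y - y' \<in> fideal R (ord_at R h) \<longrightarrow> y = y')"
  proof (intro allI)
    fix R show "\<exists>Y. R \<in> T \<longrightarrow> Y \<subseteq> R \<and> finite Y \<and> card Y = index R (fideal R (ord_at R h)) \<and>
      (\<forall>y\<in>Y. \<forall>y'\<in>Y. y - y' \<in> fideal R (ord_at R h) \<longrightarrow> y = y')"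
      using reps[OF _ order_refl fin, of R] unfolding index_def by (cases "R \<in> T") auto
  qed
  then obtain Y where Y: "\<And>R. R \<in> T \<Longrightarrow> Y R \<subseteq> R" "\<And>R. R \<in> T \<Longrightarrow> finite (Y R)"
      "\<And>R. R \<in> T \<Longrightarrow> card (Y R) = index R (fideal R (ord_at R h))"
      "\<And>R y y'. R \<in> T \<Longrightarrow> y \<in> Y R \<Longrightarrow> y' \<in> Y R \<Longrightarrow> y - y' \<in> fideal R (ord_at R h) \<Longrightarrow> y = y'"
    by metis
  have "(\<Prod>R\<in>T. card (Y R)) \<le> CARD('k) ^ (N * d)"
    by (rule prod_card_incongruent_le[OF h T Y(1,2,4)]) auto
  then show "(\<Prod>R\<in>T. index R (fideal R (ord_at R h))) \<le> CARD('k) ^ (N * d)"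
    using Y(3) by simp
qed

lemma finite_cosets_max_ideal:
  assumes "h = ev \<iota> t h1 / ev \<iota> t h2" "h1 \<noteq> 0" "h2 \<noteq> 0" and R: "is_dvr R" "1 \<le> ord_at R h"
  shows "finite (cosets R (max_ideal R))"
proof -
  interpret R: dvr R using R by unfold_locales
  have "finite (cosets R (fideal R (ord_at R h)))"
    by (rule finite_cosets_fideal[OF assms(1-3), of "max (degree h1) (degree h2)" "{R}"]) (use R in auto)
  then show ?thesis
    using index_tower(2)[OF R.fideal_subgroup[of 1] R.fideal_subgroup[of "ord_at R h"] R.fideal_subgroup[of 0]]
      R.fideal_antimono[OF R(2)] R.fideal_antimono[of 0 1] by (simp add: R.fideal_0 R.fideal_1)
qed

text \<open>The elements \<open>0\<close> and \<open>1\<close> are incongruent at every zero of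
  \<open>h\<close>. With \<open>m\<close> the counting bound itself, \<open>m\<close> zeros would
  give \<open>2 ^ m \<le> m\<close>.\<close>

lemma finite_zeros:
  assumes h: "h = ev \<iota> t h1 / ev \<iota> t h2" "h1 \<noteq> 0" "h2 \<noteq> 0" and V: "\<And>R. R \<in> V \<Longrightarrow> is_dvr R"
  shows "finite {R\<in>V. 1 \<le> ord_at R h}"
proof (rule ccontr)
  let ?d = "max (degree h1) (degree h2)"
  define m where "m = CARD('k) ^ (N * ?d)"
  assume "infinite {R\<in>V. 1 \<le> ord_at R h}"
  then obtain T where T: "T \<subseteq> {R\<in>V. 1 \<le> ord_at R h}" "finite T" "card T = m"
    using infinite_arbitrarily_large by blast
  have "(\<Prod>R\<in>T. card {0::'a, 1}) \<le> m"
    unfolding m_def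
  proof (rule prod_card_incongruent_le[OF h])
    fix R assume R: "R \<in> T"
    then show "is_dvr R" "0 \<le> ord_at R h" using T V by auto
    then interpret R: dvr R by unfold_locales
    show "{0::'a, 1} \<subseteq> R" using is_subringD[OF R.subring] by auto
    fix y y' :: 'a assume "y \<in> {0, 1}" "y' \<in> {0, 1}" "y - y' \<in> fideal R (ord_at R h)"
    moreover have "1 \<le> ord_at R h" using T R by auto
    ultimately show "y = y'" by (auto simp: fideal_def R.ord_minus)
  qed (use T in auto)
  then have "2 ^ m \<le> m" using T(3) by (simp add: numeral_2_eq_2)
  then show False using less_exp[of m] by simp
qed

end

section \<open>Divisors and the Riemann inequality\<close>

lemma (in embedding) vector_space_mult: "vector_space (\<lambda>c a. \<iota> c * a)"
  by unfold_locales (simp_all add: emb algebra_simps)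

text \<open>\<open>independent\<close> makes \<open>u\<close> a basis over \<open>k(t)\<close>, so
  \<open>N\<close> is the degree of the extension; the lower bound for dimensions in
  \<open>defect_bounded\<close> rests on it. It is through \<open>constants_V\<close> that
  \<open>V\<close> has to contain enough places.\<close>

locale function_field = field_extension \<iota> t N u
  for \<iota> :: "'k::{field,finite} \<Rightarrow> 'a::field" and t :: 'a and N :: nat and u :: "nat \<Rightarrow> 'a" +
  fixes V :: "'a set set"
  assumes dvr_V: "R \<in> V \<Longrightarrow> is_dvr R"
    and scalars_V: "R \<in> V \<Longrightarrow> range \<iota> \<subseteq> R"
    and constants_V: "\<Inter>V = range \<iota>"
    and independent: "(\<Sum>i<N. ev \<iota> t (p i) * u i) = 0 \<Longrightarrow> i < N \<Longrightarrow> p i = 0"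
    and algebraic: "\<exists>P :: 'k poly poly. P \<noteq> 0 \<and> poly (map_poly (ev \<iota> t) P) y = 0"
begin

sublocale scal: vector_space "\<lambda>c a. \<iota> c * a"
  by (rule vector_space_mult)

lemma dvr_locale: "R \<in> V \<Longrightarrow> dvr R"
  by unfold_locales (rule dvr_V)

lemmas fideal_subgroup = dvr.fideal_subgroup[OF dvr_locale]
  and fideal_antimono = dvr.fideal_antimono[OF dvr_locale]

lemma t_nonzero: "t \<noteq> 0"
  using transcendental[of "[:0, 1:]"] by simp

lemma subspace_fideal: "R \<in> V \<Longrightarrow> scal.subspace (fideal R m)"
proof -
  assume R: "R \<in> V"
  interpret R: dvr R by (rule dvr_locale[OF R])
  have "\<iota> c * x \<in> fideal R m" if "x \<in> fideal R m" for c x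
  proof -
    have "\<iota> c \<in> fideal R 0" using scalars_V[OF R] by (auto simp: R.fideal_0)
    from R.fideal_mult[OF this that] show ?thesis by simp
  qed
  then show ?thesis
    unfolding scal.subspace_def using add_subgroupD[OF R.fideal_subgroup] by blast
qed

lemma ex_multiple_ev':
  "y \<noteq> 0 \<Longrightarrow> \<exists>h b n. h \<noteq> 0 \<and> ev \<iota> t h = y * (\<Sum>i<n. ev \<iota> t (b i) * y ^ i)"
  using algebraic ex_multiple_ev by blast

lemma ord_multiple_ev:
  assumes R: "R \<in> V" "t \<in> R" "y \<noteq> 0" "1 \<le> ord_at R y" "ev \<iota> t h = y * (\<Sum>i<n. ev \<iota> t (b i) * y ^ i)" "h \<noteq> 0"
  shows "1 \<le> ord_at R (ev \<iota> t h)"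
proof -
  interpret R: dvr R by (rule dvr_locale[OF R(1)])
  have y: "y \<in> R" using R(4) by (simp add: R.mem_iff_ord)
  let ?s = "\<Sum>i<n. ev \<iota> t (b i) * y ^ i"
  have "?s \<in> R"
    by (intro is_subring_sum[OF R.subring] is_subringD(4,7)[OF R.subring] ev_mem[OF R.subring]
        scalars_V R y)
  moreover have "ev \<iota> t h \<noteq> 0" using transcendental R(6) .
  then have "?s \<noteq> 0" using R(5) by auto
  ultimately have "0 \<le> ord_at R ?s" by (simp add: R.mem_iff_ord)
  then show ?thesis using R(4) \<open>?s \<noteq> 0\<close> by (simp add: R(5) R.ord_mult[OF R(3)])
qed

lemma ex_local_polynomial:
  assumes R: "R \<in> V" "t \<in> R"
  shows "\<exists>h. h \<noteq> 0 \<and> 1 \<le> ord_at R (ev \<iota> t h)"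
proof -
  interpret R: dvr R by (rule dvr_locale[OF R(1)])
  have "ord_at R R.\<pi> = 1" using R.ord_\<pi>_powi[of 1] by simp
  then show ?thesis using ex_multiple_ev'[OF R.\<pi>(2)] ord_multiple_ev[OF R R.\<pi>(2)] by (metis order_refl)
qed

lemma finite_residue: "R \<in> V \<Longrightarrow> finite (cosets R (max_ideal R))"
proof -
  assume R: "R \<in> V"
  interpret R: dvr R by (rule dvr_locale[OF R(1)])
  show ?thesis
  proof (cases "t \<in> R")
    case True
    then obtain h where "h \<noteq> 0" "1 \<le> ord_at R (ev \<iota> t h)" using ex_local_polynomial R by blast
    then show ?thesis using finite_cosets_max_ideal[of "ev \<iota> t h" h 1 R] R dvr_V by simp
  next
    case False
    then have "1 \<le> ord_at R (1 / t)" using t_nonzero by (simp add: R.mem_iff_ord R.ord_divide)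
    then show ?thesis using finite_cosets_max_ideal[of "1 / t" 1 "[:0, 1:]" R] R dvr_V by simp
  qed
qed

text \<open>A zero of \<open>x\<close> at which \<open>t\<close> is regular is a zero of a fixed
  polynomial in \<open>t\<close>; every other place is a zero of \<open>1 / t\<close>. Both sets are
  finite by \<open>finite_zeros\<close>.\<close>

lemma finite_ord_pos: "x \<noteq> 0 \<Longrightarrow> finite {R\<in>V. 1 \<le> ord_at R x}"
proof -
  assume x: "x \<noteq> 0"
  obtain h b n where h: "h \<noteq> 0" "ev \<iota> t h = x * (\<Sum>i<n. ev \<iota> t (b i) * x ^ i)" using ex_multiple_ev'[OF x] by blast
  have "{R\<in>V. 1 \<le> ord_at R x} \<subseteq> {R\<in>V. 1 \<le> ord_at R (ev \<iota> t h)} \<union> {R\<in>V. 1 \<le> ord_at R (1 / t)}"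
  proof
    fix R assume "R \<in> {R\<in>V. 1 \<le> ord_at R x}"
    then have R: "R \<in> V" "1 \<le> ord_at R x" by auto
    interpret R: dvr R by (rule dvr_locale[OF R(1)])
    show "R \<in> {R\<in>V. 1 \<le> ord_at R (ev \<iota> t h)} \<union> {R\<in>V. 1 \<le> ord_at R (1 / t)}"
    proof (cases "t \<in> R")
      case True
      then show ?thesis using ord_multiple_ev[OF R(1) True x R(2) h(2,1)] R by simp
    next
      case False
      then show ?thesis using R(1) t_nonzero by (simp add: R.mem_iff_ord R.ord_divide)
    qed
  qed
  moreover have "finite {R\<in>V. 1 \<le> ord_at R (ev \<iota> t h)}"
    by (rule finite_zeros[of _ h 1]) (use h dvr_V in auto)
  moreover have "finite {R\<in>V. 1 \<le> ord_at R (1 / t)}"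
    by (rule finite_zeros[of _ 1 "[:0, 1:]"]) (use dvr_V in auto)
  ultimately show ?thesis by (meson finite_UnI finite_subset)
qed

lemma finite_ord: "x \<noteq> 0 \<Longrightarrow> finite {R\<in>V. ord_at R x \<noteq> 0}"
proof -
  assume x: "x \<noteq> 0"
  have "{R\<in>V. ord_at R x \<noteq> 0} \<subseteq> {R\<in>V. 1 \<le> ord_at R x} \<union> {R\<in>V. 1 \<le> ord_at R (inverse x)}"
    using dvr.ord_inverse[OF dvr_locale x] by auto
  then show ?thesis using finite_ord_pos[OF x] finite_ord_pos[of "inverse x"] x
    by (meson finite_UnI finite_subset inverse_nonzero_iff_nonzero)
qed

section \<open>Residue degrees, divisors and adeles\<close>

lemma q_gt_1: "1 < CARD('k)"
proof -
  have "card {0::'k, 1} \<le> CARD('k)" by (rule card_mono) auto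
  then show ?thesis by simp
qed

abbreviation rdeg :: "'a set \<Rightarrow> nat" where "rdeg \<equiv> residue_degree \<iota>"

lemma q_power_rdeg: "R \<in> V \<Longrightarrow> CARD('k) ^ rdeg R = index R (max_ideal R)"
  unfolding residue_degree_def
  using scal.card_quotient_dim[OF finite subspace_fideal[of R 0] subspace_fideal[of R 1]] finite_residue[of R]
    fideal_antimono[of R 0 1] dvr.fideal_0[OF dvr_locale] dvr.fideal_1[OF dvr_locale] by simp

lemma rdeg_pos: "R \<in> V \<Longrightarrow> 0 < rdeg R"
proof (rule ccontr)
  assume R: "R \<in> V" and "\<not> 0 < rdeg R"
  interpret R: dvr R by (rule dvr_locale[OF R(1)])
  have m: "add_subgroup (max_ideal R)" using R.fideal_subgroup[of 1] by (simp add: R.fideal_1)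
  have "card (cosets R (max_ideal R)) = 1" using q_power_rdeg[OF R] \<open>\<not> 0 < rdeg R\<close> by (simp add: index_def)
  then obtain C where "cosets R (max_ideal R) = {C}" by (rule card_1_singletonE)
  moreover have "(+) 1 ` max_ideal R \<in> cosets R (max_ideal R)" "(+) 0 ` max_ideal R \<in> cosets R (max_ideal R)"
    unfolding cosets_def using is_subringD(1,2)[OF R.subring] by blast+
  ultimately have "(+) 1 ` max_ideal R = (+) 0 ` max_ideal R" by (metis singletonD)
  then have "1 \<in> max_ideal R" using coset_eq_iff[OF m, of 1 0] by simp
  then show False using one_unit[OF R.subring] by blast
qed

lemma index_fideal_q:
  assumes "R \<in> V" "m \<le> m'"
  shows "index (fideal R m) (fideal R m') = CARD('k) ^ (rdeg R * nat (m' - m))"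
    "finite (cosets (fideal R m) (fideal R m'))"
proof -
  have "m' = m + int (nat (m' - m))" using assms by simp
  then show "index (fideal R m) (fideal R m') = CARD('k) ^ (rdeg R * nat (m' - m))"
    "finite (cosets (fideal R m) (fideal R m'))"
    using dvr.index_fideal[OF dvr_locale finite_residue, of R m "nat (m' - m)"] assms(1)
    by (simp_all add: q_power_rdeg[symmetric] power_mult)
qed

definition divisor :: "('a set \<Rightarrow> int) \<Rightarrow> bool" where
  "divisor D \<longleftrightarrow> finite {R. D R \<noteq> 0} \<and> {R. D R \<noteq> 0} \<subseteq> V"

definition deg :: "('a set \<Rightarrow> int) \<Rightarrow> int" where
  "deg D = (\<Sum>R | D R \<noteq> 0. int (rdeg R) * D R)"

lemma deg_eq_sum: "finite S \<Longrightarrow> (\<And>R. D R \<noteq> 0 \<Longrightarrow> R \<in> S) \<Longrightarrow> deg D = (\<Sum>R\<in>S. int (rdeg R) * D R)"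
  unfolding deg_def by (rule sum.mono_neutral_left) auto

lemma divisor_0: "divisor (\<lambda>_. 0)"
  by (simp add: divisor_def)

lemma deg_0: "deg (\<lambda>_. 0) = 0"
  by (simp add: deg_def)

lemma divisor_zip: "divisor D \<Longrightarrow> divisor D' \<Longrightarrow> f 0 0 = 0 \<Longrightarrow> divisor (\<lambda>R. f (D R) (D' R))"
proof -
  assume a: "divisor D" "divisor D'" "f 0 0 = 0"
  have "{R. f (D R) (D' R) \<noteq> 0} \<subseteq> {R. D R \<noteq> 0} \<union> {R. D' R \<noteq> 0}" using a(3) by auto
  then show ?thesis using a(1,2) unfolding divisor_def by (meson Un_least finite_UnI finite_subset order_trans)
qed

lemma divisor_add: "divisor D \<Longrightarrow> divisor D' \<Longrightarrow> divisor (\<lambda>R. D R + D' R)"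
  by (rule divisor_zip) auto

lemma divisor_max: "divisor D \<Longrightarrow> divisor D' \<Longrightarrow> divisor (\<lambda>R. max (D R) (D' R))"
  by (rule divisor_zip) auto

lemma divisor_scale: "divisor D \<Longrightarrow> divisor (\<lambda>R. m * D R)"
  using divisor_zip[of D D "\<lambda>a b. m * a"] by simp

lemma deg_add: "divisor D \<Longrightarrow> divisor D' \<Longrightarrow> deg (\<lambda>R. D R + D' R) = deg D + deg D'"
proof -
  assume a: "divisor D" "divisor D'"
  let ?S = "{R. D R \<noteq> 0} \<union> {R. D' R \<noteq> 0}"
  have "finite ?S" using a by (simp add: divisor_def)
  then show ?thesis
    by (subst (1 2 3) deg_eq_sum[of ?S]) (auto simp: sum.distrib algebra_simps)
qed

lemma deg_scale: "divisor D \<Longrightarrow> deg (\<lambda>R. m * D R) = m * deg D"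
proof -
  assume a: "divisor D"
  have "finite {R. D R \<noteq> 0}" using a by (simp add: divisor_def)
  then show ?thesis
    by (subst (1 2) deg_eq_sum[of "{R. D R \<noteq> 0}"]) (auto simp: sum_distrib_left algebra_simps)
qed

lemma deg_diff: "divisor D \<Longrightarrow> divisor D' \<Longrightarrow> deg (\<lambda>R. D R - D' R) = deg D - deg D'"
  using deg_add[of D "\<lambda>R. (-1) * D' R"] deg_scale[of D' "-1"] divisor_scale[of D' "-1"] by simp

lemma deg_mono: "divisor D \<Longrightarrow> divisor D' \<Longrightarrow> (\<And>R. D R \<le> D' R) \<Longrightarrow> deg D \<le> deg D'"
proof -
  assume a: "divisor D" "divisor D'" "\<And>R. D R \<le> D' R"
  let ?S = "{R. D R \<noteq> 0} \<union> {R. D' R \<noteq> 0}"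
  have "finite ?S" using a by (simp add: divisor_def)
  then show ?thesis
    by (subst (1 2) deg_eq_sum[of ?S]) (auto intro!: sum_mono mult_left_mono a(3))
qed

text \<open>Families of local functions with poles bounded by \<open>D\<close>. Components outside
  \<open>V\<close> are unrestricted, so they contribute a trivial factor to every index between two
  such groups.\<close>

definition adeles :: "('a set \<Rightarrow> int) \<Rightarrow> ('a set \<Rightarrow> 'a) set" where
  "adeles D = {s. \<forall>R. s R \<in> (if R \<in> V then fideal R (- D R) else UNIV)}"

definition L :: "('a set \<Rightarrow> int) \<Rightarrow> 'a set" where
  "L D = {x. \<forall>R\<in>V. x \<in> fideal R (- D R)}"

definition diag :: "('a set \<Rightarrow> 'a) set" where
  "diag = range (\<lambda>x R. x)"

lemma adeles_subgroup: "add_subgroup (adeles D)"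
  using fideal_subgroup by (auto simp: adeles_def add_subgroup_def)

lemma diag_subgroup: "add_subgroup diag"
  by (auto simp: diag_def add_subgroup_def image_iff fun_eq_iff)

lemma subspace_L: "scal.subspace (L D)"
  using subspace_fideal unfolding L_def scal.subspace_def by blast

lemma L_subgroup: "add_subgroup (L D)"
  by (rule scal.add_subgroup_subspace[OF subspace_L])

lemma L_mono: "(\<And>R. D R \<le> D' R) \<Longrightarrow> L D \<subseteq> L D'"
  using fideal_antimono[of _ "- D' _" "- D _"] unfolding L_def by fastforce

lemma adeles_mono: "(\<And>R. D R \<le> D' R) \<Longrightarrow> adeles D \<subseteq> adeles D'"
proof
  fix s assume le: "\<And>R. D R \<le> D' R" and s: "s \<in> adeles D"
  have "fideal R (- D R) \<subseteq> fideal R (- D' R)" if "R \<in> V" for R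
    by (rule fideal_antimono[OF that]) (simp add: le)
  with s show "s \<in> adeles D'" unfolding adeles_def by (auto split: if_splits)
qed

lemma index_adeles:
  assumes D: "divisor D" "divisor D'" and le: "\<And>R. D R \<le> D' R"
  shows "index (adeles D') (adeles D) = CARD('k) ^ nat (deg D' - deg D)" "finite (cosets (adeles D') (adeles D))"
proof -
  let ?G = "\<lambda>D R. if R \<in> V then fideal R (- D R) else UNIV"
  let ?S = "{R. D R \<noteq> 0} \<union> {R. D' R \<noteq> 0}"
  have S: "finite ?S" "?S \<subseteq> V" using D by (auto simp: divisor_def)
  have G: "add_subgroup (?G D R)" for D R using fideal_subgroup[of R] by (auto simp: add_subgroup_def)
  have sub: "?G D R \<subseteq> ?G D' R" for R using fideal_antimono[of R "- D' R" "- D R"] le by auto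
  have eq: "?G D' R = ?G D R" if "R \<notin> ?S" for R using that by auto
  have i: "index (?G D' R) (?G D R) = CARD('k) ^ (rdeg R * nat (D' R - D R))" "finite (cosets (?G D' R) (?G D R))"
    if "R \<in> ?S" for R
    using index_fideal_q[of R "- D' R" "- D R"] that S(2) le by auto
  have "index (adeles D') (adeles D) = (\<Prod>R\<in>?S. index (?G D' R) (?G D R))"
    unfolding adeles_def by (rule index_family(1)[OF G G sub S(1) eq])
  also have "\<dots> = CARD('k) ^ (\<Sum>R\<in>?S. rdeg R * nat (D' R - D R))" by (simp only: i(1) power_sum cong: prod.cong)
  also have "(\<Sum>R\<in>?S. rdeg R * nat (D' R - D R)) = nat (deg D' - deg D)"
  proof -
    have "deg D' - deg D = (\<Sum>R\<in>?S. int (rdeg R) * D' R) - (\<Sum>R\<in>?S. int (rdeg R) * D R)"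
      using deg_eq_sum[OF S(1), of D] deg_eq_sum[OF S(1), of D'] by auto
    also have "\<dots> = int (\<Sum>R\<in>?S. rdeg R * nat (D' R - D R))"
      using le by (simp add: sum_subtractf[symmetric] algebra_simps)
    finally have e: "deg D' - deg D = int (\<Sum>R\<in>?S. rdeg R * nat (D' R - D R))" .
    show ?thesis unfolding e by (rule nat_int[symmetric])
  qed
  finally show "index (adeles D') (adeles D) = CARD('k) ^ nat (deg D' - deg D)" .
  show "finite (cosets (adeles D') (adeles D))"
    unfolding adeles_def by (rule index_family(2)[OF G G sub S(1) eq i(2)])
qed

lemma index_L_eq_diag:
  assumes "\<And>R. D R \<le> D' R"
  shows "index (L D') (L D) = index (adeles D' \<inter> diag) (adeles D \<inter> diag)"
    "finite (cosets (L D') (L D)) = finite (cosets (adeles D' \<inter> diag) (adeles D \<inter> diag))"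
proof -
  have "adeles D \<inter> diag = (\<lambda>x R. x) ` L D" for D by (auto simp: adeles_def diag_def L_def split: if_splits)
  moreover have "inj (\<lambda>(x::'a) (R::'a set). x)" by (auto simp: inj_def fun_eq_iff)
  ultimately show "index (L D') (L D) = index (adeles D' \<inter> diag) (adeles D \<inter> diag)"
    "finite (cosets (L D') (L D)) = finite (cosets (adeles D' \<inter> diag) (adeles D \<inter> diag))"
    using index_additive_image[OF L_subgroup L_subgroup L_mono[of D D', OF assms], of "\<lambda>(x::'a) (R::'a set). x"]
    by (auto simp: fun_eq_iff)
qed

lemma L_0: "L (\<lambda>_. 0) = range \<iota>"
proof -
  have "L (\<lambda>_. 0) = \<Inter>V" using dvr.fideal_0[OF dvr_locale] by (auto simp: L_def)
  then show ?thesis using constants_V by simp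
qed

text \<open>Enlarge \<open>D\<close> to the maximum of \<open>D\<close> and \<open>0\<close>: the
  resulting space has finite index over \<open>L (\<lambda>_. 0)\<close> by the adelic count, and
  the latter is the finite field of constants.\<close>

lemma finite_L: "divisor D \<Longrightarrow> finite (L D)"
proof -
  assume D: "divisor D"
  let ?D' = "\<lambda>R. max (D R) 0"
  have D': "divisor ?D'" using divisor_max[OF D divisor_0] .
  have "finite (cosets (adeles ?D' \<inter> diag) (adeles (\<lambda>_. 0) \<inter> diag))"
    using index_sum_Int(2)[OF adeles_subgroup adeles_subgroup adeles_mono[of "\<lambda>_. 0" ?D'] diag_subgroup]
      index_adeles(2)[OF divisor_0 D'] by simp
  then have "finite (cosets (L ?D') (L (\<lambda>_. 0)))" using index_L_eq_diag(2)[of "\<lambda>_. 0" ?D'] by simp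
  moreover have "finite (L (\<lambda>_. 0))" by (simp add: L_0)
  ultimately have "finite (L ?D')"
    using card_eq_index_times(2)[OF L_subgroup L_subgroup L_mono[of "\<lambda>_. 0" ?D']] by simp
  then show ?thesis using L_mono[of D ?D'] finite_subset by fastforce
qed

definition ell :: "('a set \<Rightarrow> int) \<Rightarrow> nat" where
  "ell D = scal.dim (L D)"

lemma card_L: "divisor D \<Longrightarrow> card (L D) = CARD('k) ^ ell D"
  unfolding ell_def by (rule scal.card_subspace[OF finite subspace_L finite_L])

lemma ell_0: "ell (\<lambda>_. 0) = 1"
proof -
  have "CARD('k) ^ ell (\<lambda>_. 0) = CARD('k) ^ 1"
    using card_L[OF divisor_0] by (simp add: L_0 card_image emb)
  then show ?thesis using q_gt_1 power_inject_exp by blast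
qed

text \<open>In the adelic description of \<open>H^1\<close>, the index on the left is the order of the kernel of
  \<open>H^1(D) \<rightarrow> H^1(D')\<close>.\<close>

lemma index_adeles_diag:
  assumes D: "divisor D" "divisor D'" and le: "\<And>R. D R \<le> D' R"
  shows "index {a + x | a x. a \<in> adeles D' \<and> x \<in> diag} {a + x | a x. a \<in> adeles D \<and> x \<in> diag} * CARD('k) ^ ell D'
      = CARD('k) ^ (nat (deg D' - deg D) + ell D)"
    "finite (cosets {a + x | a x. a \<in> adeles D' \<and> x \<in> diag} {a + x | a x. a \<in> adeles D \<and> x \<in> diag})"
proof -
  note i = index_sum_Int[OF adeles_subgroup adeles_subgroup adeles_mono[of D D', OF le] diag_subgroup]
  note j = index_L_eq_diag[of D D', OF le]
  have "card (L D') = index (L D') (L D) * card (L D)"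
    by (rule card_eq_index_times(1)[OF L_subgroup L_subgroup L_mono[of D D', OF le]])
  then show "index {a + x | a x. a \<in> adeles D' \<and> x \<in> diag} {a + x | a x. a \<in> adeles D \<and> x \<in> diag} * CARD('k) ^ ell D'
      = CARD('k) ^ (nat (deg D' - deg D) + ell D)"
    using i(1) j(1) index_adeles(1)[OF assms] by (simp add: card_L D power_add)
  show "finite (cosets {a + x | a x. a \<in> adeles D' \<and> x \<in> diag} {a + x | a x. a \<in> adeles D \<and> x \<in> diag})"
    using i(2) index_adeles(2)[OF assms] by simp
qed

text \<open>By \<open>index_adeles_diag\<close>, for \<open>D \<le> D'\<close> the difference
  \<open>defect D' - defect D\<close> is the dimension of the kernel of
  \<open>H^1(D) \<rightarrow> H^1(D')\<close>. Thus \<open>defect\<close> is minus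
  \<open>dim H^1\<close> up to a constant.\<close>

definition defect :: "('a set \<Rightarrow> int) \<Rightarrow> int" where
  "defect D = deg D - int (ell D)"

lemma defect_mono:
  assumes "divisor D" "divisor D'" "\<And>R. D R \<le> D' R"
  shows "defect D \<le> defect D'"
proof -
  let ?i = "index {a + x | a x. a \<in> adeles D' \<and> x \<in> diag} {a + x | a x. a \<in> adeles D \<and> x \<in> diag}"
  have "0 < ?i" by (rule index_pos[OF index_adeles_diag(2)[OF assms]])
      (use add_subgroupD(1)[OF adeles_subgroup] add_subgroupD(1)[OF diag_subgroup] in blast)
  then have "CARD('k) ^ ell D' \<le> CARD('k) ^ (nat (deg D' - deg D) + ell D)"
    unfolding index_adeles_diag(1)[OF assms, symmetric] by simp
  then have "ell D' \<le> nat (deg D' - deg D) + ell D" using q_gt_1 power_increasing_iff by blast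
  then show ?thesis using deg_mono[OF assms] by (simp add: defect_def)
qed

end

lemma index_1_imp_subset:
  assumes "add_subgroup G" "add_subgroup H" "index G H = 1"
  shows "G \<subseteq> H"
proof
  fix x assume x: "x \<in> G"
  obtain C where C: "cosets G H = {C}" using assms(3) unfolding index_def by (rule card_1_singletonE)
  have "(+) x ` H \<in> cosets G H" "(+) 0 ` H \<in> cosets G H"
    unfolding cosets_def by (rule imageI, fact x, rule imageI, rule add_subgroupD(1)[OF assms(1)])
  then have "(+) x ` H = (+) 0 ` H" using C by (metis singletonD)
  then show "x \<in> H" using coset_eq_iff[OF assms(2), of x 0] by simp
qed

context function_field
begin

lemma card_polys_ge: "CARD('k) ^ (b + 1) \<le> card {p::'k poly. degree p \<le> b}"
proof -
  let ?f = "\<lambda>c::nat \<Rightarrow> 'k. \<Sum>i\<le>b. monom (c i) i"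
  have c: "coeff (?f c) i = c i" if "i \<le> b" for c i using that by (simp add: coeff_sum if_distrib cong: if_cong)
  have "inj_on ?f ({..b} \<rightarrow>\<^sub>E UNIV)"
  proof (rule inj_onI)
    fix x y assume xy: "x \<in> {..b} \<rightarrow>\<^sub>E UNIV" "y \<in> {..b} \<rightarrow>\<^sub>E UNIV" "?f x = ?f y"
    have "x i = y i" if "i \<in> {..b}" for i using c[of i x] c[of i y] that xy(3) by simp
    then show "x = y" by (rule PiE_ext[OF xy(1,2)])
  qed
  moreover have "?f ` ({..b} \<rightarrow>\<^sub>E UNIV) \<subseteq> {p. degree p \<le> b}"
    by (auto intro!: degree_sum_le order_trans[OF degree_monom_le])
  ultimately have "card ({..b} \<rightarrow>\<^sub>E (UNIV :: 'k set)) \<le> card {p::'k poly. degree p \<le> b}"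
    using card_polys(1) by (rule card_inj_on_le)
  then show ?thesis by (simp add: card_PiE)
qed

section \<open>Principal divisors, Riemann's inequality and the vanishing of
  \<open>H^1\<close>\<close>

definition dv :: "'a \<Rightarrow> 'a set \<Rightarrow> int" where
  "dv x R = (if R \<in> V then ord_at R x else 0)"

lemma divisor_dv: "x \<noteq> 0 \<Longrightarrow> divisor (dv x)"
proof -
  assume "x \<noteq> 0"
  moreover have "{R. dv x R \<noteq> 0} = {R\<in>V. ord_at R x \<noteq> 0}" by (auto simp: dv_def)
  ultimately show ?thesis using finite_ord by (simp add: divisor_def)
qed

definition poles :: "'a \<Rightarrow> 'a set \<Rightarrow> int" where
  "poles x R = (if R \<in> V then max 0 (- ord_at R x) else 0)"

lemma divisor_poles: "x \<noteq> 0 \<Longrightarrow> divisor (poles x)"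
proof -
  assume "x \<noteq> 0"
  moreover have e: "poles x = (\<lambda>R. max ((-1) * dv x R) 0)" by (auto simp: poles_def dv_def fun_eq_iff)
  ultimately show ?thesis unfolding e by (intro divisor_max divisor_scale divisor_dv divisor_0)
qed

lemma deg_zeros_le:
  assumes h: "h = ev \<iota> t h1 / ev \<iota> t h2" "h1 \<noteq> 0" "h2 \<noteq> 0" "degree h1 \<le> d" "degree h2 \<le> d"
    and T: "finite T" "T \<subseteq> V" "\<And>R. R \<in> T \<Longrightarrow> 0 \<le> ord_at R h"
  shows "(\<Sum>R\<in>T. int (rdeg R) * ord_at R h) \<le> int (N * d)"
proof -
  have "CARD('k) ^ (\<Sum>R\<in>T. rdeg R * nat (ord_at R h)) = (\<Prod>R\<in>T. index R (fideal R (ord_at R h)))"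
    unfolding power_sum
  proof (rule prod.cong)
    fix R assume R: "R \<in> T"
    then show "CARD('k) ^ (rdeg R * nat (ord_at R h)) = index R (fideal R (ord_at R h))"
      using index_fideal_q(1)[of R 0 "ord_at R h"] T dvr.fideal_0[OF dvr_locale, of R] by auto
  qed simp
  also have "\<dots> \<le> CARD('k) ^ (N * d)"
    by (rule prod_index_fideal_le[OF h T(1)]) (use T dvr_V in auto)
  finally have "(\<Sum>R\<in>T. rdeg R * nat (ord_at R h)) \<le> N * d" using q_gt_1 power_increasing_iff by blast
  then have "int (\<Sum>R\<in>T. rdeg R * nat (ord_at R h)) \<le> int (N * d)" by (simp only: of_nat_le_iff)
  moreover have "int (\<Sum>R\<in>T. rdeg R * nat (ord_at R h)) = (\<Sum>R\<in>T. int (rdeg R) * ord_at R h)"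
    unfolding of_nat_sum by (rule sum.cong) (use T in auto)
  ultimately show ?thesis by simp
qed

text \<open>Up to a principal divisor, every divisor is bounded by a divisor \<open>m B + C\<close>, where \<open>B\<close> is the polar
  divisor of \<open>t\<close> and \<open>C\<close> bounds the poles of the basis \<open>u\<close>.\<close>

lemma defect_bounded: "\<exists>c. \<forall>D. divisor D \<longrightarrow> defect D \<le> c"
proof -
  define C where "C R = (\<Sum>i<N. if u i = 0 then 0 else poles (u i) R)" for R
  have C: "divisor C"
  proof -
    have "divisor (\<lambda>R. \<Sum>i\<in>I. if u i = 0 then 0 else poles (u i) R)" if "finite I" for I :: "nat set"
      using that
    proof induction
      case (insert i I)
      have "divisor (\<lambda>R. if u i = 0 then 0 else poles (u i) R)"
        using divisor_poles[of "u i"] divisor_0 by (cases "u i = 0") auto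
      from divisor_add[OF this insert.IH] show ?case using insert by simp
    qed (simp add: divisor_0)
    then show ?thesis unfolding C_def by simp
  qed
  have C0: "0 \<le> C R" for R unfolding C_def by (rule sum_nonneg) (auto simp: poles_def)
  have uC: "u i \<in> L C" if "i < N" for i
    unfolding L_def
  proof (intro CollectI ballI)
    fix R assume R: "R \<in> V"
    show "u i \<in> fideal R (- C R)"
    proof (cases "u i = 0")
      case False
      have "poles (u i) R = (if u i = 0 then 0 else poles (u i) R)" using False by simp
      also have "\<dots> \<le> C R" unfolding C_def
        by (rule member_le_sum[of i "{..<N}" "\<lambda>i. if u i = 0 then 0 else poles (u i) R"])
          (use that in \<open>auto simp: poles_def\<close>)
      finally show ?thesis using False R by (simp add: fideal_def poles_def)
    qed (simp add: fideal_def)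
  qed
  let ?B = "poles t"
  have dB: "divisor ?B" by (rule divisor_poles[OF t_nonzero])
  \<comment> \<open>The poles of \<open>t\<close> are the zeros of \<open>1 / t\<close>, a quotient
    of polynomials of degree at most one.\<close>
  have degB: "deg ?B \<le> int N"
  proof -
    let ?T = "{R. ?B R \<noteq> 0}"
    have T: "finite ?T" "?T \<subseteq> V" using dB by (auto simp: divisor_def)
    have ord: "?B R = ord_at R (1 / t) \<and> 0 \<le> ord_at R (1 / t)" if "R \<in> ?T" for R
    proof -
      interpret R: dvr R using T that dvr_V by unfold_locales auto
      show ?thesis using that T t_nonzero by (auto simp: poles_def R.ord_divide)
    qed
    then have "deg ?B = (\<Sum>R\<in>?T. int (rdeg R) * ord_at R (1 / t))" unfolding deg_def by simp
    also have "\<dots> \<le> int (N * 1)"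
      by (rule deg_zeros_le[of _ 1 "[:0, 1:]", OF _ _ _ _ _ T]) (use conjunct2[OF ord] in simp_all)
    finally show ?thesis by simp
  qed
  have "defect D \<le> deg C - int N" if D: "divisor D" for D
  proof -
    \<comment> \<open>Where \<open>t\<close> is regular, the positive part of \<open>D\<close> is
      dominated by the zeros of a polynomial \<open>H\<close> in \<open>t\<close>; at the poles of
      \<open>t\<close> it is dominated by the multiple \<open>m\<close> of the polar divisor.
      Division by \<open>H\<close> is the principal shift.\<close>
    define F where "F = {R. D R \<noteq> 0 \<and> t \<in> R}"
    have F: "finite F" "F \<subseteq> V" using D unfolding F_def divisor_def by (auto elim: finite_subset[rotated])
    have "\<forall>R. \<exists>h. R \<in> F \<longrightarrow> h \<noteq> 0 \<and> 1 \<le> ord_at R (ev \<iota> t h)"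
      using ex_local_polynomial F(2) unfolding F_def by (metis (mono_tags, lifting) mem_Collect_eq subsetD)
    then obtain h where h: "\<And>R. R \<in> F \<Longrightarrow> h R \<noteq> 0" "\<And>R. R \<in> F \<Longrightarrow> 1 \<le> ord_at R (ev \<iota> t (h R))"
      by metis
    define H where "H = (\<Prod>R\<in>F. h R ^ nat (D R))"
    have H0: "H \<noteq> 0" using h(1) F(1) by (simp add: H_def)
    then have evH: "ev \<iota> t H \<noteq> 0" by (rule transcendental)
    define d where "d = degree H"
    define m where "m = (\<Sum>R | D R \<noteq> 0. nat \<bar>D R\<bar>)"
    define Z where "Z R = (if R \<in> V \<and> t \<in> R then ord_at R (ev \<iota> t H) else 0)" for R
    have evR: "0 \<le> ord_at R (ev \<iota> t p)" if "R \<in> V" "t \<in> R" "p \<noteq> 0" for R p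
    proof -
      interpret R: dvr R by (rule dvr_locale[OF that(1)])
      have "ev \<iota> t p \<in> R" by (rule ev_mem[OF R.subring scalars_V]) (use that in auto)
      then show ?thesis using transcendental[OF that(3)] by (simp add: R.mem_iff_ord)
    qed
    have Z0: "0 \<le> Z R" for R using evR H0 by (simp add: Z_def)
    have dZ: "divisor Z"
    proof -
      have sub: "{R. Z R \<noteq> 0} \<subseteq> {R\<in>V. ord_at R (ev \<iota> t H) \<noteq> 0}" by (auto simp: Z_def)
      show ?thesis
        unfolding divisor_def using finite_subset[OF sub finite_ord[OF evH]] sub by blast
    qed
    have degZ: "deg Z \<le> int (N * d)"
    proof -
      have T: "finite {R. Z R \<noteq> 0}" "{R. Z R \<noteq> 0} \<subseteq> V" using dZ by (auto simp: divisor_def)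
      have "deg Z = (\<Sum>R | Z R \<noteq> 0. int (rdeg R) * ord_at R (ev \<iota> t H))"
        unfolding deg_def by (rule sum.cong) (auto simp: Z_def)
      also have "\<dots> \<le> int (N * d)"
        by (rule deg_zeros_le[of _ H 1]) (use T H0 evR in \<open>auto simp: d_def Z_def split: if_splits\<close>)
      finally show ?thesis .
    qed
    define D' where "D' R = int m * ?B R + C R + Z R" for R
    have dmB: "divisor (\<lambda>R. int m * ?B R)" by (rule divisor_scale[OF dB])
    have dD': "divisor D'" unfolding D'_def by (rule divisor_add[OF divisor_add[OF dmB C] dZ])
    have degD': "deg D' = int m * deg ?B + deg C + deg Z"
      unfolding D'_def by (simp add: deg_add[OF divisor_add[OF dmB C] dZ] deg_add[OF dmB C] deg_scale[OF dB])
    have le: "D R \<le> D' R" for R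
    proof (cases "D R \<le> 0")
      case True
      have "0 \<le> ?B R" by (simp add: poles_def)
      then have "0 \<le> D' R" unfolding D'_def using C0[of R] Z0[of R] by (intro add_nonneg_nonneg mult_nonneg_nonneg) auto
      then show ?thesis using True by simp
    next
      case False
      then have R: "R \<in> V" using D by (auto simp: divisor_def)
      interpret R: dvr R by (rule dvr_locale[OF R])
      show ?thesis
      proof (cases "t \<in> R")
        case True
        have RF: "R \<in> F" using False True by (simp add: F_def)
        have "H = h R ^ nat (D R) * (\<Prod>S\<in>F - {R}. h S ^ nat (D S))"
          unfolding H_def by (rule prod.remove[OF F(1) RF])
        moreover have p0: "(\<Prod>S\<in>F - {R}. h S ^ nat (D S)) \<noteq> 0" using h(1) F(1) by simp
        ultimately have "ord_at R (ev \<iota> t H) = D R * ord_at R (ev \<iota> t (h R))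
            + ord_at R (ev \<iota> t (\<Prod>S\<in>F - {R}. h S ^ nat (D S)))"
          using transcendental[OF h(1)[OF RF]] transcendental[OF p0] False
          by (simp add: ev_mult ev_power R.ord_mult R.ord_power)
        moreover have "D R * 1 \<le> D R * ord_at R (ev \<iota> t (h R))"
          using h(2)[OF RF] False by (intro mult_left_mono) auto
        moreover have "Z R = ord_at R (ev \<iota> t H)" using R True by (simp add: Z_def)
        ultimately have "D R \<le> Z R" using evR[OF R True p0] by linarith
        moreover have "0 \<le> int m * ?B R" by (simp add: poles_def)
        ultimately show ?thesis using C0[of R] by (simp add: D'_def)
      next
        case F: False
        then have "1 \<le> ?B R" using R by (simp add: poles_def R.mem_iff_ord)
        then have "int m * 1 \<le> int m * ?B R" by (intro mult_left_mono) auto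
        moreover have "nat \<bar>D R\<bar> \<le> m" unfolding m_def
          by (rule member_le_sum) (use D False in \<open>auto simp: divisor_def\<close>)
        ultimately show ?thesis using C0[of R] Z0[of R] by (simp add: D'_def)
      qed
    qed
    \<comment> \<open>The fractions \<open>(\<Sum>i. p i * u i) / H\<close> with
      \<open>degree (p i) \<le> m + d\<close> are pairwise distinct and lie in \<open>L D'\<close>.
      At the poles of \<open>t\<close> the degree \<open>d\<close> of the denominator makes up for
      the excess of the numerator degrees over \<open>m\<close>.\<close>
    have "N * (m + d + 1) \<le> ell D'"
    proof -
      let ?P = "{p::'k poly. degree p \<le> m + d}"
      let ?f = "\<lambda>p. (\<Sum>i<N. ev \<iota> t (p i) * u i) / ev \<iota> t H"
      have inj: "inj_on ?f ({..<N} \<rightarrow>\<^sub>E ?P)"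
      proof (rule inj_onI)
        fix x y assume xy: "x \<in> {..<N} \<rightarrow>\<^sub>E ?P" "y \<in> {..<N} \<rightarrow>\<^sub>E ?P" "?f x = ?f y"
        then have "(\<Sum>i<N. ev \<iota> t (x i - y i) * u i) = 0"
          using evH by (simp add: ev_diff left_diff_distrib sum_subtractf)
        then have "x i - y i = 0" if "i < N" for i by (rule independent[OF _ that])
        then have "x i = y i" if "i \<in> {..<N}" for i using that by simp
        then show "x = y" by (rule PiE_ext[OF xy(1,2)])
      qed
      have sub: "?f ` ({..<N} \<rightarrow>\<^sub>E ?P) \<subseteq> L D'"
      proof (clarsimp simp: L_def)
        fix p R assume p: "p \<in> {..<N} \<rightarrow>\<^sub>E ?P" and R: "R \<in> V"
        interpret R: dvr R by (rule dvr_locale[OF R])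
        show "?f p \<in> fideal R (- D' R)"
        proof (cases "t \<in> R")
          case True
          have "ev \<iota> t (p i) * u i \<in> fideal R (- C R)" if "i < N" for i
          proof -
            have "ev \<iota> t (p i) \<in> fideal R 0"
              using ev_mem[OF R.subring scalars_V[OF R] True] by (simp add: R.fideal_0)
            moreover have "u i \<in> fideal R (- C R)" using uC[OF that] R by (simp add: L_def)
            ultimately show ?thesis using R.fideal_mult by fastforce
          qed
          then have "(\<Sum>i<N. ev \<iota> t (p i) * u i) \<in> fideal R (- C R)"
            by (intro add_subgroup_sum[OF R.fideal_subgroup]) auto
          moreover have "inverse (ev \<iota> t H) \<in> fideal R (- Z R)"
            using evH R True by (simp add: fideal_def Z_def R.ord_inverse)
          ultimately have "?f p \<in> fideal R (- C R + (- Z R))"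
            unfolding divide_inverse by (rule R.fideal_mult)
          moreover have "?B R = 0" using True R t_nonzero by (auto simp: poles_def R.mem_iff_ord)
          ultimately show ?thesis by (simp add: D'_def)
        next
          case False
          then have ot: "ord_at R t < 0" by (simp add: R.mem_iff_ord)
          then have B: "?B R = - ord_at R t" using R by (simp add: poles_def)
          have ev_ord: "ev \<iota> t g \<in> fideal R (int e * ord_at R t)" if "degree g \<le> e" for g e
          proof -
            have "ev \<iota> t g = (\<Sum>i\<le>degree g. \<iota> (coeff g i) * t ^ i)"
            proof -
              have "poly (map_poly \<iota> g) t = (\<Sum>i\<le>degree g. \<iota> (coeff g i) * t ^ i)"
                unfolding poly_altdef
                by (rule sum.mono_neutral_cong_left)
                  (use map_poly_degree_leq[of \<iota> g] in \<open>auto simp: coeff_map_poly emb intro!: le_degree\<close>)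
              then show ?thesis by (simp add: ev_def)
            qed
            moreover have "\<iota> (coeff g i) * t ^ i \<in> fideal R (int e * ord_at R t)" if "i \<in> {..degree g}" for i
            proof -
              have "int e * ord_at R t \<le> int i * ord_at R t"
                using that \<open>degree g \<le> e\<close> ot by (intro mult_right_mono_neg) auto
              moreover have "\<iota> (coeff g i) \<in> fideal R 0" using scalars_V[OF R] by (auto simp: R.fideal_0)
              moreover have "t ^ i \<in> fideal R (int i * ord_at R t)"
                using t_nonzero by (simp add: fideal_def R.ord_power)
              ultimately show ?thesis using R.fideal_mult[of "\<iota> (coeff g i)" 0 "t ^ i"] R.fideal_antimono by fastforce
            qed
            ultimately show ?thesis
              by (simp only:) (rule add_subgroup_sum[OF R.fideal_subgroup])
          qed
          \<comment> \<open>At a pole of \<open>t\<close> the leading term strictly dominates the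
            lower ones, so no cancellation can occur.\<close>
          have "ord_at R (ev \<iota> t H) = int d * ord_at R t"
            unfolding ev_def d_def
          proof -
            define g where "g = (\<Sum>i<degree H. \<iota> (coeff H i) * t ^ i)"
            define b where "b = \<iota> (lead_coeff H) * t ^ degree H"
            have e: "poly (map_poly \<iota> H) t = b + g"
            proof -
              have "poly (map_poly \<iota> H) t = (\<Sum>i\<le>degree H. \<iota> (coeff H i) * t ^ i)"
                unfolding poly_altdef
                by (rule sum.mono_neutral_cong_left)
                  (use map_poly_degree_leq[of \<iota> H] in \<open>auto simp: coeff_map_poly emb intro!: le_degree\<close>)
              then show ?thesis by (simp add: b_def g_def lessThan_Suc_atMost[symmetric])
            qed
            have lc: "\<iota> (lead_coeff H) \<in> R - max_ideal R"
              unfolding unit_iff using scalars_V[OF R] H0 emb(9)[symmetric] by (auto simp: emb(7))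
            then have b0: "b \<noteq> 0" and ordb: "ord_at R b = int (degree H) * ord_at R t"
              using t_nonzero R.ord_unit[OF lc] unfolding b_def unit_iff by (auto simp: R.ord_mult R.ord_power)
            have "g \<in> fideal R (int (degree H) * ord_at R t + 1)"
              unfolding g_def
            proof (rule add_subgroup_sum[OF R.fideal_subgroup])
              fix i assume i: "i \<in> {..<degree H}"
              have "int (degree H) * ord_at R t \<le> int (Suc i) * ord_at R t"
                using i ot by (intro mult_right_mono_neg) auto
              also have "\<dots> \<le> int i * ord_at R t - 1" using ot by (simp add: algebra_simps)
              finally have "int (degree H) * ord_at R t + 1 \<le> 0 + int i * ord_at R t" by simp
              moreover have "\<iota> (coeff H i) \<in> fideal R 0" using scalars_V[OF R] by (auto simp: R.fideal_0)
              moreover have "t ^ i \<in> fideal R (int i * ord_at R t)"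
                using t_nonzero by (simp add: fideal_def R.ord_power)
              ultimately show "\<iota> (coeff H i) * t ^ i \<in> fideal R (int (degree H) * ord_at R t + 1)"
                using R.fideal_mult[of "\<iota> (coeff H i)" 0 "t ^ i"] R.fideal_antimono by blast
            qed
            then have "g = 0 \<or> ord_at R b < ord_at R g" by (auto simp: fideal_def ordb)
            then show "ord_at R (poly (map_poly \<iota> H) t) = int (degree H) * ord_at R t"
              unfolding e using R.ord_add_eq(2)[OF b0] ordb by simp
          qed
          then have iH: "inverse (ev \<iota> t H) \<in> fideal R (- (int d * ord_at R t))"
            using evH by (simp add: fideal_def R.ord_inverse)
          have "ev \<iota> t (p i) * u i \<in> fideal R (int (m + d) * ord_at R t + (- C R))" if "i < N" for i
          proof (rule R.fideal_mult)
            show "ev \<iota> t (p i) \<in> fideal R (int (m + d) * ord_at R t)" using p that by (intro ev_ord) auto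
            show "u i \<in> fideal R (- C R)" using uC[OF that] R by (simp add: L_def)
          qed
          then have "(\<Sum>i<N. ev \<iota> t (p i) * u i) \<in> fideal R (int (m + d) * ord_at R t + (- C R))"
            by (intro add_subgroup_sum[OF R.fideal_subgroup]) auto
          from R.fideal_mult[OF this iH] show ?thesis
            using False by (simp add: D'_def B Z_def divide_inverse algebra_simps)
        qed
      qed
      have "CARD('k) ^ (N * (m + d + 1)) = (CARD('k) ^ (m + d + 1)) ^ N"
        by (simp only: power_mult[symmetric] mult.commute)
      also have "\<dots> \<le> card ?P ^ N" by (rule power_mono[OF card_polys_ge]) simp
      also have "\<dots> = card ({..<N} \<rightarrow>\<^sub>E ?P)" by (simp add: card_PiE)
      also have "\<dots> \<le> card (L D')" by (rule card_inj_on_le[OF inj sub finite_L[OF dD']])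
      finally show ?thesis using card_L[OF dD'] q_gt_1 power_increasing_iff by metis
    qed
    \<comment> \<open>Since \<open>deg D' \<le> m N + deg C + d N\<close>, the quantities
      \<open>m\<close> and \<open>d\<close>, which depend on \<open>D\<close>, cancel in the
      difference and only \<open>deg C - N\<close> is left.\<close>
    then have "int (N * (m + d + 1)) \<le> int (ell D')" by (simp only: of_nat_le_iff)
    moreover have "int m * deg ?B \<le> int m * int N" using degB by (intro mult_left_mono) auto
    ultimately have "defect D' \<le> deg C - int N" using degD' degZ by (simp add: defect_def algebra_simps)
    then show ?thesis using defect_mono[OF D dD' le] by simp
  qed
  then show ?thesis by blast
qed

text \<open>\<open>H^1(D) = 0\<close> for \<open>D \<ge> D0\<close>, and \<open>gg\<close> turns out to be the genus.\<close>

definition D0 :: "'a set \<Rightarrow> int" where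
  "D0 = (SOME D. divisor D \<and> (\<forall>D'. divisor D' \<longrightarrow> defect D' \<le> defect D))"

lemma D0: "divisor D0" "\<And>D. divisor D \<Longrightarrow> defect D \<le> defect D0"
proof -
  obtain c where c: "\<And>D. divisor D \<Longrightarrow> defect D \<le> c" using defect_bounded by blast
  define k where "k = (LEAST k. \<exists>D. divisor D \<and> nat (c - defect D) = k)"
  have "\<exists>D. divisor D \<and> nat (c - defect D) = k" unfolding k_def by (rule LeastI_ex) (use divisor_0 in blast)
  then obtain D where D: "divisor D" "nat (c - defect D) = k" by blast
  have "defect D' \<le> defect D" if D': "divisor D'" for D'
  proof -
    have "k \<le> nat (c - defect D')" unfolding k_def by (rule Least_le) (use D' in blast)
    then show ?thesis using D c[OF D'] c[OF D(1)] by simp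
  qed
  then have "divisor D0 \<and> (\<forall>D'. divisor D' \<longrightarrow> defect D' \<le> defect D0)"
    unfolding D0_def using D(1) by (intro someI[of "\<lambda>D. divisor D \<and> (\<forall>D'. divisor D' \<longrightarrow> defect D' \<le> defect D)" D]) blast
  then show "divisor D0" "\<And>D. divisor D \<Longrightarrow> defect D \<le> defect D0" by auto
qed

definition gg :: int where "gg = defect D0 + 1"

lemma gg_nonneg: "0 \<le> gg"
  using D0(2)[OF divisor_0] by (simp add: defect_def gg_def ell_0 deg_0)

lemma riemann_inequality: "divisor D \<Longrightarrow> deg D + 1 - gg \<le> int (ell D)"
  using D0(2)[of D] by (simp add: defect_def gg_def)

text \<open>For \<open>D \<ge> D0\<close>, monotonicity of \<open>defect\<close> bounds it from
  below by its maximal value.\<close>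

lemma riemann_equality:
  assumes "divisor D" "\<And>R. D0 R \<le> D R"
  shows "int (ell D) = deg D + 1 - gg"
  using defect_mono[OF D0(1) assms] riemann_inequality[OF assms(1)] by (simp add: defect_def gg_def)

text \<open>The vanishing of \<open>H^1(D)\<close> for \<open>D \<ge> D0\<close>: enlarging
  \<open>D\<close> to the maximum with \<open>D'\<close> leaves the defect at its maximal value, so
  the corresponding index is one and no new principal parts arise.\<close>

lemma adeles_diag_stable:
  assumes D: "divisor D" and ge: "\<And>R. D0 R \<le> D R" and s: "s \<in> adeles D'" "divisor D'"
  shows "s \<in> {a + x | a x. a \<in> adeles D \<and> x \<in> diag}"
proof -
  let ?M = "\<lambda>R. max (D R) (D' R)"
  let ?A = "\<lambda>D. {a + x | a x. a \<in> adeles D \<and> x \<in> diag}"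
  have M: "divisor ?M" by (rule divisor_max[OF D s(2)])
  have le: "D R \<le> ?M R" for R by simp
  have geM: "D0 R \<le> ?M R" for R using order_trans[OF ge le] .
  have "index (?A ?M) (?A D) * CARD('k) ^ ell ?M = CARD('k) ^ (nat (deg ?M - deg D) + ell D)"
    by (rule index_adeles_diag(1)[OF D M le])
  also have "nat (deg ?M - deg D) + ell D = ell ?M"
    using riemann_equality[OF D ge] riemann_equality[OF M geM] deg_mono[OF D M le] by simp
  finally have "index (?A ?M) (?A D) * CARD('k) ^ ell ?M = 1 * CARD('k) ^ ell ?M" by (simp only: mult_1)
  then have "index (?A ?M) (?A D) = 1" by (rule mult_right_cancel[THEN iffD1, rotated]) simp
  then have "?A ?M \<subseteq> ?A D"
    by (intro index_1_imp_subset add_subgroup_setsum adeles_subgroup diag_subgroup)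
  moreover have "s \<in> adeles ?M" using adeles_mono[of D' ?M] s(1) by auto
  then have "s \<in> ?A ?M" using add_subgroupD(1)[OF diag_subgroup]
    by (intro CollectI exI[of _ s] exI[of _ 0]) simp
  ultimately show ?thesis by blast
qed

text \<open>All principal parts are already represented with poles bounded by the maximum of
  \<open>D0\<close> and \<open>0\<close>. The index is therefore \<open>q\<close> to the difference
  of the defects, \<open>gg - 1\<close> there and \<open>- 1\<close> at the zero divisor.\<close>

lemma index_principal_parts:
  fixes PP
  defines "PP \<equiv> {a + x | a x. (\<exists>D. divisor D \<and> a \<in> adeles D) \<and> x \<in> diag}"
  shows "index PP {a + x | a x. a \<in> adeles (\<lambda>_. 0) \<and> x \<in> diag} = CARD('k) ^ nat gg"
    "finite (cosets PP {a + x | a x. a \<in> adeles (\<lambda>_. 0) \<and> x \<in> diag})"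
proof -
  let ?A = "\<lambda>D. {a + x | a x. a \<in> adeles D \<and> x \<in> diag}"
  let ?D = "\<lambda>R. max (D0 R) 0"
  have D: "divisor ?D" by (rule divisor_max[OF D0(1) divisor_0])
  have ge: "D0 R \<le> ?D R" for R by simp
  have "PP = ?A ?D"
  proof (intro equalityI subsetI)
    fix s assume "s \<in> PP"
    then obtain a x D' where s: "s = a + x" "divisor D'" "a \<in> adeles D'" "x \<in> diag" unfolding PP_def by blast
    have "a \<in> ?A ?D" by (rule adeles_diag_stable[OF D ge s(3,2)])
    then obtain b y where "a = b + y" "b \<in> adeles ?D" "y \<in> diag" by blast
    then have "s = b + (y + x)" "b \<in> adeles ?D" "y + x \<in> diag"
      using s add_subgroupD(4)[OF diag_subgroup] by (auto simp: add.assoc)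
    then show "s \<in> ?A ?D" by blast
  qed (use D in \<open>auto simp: PP_def\<close>)
  moreover have le: "(\<lambda>_. 0) R \<le> ?D R" for R by simp
  moreover have "index (?A ?D) (?A (\<lambda>_. 0)) = CARD('k) ^ nat gg"
  proof -
    have "index (?A ?D) (?A (\<lambda>_. 0)) * CARD('k) ^ ell ?D = CARD('k) ^ (nat (deg ?D - deg (\<lambda>_. 0)) + ell (\<lambda>_. 0))"
      by (rule index_adeles_diag(1)[OF divisor_0 D le])
    also have "nat (deg ?D - deg (\<lambda>_. 0)) + ell (\<lambda>_. 0) = nat gg + ell ?D"
      using riemann_equality[OF D ge] deg_mono[OF divisor_0 D le] gg_nonneg by (simp add: deg_0 ell_0)
    finally have "index (?A ?D) (?A (\<lambda>_. 0)) * CARD('k) ^ ell ?D = CARD('k) ^ nat gg * CARD('k) ^ ell ?D"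
      by (simp only: power_add)
    then show ?thesis by (rule mult_right_cancel[THEN iffD1, rotated]) simp
  qed
  ultimately show "index PP (?A (\<lambda>_. 0)) = CARD('k) ^ nat gg" "finite (cosets PP (?A (\<lambda>_. 0)))"
    using index_adeles_diag(2)[OF divisor_0 D le] by simp_all
qed

lemma L_scale: "c \<noteq> 0 \<Longrightarrow> L (\<lambda>R. D R - dv c R) = (*) c ` L D"
proof -
  assume c: "c \<noteq> 0"
  have "x \<in> L (\<lambda>R. D R - dv c R) \<longleftrightarrow> x / c \<in> L D" for x
  proof -
    have "x \<in> fideal R (- (D R - dv c R)) \<longleftrightarrow> x / c \<in> fideal R (- D R)" if "R \<in> V" for R
      using that c by (cases "x = 0") (auto simp: fideal_def dv_def dvr.ord_divide[OF dvr_locale])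
    then show ?thesis by (simp add: L_def)
  qed
  moreover have "x \<in> (*) c ` L D \<longleftrightarrow> x / c \<in> L D" for x using c by (auto simp: image_iff intro!: bexI[of _ "x / c"])
  ultimately show ?thesis by blast
qed

text \<open>Multiplication by a power of \<open>x\<close> identifies \<open>L\<close> of any
  multiple \<open>m\<close> of the divisor with the constants, so its dimension is one. Riemann's
  inequality then bounds \<open>m * deg (dv x)\<close> by \<open>gg\<close> for all integers
  \<open>m\<close>, of either sign.\<close>

theorem deg_dv: "x \<noteq> 0 \<Longrightarrow> deg (dv x) = 0"
proof -
  assume x: "x \<noteq> 0"
  have *: "m * deg (dv x) \<le> gg" for m
  proof -
    have xm: "x powi (- m) \<noteq> 0" using x by simp
    have e: "(\<lambda>R. 0 - dv (x powi (- m)) R) = (\<lambda>R. m * dv x R)"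
      using x by (auto simp: dv_def fun_eq_iff dvr.ord_powi[OF dvr_locale])
    have D: "divisor (\<lambda>R. m * dv x R)" by (rule divisor_scale[OF divisor_dv[OF x]])
    have "card (L (\<lambda>R. m * dv x R)) = card (L (\<lambda>_. 0))"
      unfolding e[symmetric] L_scale[OF xm] by (rule card_image) (use xm in \<open>auto simp: inj_on_def\<close>)
    then have "ell (\<lambda>R. m * dv x R) = 1"
      using card_L[OF D] card_L[OF divisor_0] ell_0 q_gt_1 by (simp add: power_inject_exp[where n=1, simplified])
    then show ?thesis using riemann_inequality[OF D] by (simp add: deg_scale[OF divisor_dv[OF x]])
  qed
  show ?thesis
  proof (rule ccontr)
    assume ne: "deg (dv x) \<noteq> 0"
    have "(gg + 1) * 1 \<le> (gg + 1) * \<bar>deg (dv x)\<bar>" using ne gg_nonneg by (intro mult_left_mono) auto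
    moreover have "(gg + 1) * \<bar>deg (dv x)\<bar> \<le> gg"
      using *[of "gg + 1"] *[of "- (gg + 1)"] by (cases "0 \<le> deg (dv x)") (simp_all add: abs_if algebra_simps)
    ultimately have "(gg + 1) * 1 \<le> gg" by (rule order_trans)
    then show False by simp
  qed
qed

text \<open>A function regular at all of \<open>V\<close> is constant, while \<open>t\<close> is
  transcendental. The value is the step width of the twists used later to compare different
  degrees.\<close>

lemma deg_poles_pos: "1 \<le> deg (poles t)"
proof -
  have "t \<notin> range \<iota>"
  proof
    assume "t \<in> range \<iota>"
    then obtain c where "t = \<iota> c" by blast
    then have "ev \<iota> t [:- c, 1:] = 0" by (simp add: ev_pCons emb)
    then show False using transcendental[of "[:- c, 1:]"] by simp
  qed
  then obtain R where R: "R \<in> V" "t \<notin> R" using constants_V by blast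
  interpret R: dvr R by (rule dvr_locale[OF R(1)])
  have S: "finite {R. poles t R \<noteq> 0}" using divisor_poles[OF t_nonzero] by (simp add: divisor_def)
  have p: "1 \<le> poles t R" using R by (simp add: poles_def R.mem_iff_ord)
  have "1 * 1 \<le> int (rdeg R) * poles t R" using p rdeg_pos[OF R(1)] by (intro mult_mono) auto
  also have "\<dots> \<le> deg (poles t)" unfolding deg_def
    by (rule member_le_sum[of R "{R. poles t R \<noteq> 0}" "\<lambda>R. int (rdeg R) * poles t R"]) (use p S in \<open>auto simp: poles_def\<close>)
  finally show ?thesis by simp
qed

end

section \<open>The function field and the local rings of a regular projective curve\<close>

lemma sum_powers_least:
  fixes z :: "'a::field"
  assumes "i < M" "f i \<noteq> 0"
  shows "\<exists>k<M. f k \<noteq> 0 \<and> (\<Sum>i<M. f i * z ^ i) = z ^ k * (f k + z * (\<Sum>i<M - Suc k. f (i + Suc k) * z ^ i))"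
proof -
  define k where "k = (LEAST i. f i \<noteq> 0)"
  have k: "f k \<noteq> 0" unfolding k_def by (rule LeastI[of _ i]) (fact assms(2))
  have kz: "f i = 0" if "i < k" for i using not_less_Least that unfolding k_def by blast
  have kM: "k < M" using Least_le[of "\<lambda>i. f i \<noteq> 0" i] assms by (simp add: k_def)
  have "(\<Sum>i<M. f i * z ^ i) = (\<Sum>i=k..<M. f i * z ^ i)"
    by (rule sum.mono_neutral_right) (use kz in auto)
  also have "\<dots> = f k * z ^ k + (\<Sum>i=Suc k..<M. f i * z ^ i)" using kM by (simp add: sum.atLeast_Suc_lessThan)
  also have "(\<Sum>i=Suc k..<M. f i * z ^ i) = (\<Sum>i<M - Suc k. f (i + Suc k) * z ^ (i + Suc k))"
    using sum.shift_bounds_nat_ivl[of "\<lambda>i. f i * z ^ i" 0 "Suc k" "M - Suc k"] kM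
    by (simp add: add.commute atLeast0LessThan)
  also have "f k * z ^ k + \<dots> = z ^ k * (f k + z * (\<Sum>i<M - Suc k. f (i + Suc k) * z ^ i))"
    by (simp add: sum_distrib_left power_add algebra_simps)
  finally show ?thesis using k kM by blast
qed

section \<open>The function field as a finite extension of \<open>k(t)\<close>\<close>

context embedding
begin

definition rat :: "'a \<Rightarrow> 'a set" where
  "rat t = {ev \<iota> t p / ev \<iota> t c | p c. ev \<iota> t c \<noteq> 0}"

lemma ratI: "ev \<iota> t c \<noteq> 0 \<Longrightarrow> ev \<iota> t p / ev \<iota> t c \<in> rat t"
  by (auto simp: rat_def)

lemma rat_subring: "is_subring (rat t)"
  unfolding is_subring_def
proof (intro conjI ballI)
  show "0 \<in> rat t" using ratI[of t 1 0] by simp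
  show "1 \<in> rat t" using ratI[of t 1 1] by simp
  fix a b assume "a \<in> rat t" "b \<in> rat t"
  then obtain p c p' c' where ab: "a = ev \<iota> t p / ev \<iota> t c" "b = ev \<iota> t p' / ev \<iota> t c'" "ev \<iota> t c \<noteq> 0" "ev \<iota> t c' \<noteq> 0"
    by (auto simp: rat_def)
  have "a - b = ev \<iota> t (p * c' - p' * c) / ev \<iota> t (c * c')" "a * b = ev \<iota> t (p * p') / ev \<iota> t (c * c')"
    unfolding ab(1,2) using ab(3,4) by (simp_all add: ev_diff ev_mult field_simps)
  moreover have "ev \<iota> t (c * c') \<noteq> 0" using ab by (simp add: ev_mult)
  ultimately show "a - b \<in> rat t" "a * b \<in> rat t" by (simp_all only: ratI not_False_eq_True)
qed

lemma rat_inverse: "a \<in> rat t \<Longrightarrow> inverse a \<in> rat t"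
proof (cases "a = 0")
  case False
  assume "a \<in> rat t"
  then obtain p c where "a = ev \<iota> t p / ev \<iota> t c" "ev \<iota> t c \<noteq> 0" by (auto simp: rat_def)
  then show ?thesis using False ratI[of t p c] by auto
qed simp

lemma ev_in_rat: "ev \<iota> t p \<in> rat t"
  using ratI[of t 1 p] by simp

definition rspan :: "'a \<Rightarrow> 'a set \<Rightarrow> 'a set" where
  "rspan t B = {\<Sum>b\<in>B. c b * b | c. \<forall>b\<in>B. c b \<in> rat t}"

lemma rspan_add: "x \<in> rspan t B \<Longrightarrow> y \<in> rspan t B \<Longrightarrow> x + y \<in> rspan t B"
proof -
  assume "x \<in> rspan t B" "y \<in> rspan t B"
  then obtain c d where "\<forall>b\<in>B. c b \<in> rat t" "\<forall>b\<in>B. d b \<in> rat t" "x = (\<Sum>b\<in>B. c b * b)" "y = (\<Sum>b\<in>B. d b * b)"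
    by (auto simp: rspan_def)
  then show ?thesis unfolding rspan_def
    by (intro CollectI exI[of _ "\<lambda>b. c b + d b"])
      (auto simp: sum.distrib distrib_right is_subringD[OF rat_subring])
qed

lemma rspan_scale: "a \<in> rat t \<Longrightarrow> x \<in> rspan t B \<Longrightarrow> a * x \<in> rspan t B"
proof -
  assume a: "a \<in> rat t" and "x \<in> rspan t B"
  then obtain c where "\<forall>b\<in>B. c b \<in> rat t" "x = (\<Sum>b\<in>B. c b * b)" by (auto simp: rspan_def)
  then show ?thesis unfolding rspan_def using a
    by (intro CollectI exI[of _ "\<lambda>b. a * c b"])
      (auto simp: sum_distrib_left mult.assoc is_subringD[OF rat_subring])
qed

lemma rspan_0: "0 \<in> rspan t B"
  unfolding rspan_def by (rule CollectI, rule exI[of _ "\<lambda>_. 0"]) (simp add: is_subringD[OF rat_subring])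

lemma rspan_sum: "(\<And>i. i \<in> I \<Longrightarrow> f i \<in> rspan t B) \<Longrightarrow> sum f I \<in> rspan t B"
  by (induction I rule: infinite_finite_induct) (auto intro: rspan_add rspan_0)

lemma rspan_base: "finite B \<Longrightarrow> b \<in> B \<Longrightarrow> b \<in> rspan t B"
  unfolding rspan_def
  by (rule CollectI, rule exI[of _ "\<lambda>b'. if b' = b then 1 else 0"])
    (auto simp: is_subringD[OF rat_subring] if_distrib if_distribR sum.delta cong: if_cong)

text \<open>The leading coefficient of the equation of \<open>y\<close> is invertible in
  \<open>A\<close>, because \<open>A\<close> contains \<open>k(t)\<close>. The monic equation
  reduces all powers of \<open>y\<close> to those below its degree, so products of \<open>B\<close>
  with these powers span the enlarged ring.\<close>

lemma extend_finite_ring: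
  assumes A: "is_subring A" "rat t \<subseteq> A" "finite B" "A \<subseteq> rspan t B"
    and P: "P \<noteq> 0" "poly (map_poly (ev \<iota> t) P) y = 0" and tr: "\<And>p. p \<noteq> 0 \<Longrightarrow> ev \<iota> t p \<noteq> 0"
  shows "\<exists>A' B'. is_subring A' \<and> A \<subseteq> A' \<and> y \<in> A' \<and> finite B' \<and> A' \<subseteq> rspan t B'"
proof -
  define d where "d = degree P"
  define c where "c i = - ev \<iota> t (coeff P i) / ev \<iota> t (coeff P d)" for i
  have lc: "ev \<iota> t (coeff P d) \<noteq> 0" using P(1) tr by (simp add: d_def)
  have c: "c i \<in> A" for i using ratI[OF lc, of "- coeff P i"] A(2) by (auto simp: c_def ev_minus)
  have "(\<Sum>i\<le>d. ev \<iota> t (coeff P i) * y ^ i) = poly (map_poly (ev \<iota> t) P) y"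
    unfolding poly_altdef d_def
    by (rule sum.mono_neutral_cong_right) (use map_poly_degree_leq[of "ev \<iota> t" P] in \<open>auto simp: coeff_map_poly intro!: le_degree\<close>)
  then have "(\<Sum>i<d. ev \<iota> t (coeff P i) * y ^ i) + ev \<iota> t (coeff P d) * y ^ d = 0"
    using P(2) by (simp add: lessThan_Suc_atMost[symmetric])
  then have "ev \<iota> t (coeff P d) * y ^ d = - (\<Sum>i<d. ev \<iota> t (coeff P i) * y ^ i)" by (simp add: add_eq_0_iff)
  then have "y ^ d = - (\<Sum>i<d. ev \<iota> t (coeff P i) * y ^ i) / ev \<iota> t (coeff P d)" using lc by (simp add: field_simps)
  also have "\<dots> = (\<Sum>i<d. c i * y ^ i)" by (simp add: c_def sum_negf sum_divide_distrib)
  finally have yd: "y ^ d = (\<Sum>i<d. c i * y ^ i)" .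
  then have d0: "0 < d" by (cases "d = 0") auto
  define A' where "A' = {\<Sum>i<d. a i * y ^ i | a. \<forall>i<d. a i \<in> A}"
  note Ar = is_subringD[OF A(1)]
  have add: "v + w \<in> A'" if "v \<in> A'" "w \<in> A'" for v w
  proof -
    obtain a b where "\<forall>i<d. a i \<in> A" "\<forall>i<d. b i \<in> A" "v = (\<Sum>i<d. a i * y ^ i)" "w = (\<Sum>i<d. b i * y ^ i)"
      using \<open>v \<in> A'\<close> \<open>w \<in> A'\<close> by (auto simp: A'_def)
    then show ?thesis unfolding A'_def
      by (intro CollectI exI[of _ "\<lambda>i. a i + b i"]) (auto simp: sum.distrib distrib_right Ar)
  qed
  have scale: "v * w \<in> A'" if "v \<in> A" "w \<in> A'" for v w
  proof -
    obtain b where "\<forall>i<d. b i \<in> A" "w = (\<Sum>i<d. b i * y ^ i)" using \<open>w \<in> A'\<close> by (auto simp: A'_def)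
    then show ?thesis unfolding A'_def using \<open>v \<in> A\<close>
      by (intro CollectI exI[of _ "\<lambda>i. v * b i"]) (auto simp: sum_distrib_left mult.assoc Ar)
  qed
  have pow: "y ^ i \<in> A'" if "i < d" for i
    unfolding A'_def using that
    by (intro CollectI exI[of _ "\<lambda>j. if j = i then 1 else 0"])
      (auto simp: Ar if_distrib if_distribR sum.delta cong: if_cong)
  have 0: "0 \<in> A'" unfolding A'_def by (intro CollectI exI[of _ "\<lambda>_. 0"]) (simp add: Ar)
  have sum: "sum f I \<in> A'" if "\<And>i. i \<in> I \<Longrightarrow> f i \<in> A'" for f and I :: "nat set"
    using that by (induction I rule: infinite_finite_induct) (auto intro: add 0)
  have ypow: "y ^ i \<in> A'" if "i \<le> d" for i
  proof (cases "i = d")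
    case True
    have "(\<Sum>i<d. c i * y ^ i) \<in> A'" unfolding A'_def using c by blast
    then show ?thesis using True yd by simp
  qed (use that pow in simp)
  have ymult: "y * w \<in> A'" if "w \<in> A'" for w
  proof -
    obtain b where b: "\<forall>i<d. b i \<in> A" "w = (\<Sum>i<d. b i * y ^ i)" using \<open>w \<in> A'\<close> by (auto simp: A'_def)
    have "y * w = (\<Sum>i<d. b i * y ^ Suc i)" unfolding b(2) by (simp add: sum_distrib_left algebra_simps)
    moreover have "\<dots> \<in> A'" by (rule sum, rule scale) (use b ypow in \<open>auto simp: Suc_leI simp del: power_Suc\<close>)
    ultimately show ?thesis by simp
  qed
  have powmult: "y ^ n * w \<in> A'" if "w \<in> A'" for n w
    using that by (induction n) (auto simp: mult.assoc intro: ymult)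
  have "is_subring A'"
    unfolding is_subring_def
  proof (intro conjI ballI)
    show "0 \<in> A'" by (rule 0)
    show "1 \<in> A'" using pow[OF d0] by simp
    fix v w assume v: "v \<in> A'" and w: "w \<in> A'"
    have "(- 1) * w \<in> A'" using Ar w by (intro scale) auto
    then show "v - w \<in> A'" using add[OF v, of "- w"] by simp
    obtain a where a: "\<forall>i<d. a i \<in> A" "v = (\<Sum>i<d. a i * y ^ i)" using v by (auto simp: A'_def)
    have "v * w = (\<Sum>i<d. a i * (y ^ i * w))" unfolding a(2) by (simp add: sum_distrib_right mult.assoc)
    also have "\<dots> \<in> A'" by (rule sum, rule scale) (use a powmult[OF w] in auto)
    finally show "v * w \<in> A'" .
  qed
  moreover have "A \<subseteq> A'" using scale[of _ 1] pow[OF d0] by auto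
  moreover have "y \<in> A'" using ypow[of 1] d0 by simp
  moreover define B' where "B' = (\<lambda>(b, i). b * y ^ i) ` (B \<times> {..<d})"
  have fB': "finite B'" unfolding B'_def using A(3) by simp
  moreover have "A' \<subseteq> rspan t B'"
  proof
    fix v assume "v \<in> A'"
    then obtain a where a: "\<forall>i<d. a i \<in> A" "v = (\<Sum>i<d. a i * y ^ i)" by (auto simp: A'_def)
    have "a i * y ^ i \<in> rspan t B'" if i: "i < d" for i
    proof -
      have "a i \<in> rspan t B" using a(1) i A(4) by blast
      then obtain f where f: "\<forall>b\<in>B. f b \<in> rat t" "a i = (\<Sum>b\<in>B. f b * b)" by (auto simp: rspan_def)
      have "a i * y ^ i = (\<Sum>b\<in>B. f b * (b * y ^ i))" unfolding f(2) by (simp add: sum_distrib_right mult.assoc)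
      also have "\<dots> \<in> rspan t B'"
      proof (rule rspan_sum, rule rspan_scale)
        fix b assume "b \<in> B"
        then show "f b \<in> rat t" "b * y ^ i \<in> rspan t B'" using f(1) i fB' by (auto simp: B'_def intro!: rspan_base)
      qed
      finally show ?thesis .
    qed
    then show "v \<in> rspan t B'" unfolding a(2) by (intro rspan_sum) auto
  qed
  ultimately show ?thesis by blast
qed

end

locale function_field_generator = embedding \<iota>
  for \<iota> :: "'k::field \<Rightarrow> 'a::field" +
  fixes t :: 'a and S :: "'a set"
  assumes tr: "p \<noteq> 0 \<Longrightarrow> ev \<iota> t p \<noteq> 0"
    and alg: "\<exists>P :: 'k poly poly. P \<noteq> 0 \<and> poly (map_poly (ev \<iota> t) P) y = 0"
    and finite_S: "finite S"
    and fractions: "\<exists>a\<in>adjoin \<iota> S. \<exists>b\<in>adjoin \<iota> S. b \<noteq> 0 \<and> y = a / b"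
begin

text \<open>Adjoining the generators of a chart to \<open>k(t)\<close> one by one yields a ring that
  is finite over \<open>k(t)\<close>. It is closed under inverses, since an algebraic element
  divides a polynomial in \<open>t\<close>, and hence contains all fractions of the chart, that is,
  the whole field.\<close>

lemma ex_finite_rspan: "\<exists>B. finite B \<and> rspan t B = UNIV"
proof -
  have "\<exists>A B. is_subring A \<and> rat t \<subseteq> A \<and> T \<subseteq> A \<and> finite B \<and> A \<subseteq> rspan t B" if "finite T" for T
    using that
  proof induction
    case empty
    have "rat t \<subseteq> rspan t {1}"
    proof
      fix a assume "a \<in> rat t"
      then show "a \<in> rspan t {1}" using rspan_scale[of a t 1 "{1}"] rspan_base[of "{1}" 1 t] by simp
    qed
    then show ?case using rat_subring[of t] by blast
  next
    case (insert y T)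
    then obtain A B where A: "is_subring A" "rat t \<subseteq> A" "T \<subseteq> A" "finite B" "A \<subseteq> rspan t B" by blast
    obtain P :: "'k poly poly" where P: "P \<noteq> 0" "poly (map_poly (ev \<iota> t) P) y = 0" using alg by blast
    obtain A' B' where "is_subring A'" "A \<subseteq> A'" "y \<in> A'" "finite B'" "A' \<subseteq> rspan t B'"
      using extend_finite_ring[OF A(1,2,4,5) P tr] by blast
    then show ?case using A by (intro exI[of _ A'] exI[of _ B']) blast
  qed
  from this[OF finite_S] obtain A B where A: "is_subring A" "rat t \<subseteq> A" "S \<subseteq> A" "finite B" "A \<subseteq> rspan t B" by blast
  have "\<iota> c \<in> A" for c using ev_in_rat[of t "[:c:]"] A(2) by (auto simp: ev_pCons)
  then have adj: "adjoin \<iota> S \<subseteq> A" using A by (auto simp: adjoin_def)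
  have inv: "inverse b \<in> A" if b: "b \<in> A" "b \<noteq> 0" for b
  proof -
    obtain P :: "'k poly poly" where P: "P \<noteq> 0" "poly (map_poly (ev \<iota> t) P) b = 0" using alg by blast
    obtain h f n where h: "h \<noteq> 0" "ev \<iota> t h = b * (\<Sum>i<n. ev \<iota> t (f i) * b ^ i)"
      using ex_multiple_ev[OF b(2) P] by blast
    have "inverse b = inverse (ev \<iota> t h) * (\<Sum>i<n. ev \<iota> t (f i) * b ^ i)"
      using h tr[OF h(1)] b(2) by (simp add: field_simps)
    also have "\<dots> \<in> A"
      using A(2) rat_inverse[OF ev_in_rat] ev_in_rat[of t] b(1)
      by (intro is_subringD(4)[OF A(1)] is_subring_sum[OF A(1)] is_subringD(7)[OF A(1)]) blast+
    finally show ?thesis .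
  qed
  have "y \<in> A" for y
  proof -
    obtain a b where "a \<in> A" "b \<in> A" "b \<noteq> 0" "y = a / b" using fractions[of y] adj by blast
    then show ?thesis using inv is_subringD(4)[OF A(1)] by (simp add: divide_inverse)
  qed
  then have "rspan t B = UNIV" using A(5) by auto
  then show ?thesis using A(4) by blast
qed

definition set_spans :: "'a set \<Rightarrow> bool" where
  "set_spans B \<longleftrightarrow> finite B \<and> (\<forall>y. \<exists>c p. c \<noteq> 0 \<and> ev \<iota> t c * y = (\<Sum>b\<in>B. ev \<iota> t (p b) * b))"

lemma ex_set_spans: "\<exists>B. set_spans B"
proof -
  obtain B where B: "finite B" "rspan t B = UNIV" using ex_finite_rspan by blast
  have "\<exists>c p. c \<noteq> 0 \<and> ev \<iota> t c * y = (\<Sum>b\<in>B. ev \<iota> t (p b) * b)" for y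
  proof -
    obtain f where f: "\<forall>b\<in>B. f b \<in> rat t" "y = (\<Sum>b\<in>B. f b * b)" using B(2) unfolding rspan_def by blast
    have "\<forall>b. \<exists>p c. b \<in> B \<longrightarrow> ev \<iota> t c \<noteq> 0 \<and> f b = ev \<iota> t p / ev \<iota> t c"
      using f(1) unfolding rat_def by blast
    then obtain p c where pc: "\<And>b. b \<in> B \<Longrightarrow> ev \<iota> t (c b) \<noteq> 0" "\<And>b. b \<in> B \<Longrightarrow> f b = ev \<iota> t (p b) / ev \<iota> t (c b)"
      by metis
    have c0: "c b \<noteq> 0" if "b \<in> B" for b using pc(1)[OF that] by auto
    have "ev \<iota> t (\<Prod>b\<in>B. c b) * y = (\<Sum>b\<in>B. ev \<iota> t (p b * (\<Prod>b'\<in>B - {b}. c b')) * b)"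
      unfolding f(2) sum_distrib_left
    proof (rule sum.cong)
      fix b assume b: "b \<in> B"
      have "(\<Prod>b\<in>B. c b) = c b * (\<Prod>b'\<in>B - {b}. c b')" by (rule prod.remove[OF B(1) b])
      then show "ev \<iota> t (\<Prod>b\<in>B. c b) * (f b * b) = ev \<iota> t (p b * (\<Prod>b'\<in>B - {b}. c b')) * b"
        using pc[OF b] by (simp add: ev_mult)
    qed simp
    moreover have "(\<Prod>b\<in>B. c b) \<noteq> 0" using B(1) c0 by simp
    ultimately show ?thesis
      by (intro exI[of _ "\<Prod>b\<in>B. c b"] exI[of _ "\<lambda>b. p b * (\<Prod>b'\<in>B - {b}. c b')"] conjI)
  qed
  then show ?thesis using B(1) unfolding set_spans_def by (intro exI[of _ B]) simp
qed

text \<open>A spanning set of least cardinality is independent: a non-trivial relation eliminates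
  one of its elements after multiplication by the coefficient of that element.\<close>

lemma ex_basis:
  "\<exists>N u. fin_spans \<iota> t N u \<and> (\<forall>p. (\<Sum>i<N. ev \<iota> t (p i) * u i) = 0 \<longrightarrow> (\<forall>i<N. p i = 0))"
proof -
  define N where "N = (LEAST N. \<exists>B. set_spans B \<and> card B = N)"
  have "\<exists>B. set_spans B \<and> card B = N" unfolding N_def by (rule LeastI_ex) (use ex_set_spans in blast)
  then obtain B where B: "set_spans B" "card B = N" by blast
  have fin: "finite B" using B by (simp add: set_spans_def)
  have ind: "p b = 0" if 0: "(\<Sum>b\<in>B. ev \<iota> t (p b) * b) = 0" and b: "b \<in> B" for p b
  proof (rule ccontr)
    assume pb: "p b \<noteq> 0"
    have "set_spans (B - {b})"
      unfolding set_spans_def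
    proof (intro conjI allI)
      fix y
      obtain c f where f: "c \<noteq> 0" "ev \<iota> t c * y = (\<Sum>b\<in>B. ev \<iota> t (f b) * b)"
        using B(1) unfolding set_spans_def by blast
      have e: "ev \<iota> t (p b) * b = - (\<Sum>b'\<in>B - {b}. ev \<iota> t (p b') * b')"
        using 0 unfolding sum.remove[OF fin b] by (simp add: add_eq_0_iff)
      have "ev \<iota> t (p b * c) * y = ev \<iota> t (p b) * (ev \<iota> t c * y)" by (simp add: ev_mult)
      also have "\<dots> = ev \<iota> t (f b) * (ev \<iota> t (p b) * b)
          + ev \<iota> t (p b) * (\<Sum>b'\<in>B - {b}. ev \<iota> t (f b') * b')"
        unfolding f(2) sum.remove[OF fin b] by (simp add: algebra_simps)
      also have "\<dots> = (\<Sum>b'\<in>B - {b}. ev \<iota> t (p b * f b' - f b * p b') * b')"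
        unfolding e by (simp add: ev_mult ev_diff sum_distrib_left sum_subtractf algebra_simps)
      finally show "\<exists>c f. c \<noteq> 0 \<and> ev \<iota> t c * y = (\<Sum>b'\<in>B - {b}. ev \<iota> t (f b') * b')"
        using pb f(1) by (intro exI[of _ "p b * c"] exI[of _ "\<lambda>b'. p b * f b' - f b * p b'"]) simp
    qed (use fin in simp)
    then have "N \<le> card (B - {b})" unfolding N_def by (intro Least_le) blast
    moreover have "card (B - {b}) < card B" using fin b by (intro psubset_card_mono) auto
    ultimately show False using B(2) by simp
  qed
  obtain u where u: "bij_betw u {0..<card B} B" using ex_bij_betw_nat_finite[OF fin] by blast
  have u': "bij_betw u {..<N} B" using u B(2) by (simp add: atLeast0LessThan)
  have re: "(\<Sum>b\<in>B. ev \<iota> t (p b) * b) = (\<Sum>i<N. ev \<iota> t (p (u i)) * u i)" for p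
    by (rule sum.reindex_bij_betw[OF u', symmetric])
  have "fin_spans \<iota> t N u"
    unfolding fin_spans_def
  proof
    fix y
    obtain c f where "c \<noteq> 0" "ev \<iota> t c * y = (\<Sum>b\<in>B. ev \<iota> t (f b) * b)"
      using B(1) unfolding set_spans_def by blast
    then show "\<exists>c p. c \<noteq> 0 \<and> ev \<iota> t c * y = (\<Sum>i<N. ev \<iota> t (p i) * u i)"
      unfolding re by (intro exI[of _ c] exI[of _ "\<lambda>i. f (u i)"]) simp
  qed
  moreover have "\<forall>i<N. p i = 0" if 0: "(\<Sum>i<N. ev \<iota> t (p i) * u i) = 0" for p
  proof (intro allI impI)
    fix i assume i: "i < N"
    define g where "g = inv_into {..<N} u"
    have g: "g (u i) = i" if "i < N" for i using that u' unfolding g_def by (simp add: bij_betw_inv_into_left)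
    have "(\<Sum>b\<in>B. ev \<iota> t (p (g b)) * b) = 0" unfolding re using 0 g by simp
    from ind[OF this, of "u i"] show "p i = 0" using g[OF i] u' i by (auto simp: bij_betw_def)
  qed
  ultimately show ?thesis by blast
qed

end

section \<open>Regular local rings as discrete valuation rings\<close>

context field_extension
begin

text \<open>There are \<open>q^(M * M)\<close> polynomials over \<open>k\<close> of degree below
  \<open>M\<close> in each of two variables, whereas their values at \<open>x\<close> and
  \<open>y\<close>, after clearing denominators, lie in a box whose size is \<open>q\<close> to a
  power linear in \<open>M\<close>. For large \<open>M\<close> two values coincide.\<close>

lemma algebraic_dependence:
  "\<exists>(a :: nat \<Rightarrow> nat \<Rightarrow> 'k) M. (\<exists>i<M. \<exists>j<M. a i j \<noteq> 0) \<and> (\<Sum>i<M. \<Sum>j<M. \<iota> (a i j) * x ^ i * y ^ j) = 0"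
proof -
  obtain c b where cb: "c \<noteq> 0" "\<And>z. z \<in> (\<lambda>i. x * u i) ` {..<N} \<union> (\<lambda>i. y * u i) ` {..<N} \<Longrightarrow> ev \<iota> t c * z \<in> box b"
    using finite_subset_box[of "(\<lambda>i. x * u i) ` {..<N} \<union> (\<lambda>i. y * u i) ` {..<N}"] by blast
  obtain c' b' where cb': "c' \<noteq> 0" "ev \<iota> t c' * 1 \<in> box b'" using finite_subset_box[of "{1}"] by blast
  define e where "e = max b (degree c)"
  let ?c = "ev \<iota> t c"
  have c0: "?c \<noteq> 0" "ev \<iota> t c' \<noteq> 0" using cb(1) cb'(1) transcendental by auto
  have mult: "?c * z * w \<in> box (n + e)" if z: "z = x \<or> z = y" and w: "w \<in> box n" for z w n
  proof -
    obtain p where p: "\<forall>i<N. degree (p i) \<le> n" "w = (\<Sum>i<N. ev \<iota> t (p i) * u i)" using w by (auto simp: box_def)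
    have "?c * z * w = (\<Sum>i<N. ev \<iota> t (p i) * (?c * (z * u i)))"
      unfolding p(2) by (simp add: sum_distrib_left algebra_simps)
    also have "\<dots> \<in> box (e + n)"
    proof (rule box_sum, rule box_mult)
      fix i assume i: "i \<in> {..<N}"
      then have "?c * (z * u i) \<in> box b" using z by (intro cb(2)) auto
      then show "?c * (z * u i) \<in> box e" using box_mono[of b e] by (auto simp: e_def)
      show "degree (p i) \<le> n" using p(1) i by simp
    qed
    finally show ?thesis by (simp add: add.commute)
  qed
  have cmult: "?c * w \<in> box (n + e)" if "w \<in> box n" for w n
    using box_mult[OF that, of c e] by (simp add: e_def)
  have mults: "(?c * z) ^ i * w \<in> box (n + i * e)" if "z = x \<or> z = y" "w \<in> box n" for z i w n
  proof (induction i)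
    case (Suc i)
    from mult[OF that(1) Suc] show ?case by (simp add: algebra_simps)
  qed (use that in simp)
  have cmults: "?c ^ i * w \<in> box (n + i * e)" if "w \<in> box n" for i w n
  proof (induction i)
    case (Suc i)
    from cmult[OF Suc] show ?case by (simp add: algebra_simps)
  qed (use that in simp)
  \<comment> \<open>The exponent of the box satisfies
    \<open>N * (D + 1) \<le> M * (N * (b' + 2 * e + 1))\<close>, which is \<open>M * (M - 1)\<close>
    for this choice and so below \<open>M * M\<close>.\<close>
  define M where "M = N * (b' + 2 * e + 1) + 1"
  define C where "C = ?c ^ (2 * M) * ev \<iota> t c'"
  have C0: "C \<noteq> 0" using c0 by (simp add: C_def)
  have mono: "C * (x ^ i * y ^ j) \<in> box (b' + 2 * M * e)" if ij: "i < M" "j < M" for i j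
  proof -
    have "C * (x ^ i * y ^ j) = (?c * x) ^ i * ((?c * y) ^ j * (?c ^ (2 * M - i - j) * (ev \<iota> t c' * 1)))"
    proof -
      have "?c ^ (2 * M) = ?c ^ i * ?c ^ j * ?c ^ (2 * M - i - j)"
        using ij by (simp add: power_add[symmetric])
      then show ?thesis by (simp add: C_def power_mult_distrib algebra_simps)
    qed
    also have "\<dots> \<in> box (b' + (2 * M - i - j) * e + j * e + i * e)"
      by (intro mults cmults cb'(2)) auto
    also have "b' + (2 * M - i - j) * e + j * e + i * e = b' + 2 * M * e"
      using ij by (simp add: add_mult_distrib[symmetric])
    finally show ?thesis .
  qed
  define D where "D = b' + 2 * M * e"
  let ?I = "{..<M} \<times> {..<M}"
  define f where "f a = (\<Sum>(i, j)\<in>?I. \<iota> (a (i, j)) * (x ^ i * y ^ j))" for a :: "nat \<times> nat \<Rightarrow> 'k"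
  have sub: "(\<lambda>a. C * f a) ` (?I \<rightarrow>\<^sub>E UNIV) \<subseteq> box D"
  proof
    fix z assume "z \<in> (\<lambda>a. C * f a) ` (?I \<rightarrow>\<^sub>E UNIV)"
    then obtain a where "z = C * f a" by blast
    then have "z = (\<Sum>(i, j)\<in>?I. ev \<iota> t [:a (i, j):] * (C * (x ^ i * y ^ j)))"
      by (simp add: f_def sum_distrib_left split_def ev_pCons algebra_simps)
    also have "\<dots> \<in> box D"
    proof (rule box_sum, clarsimp)
      fix i j assume "i < M" "j < M"
      from box_mult[OF mono[OF this], of "[:a (i, j):]" 0]
      show "ev \<iota> t [:a (i, j):] * (C * (x ^ i * y ^ j)) \<in> box D" by (simp add: D_def)
    qed
    finally show "z \<in> box D" .
  qed
  have "\<not> inj_on (\<lambda>a. C * f a) (?I \<rightarrow>\<^sub>E UNIV)"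
  proof
    assume inj: "inj_on (\<lambda>a. C * f a) (?I \<rightarrow>\<^sub>E UNIV)"
    have "card (?I \<rightarrow>\<^sub>E (UNIV :: 'k set)) \<le> card (box D)" by (rule card_inj_on_le[OF inj sub box_finite])
    then have "CARD('k) ^ (M * M) \<le> CARD('k) ^ (N * (D + 1))"
      using card_box[of D] by (simp add: card_PiE)
    moreover have "1 < CARD('k)"
    proof -
      have "card {0::'k, 1} \<le> CARD('k)" by (rule card_mono) auto
      then show ?thesis by simp
    qed
    ultimately have "M * M \<le> N * (D + 1)" using power_increasing_iff by blast
    moreover have "D + 1 \<le> M * (b' + 2 * e + 1)"
    proof -
      have "1 \<le> M" by (simp add: M_def)
      from mult_le_mono1[OF this, of "b' + 1"] have "b' + 1 \<le> M * (b' + 1)" by simp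
      then show ?thesis by (simp add: D_def algebra_simps)
    qed
    then have "N * (D + 1) \<le> M * (N * (b' + 2 * e + 1))"
      using mult_le_mono2[of "D + 1" "M * (b' + 2 * e + 1)" N] by (simp only: mult.left_commute)
    ultimately have "M * M \<le> M * (N * (b' + 2 * e + 1))" by (rule order_trans)
    then show False by (simp add: M_def)
  qed
  then obtain a a' where a: "a \<in> ?I \<rightarrow>\<^sub>E UNIV" "a' \<in> ?I \<rightarrow>\<^sub>E UNIV" "a \<noteq> a'" "C * f a = C * f a'"
    unfolding inj_on_def by blast
  have "\<exists>p\<in>?I. a p \<noteq> a' p" using PiE_ext[OF a(1,2)] a(3) by blast
  then have 1: "\<exists>i<M. \<exists>j<M. a (i, j) - a' (i, j) \<noteq> 0" by auto
  have "f a - f a' = 0" using a(4) C0 by simp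
  then have "(\<Sum>p\<in>?I. \<iota> (a p - a' p) * (x ^ fst p * y ^ snd p)) = 0"
    by (simp add: f_def split_def emb left_diff_distrib sum_subtractf)
  then have "(\<Sum>i<M. \<Sum>j<M. \<iota> (a (i, j) - a' (i, j)) * x ^ i * y ^ j) = 0"
    by (simp add: sum.cartesian_product split_def mult.assoc)
  with 1 show ?thesis by (intro exI[of _ "\<lambda>i j. a (i, j) - a' (i, j)"] exI[of _ M]) blast
qed

text \<open>The point is that no non-zero \<open>z\<close> is divisible by all powers of
  \<open>\<tau>\<close>. In an algebraic relation between \<open>z\<close> and
  \<open>\<tau>\<close>, the lowest non-zero coefficient with respect to \<open>z\<close> is a unit
  times a power of \<open>\<tau>\<close>, but also a multiple of \<open>z\<close>. This plays the
  role of Krull's intersection theorem.\<close>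

lemma is_dvrI:
  assumes R: "is_subring R" "range \<iota> \<subseteq> R" and frac: "\<And>y. \<exists>a\<in>R. \<exists>b\<in>R. b \<noteq> 0 \<and> y = a / b"
    and \<tau>: "uniformizer R \<tau>" "\<tau> \<noteq> 0"
  shows "is_dvr R"
proof -
  note Rs = is_subringD[OF R(1)]
  have \<tau>R: "\<tau> \<in> R" using uniformizer_mem[OF \<tau>(1) R(1)] by (simp add: max_ideal_def)
  have msub: "add_subgroup (max_ideal R)"
    unfolding add_subgroup_def
  proof (intro conjI ballI)
    show "0 \<in> max_ideal R" using Rs(1) by (simp add: max_ideal_def)
    fix x y assume "x \<in> max_ideal R" "y \<in> max_ideal R"
    then obtain a b where "a \<in> R" "b \<in> R" "x = a * \<tau>" "y = b * \<tau>" using \<tau>(1) unfolding uniformizer_def by blast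
    then have "x - y = (a - b) * \<tau>" "a - b \<in> R" using Rs by (auto simp: left_diff_distrib)
    then show "x - y \<in> max_ideal R" using \<tau>(1) unfolding uniformizer_def by blast
  qed
  have \<tau>mult: "\<tau> * a \<in> max_ideal R" if "a \<in> R" for a
    using \<tau>(1) that unfolding uniformizer_def by (auto simp: mult.commute)
  have unit_add: "v + \<tau> * a \<in> R - max_ideal R" if v: "v \<in> R - max_ideal R" and a: "a \<in> R" for v a
  proof -
    have "v \<in> R" using v by simp
    then have "v + \<tau> * a \<in> R" using a \<tau>R by (intro Rs(6) Rs(4))
    moreover have "v + \<tau> * a \<notin> max_ideal R"
    proof
      assume "v + \<tau> * a \<in> max_ideal R"
      then have "v + \<tau> * a - \<tau> * a \<in> max_ideal R" using add_subgroupD(2)[OF msub] \<tau>mult[OF a] by blast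
      then show False using v by simp
    qed
    ultimately show ?thesis by blast
  qed
  have scal: "\<iota> a \<in> R - max_ideal R" if "a \<noteq> 0" for a
    unfolding unit_iff emb(9)[symmetric] using R(2) that by (auto simp: emb(7))
  have elem: "\<exists>w j. w \<in> R - max_ideal R \<and> z = w * \<tau> ^ j" if z: "z \<in> R" "z \<noteq> 0" for z
  proof (rule ccontr)
    assume no: "\<not> (\<exists>w j. w \<in> R - max_ideal R \<and> z = w * \<tau> ^ j)"
    have div: "\<exists>w\<in>R. z = w * \<tau> ^ j" for j
    proof (induction j)
      case 0 show ?case using z by simp
    next
      case (Suc j)
      then obtain w where w: "w \<in> R" "z = w * \<tau> ^ j" by blast
      then have "w \<in> max_ideal R" using no by blast
      then obtain v where "v \<in> R" "w = v * \<tau>" using \<tau>(1) unfolding uniformizer_def by blast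
      then show ?case using w by (intro bexI[of _ v]) (auto simp: algebra_simps)
    qed
    obtain a :: "nat \<Rightarrow> nat \<Rightarrow> 'k" and M where a: "\<exists>i<M. \<exists>j<M. a i j \<noteq> 0"
      "(\<Sum>i<M. \<Sum>j<M. \<iota> (a i j) * z ^ i * \<tau> ^ j) = 0" using algebraic_dependence[of z \<tau>] by blast
    define g where "g i = (\<Sum>j<M. \<iota> (a i j) * \<tau> ^ j)" for i
    have gR: "g i \<in> R" for i
      unfolding g_def using R(2) \<tau>R by (intro is_subring_sum[OF R(1)] Rs(4,7)) auto
    \<comment> \<open>A polynomial in \<open>\<tau>\<close> with scalar coefficients is its lowest
      power of \<open>\<tau>\<close> times a unit, because a non-zero scalar plus a multiple of
      \<open>\<tau>\<close> is a unit.\<close>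
    have grow: "\<exists>w j. w \<in> R - max_ideal R \<and> g i = w * \<tau> ^ j" if ja: "j < M" "a i j \<noteq> 0" for i j
    proof -
      obtain k where k: "k < M" "\<iota> (a i k) \<noteq> 0"
        "g i = \<tau> ^ k * (\<iota> (a i k) + \<tau> * (\<Sum>j<M - Suc k. \<iota> (a i (j + Suc k)) * \<tau> ^ j))"
        using sum_powers_least[of j M "\<lambda>j. \<iota> (a i j)" \<tau>] ja unfolding g_def emb(7) by blast
      have "(\<Sum>j<M - Suc k. \<iota> (a i (j + Suc k)) * \<tau> ^ j) \<in> R"
        using R(2) \<tau>R by (intro is_subring_sum[OF R(1)] Rs(4,7)) auto
      moreover have "a i k \<noteq> 0" using k(2) by (simp add: emb(7))
      ultimately have "\<iota> (a i k) + \<tau> * (\<Sum>j<M - Suc k. \<iota> (a i (j + Suc k)) * \<tau> ^ j) \<in> R - max_ideal R"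
        using unit_add[OF scal] by blast
      then show ?thesis unfolding k(3) mult.commute[of "\<tau> ^ k"] by blast
    qed
    obtain i j where ij: "i < M" "j < M" "a i j \<noteq> 0" using a(1) by blast
    have "g i \<noteq> 0" using grow[OF ij(2,3)] \<tau>(2) unfolding unit_iff by auto
    from sum_powers_least[of i M g z, OF ij(1) this] obtain k where k: "g k \<noteq> 0"
      "(\<Sum>i<M. g i * z ^ i) = z ^ k * (g k + z * (\<Sum>i<M - Suc k. g (i + Suc k) * z ^ i))" by blast
    have "(\<Sum>i<M. g i * z ^ i) = 0"
      using a(2) by (simp add: g_def sum_distrib_left sum_distrib_right algebra_simps)
    then have gk: "g k = - (z * (\<Sum>i<M - Suc k. g (i + Suc k) * z ^ i))"
      using k(2) z(2) by (simp add: add_eq_0_iff2)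
    define s where "s = (\<Sum>i<M - Suc k. g (i + Suc k) * z ^ i)"
    have sR: "s \<in> R" unfolding s_def using gR z(1) by (intro is_subring_sum[OF R(1)] Rs(4,7)) auto
    have "\<exists>j<M. a k j \<noteq> 0"
    proof (rule ccontr)
      assume "\<not> (\<exists>j<M. a k j \<noteq> 0)"
      then show False using k(1) by (simp add: g_def emb(1))
    qed
    then obtain w j where w: "w \<in> R - max_ideal R" "g k = w * \<tau> ^ j" using grow by blast
    \<comment> \<open>One power of \<open>\<tau>\<close> more than occurs in \<open>g k\<close>
      suffices to turn the unit \<open>w\<close> into a multiple of \<open>\<tau>\<close>.\<close>
    obtain v where v: "v \<in> R" "z = v * \<tau> ^ Suc j" using div by blast
    have "w * \<tau> ^ j = - (z * s)" using gk w(2) unfolding s_def by simp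
    also have "\<dots> = (- (v * s) * \<tau>) * \<tau> ^ j" by (subst v(2)) (simp add: algebra_simps)
    finally have "w * \<tau> ^ j = (- (v * s) * \<tau>) * \<tau> ^ j" .
    then have "w = - (v * s) * \<tau>"
      by (rule mult_right_cancel[THEN iffD1, rotated]) (use \<tau>(2) in simp)
    then have "w = \<tau> * (- (v * s))" by (simp add: mult.commute)
    moreover have "- (v * s) \<in> R" using v(1) sR Rs by blast
    ultimately have "w \<in> max_ideal R" using \<tau>mult by blast
    then show False using w(1) by blast
  qed
  have "\<exists>w m. w \<in> R - max_ideal R \<and> x = w * \<tau> powi m" if x: "x \<noteq> 0" for x
  proof -
    obtain a b where ab: "a \<in> R" "b \<in> R" "b \<noteq> 0" "x = a / b" using frac by blast
    then have "a \<noteq> 0" using x by auto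
    then obtain w i where w: "w \<in> R - max_ideal R" "a = w * \<tau> ^ i" using elem ab(1) by blast
    obtain v j where v: "v \<in> R - max_ideal R" "b = v * \<tau> ^ j" using elem ab(2,3) by blast
    have "x = (w * inverse v) * \<tau> powi (int i - int j)"
      using ab(4) w(2) v(2) \<tau>(2) by (simp add: power_int_diff field_simps)
    moreover have "w * inverse v \<in> R - max_ideal R" by (intro unit_mult R(1) unit_inverse w v)
    ultimately show ?thesis by blast
  qed
  then show ?thesis unfolding is_dvr_def using R(1) \<tau> by blast
qed

end

lemma is_subring_adjoin: "is_subring (adjoin \<iota> S)"
  unfolding adjoin_def is_subring_def by auto

lemma range_subset_adjoin: "range \<iota> \<subseteq> adjoin \<iota> S"
  unfolding adjoin_def by auto

lemma
  assumes A: "is_subring A" and p: "prime_ideal_of A p"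
  shows is_subring_localization: "is_subring (localization_at A p)"
    and subset_localization: "A \<subseteq> localization_at A p"
proof -
  note As = is_subringD[OF A]
  have s: "s \<noteq> 0" if "s \<in> A - p" for s using that p by (auto simp: prime_ideal_of_def)
  have mult: "s * r \<in> A - p" if "s \<in> A - p" "r \<in> A - p" for s r
    using that p As by (auto simp: prime_ideal_of_def)
  have 1: "1 \<in> A - p" using p As by (auto simp: prime_ideal_of_def)
  show sub: "A \<subseteq> localization_at A p"
  proof
    fix a assume "a \<in> A"
    then show "a \<in> localization_at A p" unfolding localization_at_def using 1
      by (intro CollectI exI[of _ a] exI[of _ 1]) simp
  qed
  show "is_subring (localization_at A p)"
    unfolding is_subring_def
  proof (intro conjI ballI)
    show "0 \<in> localization_at A p" "1 \<in> localization_at A p" using sub As by auto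
    fix a b assume "a \<in> localization_at A p" "b \<in> localization_at A p"
    then obtain x s y r where xs: "a = x / s" "b = y / r" "x \<in> A" "y \<in> A" "s \<in> A - p" "r \<in> A - p"
      unfolding localization_at_def by blast
    then have "a - b = (x * r - y * s) / (s * r)" "a * b = (x * y) / (s * r)"
      using s[OF xs(5)] s[OF xs(6)] by (simp_all add: diff_frac_eq)
    moreover have "x * r - y * s \<in> A" "x * y \<in> A" using xs As by auto
    ultimately show "a - b \<in> localization_at A p" "a * b \<in> localization_at A p"
      unfolding localization_at_def using mult[OF xs(5,6)] by blast+
  qed
qed

text \<open>Passage from the projective model to the locale. Any chart with a non-vanishing
  coordinate supplies finitely many generators of the function field, and its localisation at the
  zero ideal is the generic point.\<close>

lemma function_field_closed_points:
  fixes \<iota> :: "'k::{field,finite} \<Rightarrow> 'a::field"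
  assumes curve: "regular_projective_curve \<iota> X" and const: "struct_sheaf X = range \<iota>"
  shows "(\<exists>t N u. function_field \<iota> t N u (closed_points X)) \<and> UNIV \<in> X"
proof -
  interpret embedding \<iota> by unfold_locales (use curve in \<open>simp add: regular_projective_curve_def\<close>)
  obtain t where tr: "\<And>p. p \<noteq> 0 \<Longrightarrow> ev \<iota> t p \<noteq> 0"
    and alg: "\<And>y. \<exists>P :: 'k poly poly. P \<noteq> 0 \<and> poly (map_poly (ev \<iota> t) P) y = 0"
    using curve unfolding regular_projective_curve_def transcendence_degree_one_def ev_def by blast
  obtain n x where x: "\<exists>i\<le>n. x i \<noteq> 0" and X: "X = projective_model \<iota> n x"
    and fr: "\<And>i y. i \<le> n \<Longrightarrow> x i \<noteq> 0 \<Longrightarrow> \<exists>a\<in>chart \<iota> n x i. \<exists>b\<in>chart \<iota> n x i. b \<noteq> 0 \<and> y = a / b"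
    using curve unfolding regular_projective_curve_def integral_projective_def by metis
  obtain i where i: "i \<le> n" "x i \<noteq> 0" using x by blast
  interpret gen: function_field_generator \<iota> t "(\<lambda>j. x j / x i) ` {..n}"
    by unfold_locales (use tr alg fr[OF i] in \<open>auto simp: chart_def\<close>)
  obtain N u where u: "fin_spans \<iota> t N u"
    and ind: "\<And>p. (\<Sum>i<N. ev \<iota> t (p i) * u i) = 0 \<Longrightarrow> \<forall>i<N. p i = 0"
    using gen.ex_basis by blast
  interpret field_extension \<iota> t N u by unfold_locales (use tr u in auto)
  have A: "is_subring (chart \<iota> n x j)" "range \<iota> \<subseteq> chart \<iota> n x j" for j
    unfolding chart_def by (rule is_subring_adjoin range_subset_adjoin)+
  have dvr: "is_dvr R \<and> range \<iota> \<subseteq> R" if R: "R \<in> closed_points X" for R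
  proof -
    obtain j p where j: "j \<le> n" "x j \<noteq> 0" "prime_ideal_of (chart \<iota> n x j) p"
      "R = localization_at (chart \<iota> n x j) p"
      using R unfolding closed_points_def X projective_model_def by blast
    have sub: "is_subring R" "chart \<iota> n x j \<subseteq> R"
      unfolding j(4) by (rule is_subring_localization[OF A(1) j(3)] subset_localization[OF A(1) j(3)])+
    have fR: "\<exists>a\<in>R. \<exists>b\<in>R. b \<noteq> 0 \<and> y = a / b" for y using fr[OF j(1,2), of y] sub(2) by blast
    have \<iota>R: "range \<iota> \<subseteq> R" using A(2)[of j] sub(2) by blast
    obtain \<tau> where \<tau>: "uniformizer R \<tau>"
      using curve R unfolding regular_projective_curve_def regular_model_def closed_points_def by blast
    \<comment> \<open>A vanishing uniformizer would make \<open>R\<close> a field; having the whole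
      function field as its field of fractions, it would be the generic point.\<close>
    have "\<tau> \<noteq> 0"
    proof
      assume "\<tau> = 0"
      then have m: "max_ideal R \<subseteq> {0}" using \<tau> by (auto simp: uniformizer_def)
      have "y \<in> R" for y
      proof -
        obtain a b where ab: "a \<in> R" "b \<in> R" "b \<noteq> 0" "y = a / b" using fR by blast
        then have "inverse b \<in> R" using m by (auto simp: max_ideal_def)
        then show ?thesis using ab is_subringD(4)[OF sub(1)] by (simp add: divide_inverse)
      qed
      then show False using R by (auto simp: closed_points_def)
    qed
    then show ?thesis using is_dvrI[OF sub(1) \<iota>R fR \<tau>] \<iota>R by blast
  qed
  have "\<Inter>(closed_points X) = \<Inter>X" by (auto simp: closed_points_def)
  then have "\<Inter>(closed_points X) = range \<iota>" using const by (simp add: struct_sheaf_def)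
  then have "function_field \<iota> t N u (closed_points X)"
    by unfold_locales (use dvr ind alg in auto)
  moreover have "UNIV \<in> X"
  proof -
    let ?A = "chart \<iota> n x i"
    have "localization_at ?A {0} = UNIV"
      unfolding localization_at_def using fr[OF i] by blast
    moreover have "prime_ideal_of ?A {0}"
      using is_subringD(1)[OF A(1)] by (auto simp: prime_ideal_of_def)
    ultimately show ?thesis unfolding X projective_model_def using i by force
  qed
  ultimately show ?thesis by blast
qed

section \<open>The Zariski topology and the genus\<close>

locale curve = function_field \<iota> t N u V
  for \<iota> :: "'k::{field,finite} \<Rightarrow> 'a::field" and t :: 'a and N :: nat and u :: "nat \<Rightarrow> 'a"
    and V :: "'a set set" +
  fixes X :: "'a set set"
  assumes V_eq: "V = closed_points X" and generic_point: "UNIV \<in> X"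
begin

lemma V_subset: "V \<subseteq> X" and X_eq: "X = insert UNIV V" and UNIV_notin_V: "UNIV \<notin> V"
  using V_eq generic_point by (auto simp: closed_points_def)

lemma finite_nonregular: "finite {R\<in>X. y \<notin> R}"
proof (cases "y = 0")
  case True
  have "y \<in> R" if "R \<in> X" for R
    using that is_subringD(1)[OF dvr.subring[OF dvr_locale], of R] True by (auto simp: X_eq)
  then have "{R\<in>X. y \<notin> R} = {}" by blast
  then show ?thesis by (simp only: finite.emptyI)
next
  case False
  have "{R\<in>X. y \<notin> R} \<subseteq> {R\<in>V. ord_at R y \<noteq> 0}" using dvr.mem_iff_ord[OF dvr_locale] by (auto simp: X_eq)
  then show ?thesis using finite_ord[OF False] finite_subset by blast
qed

lemma domain_open: "openin (zariski X) {R\<in>X. y \<in> R}"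
  unfolding zariski_def by (rule topology_generated_by_Basis) blast

lemma openin_X: "openin (zariski X) X"
proof -
  have "0 \<in> R" if "R \<in> X" for R
    using that is_subringD(1)[OF dvr.subring[OF dvr_locale], of R] by (auto simp: X_eq)
  then have "{R\<in>X. 0 \<in> R} = X" by blast
  then show ?thesis using domain_open[of 0] by simp
qed

text \<open>The complement of \<open>R\<close> is the union of the domains of all functions with a
  pole at \<open>R\<close>. Every other point lies in one of them, because no local ring different
  from \<open>R\<close> is contained in \<open>R\<close>.\<close>

lemma openin_remove: "R \<in> V \<Longrightarrow> openin (zariski X) (X - {R})"
proof -
  assume R: "R \<in> V"
  interpret R: dvr R by (rule dvr_locale[OF R])
  have "X - {R} = (\<Union>y\<in>- R. {S\<in>X. y \<in> S})"
  proof (intro equalityI subsetI)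
    fix S assume S: "S \<in> X - {R}"
    have "\<not> S \<subseteq> R"
    proof (cases "S = UNIV")
      case False
      then have "S \<in> V" using S X_eq by auto
      then interpret S: dvr S by (rule dvr_locale)
      show ?thesis using S.maximal_subring[OF R.subring _ R.not_UNIV] S by blast
    qed (use R.not_UNIV in auto)
    then show "S \<in> (\<Union>y\<in>- R. {S\<in>X. y \<in> S})" using S by blast
  qed auto
  then show ?thesis using domain_open by auto
qed

text \<open>Generating sets are cofinite because a function has finitely many poles, and this
  property survives finite intersections and arbitrary unions. Conversely, finitely many closed
  points are removed one after the other by \<open>openin_remove\<close>.\<close>

lemma opens_iff: "U \<in> opens X \<longleftrightarrow> U \<subseteq> X \<and> UNIV \<in> U \<and> finite (X - U)"
proof
  assume U: "U \<in> opens X"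
  have "generate_topology_on (range (\<lambda>y. {R\<in>X. y \<in> R})) U \<Longrightarrow> U = {} \<or> (U \<subseteq> X \<and> UNIV \<in> U \<and> finite (X - U))" for U
  proof (induction rule: generate_topology_on.induct)
    case (Int a b)
    moreover have "X - (a \<inter> b) = (X - a) \<union> (X - b)" by auto
    ultimately show ?case by auto
  next
    case (UN K)
    show ?case
    proof (cases "\<Union>K = {}")
      case False
      then obtain k where k: "k \<in> K" "k \<noteq> {}" by blast
      then have "X - \<Union>K \<subseteq> X - k" by blast
      then have "finite (X - \<Union>K)" using UN.IH[OF k(1)] k(2) finite_subset by blast
      then show ?thesis using UN.IH k by blast
    qed simp
  next
    case (Basis s)
    then obtain y where "s = {R\<in>X. y \<in> R}" by blast
    moreover have "X - {R\<in>X. y \<in> R} = {R\<in>X. y \<notin> R}" by auto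
    ultimately show ?case using finite_nonregular[of y] generic_point by auto
  qed simp
  then show "U \<subseteq> X \<and> UNIV \<in> U \<and> finite (X - U)"
    using U by (auto simp: opens_def zariski_def openin_topology_generated_by_iff)
next
  assume U: "U \<subseteq> X \<and> UNIV \<in> U \<and> finite (X - U)"
  have "openin (zariski X) (X - F)" if "finite F" "F \<subseteq> V" for F
    using that
  proof induction
    case (insert R F)
    have e: "X - insert R F = (X - {R}) \<inter> (X - F)" by auto
    have "R \<in> V" "F \<subseteq> V" using insert.prems by auto
    then show ?case unfolding e by (intro openin_Int openin_remove insert.IH)
  qed (simp add: openin_X)
  moreover have "X - U \<subseteq> V" using U X_eq by auto
  moreover have "X - (X - U) = U" using U by auto
  ultimately have "openin (zariski X) U" using U by metis
  then show "U \<in> opens X" using U by (auto simp: opens_def)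
qed

lemma X_opens: "X \<in> opens X"
  by (simp add: opens_iff generic_point)

lemma vector_space_fun: "vector_space (\<lambda>c (s :: 'a set \<Rightarrow> 'a) R. \<iota> c * s R)"
  by unfold_locales (auto simp: fun_eq_iff emb algebra_simps)

lemma adelesI: "(\<And>R. R \<in> V \<Longrightarrow> s R \<in> fideal R (- D R)) \<Longrightarrow> s \<in> adeles D"
  by (simp add: adeles_def)

lemma adelesD: "s \<in> adeles D \<Longrightarrow> R \<in> V \<Longrightarrow> s R \<in> fideal R (- D R)"
  by (auto simp: adeles_def split: if_splits)

lemma ex_divisor_adele:
  assumes U: "U \<in> opens X" and a: "\<And>R. R \<in> U \<Longrightarrow> a R \<in> R"
  shows "\<exists>D. divisor D \<and> a \<in> adeles D"
proof -
  define D where "D R = (if R \<in> V - U then max 0 (- ord_at R (a R)) else 0)" for R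
  have sub: "{R. D R \<noteq> 0} \<subseteq> X - U" "{R. D R \<noteq> 0} \<subseteq> V" using V_subset by (auto simp: D_def)
  have "divisor D" unfolding divisor_def using U sub finite_subset by (auto simp: opens_iff)
  moreover have "a \<in> adeles D"
  proof (rule adelesI)
    fix R assume R: "R \<in> V"
    interpret R: dvr R by (rule dvr_locale[OF R])
    show "a R \<in> fideal R (- D R)"
      using a[of R] R by (cases "R \<in> U") (auto simp: D_def fideal_def R.mem_iff_ord)
  qed
  ultimately show ?thesis by blast
qed

text \<open>Near the generic point a section is induced by one function, and subtracting it leaves
  poles at finitely many closed points only. These are recorded by a divisor.\<close>

lemma principal_parts_eq:
  "principal_parts X = {a + x | a x. (\<exists>D. divisor D \<and> a \<in> adeles D) \<and> x \<in> diag}"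
proof (intro equalityI subsetI)
  fix s assume "s \<in> principal_parts X"
  then obtain U f where U: "U \<in> opens X" "\<And>S. S \<in> U \<Longrightarrow> s S - f \<in> S"
    using generic_point unfolding principal_parts_def by blast
  have "\<exists>D. divisor D \<and> s - (\<lambda>_. f) \<in> adeles D"
    by (rule ex_divisor_adele[OF U(1)]) (use U(2) in simp)
  moreover have "s = (s - (\<lambda>_. f)) + (\<lambda>_. f)" by (simp add: fun_eq_iff)
  ultimately show "s \<in> {a + x | a x. (\<exists>D. divisor D \<and> a \<in> adeles D) \<and> x \<in> diag}"
    unfolding diag_def by blast
next
  fix s assume "s \<in> {a + x | a x. (\<exists>D. divisor D \<and> a \<in> adeles D) \<and> x \<in> diag}"
  then obtain a D f where s: "s = a + (\<lambda>_. f)" "divisor D" "a \<in> adeles D" unfolding diag_def by blast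
  show "s \<in> principal_parts X"
    unfolding principal_parts_def
  proof (intro CollectI ballI)
    fix R assume R: "R \<in> X"
    have aS: "a S \<in> S" if "S \<in> X" "D S = 0" for S
    proof (cases "S = UNIV")
      case False
      then have S: "S \<in> V" using that X_eq by auto
      then show ?thesis using adelesD[OF s(3) S] that(2) dvr.fideal_0[OF dvr_locale] by simp
    qed simp
    \<comment> \<open>At a closed point the function inducing the section may be its own value
      there, which holds at \<open>R\<close> trivially. The neighbourhood omits the other points
      where \<open>D\<close> is non-zero or where \<open>f - h\<close> has a pole; both sets are
      finite.\<close>
    define h where "h = (if R = UNIV then f else s R)"
    define U where "U = insert R {S\<in>X. D S = 0 \<and> f - h \<in> S}"
    have "X - U \<subseteq> {S. D S \<noteq> 0} \<union> {S\<in>X. f - h \<notin> S}" by (auto simp: U_def)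
    moreover have "finite ({S. D S \<noteq> 0} \<union> {S\<in>X. f - h \<notin> S})"
      using s(2) finite_nonregular by (simp add: divisor_def)
    ultimately have "finite (X - U)" by (rule finite_subset)
    moreover have "D UNIV = 0" using s(2) UNIV_notin_V by (auto simp: divisor_def)
    ultimately have "U \<in> opens X" using R generic_point by (auto simp: opens_iff U_def)
    moreover have "s S - h \<in> S" if S: "S \<in> U" for S
    proof (cases "S = R")
      case True
      then show ?thesis
      proof (cases "R = UNIV")
        case False
        then have "R \<in> V" using R X_eq by auto
        from is_subringD(1)[OF dvr.subring[OF dvr_locale[OF this]]] show ?thesis using True False by (simp add: h_def)
      qed simp
    next
      case False
      then have S': "S \<in> X" "D S = 0" "f - h \<in> S" using S by (auto simp: U_def)
      have "a S + (f - h) \<in> S"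
      proof (cases "S = UNIV")
        case False
        then have "S \<in> V" using S' X_eq by auto
        then show ?thesis using aS[OF S'(1,2)] S'(3) is_subringD(6)[OF dvr.subring[OF dvr_locale]] by blast
      qed simp
      then show ?thesis by (simp add: s(1) add_diff_eq)
    qed
    moreover have "R \<in> U" by (simp add: U_def)
    ultimately show "\<exists>U\<in>opens X. R \<in> U \<and> (\<exists>f. \<forall>S\<in>U. s S - f \<in> S)" by blast
  qed
qed

lemma trivial_principal_parts_eq:
  "trivial_principal_parts X = {a + x | a x. a \<in> adeles (\<lambda>_. 0) \<and> x \<in> diag}"
proof (intro equalityI subsetI)
  fix s assume "s \<in> trivial_principal_parts X"
  then obtain f where f: "\<And>R. R \<in> X \<Longrightarrow> s R - f \<in> R" unfolding trivial_principal_parts_def by blast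
  have "s - (\<lambda>_. f) \<in> adeles (\<lambda>_. 0)"
    by (rule adelesI) (use f V_subset dvr.fideal_0[OF dvr_locale] in auto)
  moreover have "s = (s - (\<lambda>_. f)) + (\<lambda>_. f)" by (simp add: fun_eq_iff)
  ultimately show "s \<in> {a + x | a x. a \<in> adeles (\<lambda>_. 0) \<and> x \<in> diag}" unfolding diag_def by blast
next
  fix s assume "s \<in> {a + x | a x. a \<in> adeles (\<lambda>_. 0) \<and> x \<in> diag}"
  then obtain a f where s: "s = a + (\<lambda>_. f)" "a \<in> adeles (\<lambda>_. 0)" unfolding diag_def by blast
  have "s R - f \<in> R" if "R \<in> X" for R
    using that adelesD[OF s(2), of R] dvr.fideal_0[OF dvr_locale, of R] by (auto simp: s(1) X_eq)
  then show "s \<in> trivial_principal_parts X" unfolding trivial_principal_parts_def by blast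
qed

lemma genus_eq: "genus \<iota> X = nat gg"
proof -
  interpret fv: vector_space "\<lambda>c (s :: 'a set \<Rightarrow> 'a) R. \<iota> c * s R" by (rule vector_space_fun)
  let ?PP = "principal_parts X" and ?TP = "trivial_principal_parts X"
  have adscal: "(\<lambda>R. \<iota> c * a R) \<in> adeles D" if "a \<in> adeles D" for c a D
    by (rule adelesI) (use scal.subspace_scale[OF subspace_fideal] adelesD[OF that] in blast)
  have sub: "fv.subspace {a + x | a x. Q a \<and> x \<in> diag}"
    if Q: "Q 0" "\<And>a b. Q a \<Longrightarrow> Q b \<Longrightarrow> Q (a + b)" "\<And>c a. Q a \<Longrightarrow> Q (\<lambda>R. \<iota> c * a R)" for Q
    unfolding fv.subspace_def
  proof (intro conjI ballI allI)
    show "0 \<in> {a + x | a x. Q a \<and> x \<in> diag}"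
      using Q(1) add_subgroupD(1)[OF diag_subgroup] by (intro CollectI exI[of _ 0]) simp
    fix v assume v: "v \<in> {a + x | a x. Q a \<and> x \<in> diag}"
    then obtain a x where a: "v = a + x" "Q a" "x \<in> diag" by blast
    show "(\<lambda>R. \<iota> c * v R) \<in> {a + x | a x. Q a \<and> x \<in> diag}" for c
    proof (intro CollectI exI conjI)
      show "(\<lambda>R. \<iota> c * v R) = (\<lambda>R. \<iota> c * a R) + (\<lambda>R. \<iota> c * x R)"
        by (simp add: a(1) fun_eq_iff distrib_left)
      show "(\<lambda>R. \<iota> c * x R) \<in> diag" using a(3) by (auto simp: diag_def)
    qed (rule Q(3)[OF a(2)])
    fix w assume "w \<in> {a + x | a x. Q a \<and> x \<in> diag}"
    then obtain b y where b: "w = b + y" "Q b" "y \<in> diag" by blast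
    show "v + w \<in> {a + x | a x. Q a \<and> x \<in> diag}"
      using Q(2)[OF a(2) b(2)] add_subgroupD(4)[OF diag_subgroup a(3) b(3)]
      by (intro CollectI exI[of _ "a + b"] exI[of _ "x + y"]) (simp add: a(1) b(1) algebra_simps)
  qed
  have "fv.subspace ?PP"
    unfolding principal_parts_eq
  proof (rule sub)
    show "\<exists>D. divisor D \<and> 0 \<in> adeles D" using divisor_0 add_subgroupD(1)[OF adeles_subgroup] by blast
    fix a b assume "\<exists>D. divisor D \<and> a \<in> adeles D" "\<exists>D. divisor D \<and> b \<in> adeles D"
    then obtain D D' where D: "divisor D" "divisor D'" "a \<in> adeles D" "b \<in> adeles D'" by blast
    then have "a \<in> adeles (\<lambda>R. max (D R) (D' R))" "b \<in> adeles (\<lambda>R. max (D R) (D' R))"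
      using adeles_mono[of D "\<lambda>R. max (D R) (D' R)"] adeles_mono[of D' "\<lambda>R. max (D R) (D' R)"] by auto
    then show "\<exists>D. divisor D \<and> a + b \<in> adeles D"
      using divisor_max[OF D(1,2)] add_subgroupD(4)[OF adeles_subgroup] by blast
  qed (use adscal in blast)
  moreover have "fv.subspace ?TP"
    unfolding trivial_principal_parts_eq
    by (rule sub) (rule add_subgroupD(1,4)[OF adeles_subgroup] adscal; assumption)+
  moreover have "?TP \<subseteq> ?PP"
    unfolding trivial_principal_parts_eq principal_parts_eq using divisor_0 by blast
  ultimately have "CARD('k) ^ genus \<iota> X = index ?PP ?TP"
    unfolding genus_def
    by (intro fv.card_quotient_dim) (simp_all add: principal_parts_eq trivial_principal_parts_eq index_principal_parts(2))
  also have "\<dots> = CARD('k) ^ nat gg"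
    unfolding principal_parts_eq trivial_principal_parts_eq by (rule index_principal_parts(1))
  finally show ?thesis using q_gt_1 power_inject_exp by blast
qed

end

section \<open>Determinants and bases\<close>

lemma leibniz_det_eq_det: "leibniz_det r M = Determinant.det (Matrix.mat r r (\<lambda>(i, j). M i j))"
proof -
  have "Determinant.det (Matrix.mat r r (\<lambda>(i, j). M i j))
      = (\<Sum>p | p permutes {0..<r}. signof p * (\<Prod>i = 0..<r. Matrix.mat r r (\<lambda>(i, j). M i j) $$ (i, p i)))"
    by (rule det_def') simp
  also have "\<dots> = leibniz_det r M"
    unfolding leibniz_det_def atLeast0LessThan
  proof (rule sum.cong)
    fix p assume "p \<in> {p. p permutes {..<r}}"
    then have p: "p permutes {..<r}" by simp
    have "p i < r" if "i < r" for i using permutes_in_image[OF p, of i] that by simp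
    then show "signof p * (\<Prod>i<r. Matrix.mat r r (\<lambda>(i, j). M i j) $$ (i, p i)) = of_int (sign p) * (\<Prod>i<r. M i (p i))"
      by (auto intro!: prod.cong)
  qed simp
  finally show ?thesis ..
qed

lemma leibniz_det_mult:
  "leibniz_det r (\<lambda>i j. \<Sum>k<r. M i k * N k j) = leibniz_det r M * leibniz_det r N"
proof -
  have "Matrix.mat r r (\<lambda>(i, j). \<Sum>k<r. M i k * N k j)
      = Matrix.mat r r (\<lambda>(i, j). M i j) * Matrix.mat r r (\<lambda>(i, j). N i j)"
    by (rule eq_matI) (auto simp: scalar_prod_def atLeast0LessThan)
  then show ?thesis
    unfolding leibniz_det_eq_det using det_mult[of "Matrix.mat r r (\<lambda>(i, j). M i j)" r] by simp
qed

lemma leibniz_det_cong: "(\<And>i j. i < r \<Longrightarrow> j < r \<Longrightarrow> M i j = N i j) \<Longrightarrow> leibniz_det r M = leibniz_det r N"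
  unfolding leibniz_det_eq_det by (rule arg_cong[of _ _ Determinant.det]) (auto intro!: eq_matI)

lemma leibniz_det_lower_triangular:
  assumes "\<And>i j. i < j \<Longrightarrow> j < r \<Longrightarrow> M i j = 0"
  shows "leibniz_det r M = (\<Prod>i<r. M i i)"
proof -
  have "Determinant.det (Matrix.mat r r (\<lambda>(i, j). M i j)) = prod_list (diag_mat (Matrix.mat r r (\<lambda>(i, j). M i j)))"
    by (rule det_lower_triangular[of r]) (use assms in auto)
  also have "\<dots> = (\<Prod>i<r. M i i)"
    unfolding diag_mat_def by (simp add: prod.list_conv_set_nth atLeast0LessThan)
  finally show ?thesis by (simp add: leibniz_det_eq_det)
qed

lemma leibniz_det_one: "leibniz_det r (\<lambda>i j. if i = j then 1 else 0) = 1"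
  by (subst leibniz_det_lower_triangular) auto

lemma leibniz_det_mem:
  assumes R: "is_subring R" and M: "\<And>i j. i < r \<Longrightarrow> j < r \<Longrightarrow> M i j \<in> R"
  shows "leibniz_det r M \<in> R"
  unfolding leibniz_det_def
proof (rule is_subring_sum[OF R])
  fix p assume "p \<in> {p. p permutes {..<r}}"
  then have p: "p permutes {..<r}" by simp
  have pi: "p i < r" if "i < r" for i using permutes_in_image[OF p, of i] that by simp
  have "(\<Prod>i\<in>I. M i (p i)) \<in> R" if "I \<subseteq> {..<r}" for I
    using that by (induction I rule: infinite_finite_induct) (auto intro!: is_subringD[OF R] M pi)
  moreover have "of_int (sign p) \<in> R"
    using is_subringD(2,5)[OF R] by (auto simp: sign_def)
  ultimately show "of_int (sign p) * (\<Prod>i<r. M i (p i)) \<in> R" using is_subringD(4)[OF R] by blast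
qed

lemma leibniz_det_scale: "leibniz_det r (\<lambda>i j. c * M i j) = c ^ r * leibniz_det r M"
  unfolding leibniz_det_def by (simp add: prod.distrib sum_distrib_left mult.left_commute mult.assoc)

text \<open>The coefficient set is a parameter: a local ring gives the lattice generated by
  \<open>b\<close>, and \<open>UNIV\<close> the vector space which that lattice spans.\<close>

definition lspan :: "'a::field set \<Rightarrow> nat \<Rightarrow> (nat \<Rightarrow> 'a ^ 'n::finite) \<Rightarrow> ('a ^ 'n) set" where
  "lspan S r b = {\<Sum>i<r. c i *s b i | c. \<forall>i<r. c i \<in> S}"

lemma lspanI: "(\<And>i. i < r \<Longrightarrow> c i \<in> S) \<Longrightarrow> (\<Sum>i<r. c i *s b i) \<in> lspan S r b"
  unfolding lspan_def by blast

lemma lspan_mono: "S \<subseteq> S' \<Longrightarrow> lspan S r b \<subseteq> lspan S' r b"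
  unfolding lspan_def by blast

lemma lin_indep_unique:
  assumes "lin_indep r b" "(\<Sum>i<r. c i *s b i) = (\<Sum>i<r. d i *s b i)" "i < r"
  shows "c i = d i"
proof -
  have "(\<Sum>i<r. (c i - d i) *s b i) = 0"
    using assms(2) by (simp add: vec.scale_left_diff_distrib sum_subtractf)
  then have "\<forall>i<r. c i - d i = 0" using assms(1) unfolding lin_indep_def by (elim allE) (erule mp)
  then show ?thesis using assms(3) by simp
qed

lemma lspan_UNIV: "lspan UNIV r b = vec.span (b ` {..<r})"
proof (intro equalityI subsetI)
  fix v assume "v \<in> lspan UNIV r b"
  then obtain c where "v = (\<Sum>i<r. c i *s b i)" by (auto simp: lspan_def)
  then show "v \<in> vec.span (b ` {..<r})"
    by (simp only:) (intro vec.span_sum vec.span_scale vec.span_base imageI)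
next
  fix v assume "v \<in> vec.span (b ` {..<r})"
  then show "v \<in> lspan UNIV r b"
  proof (induction rule: vec.span_induct_alt)
    case base
    show ?case using lspanI[of r "\<lambda>_. 0" UNIV b] by simp
  next
    case (step c x y)
    then obtain i d where i: "i < r" "x = b i" "y = (\<Sum>i<r. d i *s b i)" by (auto simp: lspan_def)
    have "(\<Sum>j<r. (if j = i then c else 0) *s b j) = c *s b i"
    proof -
      have "(\<Sum>j<r. (if j = i then c else 0) *s b j) = (\<Sum>j<r. if j = i then c *s b i else 0)"
        by (rule sum.cong) auto
      then show ?thesis using i(1) by simp
    qed
    then have "c *s x + y = (\<Sum>j<r. ((if j = i then c else 0) + d j) *s b j)"
      using i by (simp add: vec.scale_left_distrib sum.distrib)
    then show ?case using lspanI[of r "\<lambda>j. (if j = i then c else 0) + d j" UNIV b] by simp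
  qed
qed

lemma lspan_base: "i < r \<Longrightarrow> 0 \<in> S \<Longrightarrow> 1 \<in> S \<Longrightarrow> b i \<in> lspan S r b"
proof -
  assume i: "i < r" and S: "0 \<in> S" "1 \<in> S"
  have "(\<Sum>j<r. (if j = i then 1 else 0) *s b j) = (\<Sum>j<r. if j = i then b i else 0)"
    by (rule sum.cong) auto
  then have "(\<Sum>j<r. (if j = i then 1 else 0) *s b j) = b i" using i by simp
  then show ?thesis using lspanI[of r "\<lambda>j. if j = i then 1 else 0" S b] S by simp
qed

lemma lin_indep_imp_independent:
  assumes "lin_indep r b"
  shows "vec.independent (b ` {..<r})" "inj_on b {..<r}" "card (b ` {..<r}) = r"
proof -
  show inj: "inj_on b {..<r}"
  proof (rule inj_onI)
    fix i j assume ij: "i \<in> {..<r}" "j \<in> {..<r}" "b i = b j"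
    have "(\<Sum>k<r. (if k = i then 1 else 0) *s b k) = (\<Sum>k<r. if k = i then b i else 0)" for i
      by (rule sum.cong) auto
    then have "(\<Sum>k<r. (if k = i then 1 else 0) *s b k) = (\<Sum>k<r. (if k = j then 1 else 0) *s b k)" using ij by simp
    from lin_indep_unique[OF assms this, of i] ij show "i = j" by (auto split: if_splits)
  qed
  then show "card (b ` {..<r}) = r" by (simp add: card_image)
  show "vec.independent (b ` {..<r})"
    unfolding vec.independent_explicit_finite_subsets
  proof (intro allI impI ballI)
    fix A u v assume A: "A \<subseteq> b ` {..<r}" "finite A" "(\<Sum>v\<in>A. u v *s v) = 0" "v \<in> A"
    define c where "c i = (if b i \<in> A then u (b i) else 0)" for i
    have "(\<Sum>i<r. c i *s b i) = (\<Sum>v\<in>b ` {..<r}. (if v \<in> A then u v else 0) *s v)"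
      by (simp add: sum.reindex[OF inj] c_def)
    also have "\<dots> = (\<Sum>v\<in>A. (if v \<in> A then u v else 0) *s v)"
      by (rule sum.mono_neutral_right) (use A in auto)
    also have "\<dots> = (\<Sum>v\<in>A. u v *s v)" by (rule sum.cong) auto
    also have "\<dots> = 0" by (rule A(3))
    finally have "\<forall>i<r. c i = 0" using assms unfolding lin_indep_def by blast
    then show "u v = 0" using A(1,4) unfolding c_def by fastforce
  qed
qed

lemma lspan_UNIV_eqI:
  assumes e: "lin_indep r e" and sub: "\<And>i. i < r \<Longrightarrow> e i \<in> lspan UNIV r b"
  shows "lspan UNIV r e = lspan UNIV r b"
proof
  have s: "e ` {..<r} \<subseteq> vec.span (b ` {..<r})" using sub unfolding lspan_UNIV by auto
  then show "lspan UNIV r e \<subseteq> lspan UNIV r b"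
    unfolding lspan_UNIV by (metis vec.span_minimal vec.subspace_span)
  have "vec.dim (vec.span (b ` {..<r})) \<le> card (e ` {..<r})"
    using vec.dim_le_card'[of "b ` {..<r}"] card_image_le[of "{..<r}" b] lin_indep_imp_independent(3)[OF e]
    by (simp add: vec.dim_span)
  then show "lspan UNIV r b \<subseteq> lspan UNIV r e"
    unfolding lspan_UNIV
    by (intro vec.card_ge_dim_independent s lin_indep_imp_independent(1)[OF e])
qed

lemma lin_indep_le_CARD:
  fixes b :: "nat \<Rightarrow> 'a::field ^ 'n::finite"
  shows "lin_indep r b \<Longrightarrow> r \<le> CARD('n)"
  using vec.independent_card_le_dim[OF subset_UNIV lin_indep_imp_independent(1)[of r b]]
    lin_indep_imp_independent(3)[of r b] by (simp add: vec.dim_UNIV card_cart_basis)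

lemma lspan_UNIV_full:
  fixes b :: "nat \<Rightarrow> 'a::field ^ 'n::finite"
  assumes "lin_indep CARD('n) b"
  shows "lspan UNIV CARD('n) b = UNIV"
proof -
  have "UNIV \<subseteq> vec.span (b ` {..<CARD('n)})"
    by (rule vec.card_ge_dim_independent)
      (use lin_indep_imp_independent[OF assms] in \<open>simp_all add: vec.dim_UNIV card_cart_basis\<close>)
  then show ?thesis unfolding lspan_UNIV by blast
qed

lemma lin_indep_Suc:
  assumes v: "lin_indep j v" and x: "x \<notin> lspan UNIV j v"
  shows "lin_indep (Suc j) (v(j := x))"
  unfolding lin_indep_def
proof (intro allI impI)
  fix c i assume 0: "(\<Sum>i<Suc j. c i *s (v(j := x)) i) = 0" and i: "i < Suc j"
  have s: "(\<Sum>i<j. c i *s v i) + c j *s x = 0"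
    using 0 by simp
  have "c j = 0"
  proof (rule ccontr)
    assume "c j \<noteq> 0"
    then have "x = (- inverse (c j)) *s (- (c j *s x))" by (simp add: vector_smult_assoc)
    also have "- (c j *s x) = (\<Sum>i<j. c i *s v i)" using s by (metis add.commute minus_unique)
    also have "(- inverse (c j)) *s (\<Sum>i<j. c i *s v i) = (\<Sum>i<j. (- inverse (c j) * c i) *s v i)"
      by (simp only: vec.scale_sum_right vector_smult_assoc)
    also have "\<dots> \<in> lspan UNIV j v" by (rule lspanI) simp
    finally show False using x by blast
  qed
  moreover from this have "(\<Sum>i<j. c i *s v i) = 0" using s by simp
  then have "\<forall>i<j. c i = 0" using v unfolding lin_indep_def by blast
  ultimately show "c i = 0" using i by (auto simp: less_Suc_eq)
qed

lemma lspan_cong: "(\<And>i. i < r \<Longrightarrow> b i = b' i) \<Longrightarrow> lspan S r b = lspan S r b'"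
proof -
  assume "\<And>i. i < r \<Longrightarrow> b i = b' i"
  then have "(\<Sum>i<r. c i *s b i) = (\<Sum>i<r. c i *s b' i)" for c by (intro sum.cong) auto
  then show ?thesis unfolding lspan_def by simp
qed

lemma lin_indep_extend:
  fixes v :: "nat \<Rightarrow> 'a::field ^ 'n::finite"
  assumes "lin_indep j v"
  shows "\<exists>v'. lin_indep CARD('n) v' \<and> (\<forall>i<j. v' i = v i)"
  using assms
proof (induction "CARD('n) - j" arbitrary: j v)
  case 0
  then have "j = CARD('n)" using lin_indep_le_CARD[OF 0(2)] by simp
  then show ?case using 0 by blast
next
  case (Suc k)
  have "\<exists>x. x \<notin> lspan UNIV j v"
  proof (rule ccontr)
    assume "\<not> (\<exists>x. x \<notin> lspan UNIV j v)"
    then have "vec.span (v ` {..<j}) = (UNIV :: ('a ^ 'n) set)" unfolding lspan_UNIV by blast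
    then have "CARD('n) \<le> card (v ` {..<j})"
      using vec.dim_le_card'[of "v ` {..<j}"] vec.dim_span[of "v ` {..<j}"] by (simp add: vec.dim_UNIV card_cart_basis)
    then show False using card_image_le[of "{..<j}" v] Suc(2) by simp
  qed
  then obtain x where x: "x \<notin> lspan UNIV j v" by blast
  have "\<exists>v'. lin_indep CARD('n) v' \<and> (\<forall>i<Suc j. v' i = (v(j := x)) i)"
    by (rule Suc.hyps(1)[OF _ lin_indep_Suc[OF Suc.prems x]]) (use Suc.hyps(2) in simp)
  then show ?case by force
qed

lemma lin_indep_take: "lin_indep r v \<Longrightarrow> j \<le> r \<Longrightarrow> lin_indep j v"
  unfolding lin_indep_def
proof (intro allI impI)
  fix c i assume a: "\<forall>c. (\<Sum>i<r. c i *s v i) = 0 \<longrightarrow> (\<forall>i<r. c i = 0)" "j \<le> r" "(\<Sum>i<j. c i *s v i) = 0" "i < j"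
  have "(\<Sum>i<r. (if i < j then c i else 0) *s v i) = (\<Sum>i<j. (if i < j then c i else 0) *s v i)"
    by (rule sum.mono_neutral_right) (use a(2) in auto)
  also have "\<dots> = (\<Sum>i<j. c i *s v i)" by (rule sum.cong) auto
  also have "\<dots> = 0" by (rule a(3))
  finally have "\<forall>i<r. (if i < j then c i else 0) = 0" by (rule spec[OF a(1), THEN mp])
  moreover have "i < r" using a(2,4) by simp
  ultimately have "(if i < j then c i else 0) = 0" by blast
  then show "c i = 0" using a(4) by simp
qed

definition change_matrix :: "nat \<Rightarrow> (nat \<Rightarrow> 'a::field ^ 'n::finite) \<Rightarrow> (nat \<Rightarrow> 'a ^ 'n) \<Rightarrow> (nat \<Rightarrow> nat \<Rightarrow> 'a) \<Rightarrow> bool" where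
  "change_matrix r e b M \<longleftrightarrow> (\<forall>i<r. e i = (\<Sum>j<r. M i j *s b j))"

lemma ex_change_matrix:
  assumes "\<And>i. i < r \<Longrightarrow> e i \<in> lspan S r b"
  shows "\<exists>M. change_matrix r e b M \<and> (\<forall>i<r. \<forall>j<r. M i j \<in> S)"
proof -
  have "\<forall>i. \<exists>c. i < r \<longrightarrow> e i = (\<Sum>j<r. c j *s b j) \<and> (\<forall>j<r. c j \<in> S)"
    using assms unfolding lspan_def by blast
  then obtain M where "\<And>i. i < r \<Longrightarrow> e i = (\<Sum>j<r. M i j *s b j) \<and> (\<forall>j<r. M i j \<in> S)" by metis
  then show ?thesis unfolding change_matrix_def by blast
qed

lemma change_matrix_trans:
  assumes "change_matrix r e b M" "change_matrix r b d N"
  shows "change_matrix r e d (\<lambda>i j. \<Sum>k<r. M i k * N k j)"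
  unfolding change_matrix_def
proof (intro allI impI)
  fix i assume "i < r"
  then have "e i = (\<Sum>k<r. M i k *s (\<Sum>j<r. N k j *s d j))" using assms by (simp add: change_matrix_def)
  also have "\<dots> = (\<Sum>k<r. \<Sum>j<r. (M i k * N k j) *s d j)" by (simp add: vec.scale_sum_right vector_smult_assoc)
  also have "\<dots> = (\<Sum>j<r. \<Sum>k<r. (M i k * N k j) *s d j)" by (rule sum.swap)
  also have "\<dots> = (\<Sum>j<r. (\<Sum>k<r. M i k * N k j) *s d j)" by (simp add: vec.scale_sum_left)
  finally show "e i = (\<Sum>j<r. (\<Sum>k<r. M i k * N k j) *s d j)" .
qed

lemma change_matrix_refl: "change_matrix r b b (\<lambda>i j. if i = j then 1 else 0)"
  unfolding change_matrix_def
proof (intro allI impI)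
  fix i assume i: "i < r"
  have "(\<Sum>j<r. (if i = j then 1 else 0) *s b j) = (\<Sum>j<r. if j = i then b i else 0)"
    by (rule sum.cong) auto
  then show "b i = (\<Sum>j<r. (if i = j then 1 else 0) *s b j)" using i by simp
qed

lemma change_matrix_unique:
  assumes "lin_indep r b" "change_matrix r e b M" "change_matrix r e b N"
  shows "leibniz_det r M = leibniz_det r N"
  by (rule leibniz_det_cong) (use assms lin_indep_unique in \<open>fastforce simp: change_matrix_def\<close>)

lemma change_matrix_det_mult:
  assumes d: "lin_indep r d" and M: "change_matrix r e b M" "change_matrix r b d N" "change_matrix r e d K"
  shows "leibniz_det r K = leibniz_det r M * leibniz_det r N"
  using change_matrix_unique[OF d M(3) change_matrix_trans[OF M(1,2)]] by (simp add: leibniz_det_mult)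

lemma change_matrix_det_inverse:
  assumes "lin_indep r b" "change_matrix r e b M" "change_matrix r b e N"
  shows "leibniz_det r N * leibniz_det r M = 1"
  using change_matrix_det_mult[OF assms(1,3,2) change_matrix_refl] by (simp add: leibniz_det_one)

lemma change_matrix_det_nonzero:
  assumes "lin_indep r b" "lin_indep r e" "change_matrix r e b M"
  shows "leibniz_det r M \<noteq> 0"
proof -
  have "e i \<in> lspan UNIV r b" if "i < r" for i
    using assms(3) that unfolding change_matrix_def by (auto intro: lspanI)
  then have "b i \<in> lspan UNIV r e" if "i < r" for i
    using lspan_UNIV_eqI[OF assms(2)] lspan_base[of i r UNIV b] that by blast
  then obtain N where "change_matrix r b e N" using ex_change_matrix[of r b UNIV e] by blast
  then show ?thesis using change_matrix_det_inverse[OF assms(1,3)] by auto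
qed

section \<open>Vector bundles as families of lattices\<close>

text \<open>Restriction maps are inclusions, so the direct limit over the neighbourhoods of
  \<open>R\<close> is a union.\<close>

definition stalk :: "'a::field set set \<Rightarrow> ('a, 'n::finite) subsheaf \<Rightarrow> 'a set \<Rightarrow> ('a ^ 'n) set" where
  "stalk X E R = \<Union>{E U | U. U \<in> opens X \<and> R \<in> U}"

lemma lspan_add: "is_subring S \<Longrightarrow> v \<in> lspan S r b \<Longrightarrow> w \<in> lspan S r b \<Longrightarrow> v + w \<in> lspan S r b"
proof -
  assume S: "is_subring S" and "v \<in> lspan S r b" "w \<in> lspan S r b"
  then obtain c d where "\<forall>i<r. c i \<in> S" "\<forall>i<r. d i \<in> S" "v = (\<Sum>i<r. c i *s b i)" "w = (\<Sum>i<r. d i *s b i)"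
    by (auto simp: lspan_def)
  then show ?thesis unfolding lspan_def using is_subringD(6)[OF S]
    by (intro CollectI exI[of _ "\<lambda>i. c i + d i"]) (simp add: vec.scale_left_distrib sum.distrib)
qed

lemma lspan_scale: "is_subring S \<Longrightarrow> a \<in> S \<Longrightarrow> v \<in> lspan S r b \<Longrightarrow> a *s v \<in> lspan S r b"
proof -
  assume S: "is_subring S" "a \<in> S" and "v \<in> lspan S r b"
  then obtain c where "\<forall>i<r. c i \<in> S" "v = (\<Sum>i<r. c i *s b i)" by (auto simp: lspan_def)
  then show ?thesis unfolding lspan_def using is_subringD(4)[OF S(1) S(2)]
    by (intro CollectI exI[of _ "\<lambda>i. a * c i"]) (simp add: vec.scale_sum_right vector_smult_assoc)
qed

lemma lspan_0: "is_subring S \<Longrightarrow> 0 \<in> lspan S r b"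
  using lspanI[of r "\<lambda>_. 0" S b] is_subringD(1)[of S] by simp

lemma lspan_sum: "is_subring S \<Longrightarrow> (\<And>i. i \<in> I \<Longrightarrow> f i \<in> lspan S r b) \<Longrightarrow> sum f I \<in> lspan S r b"
  by (induction I rule: infinite_finite_induct) (auto simp: lspan_0 lspan_add)

lemma lspan_subset:
  assumes "is_subring S" "\<And>i. i < r' \<Longrightarrow> b' i \<in> lspan S r b"
  shows "lspan S r' b' \<subseteq> lspan S r b"
proof
  fix v assume "v \<in> lspan S r' b'"
  then obtain c where "\<forall>i<r'. c i \<in> S" "v = (\<Sum>i<r'. c i *s b' i)" by (auto simp: lspan_def)
  then show "v \<in> lspan S r b" using assms by (auto intro!: lspan_sum lspan_scale)
qed

lemma lspan_add_subgroup: "is_subring S \<Longrightarrow> add_subgroup (lspan S r b)"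
  unfolding add_subgroup_def using lspan_0 lspan_add[of S _ r b "- _"] lspan_scale[of S "-1" _ r b]
  by (auto simp: is_subringD)

lemma is_subring_UNIV: "is_subring UNIV"
  by (simp add: is_subring_def)

lemma change_matrix_lspan:
  "change_matrix r e b M \<Longrightarrow> (\<And>i j. i < r \<Longrightarrow> j < r \<Longrightarrow> M i j \<in> S) \<Longrightarrow> i < r \<Longrightarrow> e i \<in> lspan S r b"
  by (simp add: change_matrix_def lspanI)

lemma module_subsheaf_gluing:
  "module_subsheaf X E \<Longrightarrow> \<U> \<subseteq> opens X \<Longrightarrow> \<U> \<noteq> {} \<Longrightarrow> E (\<Union>\<U>) = (\<Inter>U\<in>\<U>. E U)"
  by (simp add: module_subsheaf_def)

context curve
begin

lemma subring_X: "R \<in> X \<Longrightarrow> is_subring R"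
  using X_eq dvr.subring[OF dvr_locale] is_subring_UNIV by blast

lemma opens_Int: "U \<in> opens X \<Longrightarrow> U' \<in> opens X \<Longrightarrow> U \<inter> U' \<in> opens X"
  by (auto simp: opens_iff Diff_Int)

lemma opens_generic: "U \<in> opens X \<Longrightarrow> UNIV \<in> U"
  by (simp add: opens_iff)

lemma opens_subset: "U \<in> opens X \<Longrightarrow> U \<subseteq> X"
  by (simp add: opens_iff)

lemma opens_regular: "U \<in> opens X \<Longrightarrow> finite S \<Longrightarrow> {R\<in>U. S \<subseteq> R} \<in> opens X"
proof -
  assume U: "U \<in> opens X" and S: "finite S"
  have "X - {R\<in>U. S \<subseteq> R} \<subseteq> (X - U) \<union> (\<Union>y\<in>S. {R\<in>X. y \<notin> R})" by auto
  moreover have "finite ((X - U) \<union> (\<Union>y\<in>S. {R\<in>X. y \<notin> R}))"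
    using U S finite_nonregular by (auto simp: opens_iff)
  ultimately show ?thesis using U finite_subset by (auto simp: opens_iff)
qed

text \<open>A bundle as a family of free modules over the local rings, almost all of them generated
  by one common basis. The second clause ties every local basis to the generic stalk, so that all
  lattices span the same subspace.\<close>

definition lattices :: "nat \<Rightarrow> ('a set \<Rightarrow> ('a ^ 'n::finite) set) \<Rightarrow> bool" where
  "lattices r \<Lambda> \<longleftrightarrow>
     (\<exists>U\<in>opens X. \<exists>b. lin_indep r b \<and> (\<forall>R\<in>U. \<Lambda> R = lspan R r b)) \<and>
     (\<forall>R\<in>X. \<exists>b. lin_indep r b \<and> \<Lambda> R = lspan R r b \<and> \<Lambda> UNIV = lspan UNIV r b)"

lemma restriction:
  assumes E: "module_subsheaf X E" and "U \<in> opens X" "U' \<in> opens X" "U \<subseteq> U'"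
  shows "E U' \<subseteq> E U"
proof -
  have "E (\<Union>{U, U'}) = (\<Inter>U\<in>{U, U'}. E U)"
    by (rule module_subsheaf_gluing[OF E]) (use assms in auto)
  moreover have "\<Union>{U, U'} = U'" using assms(4) by auto
  ultimately show ?thesis by auto
qed

lemma stalk_local_frame:
  assumes E: "module_subsheaf X E" and U: "U \<in> opens X" "R \<in> U" and b: "local_frame X r E U b"
  shows "stalk X E R = lspan R r b"
proof (intro equalityI subsetI)
  fix v assume "v \<in> stalk X E R"
  then obtain U' where U': "U' \<in> opens X" "R \<in> U'" "v \<in> E U'" unfolding stalk_def by blast
  have W: "U \<inter> U' \<in> opens X" by (rule opens_Int[OF U(1) U'(1)])
  have "v \<in> E (U \<inter> U')" using restriction[OF E W U'(1)] U'(3) by blast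
  then obtain c where "\<forall>i<r. c i \<in> struct_sheaf (U \<inter> U')" "v = (\<Sum>i<r. c i *s b i)"
    using b W unfolding local_frame_def by blast
  then show "v \<in> lspan R r b" using U(2) U'(2) by (auto simp: struct_sheaf_def intro!: lspanI)
next
  fix v assume "v \<in> lspan R r b"
  then obtain c where c: "\<forall>i<r. c i \<in> R" "v = (\<Sum>i<r. c i *s b i)" by (auto simp: lspan_def)
  define W where "W = {S\<in>U. c ` {..<r} \<subseteq> S}"
  have W: "W \<in> opens X" "R \<in> W" "W \<subseteq> U"
    using opens_regular[OF U(1), of "c ` {..<r}"] U(2) c(1) by (auto simp: W_def)
  have "v \<in> E W" using b W(1,3) c(2) unfolding local_frame_def by (auto simp: struct_sheaf_def W_def)
  then show "v \<in> stalk X E R" using W unfolding stalk_def by blast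
qed

text \<open>A vector in all stalks is a section on some neighbourhood of each point of
  \<open>U\<close>. These sections agree automatically, being the same vector, and the gluing axiom
  applies.\<close>

lemma sections_eq_stalks:
  assumes E: "module_subsheaf X E" and U: "U \<in> opens X"
  shows "E U = (\<Inter>R\<in>U. stalk X E R)"
proof (intro equalityI subsetI)
  fix v assume "v \<in> E U"
  then show "v \<in> (\<Inter>R\<in>U. stalk X E R)" using U unfolding stalk_def by blast
next
  fix v assume v: "v \<in> (\<Inter>R\<in>U. stalk X E R)"
  then have "\<forall>R\<in>U. \<exists>W. W \<in> opens X \<and> R \<in> W \<and> v \<in> E W" unfolding stalk_def by blast
  then obtain W where W: "\<And>R. R \<in> U \<Longrightarrow> W R \<in> opens X \<and> R \<in> W R \<and> v \<in> E (W R)" by metis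
  have WU: "W R \<inter> U \<in> opens X" if "R \<in> U" for R using W[OF that] opens_Int U by blast
  have "v \<in> E (W R \<inter> U)" if "R \<in> U" for R
    using restriction[OF E WU[OF that], of "W R"] W[OF that] by blast
  then have "v \<in> (\<Inter>R\<in>U. E (W R \<inter> U))" by blast
  moreover have "E (\<Union>((\<lambda>R. W R \<inter> U) ` U)) = (\<Inter>W'\<in>(\<lambda>R. W R \<inter> U) ` U. E W')"
    by (rule module_subsheaf_gluing[OF E]) (use WU opens_generic[OF U] in auto)
  moreover have "\<Union>((\<lambda>R. W R \<inter> U) ` U) = U" using W by blast
  ultimately show "v \<in> E U" by simp
qed

lemma lattices_stalk:
  assumes "vector_bundle X r E"
  shows "lattices r (stalk X E)"
proof -
  have E: "module_subsheaf X E" using assms by (simp add: vector_bundle_def)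
  have lf: "\<exists>U\<in>opens X. R \<in> U \<and> (\<exists>b. local_frame X r E U b)" if "R \<in> X" for R
    using assms that by (simp add: vector_bundle_def)
  obtain U b where U: "U \<in> opens X" "local_frame X r E U b" using lf[OF generic_point] by blast
  have "lin_indep r b \<and> (\<forall>R\<in>U. stalk X E R = lspan R r b)"
    using stalk_local_frame[OF E U(1) _ U(2)] U(2) by (simp add: local_frame_def)
  moreover have "\<exists>b. lin_indep r b \<and> stalk X E R = lspan R r b \<and> stalk X E UNIV = lspan UNIV r b" if R: "R \<in> X" for R
  proof -
    obtain U b where U: "U \<in> opens X" "R \<in> U" "local_frame X r E U b" using lf[OF R] by blast
    then show ?thesis
      using stalk_local_frame[OF E U(1) U(2) U(3)] stalk_local_frame[OF E U(1) opens_generic[OF U(1)] U(3)]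
      by (auto simp: local_frame_def)
  qed
  ultimately show ?thesis unfolding lattices_def using U(1) by blast
qed

lemma lattices_generic: "lattices r \<Lambda> \<Longrightarrow> \<exists>b. lin_indep r b \<and> \<Lambda> UNIV = lspan UNIV r b"
  using generic_point unfolding lattices_def by blast

text \<open>The matrices relating \<open>w\<close> to a basis that works generically, in both
  directions, have finitely many entries and hence finitely many poles. Away from these, both bases
  generate the same lattice.\<close>

lemma opens_lattice_eq:
  assumes \<Lambda>: "lattices r \<Lambda>" and w: "lin_indep r w" "\<Lambda> UNIV = lspan UNIV r w"
  shows "{R\<in>X. \<Lambda> R = lspan R r w} \<in> opens X"
proof -
  obtain U b where U: "U \<in> opens X" and b: "lin_indep r b" "\<And>R. R \<in> U \<Longrightarrow> \<Lambda> R = lspan R r b"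
    using \<Lambda> unfolding lattices_def by blast
  have gen: "lspan UNIV r b = lspan UNIV r w" using b(2)[OF opens_generic[OF U]] w(2) by simp
  have "w i \<in> lspan UNIV r b" "b i \<in> lspan UNIV r w" if "i < r" for i
    using lspan_base[OF that, of UNIV] gen by auto
  then obtain M M' where M: "change_matrix r w b M" "change_matrix r b w M'"
    using ex_change_matrix[of r w UNIV b] ex_change_matrix[of r b UNIV w] by blast
  let ?S = "(\<lambda>(i, j). M i j) ` ({..<r} \<times> {..<r}) \<union> (\<lambda>(i, j). M' i j) ` ({..<r} \<times> {..<r})"
  have W: "{R\<in>U. ?S \<subseteq> R} \<in> opens X" by (rule opens_regular[OF U]) simp
  have eq: "\<Lambda> R = lspan R r w" if R: "R \<in> U" "?S \<subseteq> R" for R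
  proof -
    have sR: "is_subring R" using subring_X opens_subset[OF U] R(1) by blast
    have "M i j \<in> R" "M' i j \<in> R" if "i < r" "j < r" for i j using R(2) that by auto
    then have "w i \<in> lspan R r b" "b i \<in> lspan R r w" if "i < r" for i
      using change_matrix_lspan[OF M(1) _ that] change_matrix_lspan[OF M(2) _ that] by blast+
    then have "lspan R r b = lspan R r w" by (intro equalityI lspan_subset[OF sR])
    then show ?thesis using b(2)[OF R(1)] by simp
  qed
  have "{R\<in>U. ?S \<subseteq> R} \<subseteq> {R\<in>X. \<Lambda> R = lspan R r w}"
    using eq opens_subset[OF U] by blast
  then have "X - {R\<in>X. \<Lambda> R = lspan R r w} \<subseteq> X - {R\<in>U. ?S \<subseteq> R}" by blast
  then have "finite (X - {R\<in>X. \<Lambda> R = lspan R r w})" using W finite_subset unfolding opens_iff by blast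
  then show ?thesis using w(2) generic_point by (auto simp: opens_iff)
qed

definition bundle_of :: "('a set \<Rightarrow> ('a ^ 'n::finite) set) \<Rightarrow> ('a, 'n) subsheaf" where
  "bundle_of \<Lambda> U = (\<Inter>R\<in>U. \<Lambda> R)"

text \<open>The converse of \<open>lattices_stalk\<close>. A basis chosen for the lattice at one
  point is a local frame on the open set where it generates the given lattice; sections over it have
  coefficients in every local ring because coefficients with respect to a basis are unique.\<close>

lemma
  assumes \<Lambda>: "lattices r \<Lambda>"
  shows vector_bundle_of: "vector_bundle X r (bundle_of \<Lambda>)"
    and stalk_bundle_of: "R \<in> X \<Longrightarrow> stalk X (bundle_of \<Lambda>) R = \<Lambda> R"
proof -
  have lat: "\<exists>b. lin_indep r b \<and> \<Lambda> R = lspan R r b \<and> \<Lambda> UNIV = lspan UNIV r b" if "R \<in> X" for R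
    using \<Lambda> that unfolding lattices_def by blast
  have sec: "bundle_of \<Lambda> W = {\<Sum>i<r. c i *s b i | c. \<forall>i<r. c i \<in> struct_sheaf W}"
    if b: "lin_indep r b" and W: "W \<in> opens X" "\<And>R. R \<in> W \<Longrightarrow> \<Lambda> R = lspan R r b" for W b
  proof (intro equalityI subsetI)
    fix v assume "v \<in> bundle_of \<Lambda> W"
    then have v: "v \<in> lspan R r b" if "R \<in> W" for R using W(2) that by (auto simp: bundle_of_def)
    obtain c where c: "v = (\<Sum>i<r. c i *s b i)" using v[OF opens_generic[OF W(1)]] by (auto simp: lspan_def)
    have "c i \<in> R" if R: "R \<in> W" and i: "i < r" for R i
    proof -
      obtain d where d: "\<forall>i<r. d i \<in> R" "v = (\<Sum>i<r. d i *s b i)" using v[OF R] by (auto simp: lspan_def)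
      then have "c i = d i" using lin_indep_unique[OF b _ i, of c d] c by simp
      then show ?thesis using d(1) i by simp
    qed
    then show "v \<in> {\<Sum>i<r. c i *s b i | c. \<forall>i<r. c i \<in> struct_sheaf W}" using c by (auto simp: struct_sheaf_def)
  next
    fix v assume "v \<in> {\<Sum>i<r. c i *s b i | c. \<forall>i<r. c i \<in> struct_sheaf W}"
    then show "v \<in> bundle_of \<Lambda> W" using W(2) by (auto simp: bundle_of_def struct_sheaf_def intro!: lspanI)
  qed
  have E: "module_subsheaf X (bundle_of \<Lambda>)"
    unfolding module_subsheaf_def
  proof (intro conjI ballI allI impI)
    fix U assume U: "U \<in> opens X"
    have L: "\<exists>b. \<Lambda> R = lspan R r b" and sR: "is_subring R" if "R \<in> U" for R
      using lat[of R] subring_X[of R] opens_subset[OF U] that by auto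
    show "0 \<in> bundle_of \<Lambda> U" unfolding bundle_of_def using L lspan_0[OF sR] by fastforce
    fix v assume v: "v \<in> bundle_of \<Lambda> U"
    then have vR: "v \<in> \<Lambda> R" if "R \<in> U" for R using that by (simp add: bundle_of_def)
    show "v + w \<in> bundle_of \<Lambda> U" if w: "w \<in> bundle_of \<Lambda> U" for w
      unfolding bundle_of_def
    proof
      fix R assume R: "R \<in> U"
      obtain b where "\<Lambda> R = lspan R r b" using L[OF R] by blast
      moreover have "w \<in> \<Lambda> R" using w R by (simp add: bundle_of_def)
      ultimately show "v + w \<in> \<Lambda> R" using lspan_add[OF sR[OF R], of v r b w] vR[OF R] by simp
    qed
    show "a *s v \<in> bundle_of \<Lambda> U" if a: "a \<in> struct_sheaf U" for a
      unfolding bundle_of_def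
    proof
      fix R assume R: "R \<in> U"
      obtain b where "\<Lambda> R = lspan R r b" using L[OF R] by blast
      moreover have "a \<in> R" using a R by (auto simp: struct_sheaf_def)
      ultimately show "a *s v \<in> \<Lambda> R" using lspan_scale[OF sR[OF R]] vR[OF R] by simp
    qed
  next
    fix \<U> :: "'a set set set"
    show "bundle_of \<Lambda> (\<Union>\<U>) = (\<Inter>U\<in>\<U>. bundle_of \<Lambda> U)" by (auto simp: bundle_of_def)
  qed
  have lf: "\<exists>U\<in>opens X. R \<in> U \<and> (\<exists>b. local_frame X r (bundle_of \<Lambda>) U b \<and> \<Lambda> R = lspan R r b)" if R: "R \<in> X" for R
  proof -
    obtain b where b: "lin_indep r b" "\<Lambda> R = lspan R r b" "\<Lambda> UNIV = lspan UNIV r b" using lat[OF R] by blast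
    let ?U = "{R\<in>X. \<Lambda> R = lspan R r b}"
    have "?U \<in> opens X" by (rule opens_lattice_eq[OF \<Lambda> b(1,3)])
    moreover have "local_frame X r (bundle_of \<Lambda>) ?U b"
      unfolding local_frame_def
    proof (intro conjI ballI impI)
      fix W assume W: "W \<in> opens X" "W \<subseteq> ?U"
      show "bundle_of \<Lambda> W = {\<Sum>i<r. c i *s b i | c. \<forall>i<r. c i \<in> struct_sheaf W}"
        by (rule sec[OF b(1) W(1)]) (use W(2) in blast)
    qed (rule b(1))
    ultimately show ?thesis using R b(2) by (intro bexI[of _ ?U]) auto
  qed
  then show "vector_bundle X r (bundle_of \<Lambda>)" using E unfolding vector_bundle_def by blast
  show "stalk X (bundle_of \<Lambda>) R = \<Lambda> R" if "R \<in> X"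
    using lf[OF that] stalk_local_frame[OF E] by blast
qed

subsection \<open>Degrees\<close>

text \<open>Two bases of the same lattice are related by matrices with entries in \<open>R\<close>
  in both directions, so the determinant between them is a unit.\<close>

lemma change_matrix_ord_frames:
  assumes R: "R \<in> V" and b: "lin_indep r b" "lin_indep r b'" "lspan R r b = lspan R r b'"
    and e: "lin_indep r e" "change_matrix r e b M" "change_matrix r e b' M'"
  shows "ord_at R (leibniz_det r M) = ord_at R (leibniz_det r M')"
proof -
  interpret R: dvr R by (rule dvr_locale[OF R])
  note sR = is_subringD[OF R.subring]
  have "b i \<in> lspan R r b'" "b' i \<in> lspan R r b" if "i < r" for i
    using lspan_base[OF that, of R b] lspan_base[OF that, of R b'] sR(1,2) b(3) by auto
  then obtain P P' where P: "change_matrix r b b' P" "\<forall>i<r. \<forall>j<r. P i j \<in> R"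
    and P': "change_matrix r b' b P'" "\<forall>i<r. \<forall>j<r. P' i j \<in> R"
    using ex_change_matrix[of r b R b'] ex_change_matrix[of r b' R b] by blast
  have d: "leibniz_det r P \<in> R" "leibniz_det r P' \<in> R" using leibniz_det_mem[OF R.subring] P(2) P'(2) by blast+
  have 1: "leibniz_det r P' * leibniz_det r P = 1" by (rule change_matrix_det_inverse[OF b(2) P(1) P'(1)])
  then have P0: "leibniz_det r P \<noteq> 0" "leibniz_det r P' \<noteq> 0" by auto
  then have "ord_at R (leibniz_det r P') + ord_at R (leibniz_det r P) = 0" using R.ord_mult[of "leibniz_det r P'" "leibniz_det r P"] 1 by simp
  moreover have "0 \<le> ord_at R (leibniz_det r P)" "0 \<le> ord_at R (leibniz_det r P')"
    using d P0 by (simp_all add: R.mem_iff_ord)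
  ultimately have "ord_at R (leibniz_det r P) = 0" by simp
  moreover have "leibniz_det r M' = leibniz_det r M * leibniz_det r P"
    by (rule change_matrix_det_mult[OF b(2) e(2) P(1) e(3)])
  moreover have "leibniz_det r M \<noteq> 0" by (rule change_matrix_det_nonzero[OF b(1) e(1,2)])
  ultimately show ?thesis using R.ord_mult P0 by simp
qed

text \<open>The counterpart of \<open>frame_ord\<close> for a single lattice, so that orders are
  computed at one place without reference to neighbourhoods.\<close>

definition lat_ord :: "nat \<Rightarrow> 'a set \<Rightarrow> ('a ^ 'n::finite) set \<Rightarrow> (nat \<Rightarrow> 'a ^ 'n) \<Rightarrow> int" where
  "lat_ord r R \<Lambda> e =
     (THE m. \<exists>b M. lin_indep r b \<and> \<Lambda> = lspan R r b \<and> change_matrix r e b M \<and> m = ord_at R (leibniz_det r M))"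

lemma lat_ord_eq:
  assumes R: "R \<in> V" and b: "lin_indep r b" "\<Lambda> = lspan R r b" and e: "lin_indep r e" "change_matrix r e b M"
  shows "lat_ord r R \<Lambda> e = ord_at R (leibniz_det r M)"
  unfolding lat_ord_def
proof (rule the_equality)
  show "\<exists>b M'. lin_indep r b \<and> \<Lambda> = lspan R r b \<and> change_matrix r e b M' \<and> ord_at R (leibniz_det r M) = ord_at R (leibniz_det r M')"
    using b e by blast
  fix m assume "\<exists>b M. lin_indep r b \<and> \<Lambda> = lspan R r b \<and> change_matrix r e b M \<and> m = ord_at R (leibniz_det r M)"
  then obtain b' M' where "lin_indep r b'" "\<Lambda> = lspan R r b'" "change_matrix r e b' M'" "m = ord_at R (leibniz_det r M')" by blast
  then show "m = ord_at R (leibniz_det r M)" using change_matrix_ord_frames[OF R b(1) _ _ e] b(2) by metis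
qed

lemma frame_ord_eq_lat_ord:
  assumes E: "vector_bundle X r E" and R: "R \<in> V" and e: "lin_indep r e" "stalk X E UNIV = lspan UNIV r e"
  shows "frame_ord X r E e R = lat_ord r R (stalk X E R) e"
proof -
  have Em: "module_subsheaf X E" using E by (simp add: vector_bundle_def)
  obtain U b where U: "U \<in> opens X" "R \<in> U" and b: "local_frame X r E U b"
    using E R V_subset unfolding vector_bundle_def by blast
  have st: "stalk X E R = lspan R r b" "stalk X E UNIV = lspan UNIV r b" and bi: "lin_indep r b"
    using stalk_local_frame[OF Em U b] stalk_local_frame[OF Em U(1) opens_generic[OF U(1)] b] b
    by (auto simp: local_frame_def)
  have "e i \<in> lspan UNIV r b" if "i < r" for i using lspan_base[OF that, of UNIV e] st(2) e(2) by auto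
  then obtain M where M: "change_matrix r e b M" using ex_change_matrix[of r e UNIV b] by blast
  have eq: "lat_ord r R (stalk X E R) e = ord_at R (leibniz_det r M)" by (rule lat_ord_eq[OF R bi st(1) e(1) M])
  show ?thesis
    unfolding frame_ord_def
  proof (rule the_equality)
    show "\<exists>U\<in>opens X. \<exists>b M. R \<in> U \<and> local_frame X r E U b \<and> (\<forall>i<r. e i = (\<Sum>j<r. M i j *s b j)) \<and>
        lat_ord r R (stalk X E R) e = ord_at R (leibniz_det r M)"
      using U b M eq unfolding change_matrix_def by blast
    fix m assume "\<exists>U\<in>opens X. \<exists>b M. R \<in> U \<and> local_frame X r E U b \<and> (\<forall>i<r. e i = (\<Sum>j<r. M i j *s b j)) \<and>
        m = ord_at R (leibniz_det r M)"
    then obtain U' b' M' where b': "U' \<in> opens X" "R \<in> U'" "local_frame X r E U' b'" "change_matrix r e b' M'"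
      "m = ord_at R (leibniz_det r M')" unfolding change_matrix_def by blast
    have "lin_indep r b'" using b'(3) by (simp add: local_frame_def)
    then show "m = lat_ord r R (stalk X E R) e"
      using lat_ord_eq[OF R _ stalk_local_frame[OF Em b'(1-3)] e(1) b'(4)] b'(5) by simp
  qed
qed

definition lat_div :: "nat \<Rightarrow> ('a set \<Rightarrow> ('a ^ 'n::finite) set) \<Rightarrow> (nat \<Rightarrow> 'a ^ 'n) \<Rightarrow> 'a set \<Rightarrow> int" where
  "lat_div r \<Lambda> e R = (if R \<in> V then lat_ord r R (\<Lambda> R) e else 0)"

lemma lattices_frame:
  assumes "lattices r \<Lambda>" "R \<in> X" "\<Lambda> UNIV = lspan UNIV r e"
  obtains b M where "lin_indep r b" "\<Lambda> R = lspan R r b" "change_matrix r e b M"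
proof -
  obtain b where b: "lin_indep r b" "\<Lambda> R = lspan R r b" "\<Lambda> UNIV = lspan UNIV r b"
    using assms(1,2) unfolding lattices_def by blast
  have "e i \<in> lspan UNIV r b" if "i < r" for i using lspan_base[OF that, of UNIV e] b(3) assms(3) by auto
  then obtain M where "change_matrix r e b M" using ex_change_matrix[of r e UNIV b] by blast
  with b show ?thesis using that by blast
qed

lemma divisor_lat_div:
  assumes \<Lambda>: "lattices r \<Lambda>" and e: "lin_indep r e" "\<Lambda> UNIV = lspan UNIV r e"
  shows "divisor (lat_div r \<Lambda> e)"
proof -
  let ?U = "{R\<in>X. \<Lambda> R = lspan R r e}"
  have "lat_div r \<Lambda> e R = 0" if "R \<in> ?U" "R \<in> V" for R
    using that lat_ord_eq[OF that(2) e(1) _ e(1) change_matrix_refl, of "\<Lambda> R"] dvr.ord_1[OF dvr_locale[OF that(2)]]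
    by (simp add: lat_div_def leibniz_det_one)
  then have sub: "{R. lat_div r \<Lambda> e R \<noteq> 0} \<subseteq> X - ?U" using V_subset by (auto simp: lat_div_def)
  have "finite (X - ?U)" using opens_lattice_eq[OF assms] by (simp add: opens_iff)
  from finite_subset[OF sub this] show ?thesis unfolding divisor_def by (auto simp: lat_div_def)
qed

text \<open>A change of the rational basis multiplies the section of the determinant bundle by a
  non-zero function, whose divisor has degree zero. This makes the choice inside
  \<open>bundle_degree\<close> immaterial.\<close>

lemma deg_lat_div_eq:
  assumes \<Lambda>: "lattices r \<Lambda>" and e: "lin_indep r e" "\<Lambda> UNIV = lspan UNIV r e"
    and e': "lin_indep r e'" "\<Lambda> UNIV = lspan UNIV r e'"
  shows "deg (lat_div r \<Lambda> e) = deg (lat_div r \<Lambda> e')"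
proof -
  have "e' i \<in> lspan UNIV r e" if "i < r" for i using lspan_base[OF that, of UNIV e'] e e' by auto
  then obtain A where A: "change_matrix r e' e A" using ex_change_matrix[of r e' UNIV e] by blast
  have A0: "leibniz_det r A \<noteq> 0" by (rule change_matrix_det_nonzero[OF e(1) e'(1) A])
  have "lat_div r \<Lambda> e' R = lat_div r \<Lambda> e R + dv (leibniz_det r A) R" for R
  proof (cases "R \<in> V")
    case True
    interpret R: dvr R by (rule dvr_locale[OF True])
    obtain b M where b: "lin_indep r b" "\<Lambda> R = lspan R r b" "change_matrix r e b M"
      using lattices_frame[OF \<Lambda> _ e(2), of R] True V_subset by blast
    have tr: "change_matrix r e' b (\<lambda>i j. \<Sum>k<r. A i k * M k j)" by (rule change_matrix_trans[OF A b(3)])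
    show ?thesis
      using True lat_ord_eq[OF True b(1,2) e(1) b(3)] lat_ord_eq[OF True b(1,2) e'(1) tr]
        R.ord_mult[OF A0 change_matrix_det_nonzero[OF b(1) e(1) b(3)]]
      by (simp add: lat_div_def dv_def leibniz_det_mult)
  qed (simp add: lat_div_def dv_def)
  then have "lat_div r \<Lambda> e' = (\<lambda>R. lat_div r \<Lambda> e R + dv (leibniz_det r A) R)" by blast
  then show ?thesis
    using deg_add[OF divisor_lat_div[OF \<Lambda> e] divisor_dv[OF A0]] deg_dv[OF A0] by simp
qed

lemma bundle_degree_eq:
  assumes E: "vector_bundle X r E" and e: "lin_indep r e" "stalk X E UNIV = lspan UNIV r e"
  shows "bundle_degree \<iota> X r E = deg (lat_div r (stalk X E) e)"
proof -
  have rf: "rational_frame X r E e' \<longleftrightarrow> lin_indep r e' \<and> stalk X E UNIV = lspan UNIV r e'" for e'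
  proof -
    have "(\<Union>U\<in>opens X. E U) = stalk X E UNIV" unfolding stalk_def using opens_generic by blast
    then have "rational_frame X r E e' \<longleftrightarrow> lin_indep r e' \<and> (\<forall>i<r. e' i \<in> lspan UNIV r e)"
      by (simp add: rational_frame_def e(2))
    also have "\<dots> \<longleftrightarrow> lin_indep r e' \<and> stalk X E UNIV = lspan UNIV r e'"
      using lspan_UNIV_eqI[of r e' e] lspan_base[of _ r UNIV e'] by (auto simp: e(2))
    finally show ?thesis .
  qed
  define e' where "e' = (SOME e. rational_frame X r E e)"
  have e': "lin_indep r e'" "stalk X E UNIV = lspan UNIV r e'"
    using someI[of "rational_frame X r E" e] rf e unfolding e'_def by blast+
  have "bundle_degree \<iota> X r E = deg (lat_div r (stalk X E) e')"
    unfolding bundle_degree_def Let_def e'_def[symmetric] deg_def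
    by (rule sum.cong)
      (use frame_ord_eq_lat_ord[OF E _ e'] in \<open>auto simp: lat_div_def V_eq[symmetric] split: if_splits\<close>)
  then show ?thesis using deg_lat_div_eq[OF lattices_stalk[OF E] e' e] by simp
qed

end

section \<open>Flags\<close>

text \<open>Coordinates, and the flag spanned by the initial segments of \<open>v\<close>; meaningful if \<open>v\<close> is a basis of
  \<open>K^n\<close>.\<close>

definition crd :: "(nat \<Rightarrow> 'a::field ^ 'n::finite) \<Rightarrow> 'a ^ 'n \<Rightarrow> nat \<Rightarrow> 'a" where
  "crd v x = (SOME c. x = (\<Sum>i<CARD('n). c i *s v i))"

definition flag :: "(nat \<Rightarrow> 'a::field ^ 'n::finite) \<Rightarrow> nat \<Rightarrow> ('a ^ 'n) set" where
  "flag v j = {x. \<forall>i. j \<le> i \<and> i < CARD('n) \<longrightarrow> crd v x i = 0}"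

text \<open>The piece \<open>(G \<inter> flag v (Suc i)) / (G \<inter> flag v i)\<close>, realised
  inside the function field by means of the coordinate \<open>i\<close>.\<close>

definition graded :: "(nat \<Rightarrow> 'a::field ^ 'n::finite) \<Rightarrow> nat \<Rightarrow> ('a ^ 'n) set \<Rightarrow> 'a set" where
  "graded v i G = (\<lambda>x. crd v x i) ` (G \<inter> flag v (Suc i))"

locale frame =
  fixes v :: "nat \<Rightarrow> 'a::field ^ 'n::finite"
  assumes v: "lin_indep CARD('n) v"
begin

lemma crd_sum: "(\<Sum>i<CARD('n). crd v x i *s v i) = x"
proof -
  have "x \<in> lspan UNIV CARD('n) v" using lspan_UNIV_full[OF v] by blast
  then have "\<exists>c. x = (\<Sum>i<CARD('n). c i *s v i)" by (auto simp: lspan_def)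
  then have "x = (\<Sum>i<CARD('n). crd v x i *s v i)" unfolding crd_def by (rule someI_ex)
  then show ?thesis by (rule sym)
qed

lemma crd_eqI: "x = (\<Sum>i<CARD('n). c i *s v i) \<Longrightarrow> i < CARD('n) \<Longrightarrow> crd v x i = c i"
  by (rule lin_indep_unique[OF v, of "crd v x" c i]) (simp_all only: crd_sum)

lemma crd_add: "i < CARD('n) \<Longrightarrow> crd v (x + y) i = crd v x i + crd v y i"
  by (rule crd_eqI) (simp_all add: vec.scale_left_distrib sum.distrib crd_sum)

lemma crd_scale: "i < CARD('n) \<Longrightarrow> crd v (a *s x) i = a * crd v x i"
proof (rule crd_eqI)
  have "(\<Sum>i<CARD('n). (a * crd v x i) *s v i) = a *s (\<Sum>i<CARD('n). crd v x i *s v i)"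
    by (simp add: vec.scale_sum_right vector_smult_assoc)
  then show "a *s x = (\<Sum>i<CARD('n). (a * crd v x i) *s v i)" by (simp only: crd_sum)
qed

lemma crd_0: "i < CARD('n) \<Longrightarrow> crd v 0 i = 0"
  using crd_scale[of i 0 0] by simp

lemma crd_diff: "i < CARD('n) \<Longrightarrow> crd v (x - y) i = crd v x i - crd v y i"
  using crd_add[of i "x - y" y] by simp

lemma crd_sum_distrib: "i < CARD('n) \<Longrightarrow> crd v (sum f I) i = (\<Sum>k\<in>I. crd v (f k) i)"
  by (induction I rule: infinite_finite_induct) (auto simp: crd_0 crd_add)

lemma crd_base: "j < CARD('n) \<Longrightarrow> i < CARD('n) \<Longrightarrow> crd v (v j) i = (if j = i then 1 else 0)"
  by (rule crd_eqI) (use change_matrix_refl[of "CARD('n)" v] in \<open>auto simp: change_matrix_def\<close>)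

lemma flag_subgroup: "add_subgroup (flag v j)"
  by (simp add: flag_def add_subgroup_def crd_0 crd_diff)

lemma flag_scale: "x \<in> flag v j \<Longrightarrow> a *s x \<in> flag v j"
  by (simp add: flag_def crd_scale)

lemma flag_mono: "j \<le> j' \<Longrightarrow> flag v j \<subseteq> flag v j'"
  by (auto simp: flag_def)

lemma flag_0: "flag v 0 = {0}"
proof -
  have "x = 0" if "x \<in> flag v 0" for x
    by (subst crd_sum[of x, symmetric]) (use that in \<open>simp add: flag_def\<close>)
  then show ?thesis by (auto simp: flag_def crd_0)
qed

lemma flag_CARD: "flag v CARD('n) = UNIV"
  by (auto simp: flag_def)

lemma flag_iff_Suc: "j < CARD('n) \<Longrightarrow> x \<in> flag v j \<longleftrightarrow> x \<in> flag v (Suc j) \<and> crd v x j = 0"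
proof -
  assume "j < CARD('n)"
  moreover have "j \<le> i \<longleftrightarrow> i = j \<or> Suc j \<le> i" for i by auto
  ultimately show ?thesis unfolding flag_def by auto
qed

lemma flag_base: "i < j \<Longrightarrow> i < CARD('n) \<Longrightarrow> v i \<in> flag v j"
  by (auto simp: flag_def crd_base)

lemma flag_sum_eq:
  assumes "x \<in> flag v j" "j \<le> CARD('n)"
  shows "x = (\<Sum>i<j. crd v x i *s v i)"
proof -
  have "(\<Sum>i<CARD('n). crd v x i *s v i) = (\<Sum>i<j. crd v x i *s v i)"
    by (rule sum.mono_neutral_right) (use assms in \<open>auto simp: flag_def\<close>)
  then show ?thesis using crd_sum[of x] by simp
qed

lemma lspan_flag: "j \<le> CARD('n) \<Longrightarrow> lspan UNIV j v = flag v j"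
proof (intro equalityI subsetI)
  fix x assume "j \<le> CARD('n)" "x \<in> flag v j"
  then show "x \<in> lspan UNIV j v" using flag_sum_eq[of x j] by (auto simp: lspan_def)
next
  fix x assume j: "j \<le> CARD('n)" and "x \<in> lspan UNIV j v"
  then obtain c where c: "x = (\<Sum>i<j. c i *s v i)" by (auto simp: lspan_def)
  show "x \<in> flag v j" unfolding c
    by (rule add_subgroup_sum[OF flag_subgroup], rule flag_scale, rule flag_base) (use j in auto)
qed

lemma graded_subgroup: "i < CARD('n) \<Longrightarrow> add_subgroup G \<Longrightarrow> add_subgroup (graded v i G)"
proof -
  assume i: "i < CARD('n)" and "add_subgroup G"
  then have G: "add_subgroup (G \<inter> flag v (Suc i))" using add_subgroup_Int flag_subgroup by blast
  show ?thesis
    unfolding graded_def add_subgroup_def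
  proof (intro conjI ballI)
    show "0 \<in> (\<lambda>x. crd v x i) ` (G \<inter> flag v (Suc i))"
      using crd_0[OF i] add_subgroupD(1)[OF G] by (metis imageI)
    fix a b assume "a \<in> (\<lambda>x. crd v x i) ` (G \<inter> flag v (Suc i))" "b \<in> (\<lambda>x. crd v x i) ` (G \<inter> flag v (Suc i))"
    then obtain x y where "x \<in> G \<inter> flag v (Suc i)" "y \<in> G \<inter> flag v (Suc i)" "a = crd v x i" "b = crd v y i" by blast
    then show "a - b \<in> (\<lambda>x. crd v x i) ` (G \<inter> flag v (Suc i))"
      using crd_diff[OF i, of x y] add_subgroupD(2)[OF G] by (metis imageI)
  qed
qed

text \<open>On the step \<open>Suc j\<close> of the flag, the kernel of the coordinate
  \<open>j\<close> is the step \<open>j\<close>; \<open>index_hom\<close> then splits off one graded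
  piece.\<close>

lemma index_flag:
  assumes G: "add_subgroup G" and H: "add_subgroup H" and "H \<subseteq> G" and j: "j \<le> CARD('n)"
  shows "index (G \<inter> flag v j) (H \<inter> flag v j) = (\<Prod>i<j. index (graded v i G) (graded v i H))
    \<and> (finite (cosets (G \<inter> flag v j) (H \<inter> flag v j)) \<longleftrightarrow> (\<forall>i<j. finite (cosets (graded v i G) (graded v i H))))"
  using j
proof (induction j)
  case 0
  have "G \<inter> flag v 0 = {0}" "H \<inter> flag v 0 = {0}" using add_subgroupD(1)[OF G] add_subgroupD(1)[OF H] by (auto simp: flag_0)
  then show ?case by (simp add: index_zero)
next
  case (Suc j)
  have j: "j < CARD('n)" using Suc.prems by simp
  have ker: "{x \<in> G \<inter> flag v (Suc j). crd v x j = 0} = G \<inter> flag v j" for G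
    using flag_iff_Suc[OF j] by auto
  note i = index_hom[of "G \<inter> flag v (Suc j)" "H \<inter> flag v (Suc j)" "\<lambda>x. crd v x j",
      OF add_subgroup_Int[OF G flag_subgroup] add_subgroup_Int[OF H flag_subgroup], unfolded ker graded_def[symmetric]]
  have "H \<inter> flag v (Suc j) \<subseteq> G \<inter> flag v (Suc j)" using \<open>H \<subseteq> G\<close> by blast
  note i = i[OF this crd_diff[OF j]]
  show ?case using i Suc.IH j by (auto simp: less_Suc_eq)
qed

end

text \<open>The piece \<open>i\<close> involves only the basis vectors up to \<open>i\<close>. Later
  vectors can thus be exchanged while a flag is being constructed, without disturbing the pieces
  already obtained.\<close>

lemma graded_cong:
  assumes v: "lin_indep CARD('n) (v :: nat \<Rightarrow> 'a::field ^ 'n::finite)" and v': "lin_indep CARD('n) v'"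
    and eq: "\<And>l. l \<le> i \<Longrightarrow> v l = v' l" and i: "i < CARD('n)"
  shows "graded v i G = graded v' i G"
proof -
  interpret a: frame v by unfold_locales (rule v)
  interpret b: frame v' by unfold_locales (rule v')
  have f: "flag v (Suc i) = flag v' (Suc i)"
    using a.lspan_flag[of "Suc i"] b.lspan_flag[of "Suc i"] lspan_cong[of "Suc i" v v' UNIV] eq i by auto
  have "crd v x i = crd v' x i" if x: "x \<in> flag v (Suc i)" for x
  proof -
    have "(\<Sum>l<Suc i. crd v x l *s v l) = (\<Sum>l<Suc i. crd v' x l *s v l)"
    proof -
      have "x = (\<Sum>l<Suc i. crd v x l *s v l)" by (rule a.flag_sum_eq[OF x]) (use i in simp)
      moreover have "x = (\<Sum>l<Suc i. crd v' x l *s v' l)" by (rule b.flag_sum_eq) (use i x f in auto)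
      moreover have "(\<Sum>l<Suc i. crd v' x l *s v' l) = (\<Sum>l<Suc i. crd v' x l *s v l)"
        by (rule sum.cong) (auto simp: eq)
      ultimately show ?thesis by simp
    qed
    then show ?thesis using lin_indep_unique[OF lin_indep_take[OF v, of "Suc i"]] i by simp
  qed
  then show ?thesis unfolding graded_def f by (rule image_cong[OF refl]) (use f in auto)
qed

section \<open>Lattices over a discrete valuation ring and bases adapted to a flag\<close>

context dvr
begin

lemma fideal_generator:
  assumes I: "add_subgroup I" "\<And>a x. a \<in> R \<Longrightarrow> x \<in> I \<Longrightarrow> a * x \<in> I" "y \<in> I" "y \<noteq> 0" "I \<subseteq> fideal R M"
  shows "\<exists>x\<in>I. x \<noteq> 0 \<and> I = fideal R (ord_at R x)"
proof -
  define k where "k = (LEAST k. \<exists>x\<in>I. x \<noteq> 0 \<and> nat (ord_at R x - M) = k)"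
  have "\<exists>x\<in>I. x \<noteq> 0 \<and> nat (ord_at R x - M) = k" unfolding k_def by (rule LeastI_ex) (use I(3,4) in blast)
  then obtain x where x: "x \<in> I" "x \<noteq> 0" "nat (ord_at R x - M) = k" by blast
  have "I = fideal R (ord_at R x)"
  proof (intro equalityI subsetI)
    fix z assume z: "z \<in> I"
    show "z \<in> fideal R (ord_at R x)"
    proof (cases "z = 0")
      case False
      have "k \<le> nat (ord_at R z - M)" unfolding k_def by (rule Least_le) (use z False in blast)
      moreover have "M \<le> ord_at R z" "M \<le> ord_at R x" using I(5) z x False by (auto simp: fideal_def)
      ultimately have "ord_at R x \<le> ord_at R z" using x(3) by linarith
      then show ?thesis by (simp add: fideal_def)
    qed (simp add: fideal_def)
  next
    fix z assume z: "z \<in> fideal R (ord_at R x)"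
    have "z / x \<in> R" using z x(2) by (cases "z = 0") (auto simp: fideal_def mem_iff_ord ord_divide)
    from I(2)[OF this x(1)] show "z \<in> I" using x(2) by simp
  qed
  then show ?thesis using x by blast
qed

lemma fideal_inject: "fideal R m = fideal R m' \<Longrightarrow> m = m'"
proof -
  assume e: "fideal R m = fideal R m'"
  have "\<pi> powi m \<in> fideal R m" "\<pi> powi m' \<in> fideal R m'" using \<pi>(2) by (simp_all add: fideal_def ord_\<pi>_powi)
  then have "\<pi> powi m \<in> fideal R m'" "\<pi> powi m' \<in> fideal R m" using e by simp_all
  then show ?thesis using \<pi>(2) by (simp add: fideal_def ord_\<pi>_powi)
qed

lemma finite_subset_fideal: "finite S \<Longrightarrow> \<exists>M. S \<subseteq> fideal R M"
proof (induction S rule: finite_induct)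
  case (insert x S)
  then obtain M where "S \<subseteq> fideal R M" by blast
  then have "insert x S \<subseteq> fideal R (min M (ord_at R x))"
    using fideal_antimono[of "min M (ord_at R x)" M] by (auto simp: fideal_def)
  then show ?case by blast
qed simp

end

locale local_lattice = frame v + dvr R
  for v :: "nat \<Rightarrow> 'a::field ^ 'n::finite" and R :: "'a set" +
  fixes \<Lambda> :: "('a ^ 'n) set" and b :: "nat \<Rightarrow> 'a ^ 'n"
  assumes b: "lin_indep CARD('n) b" and \<Lambda>: "\<Lambda> = lspan R CARD('n) b"
begin

lemma \<Lambda>_subgroup: "add_subgroup \<Lambda>"
  unfolding \<Lambda> by (rule lspan_add_subgroup[OF subring])

lemma \<Lambda>_scale: "a \<in> R \<Longrightarrow> x \<in> \<Lambda> \<Longrightarrow> a *s x \<in> \<Lambda>"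
  unfolding \<Lambda> by (rule lspan_scale[OF subring])

lemma crd_bounded: "\<exists>M. \<forall>x\<in>\<Lambda>. \<forall>i<CARD('n). crd v x i \<in> fideal R M"
proof -
  obtain M where M: "(\<lambda>(l, i). crd v (b l) i) ` ({..<CARD('n)} \<times> {..<CARD('n)}) \<subseteq> fideal R M"
    using finite_subset_fideal[of "(\<lambda>(l, i). crd v (b l) i) ` ({..<CARD('n)} \<times> {..<CARD('n)})"] by auto
  have "crd v x i \<in> fideal R M" if x: "x \<in> \<Lambda>" and i: "i < CARD('n)" for x i
  proof -
    obtain c where c: "\<forall>l<CARD('n). c l \<in> R" "x = (\<Sum>l<CARD('n). c l *s b l)" using x unfolding \<Lambda> lspan_def by blast
    have "crd v x i = (\<Sum>l<CARD('n). c l * crd v (b l) i)" unfolding c(2) using i by (simp add: crd_sum_distrib crd_scale)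
    also have "\<dots> \<in> fideal R M"
    proof (rule add_subgroup_sum[OF fideal_subgroup])
      fix l assume l: "l \<in> {..<CARD('n)}"
      have "c l \<in> fideal R 0" using c(1) l by (simp add: fideal_0)
      moreover have "crd v (b l) i \<in> fideal R M" using M l i by auto
      ultimately show "c l * crd v (b l) i \<in> fideal R M" using fideal_mult by fastforce
    qed
    finally show ?thesis .
  qed
  then show ?thesis by blast
qed

lemma ex_multiple_mem: "\<exists>c. c \<noteq> 0 \<and> c *s x \<in> \<Lambda>"
proof -
  have "x \<in> lspan UNIV CARD('n) b" using lspan_UNIV_full[OF b] by blast
  then obtain a where a: "x = (\<Sum>l<CARD('n). a l *s b l)" by (auto simp: lspan_def)
  obtain M where M: "a ` {..<CARD('n)} \<subseteq> fideal R M" using finite_subset_fideal by blast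
  have c: "\<pi> powi (- M) \<in> fideal R (- M)" "\<pi> powi (- M) \<noteq> 0" using \<pi>(2) ord_\<pi>_powi[of "- M"] by (simp_all add: fideal_def)
  have "\<pi> powi (- M) *s x = (\<Sum>l<CARD('n). (\<pi> powi (- M) * a l) *s b l)"
    unfolding a by (simp add: vec.scale_sum_right vector_smult_assoc)
  moreover have "\<pi> powi (- M) * a l \<in> R" if "l < CARD('n)" for l
    using fideal_mult[OF c(1), of "a l" M] M that by (auto simp: fideal_0)
  ultimately have "\<pi> powi (- M) *s x \<in> \<Lambda>" unfolding \<Lambda> by (simp add: lspanI)
  then show ?thesis using c(2) by blast
qed

lemma graded_scale: "i < CARD('n) \<Longrightarrow> a \<in> R \<Longrightarrow> y \<in> graded v i \<Lambda> \<Longrightarrow> a * y \<in> graded v i \<Lambda>"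
proof -
  assume i: "i < CARD('n)" and a: "a \<in> R" and "y \<in> graded v i \<Lambda>"
  then obtain x where x: "x \<in> \<Lambda>" "x \<in> flag v (Suc i)" "y = crd v x i" by (auto simp: graded_def)
  then show ?thesis unfolding graded_def using \<Lambda>_scale[OF a x(1)] flag_scale[OF x(2), of a] i
    by (intro image_eqI[of _ _ "a *s x"]) (auto simp: crd_scale)
qed

lemma ex_graded_generator:
  assumes i: "i < CARD('n)"
  shows "\<exists>w. w \<in> \<Lambda> \<and> w \<in> flag v (Suc i) \<and> crd v w i \<noteq> 0 \<and> graded v i \<Lambda> = fideal R (ord_at R (crd v w i))"
proof -
  obtain M where M: "\<And>x. x \<in> \<Lambda> \<Longrightarrow> crd v x i \<in> fideal R M" using crd_bounded i by blast
  obtain c where c: "c \<noteq> 0" "c *s v i \<in> \<Lambda>" using ex_multiple_mem by blast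
  have "crd v (c *s v i) i = c" using i by (simp add: crd_scale crd_base)
  moreover have "c *s v i \<in> flag v (Suc i)" using i by (intro flag_scale flag_base) auto
  ultimately have "c \<in> graded v i \<Lambda>" unfolding graded_def using c(2) by (intro image_eqI[of _ _ "c *s v i"]) auto
  from fideal_generator[OF graded_subgroup[OF i \<Lambda>_subgroup] graded_scale[OF i] this c(1), of M]
  have "\<exists>y\<in>graded v i \<Lambda>. y \<noteq> 0 \<and> graded v i \<Lambda> = fideal R (ord_at R y)"
    using M by (auto simp: graded_def)
  then obtain y where "y \<in> graded v i \<Lambda>" "y \<noteq> 0" "graded v i \<Lambda> = fideal R (ord_at R y)" by blast
  then show ?thesis unfolding graded_def by blast
qed

text \<open>The sign follows divisors: the graded piece consists of the functions whose pole has
  order at most this number.\<close>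

definition deg_at :: "nat \<Rightarrow> int" where
  "deg_at i = (THE m. graded v i \<Lambda> = fideal R (- m))"

lemma deg_at_eqI: "graded v i \<Lambda> = fideal R (- m) \<Longrightarrow> deg_at i = m"
  unfolding deg_at_def by (rule the_equality) (auto dest: fideal_inject)

lemma graded_eq: "i < CARD('n) \<Longrightarrow> graded v i \<Lambda> = fideal R (- deg_at i)"
  using ex_graded_generator[of i] deg_at_eqI[of i "- ord_at R (crd v _ i)"] by force

definition w :: "nat \<Rightarrow> 'a ^ 'n" where
  "w i = (SOME w. w \<in> \<Lambda> \<and> w \<in> flag v (Suc i) \<and> crd v w i \<noteq> 0 \<and> graded v i \<Lambda> = fideal R (ord_at R (crd v w i)))"

lemma w:
  assumes i: "i < CARD('n)"
  shows "w i \<in> \<Lambda>" "w i \<in> flag v (Suc i)" "crd v (w i) i \<noteq> 0" "ord_at R (crd v (w i) i) = - deg_at i"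
proof -
  have *: "w i \<in> \<Lambda> \<and> w i \<in> flag v (Suc i) \<and> crd v (w i) i \<noteq> 0 \<and> graded v i \<Lambda> = fideal R (ord_at R (crd v (w i) i))"
    unfolding w_def using ex_graded_generator[OF i] by (rule someI_ex)
  then show "w i \<in> \<Lambda>" "w i \<in> flag v (Suc i)" "crd v (w i) i \<noteq> 0" by auto
  have "deg_at i = - ord_at R (crd v (w i) i)" by (rule deg_at_eqI) (use * in simp)
  then show "ord_at R (crd v (w i) i) = - deg_at i" by simp
qed

text \<open>Lifts \<open>w i\<close> of generators of the graded pieces form a basis of the lattice
  that is compatible with every step of the flag: subtracting a multiple of \<open>w j\<close>
  removes the coordinate \<open>j\<close> and leads to the preceding step.\<close>

lemma w_frame:
  assumes "j \<le> CARD('n)"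
  shows "\<Lambda> \<inter> flag v j = lspan R j w \<and> lin_indep j w \<and> flag v j = lspan UNIV j w"
  using assms
proof (induction j)
  case 0
  then show ?case using add_subgroupD(1)[OF \<Lambda>_subgroup] by (auto simp: flag_0 lspan_def lin_indep_def)
next
  case (Suc j)
  then have j: "j < CARD('n)" and IH: "\<Lambda> \<inter> flag v j = lspan R j w" "lin_indep j w" "flag v j = lspan UNIV j w" by auto
  note wj = w[OF j]
  have ext: "lspan S (Suc j) w = {a *s w j + y | a y. a \<in> S \<and> y \<in> lspan S j w}" for S
  proof (intro equalityI subsetI)
    fix x assume "x \<in> lspan S (Suc j) w"
    then obtain c where "\<forall>i<Suc j. c i \<in> S" "x = (\<Sum>i<Suc j. c i *s w i)" by (auto simp: lspan_def)
    then show "x \<in> {a *s w j + y | a y. a \<in> S \<and> y \<in> lspan S j w}"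
      by (intro CollectI exI[of _ "c j"] exI[of _ "\<Sum>i<j. c i *s w i"]) (auto simp: add.commute intro!: lspanI)
  next
    fix x assume "x \<in> {a *s w j + y | a y. a \<in> S \<and> y \<in> lspan S j w}"
    then obtain a c where ac: "a \<in> S" "\<forall>i<j. c i \<in> S" "x = a *s w j + (\<Sum>i<j. c i *s w i)" by (auto simp: lspan_def)
    have "(\<Sum>i<j. (c(j := a)) i *s w i) = (\<Sum>i<j. c i *s w i)" by (rule sum.cong) auto
    then have "x = (\<Sum>i<Suc j. (c(j := a)) i *s w i)" using ac(3) by (simp add: add.commute)
    moreover have "\<forall>i<Suc j. (c(j := a)) i \<in> S" using ac(1,2) by (auto simp: less_Suc_eq)
    ultimately show "x \<in> lspan S (Suc j) w" unfolding lspan_def by blast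
  qed
  have split: "x - (crd v x j / crd v (w j) j) *s w j \<in> flag v j" if x: "x \<in> flag v (Suc j)" for x
  proof -
    let ?y = "x - (crd v x j / crd v (w j) j) *s w j"
    have "?y \<in> flag v (Suc j)"
      by (rule add_subgroupD(2)[OF flag_subgroup x flag_scale[OF wj(2)]])
    moreover have "crd v ?y j = 0" using wj(3) j by (simp add: crd_diff crd_scale)
    ultimately show ?thesis using flag_iff_Suc[OF j] by blast
  qed
  have 1: "\<Lambda> \<inter> flag v (Suc j) = lspan R (Suc j) w"
  proof (intro equalityI subsetI)
    fix x assume x: "x \<in> \<Lambda> \<inter> flag v (Suc j)"
    \<comment> \<open>The coordinate of \<open>x\<close> lies in the graded piece, which is
      generated by the coordinate of \<open>w j\<close>, so this quotient is in
      \<open>R\<close>.\<close>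
    define a where "a = crd v x j / crd v (w j) j"
    have "crd v x j \<in> fideal R (ord_at R (crd v (w j) j))"
      using x graded_eq[OF j] wj(4) by (auto simp: graded_def)
    then have a: "a \<in> R" using wj(3) by (cases "crd v x j = 0") (auto simp: a_def fideal_def mem_iff_ord ord_divide subring is_subringD)
    have "x - a *s w j \<in> \<Lambda> \<inter> flag v j"
      using split[of x] x add_subgroupD(2)[OF \<Lambda>_subgroup _ \<Lambda>_scale[OF a wj(1)]] by (auto simp: a_def)
    then have "x - a *s w j \<in> lspan R j w" by (simp add: IH(1))
    moreover have "x = a *s w j + (x - a *s w j)" by simp
    ultimately show "x \<in> lspan R (Suc j) w" unfolding ext using a by blast
  next
    fix x assume "x \<in> lspan R (Suc j) w"
    then obtain a y where a: "x = a *s w j + y" "a \<in> R" "y \<in> lspan R j w" unfolding ext by blast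
    have "y \<in> \<Lambda>" "y \<in> flag v (Suc j)" using a(3) IH(1) flag_mono[of j "Suc j"] by auto
    then show "x \<in> \<Lambda> \<inter> flag v (Suc j)"
      unfolding a(1) using add_subgroupD(4)[OF \<Lambda>_subgroup \<Lambda>_scale[OF a(2) wj(1)]]
        add_subgroupD(4)[OF flag_subgroup flag_scale[OF wj(2)]] by blast
  qed
  have 2: "lin_indep (Suc j) w"
  proof -
    have "w j \<notin> lspan UNIV j w" using IH(3) wj(3) j by (auto simp: flag_def)
    from lin_indep_Suc[OF IH(2) this] show ?thesis by simp
  qed
  have 3: "flag v (Suc j) = lspan UNIV (Suc j) w"
  proof (intro equalityI subsetI)
    fix x assume x: "x \<in> flag v (Suc j)"
    define a where "a = crd v x j / crd v (w j) j"
    have "x - a *s w j \<in> lspan UNIV j w" using split[OF x] by (simp add: IH(3)[symmetric] a_def)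
    moreover have "x = a *s w j + (x - a *s w j)" by simp
    ultimately show "x \<in> lspan UNIV (Suc j) w" unfolding ext by blast
  next
    fix x assume "x \<in> lspan UNIV (Suc j) w"
    then obtain a y where a: "x = a *s w j + y" "y \<in> lspan UNIV j w" unfolding ext by blast
    then have "y \<in> flag v (Suc j)" using IH(3) flag_mono[of j "Suc j"] by auto
    then show "x \<in> flag v (Suc j)" unfolding a(1) using add_subgroupD(4)[OF flag_subgroup flag_scale[OF wj(2)]] by blast
  qed
  from 1 2 3 show ?case by blast
qed

text \<open>The inverse base change, from \<open>w\<close> to \<open>v\<close>, is lower triangular
  with the generators of the graded pieces on the diagonal.\<close>

lemma ord_det_w:
  assumes j: "j \<le> CARD('n)" and M: "change_matrix j v w M"
  shows "ord_at R (leibniz_det j M) = (\<Sum>i<j. deg_at i)"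
proof -
  have T: "change_matrix j w v (\<lambda>i l. crd v (w i) l)"
    unfolding change_matrix_def
  proof (intro allI impI)
    fix i assume i: "i < j"
    have "w i \<in> flag v j" using w(2)[of i] flag_mono[of "Suc i" j] i j by auto
    from flag_sum_eq[OF this j] show "w i = (\<Sum>l<j. crd v (w i) l *s v l)" .
  qed
  have vj: "lin_indep j v" by (rule lin_indep_take[OF v j])
  have "leibniz_det j M * leibniz_det j (\<lambda>i l. crd v (w i) l) = 1"
    by (rule change_matrix_det_inverse[OF vj T M])
  moreover have "leibniz_det j (\<lambda>i l. crd v (w i) l) = (\<Prod>i<j. crd v (w i) i)"
  proof (rule leibniz_det_lower_triangular)
    fix i l assume "i < l" "l < j"
    then show "crd v (w i) l = 0" using w(2)[of i] j by (auto simp: flag_def)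
  qed
  moreover have "ord_at R (\<Prod>i\<in>I. crd v (w i) i) = - (\<Sum>i\<in>I. deg_at i) \<and> (\<Prod>i\<in>I. crd v (w i) i) \<noteq> 0" if "I \<subseteq> {..<j}" for I
  proof -
    have "finite I" using that finite_subset by blast
    then show ?thesis using that
    proof induction
      case (insert i I)
      then show ?case using w(3,4)[of i] j by (auto simp: ord_mult)
    qed simp
  qed
  ultimately show ?thesis
    using ord_mult[of "leibniz_det j M" "\<Prod>i<j. crd v (w i) i"] by force
qed

end

section \<open>Semistable bundles of large degree\<close>

lemma (in dvr) fideal_subset_iff: "fideal R m \<subseteq> fideal R m' \<longleftrightarrow> m' \<le> m"
proof
  assume "fideal R m \<subseteq> fideal R m'"
  moreover have "\<pi> powi m \<in> fideal R m" using \<pi>(2) by (simp add: fideal_def ord_\<pi>_powi)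
  ultimately have "\<pi> powi m \<in> fideal R m'" by blast
  then show "m' \<le> m" using \<pi>(2) by (simp add: fideal_def ord_\<pi>_powi)
qed (rule fideal_antimono)

context curve
begin

text \<open>The divisor of the line bundle that forms the graded piece \<open>i\<close> of a bundle
  along the flag, put together from the local exponents.\<close>

definition gdiv :: "(nat \<Rightarrow> 'a ^ 'n::finite) \<Rightarrow> ('a set \<Rightarrow> ('a ^ 'n) set) \<Rightarrow> nat \<Rightarrow> 'a set \<Rightarrow> int" where
  "gdiv v \<Lambda> i R = (if R \<in> V then (THE m. graded v i (\<Lambda> R) = fideal R (- m)) else 0)"

lemma gdiv_eqI: "R \<in> V \<Longrightarrow> graded v i (\<Lambda> R) = fideal R (- m) \<Longrightarrow> gdiv v \<Lambda> i R = m"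
proof -
  assume R: "R \<in> V" and e: "graded v i (\<Lambda> R) = fideal R (- m)"
  have "(THE m. graded v i (\<Lambda> R) = fideal R (- m)) = m"
    by (rule the_equality) (use dvr.fideal_inject[OF dvr_locale[OF R], of _ "- m"] e in force)+
  then show ?thesis using R by (simp add: gdiv_def)
qed

end

section \<open>Counting sections of a bundle along a flag\<close>

locale flagged_bundle = curve \<iota> t N u V X + frame v
  for \<iota> :: "'k::{field,finite} \<Rightarrow> 'a::field" and t :: 'a and N :: nat and u :: "nat \<Rightarrow> 'a"
    and V :: "'a set set" and X :: "'a set set" and v :: "nat \<Rightarrow> 'a ^ 'n::finite" +
  fixes \<Lambda> :: "'a set \<Rightarrow> ('a ^ 'n) set"
  assumes lattices: "lattices CARD('n) \<Lambda>"
begin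

lemma generic_UNIV: "\<Lambda> UNIV = UNIV"
  using lattices_generic[OF lattices] lspan_UNIV_full by blast

lemma local_lattice: "R \<in> V \<Longrightarrow> \<exists>b. local_lattice v R (\<Lambda> R) b"
proof -
  assume R: "R \<in> V"
  then obtain b where "lin_indep CARD('n) b" "\<Lambda> R = lspan R CARD('n) b" using lattices V_subset unfolding lattices_def by blast
  then have "local_lattice v R (\<Lambda> R) b" using R dvr_V by unfold_locales auto
  then show ?thesis by blast
qed

lemma \<Lambda>_subgroup: "R \<in> V \<Longrightarrow> add_subgroup (\<Lambda> R)"
  using local_lattice local_lattice.\<Lambda>_subgroup by blast

lemma deg_at_eq_gdiv: "R \<in> V \<Longrightarrow> local_lattice.deg_at v R (\<Lambda> R) i = gdiv v \<Lambda> i R"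
  using local_lattice[of R] by (auto simp: local_lattice.deg_at_def gdiv_def)

lemma graded_gdiv: "R \<in> V \<Longrightarrow> i < CARD('n) \<Longrightarrow> graded v i (\<Lambda> R) = fideal R (- gdiv v \<Lambda> i R)"
  using local_lattice[of R] local_lattice.graded_eq deg_at_eq_gdiv by metis

lemma standard_opens: "{R\<in>X. \<Lambda> R = lspan R CARD('n) v} \<in> opens X"
  by (rule opens_lattice_eq[OF lattices v]) (use generic_UNIV lspan_UNIV_full[OF v] in simp)

lemma crd_lspan: "is_subring R \<Longrightarrow> x \<in> lspan R CARD('n) v \<Longrightarrow> i < CARD('n) \<Longrightarrow> crd v x i \<in> R"
  using crd_eqI by (auto simp: lspan_def)

lemma gdiv_standard: "R \<in> V \<Longrightarrow> \<Lambda> R = lspan R CARD('n) v \<Longrightarrow> i < CARD('n) \<Longrightarrow> gdiv v \<Lambda> i R = 0"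
proof (rule gdiv_eqI)
  assume R: "R \<in> V" and L: "\<Lambda> R = lspan R CARD('n) v" and i: "i < CARD('n)"
  interpret R: dvr R by (rule dvr_locale[OF R])
  have "graded v i (\<Lambda> R) = R"
  proof (intro equalityI subsetI)
    fix c assume c: "c \<in> R"
    have "c *s v i \<in> \<Lambda> R" unfolding L using is_subringD[OF R.subring] c i
      by (intro lspan_scale[OF R.subring] lspan_base) auto
    moreover have "c *s v i \<in> flag v (Suc i)" using i by (intro flag_scale flag_base) auto
    ultimately show "c \<in> graded v i (\<Lambda> R)" unfolding graded_def using i
      by (intro image_eqI[of _ _ "c *s v i"]) (auto simp: crd_scale crd_base)
  qed (use crd_lspan[OF R.subring] i in \<open>auto simp: graded_def L\<close>)
  then show "graded v i (\<Lambda> R) = fideal R (- 0)" by (simp add: R.fideal_0)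
qed

lemma divisor_gdiv: "i < CARD('n) \<Longrightarrow> divisor (gdiv v \<Lambda> i)"
proof -
  assume i: "i < CARD('n)"
  have "{R. gdiv v \<Lambda> i R \<noteq> 0} \<subseteq> X - {R\<in>X. \<Lambda> R = lspan R CARD('n) v}"
    using gdiv_standard[OF _ _ i] V_subset by (auto simp: gdiv_def)
  moreover have "finite (X - {R\<in>X. \<Lambda> R = lspan R CARD('n) v})" using standard_opens by (simp add: opens_iff)
  ultimately have "finite {R. gdiv v \<Lambda> i R \<noteq> 0}" by (rule finite_subset)
  then show ?thesis by (auto simp: divisor_def gdiv_def)
qed

text \<open>The adapted bases \<open>w\<close> have initial segments which are bases of the
  intersections with the flag, so these intersections form a subbundle.\<close>

lemma lattices_flag:
  assumes j: "j \<le> CARD('n)"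
  shows "lattices j (\<lambda>R. \<Lambda> R \<inter> flag v j)"
  unfolding lattices_def
proof (intro conjI ballI)
  have vj: "lin_indep j v" by (rule lin_indep_take[OF v j])
  have "\<Lambda> R \<inter> flag v j = lspan R j v" if R: "R \<in> {R\<in>X. \<Lambda> R = lspan R CARD('n) v}" for R
  proof (intro equalityI subsetI)
    fix x assume x: "x \<in> \<Lambda> R \<inter> flag v j"
    then have "x = (\<Sum>i<j. crd v x i *s v i)" using flag_sum_eq j by blast
    moreover have "crd v x i \<in> R" if "i < j" for i using crd_lspan[OF subring_X, of R x i] x R that j by auto
    ultimately show "x \<in> lspan R j v" unfolding lspan_def by blast
  next
    fix x assume x: "x \<in> lspan R j v"
    have sR: "is_subring R" using R subring_X by blast
    have "lspan R j v \<subseteq> lspan R CARD('n) v"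
      by (rule lspan_subset[OF sR], rule lspan_base) (use j is_subringD[OF sR] in auto)
    moreover have "x \<in> flag v j" using x lspan_mono[of R UNIV j v] lspan_flag[OF j] by auto
    ultimately show "x \<in> \<Lambda> R \<inter> flag v j" using x R by auto
  qed
  then show "\<exists>U\<in>opens X. \<exists>b. lin_indep j b \<and> (\<forall>R\<in>U. \<Lambda> R \<inter> flag v j = lspan R j b)"
    by (intro bexI[OF _ standard_opens] exI[of _ v] conjI vj ballI)
  fix R assume R: "R \<in> X"
  show "\<exists>b. lin_indep j b \<and> \<Lambda> R \<inter> flag v j = lspan R j b \<and> \<Lambda> UNIV \<inter> flag v j = lspan UNIV j b"
  proof (cases "R = UNIV")
    case True
    then show ?thesis using vj lspan_flag[OF j] generic_UNIV by auto
  next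
    case False
    then have "R \<in> V" using R X_eq by auto
    then obtain b where "local_lattice v R (\<Lambda> R) b" using local_lattice by blast
    then interpret R: local_lattice v R "\<Lambda> R" b .
    show ?thesis using R.w_frame[OF j] generic_UNIV by auto
  qed
qed

text \<open>Additivity of the degree along the flag; at each place it is the determinant computation
  \<open>ord_det_w\<close>.\<close>

lemma deg_lat_div_flag:
  assumes j: "j \<le> CARD('n)"
  shows "deg (lat_div j (\<lambda>R. \<Lambda> R \<inter> flag v j) v) = (\<Sum>i<j. deg (gdiv v \<Lambda> i))"
proof -
  have e: "lat_div j (\<lambda>R. \<Lambda> R \<inter> flag v j) v R = (\<Sum>i<j. gdiv v \<Lambda> i R)" for R
  proof (cases "R \<in> V")
    case True
    then obtain b where "local_lattice v R (\<Lambda> R) b" using local_lattice by blast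
    then interpret R: local_lattice v R "\<Lambda> R" b .
    have f: "\<Lambda> R \<inter> flag v j = lspan R j R.w" "lin_indep j R.w" "flag v j = lspan UNIV j R.w" using R.w_frame[OF j] by auto
    have "v i \<in> lspan UNIV j R.w" if "i < j" for i using flag_base[of i j] that j f(3) by auto
    then obtain M where M: "change_matrix j v R.w M" using ex_change_matrix[of j v UNIV R.w] by blast
    show ?thesis
      using lat_ord_eq[OF True f(2,1) lin_indep_take[OF v j] M] R.ord_det_w[OF j M] True deg_at_eq_gdiv[OF True]
      by (simp add: lat_div_def)
  qed (simp add: lat_div_def gdiv_def)
  have "deg (\<lambda>R. \<Sum>i\<in>I. gdiv v \<Lambda> i R) = (\<Sum>i\<in>I. deg (gdiv v \<Lambda> i)) \<and> divisor (\<lambda>R. \<Sum>i\<in>I. gdiv v \<Lambda> i R)"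
    if "finite I" "I \<subseteq> {..<j}" for I
    using that
  proof induction
    case (insert i I)
    then have "divisor (gdiv v \<Lambda> i)" using divisor_gdiv j by auto
    then show ?case using insert deg_add[of "gdiv v \<Lambda> i"] divisor_add[of "gdiv v \<Lambda> i"] by auto
  qed (simp add: deg_0 divisor_0)
  moreover have "lat_div j (\<lambda>R. \<Lambda> R \<inter> flag v j) v = (\<lambda>R. \<Sum>i<j. gdiv v \<Lambda> i R)" using e by blast
  ultimately show ?thesis by simp
qed

text \<open>The preimage in \<open>K^n\<close> of the global sections of the quotient of the bundle
  by the step \<open>j\<close> of the flag.\<close>

definition sections_mod :: "nat \<Rightarrow> ('a ^ 'n) set" where
  "sections_mod j = {x. \<forall>R\<in>V. \<exists>y\<in>\<Lambda> R. x - y \<in> flag v j}"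

text \<open>In the coordinates of \<open>v\<close> the bundle embeds in a direct sum of copies of
  \<open>O(D)\<close>; the condition \<open>D \<ge> D0\<close> makes the number of global sections
  of that sum known exactly.\<close>

lemma ex_bounding_divisor:
  "\<exists>D. divisor D \<and> (\<forall>R. D0 R \<le> D R) \<and> (\<forall>R\<in>V. \<forall>y\<in>\<Lambda> R. \<forall>i<CARD('n). crd v y i \<in> fideal R (- D R))"
proof -
  define F where "F = X - {R\<in>X. \<Lambda> R = lspan R CARD('n) v}"
  have F: "finite F" "F \<subseteq> V"
  proof -
    show "finite F" using standard_opens unfolding F_def opens_iff by blast
    have "UNIV \<notin> F" using opens_generic[OF standard_opens] unfolding F_def by blast
    then show "F \<subseteq> V" using X_eq unfolding F_def by blast
  qed
  have "\<forall>R. \<exists>M. R \<in> V \<longrightarrow> (\<forall>x\<in>\<Lambda> R. \<forall>i<CARD('n). crd v x i \<in> fideal R M)"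
    using local_lattice local_lattice.crd_bounded by meson
  then obtain M where M: "\<And>R x i. R \<in> V \<Longrightarrow> x \<in> \<Lambda> R \<Longrightarrow> i < CARD('n) \<Longrightarrow> crd v x i \<in> fideal R (M R)" by metis
  define D where "D R = (if R \<in> F then max (D0 R) (- M R) else max (D0 R) 0)" for R
  have sub: "{R. D R \<noteq> 0} \<subseteq> F \<union> {R. D0 R \<noteq> 0}" by (auto simp: D_def)
  have "finite (F \<union> {R. D0 R \<noteq> 0})" "F \<union> {R. D0 R \<noteq> 0} \<subseteq> V" using F D0(1) by (auto simp: divisor_def)
  then have "divisor D" using sub finite_subset unfolding divisor_def by blast
  moreover have "D0 R \<le> D R" for R by (simp add: D_def)
  moreover have "crd v y i \<in> fideal R (- D R)" if R: "R \<in> V" and y: "y \<in> \<Lambda> R" and i: "i < CARD('n)" for R y i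
  proof -
    interpret R: dvr R by (rule dvr_locale[OF R])
    show ?thesis
    proof (cases "R \<in> F")
      case True
      then have "- D R \<le> M R" by (simp add: D_def)
      then show ?thesis using M[OF R y i] R.fideal_antimono by blast
    next
      case False
      then have "\<Lambda> R = lspan R CARD('n) v" using R V_subset by (auto simp: F_def)
      then have "crd v y i \<in> fideal R 0" using crd_lspan[OF R.subring _ i] y by (simp add: R.fideal_0)
      moreover have "- D R \<le> 0" using False by (simp add: D_def)
      ultimately show ?thesis using R.fideal_antimono by blast
    qed
  qed
  ultimately show ?thesis by blast
qed

text \<open>The quotient by the step \<open>j\<close> sits inside \<open>n - j\<close> copies of
  \<open>O(D)\<close>, with local indices that multiply to \<open>q^e\<close>. These copies have
  \<open>q^m\<close> global sections, and passing to the subsheaf loses at most the factor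
  \<open>q^e\<close>. The difference \<open>m - e\<close> is the degree of the quotient plus its
  rank times \<open>1 - gg\<close>.\<close>

lemma riemann_inequality_mod:
  assumes j: "j \<le> CARD('n)"
  shows "\<exists>m e. CARD('k) ^ m \<le> CARD('k) ^ e * index (sections_mod j) (flag v j)
    \<and> int m - int e = (\<Sum>i=j..<CARD('n). deg (gdiv v \<Lambda> i) + 1 - gg)
    \<and> finite (cosets (sections_mod j) (flag v j))"
proof -
  obtain D where D: "divisor D" "\<And>R. D0 R \<le> D R"
    and bd: "\<And>R y i. R \<in> V \<Longrightarrow> y \<in> \<Lambda> R \<Longrightarrow> i < CARD('n) \<Longrightarrow> crd v y i \<in> fideal R (- D R)"
    using ex_bounding_divisor by blast
  define g where "g i = gdiv v \<Lambda> i" for i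
  \<comment> \<open>\<open>B\<close> and \<open>G\<close> are the preimages in \<open>K^n\<close> of
    the stalks of the direct sum and of the quotient. Both contain the step \<open>j\<close> of the
    flag, so their graded pieces below \<open>j\<close> are the whole field and contribute the index
    one.\<close>
  define B where "B R = (if R \<in> V then {x. \<forall>i. j \<le> i \<and> i < CARD('n) \<longrightarrow> crd v x i \<in> fideal R (- D R)} else UNIV)" for R
  define G where "G R = (if R \<in> V then {x. \<exists>y\<in>\<Lambda> R. x - y \<in> flag v j} else UNIV)" for R
  have subU: "add_subgroup (UNIV :: ('a ^ 'n) set)" by (simp add: add_subgroup_def)
  have sB: "add_subgroup (B R)" for R
  proof (cases "R \<in> V")
    case True
    note f = add_subgroupD[OF fideal_subgroup[OF True]]
    show ?thesis using True f(1,2) by (auto simp: B_def add_subgroup_def crd_0 crd_diff)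
  qed (simp add: B_def subU)
  have sG: "add_subgroup (G R)" for R
  proof (cases "R \<in> V")
    case True
    have "\<exists>y\<in>\<Lambda> R. (a - b) - y \<in> flag v j" if "y \<in> \<Lambda> R" "z \<in> \<Lambda> R" "a - y \<in> flag v j" "b - z \<in> flag v j" for a b y z
    proof (rule bexI)
      have "(a - b) - (y - z) = (a - y) - (b - z)" by simp
      then show "(a - b) - (y - z) \<in> flag v j" using add_subgroupD(2)[OF flag_subgroup that(3,4)] by (simp only:)
      show "y - z \<in> \<Lambda> R" using add_subgroupD(2)[OF \<Lambda>_subgroup[OF True] that(1,2)] .
    qed
    moreover have "\<exists>y\<in>\<Lambda> R. 0 - y \<in> flag v j"
      using add_subgroupD(1)[OF \<Lambda>_subgroup[OF True]] add_subgroupD(1)[OF flag_subgroup] by force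
    ultimately show ?thesis using True unfolding G_def add_subgroup_def by auto
  qed (simp add: G_def subU)
  have \<Lambda>G: "\<Lambda> R \<subseteq> G R" for R
  proof
    fix x assume "x \<in> \<Lambda> R"
    moreover have "x - x \<in> flag v j" using add_subgroupD(1)[OF flag_subgroup] by simp
    ultimately have "\<exists>y\<in>\<Lambda> R. x - y \<in> flag v j" by (rule bexI[rotated])
    then show "x \<in> G R" unfolding G_def by simp
  qed
  have flagG: "flag v j \<subseteq> G R" for R
    using add_subgroupD(1)[OF \<Lambda>_subgroup] by (auto simp: G_def intro!: bexI[of _ 0])
  have GB: "G R \<subseteq> B R" for R
  proof (cases "R \<in> V")
    case True
    have "crd v x i \<in> fideal R (- D R)" if "y \<in> \<Lambda> R" "x - y \<in> flag v j" "j \<le> i" "i < CARD('n)" for x y i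
    proof -
      have "crd v x i = crd v y i" using that(2-4) by (simp add: flag_def crd_diff)
      then show ?thesis using bd[OF True that(1,4)] by simp
    qed
    then show ?thesis using True by (auto simp: G_def B_def)
  qed (simp add: B_def)
  have base: "c *s v i \<in> flag v (Suc i)" "crd v (c *s v i) i = c" if "i < CARD('n)" for c i
    using that by (auto simp: crd_scale crd_base intro!: flag_scale flag_base)
  have gU: "graded v i H = UNIV" if i: "i < j" and H: "flag v j \<subseteq> H" for i H
  proof -
    have "c \<in> graded v i H" for c
      unfolding graded_def using base[of i c] i j H flag_mono[of "Suc i" j]
      by (intro image_eqI[of _ _ "c *s v i"]) auto
    then show ?thesis by blast
  qed
  have flagB: "flag v j \<subseteq> B R" for R using flagG GB by blast
  have gB: "graded v i (B R) = fideal R (- D R)" if R: "R \<in> V" and i: "j \<le> i" "i < CARD('n)" for R i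
  proof (intro equalityI subsetI)
    fix c assume c: "c \<in> fideal R (- D R)"
    have "crd v (c *s v i) k \<in> fideal R (- D R)" if "k < CARD('n)" for k
      using c that i add_subgroupD(1)[OF fideal_subgroup[OF R]] by (auto simp: crd_scale crd_base)
    then show "c \<in> graded v i (B R)"
      unfolding graded_def using base[OF i(2), of c] R by (intro image_eqI[of _ _ "c *s v i"]) (auto simp: B_def)
  qed (use R i in \<open>auto simp: graded_def B_def\<close>)
  have gG: "graded v i (G R) = fideal R (- g i R)" if R: "R \<in> V" and i: "j \<le> i" "i < CARD('n)" for R i
  proof -
    have "graded v i (G R) = graded v i (\<Lambda> R)"
    proof (intro equalityI subsetI)
      fix c assume "c \<in> graded v i (G R)"
      then obtain x y where x: "c = crd v x i" "x \<in> flag v (Suc i)" "y \<in> \<Lambda> R" "x - y \<in> flag v j"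
        using R by (auto simp: graded_def G_def)
      have "x - y \<in> flag v (Suc i)" using x(4) flag_mono[of j "Suc i"] i(1) by auto
      then have "x - (x - y) \<in> flag v (Suc i)" using add_subgroupD(2)[OF flag_subgroup x(2)] by blast
      then have "y \<in> flag v (Suc i)" by simp
      moreover have "crd v y i = c" using x(1,4) i by (simp add: flag_def crd_diff)
      ultimately show "c \<in> graded v i (\<Lambda> R)" unfolding graded_def using x(3) by (intro image_eqI[of _ _ y]) auto
    qed (use \<Lambda>G in \<open>auto simp: graded_def\<close>)
    then show ?thesis using graded_gdiv[OF R i(2)] by (simp add: g_def)
  qed
  have gle: "g i R \<le> D R" if R: "R \<in> V" and i: "j \<le> i" "i < CARD('n)" for R i
  proof -
    have "graded v i (G R) \<subseteq> graded v i (B R)" using GB unfolding graded_def by blast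
    then show ?thesis using gG[OF R i] gB[OF R i] dvr.fideal_subset_iff[OF dvr_locale[OF R]] by simp
  qed
  have split: "(\<Prod>i<CARD('n). f i) = (\<Prod>i<j. f i) * (\<Prod>i=j..<CARD('n). f i)" for f :: "nat \<Rightarrow> nat"
    using prod.atLeastLessThan_concat[of 0 j "CARD('n)" f] j by (simp add: atLeast0LessThan)
  have idx: "index (B R) (G R) = CARD('k) ^ (rdeg R * (\<Sum>i=j..<CARD('n). nat (D R - g i R)))" "finite (cosets (B R) (G R))"
    if R: "R \<in> V" for R
  proof -
    have i1: "index (graded v i (B R)) (graded v i (G R)) = 1 \<and> finite (cosets (graded v i (B R)) (graded v i (G R)))" if "i < j" for i
      using gU[OF that flagB] gU[OF that flagG] index_self[of "UNIV :: 'a set"] by (simp add: add_subgroup_def)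
    have i2: "index (graded v i (B R)) (graded v i (G R)) = CARD('k) ^ (rdeg R * nat (D R - g i R))"
      "finite (cosets (graded v i (B R)) (graded v i (G R)))" if i: "j \<le> i" "i < CARD('n)" for i
      unfolding gB[OF R i] gG[OF R i] using index_fideal_q[OF R, of "- D R" "- g i R"] gle[OF R i] by auto
    have "index (B R) (G R) = (\<Prod>i<CARD('n). index (graded v i (B R)) (graded v i (G R)))
        \<and> (finite (cosets (B R) (G R)) \<longleftrightarrow> (\<forall>i<CARD('n). finite (cosets (graded v i (B R)) (graded v i (G R)))))"
      using index_flag[OF sB sG GB order_refl, of R] by (simp add: flag_CARD)
    moreover have "\<forall>i<CARD('n). finite (cosets (graded v i (B R)) (graded v i (G R)))"
      using i1 i2(2) by (meson not_le)
    moreover have "(\<Prod>i<CARD('n). index (graded v i (B R)) (graded v i (G R)))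
        = CARD('k) ^ (rdeg R * (\<Sum>i=j..<CARD('n). nat (D R - g i R)))"
      unfolding split using i1 by (simp add: i2(1) power_sum sum_distrib_left)
    ultimately show "index (B R) (G R) = CARD('k) ^ (rdeg R * (\<Sum>i=j..<CARD('n). nat (D R - g i R)))" "finite (cosets (B R) (G R))"
      by auto
  qed
  have dg: "divisor (g i)" if "i < CARD('n)" for i unfolding g_def by (rule divisor_gdiv[OF that])
  define S where "S = {R. D R \<noteq> 0} \<union> (\<Union>i\<in>{j..<CARD('n)}. {R. g i R \<noteq> 0})"
  have "{R. g i R \<noteq> 0} \<subseteq> V" "finite {R. g i R \<noteq> 0}" if "i \<in> {j..<CARD('n)}" for i
    using dg[of i] that by (auto simp: divisor_def)
  moreover have "{R. D R \<noteq> 0} \<subseteq> V" "finite {R. D R \<noteq> 0}" using D(1) by (auto simp: divisor_def)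
  ultimately have S: "finite S" "S \<subseteq> V" unfolding S_def by (blast intro: finite_UN_I)+
  have BG: "B R = G R" if "R \<notin> S" for R
  proof (cases "R \<in> V")
    case True
    have "g i R = D R" if "i \<in> {j..<CARD('n)}" for i using \<open>R \<notin> S\<close> that by (auto simp: S_def)
    then have "index (B R) (G R) = 1" using idx(1)[OF True] by simp
    then show ?thesis using index_1_imp_subset[OF sB sG] GB by blast
  qed (simp add: B_def G_def)
  \<comment> \<open>The logarithm of the product of the local indices, which is finite because
    \<open>B\<close> and \<open>G\<close> agree outside \<open>S\<close>.\<close>
  define e where "e = (\<Sum>R\<in>S. rdeg R * (\<Sum>i=j..<CARD('n). nat (D R - g i R)))"
  have fam: "index {s. \<forall>R. s R \<in> B R} {s. \<forall>R. s R \<in> G R} = CARD('k) ^ e"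
    "finite (cosets {s. \<forall>R. s R \<in> B R} {s. \<forall>R. s R \<in> G R})"
  proof -
    have "index {s. \<forall>R. s R \<in> B R} {s. \<forall>R. s R \<in> G R} = (\<Prod>R\<in>S. index (B R) (G R))"
      by (rule index_family(1)[OF sB sG GB S(1) BG])
    also have "\<dots> = CARD('k) ^ e"
      unfolding e_def power_sum by (rule prod.cong) (use idx(1) S(2) in auto)
    finally show "index {s. \<forall>R. s R \<in> B R} {s. \<forall>R. s R \<in> G R} = CARD('k) ^ e" .
    show "finite (cosets {s. \<forall>R. s R \<in> B R} {s. \<forall>R. s R \<in> G R})"
      by (rule index_family(2)[OF sB sG GB S(1) BG]) (use idx(2) S(2) in auto)
  qed
  have int_e: "int e = (\<Sum>i=j..<CARD('n). deg D - deg (g i))"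
  proof -
    have "int e = (\<Sum>R\<in>S. \<Sum>i=j..<CARD('n). int (rdeg R) * (D R - g i R))"
      unfolding e_def of_nat_sum of_nat_mult sum_distrib_left
    proof (intro sum.cong refl)
      fix R i assume "R \<in> S" "i \<in> {j..<CARD('n)}"
      then have "g i R \<le> D R" using gle S(2) by auto
      then show "int (rdeg R) * int (nat (D R - g i R)) = int (rdeg R) * (D R - g i R)" by simp
    qed
    also have "\<dots> = (\<Sum>i=j..<CARD('n). \<Sum>R\<in>S. int (rdeg R) * (D R - g i R))" by (rule sum.swap)
    also have "\<dots> = (\<Sum>i=j..<CARD('n). deg D - deg (g i))"
    proof (intro sum.cong refl)
      fix i assume i: "i \<in> {j..<CARD('n)}"
      have "deg D = (\<Sum>R\<in>S. int (rdeg R) * D R)" by (rule deg_eq_sum[OF S(1)]) (auto simp: S_def)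
      moreover have "deg (g i) = (\<Sum>R\<in>S. int (rdeg R) * g i R)" by (rule deg_eq_sum[OF S(1)]) (use i in \<open>auto simp: S_def\<close>)
      ultimately show "(\<Sum>R\<in>S. int (rdeg R) * (D R - g i R)) = deg D - deg (g i)"
        by (simp add: right_diff_distrib sum_subtractf)
    qed
    finally show ?thesis .
  qed
  define HB where "HB = {x. \<forall>R. x \<in> B R}"
  define HG where "HG = {x. \<forall>R. x \<in> G R}"
  have HG_eq: "HG = sections_mod j" by (auto simp: HG_def G_def sections_mod_def)
  have sHB: "add_subgroup HB" and sHG: "add_subgroup HG"
    using add_subgroupD(1,2)[OF sB] add_subgroupD(1,2)[OF sG] by (auto simp: HB_def HG_def add_subgroup_def)
  have HGB: "HG \<subseteq> HB" using GB by (auto simp: HG_def HB_def)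
  have flagHG: "flag v j \<subseteq> HG" using flagG by (auto simp: HG_def)
  \<comment> \<open>Constant families embed the global groups in the products of the local ones, and
    an index cannot grow under intersection with a subgroup.\<close>
  have 1: "index HB HG \<le> CARD('k) ^ e" "finite (cosets HB HG)"
  proof -
    let ?c = "\<lambda>(x :: 'a ^ 'n) (R :: 'a set). x"
    have inj: "inj ?c" by (auto simp: inj_def fun_eq_iff)
    have i: "index (?c ` HB) (?c ` HG) = index HB HG" "finite (cosets (?c ` HB) (?c ` HG)) = finite (cosets HB HG)"
      using index_additive_image[OF sHB sHG HGB, of ?c] inj by (auto simp: fun_eq_iff)
    have sc: "add_subgroup (?c ` HB)"
    proof -
      have "\<exists>z\<in>HB. ?c x - ?c y = ?c z" if "x \<in> HB" "y \<in> HB" for x y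
        using add_subgroupD(2)[OF sHB that] by (intro bexI[of _ "x - y"]) (auto simp: fun_eq_iff)
      moreover have "0 = ?c 0" by (simp add: fun_eq_iff)
      ultimately show ?thesis using add_subgroupD(1)[OF sHB] unfolding add_subgroup_def by blast
    qed
    have sA: "add_subgroup {s. \<forall>R. s R \<in> G R}" using sG by (auto simp: add_subgroup_def)
    have sub: "?c ` HB \<subseteq> {s. \<forall>R. s R \<in> B R}" by (auto simp: HB_def)
    have eq: "?c ` HB \<inter> {s. \<forall>R. s R \<in> G R} = ?c ` HG" using HGB by (auto simp: HG_def)
    show "index HB HG \<le> CARD('k) ^ e" "finite (cosets HB HG)"
      using index_Int_le[OF sA sc sub fam(2)] unfolding eq i fam(1) by auto
  qed
  \<comment> \<open>Modulo the flag, the global elements of the direct sum are \<open>n - j\<close>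
    copies of \<open>L D\<close>, one for each remaining coordinate.\<close>
  have 2: "index HB (flag v j) = CARD('k) ^ ((CARD('n) - j) * ell D)" "finite (cosets HB (flag v j))"
  proof -
    have gHB: "graded v i HB = L D" if i: "j \<le> i" "i < CARD('n)" for i
    proof (intro equalityI subsetI)
      fix c assume "c \<in> graded v i HB"
      then obtain x where "x \<in> HB" "c = crd v x i" by (auto simp: graded_def)
      then show "c \<in> L D" using i by (auto simp: L_def HB_def B_def split: if_splits)
    next
      fix c assume c: "c \<in> L D"
      have "c *s v i \<in> B R" for R
      proof (cases "R \<in> V")
        case True
        have "crd v (c *s v i) k \<in> fideal R (- D R)" if "k < CARD('n)" for k
          using c that i True add_subgroupD(1)[OF fideal_subgroup[OF True]] by (auto simp: crd_scale crd_base L_def)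
        then show ?thesis using True by (simp add: B_def)
      qed (simp add: B_def)
      then show "c \<in> graded v i HB"
        unfolding graded_def using base[OF i(2), of c] by (intro image_eqI[of _ _ "c *s v i"]) (auto simp: HB_def)
    qed
    have gF: "graded v i (flag v j) = {0}" if i: "j \<le> i" "i < CARD('n)" for i
    proof -
      have "crd v x i = 0" if "x \<in> flag v j" for x using that i by (simp add: flag_def)
      moreover have "0 \<in> flag v j \<inter> flag v (Suc i)" using add_subgroupD(1)[OF flag_subgroup] by blast
      ultimately show ?thesis unfolding graded_def by (force simp: crd_0 i)
    qed
    have i1: "index (graded v i HB) (graded v i (flag v j)) = 1 \<and> finite (cosets (graded v i HB) (graded v i (flag v j)))"
      if "i < j" for i
      using gU[OF that subset_trans[OF flagHG HGB]] gU[OF that order_refl] index_self[of "UNIV :: 'a set"]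
      by (simp add: add_subgroup_def)
    have i2: "index (graded v i HB) (graded v i (flag v j)) = CARD('k) ^ ell D"
      "finite (cosets (graded v i HB) (graded v i (flag v j)))" if i: "j \<le> i" "i < CARD('n)" for i
      unfolding gHB[OF i] gF[OF i] index_zero using card_L[OF D(1)] finite_L[OF D(1)] by auto
    have *: "index HB (flag v j) = (\<Prod>i<CARD('n). index (graded v i HB) (graded v i (flag v j)))
        \<and> (finite (cosets HB (flag v j)) \<longleftrightarrow> (\<forall>i<CARD('n). finite (cosets (graded v i HB) (graded v i (flag v j)))))"
      using index_flag[OF sHB flag_subgroup subset_trans[OF flagHG HGB] order_refl] by (simp add: flag_CARD)
    show "finite (cosets HB (flag v j))" using * i1 i2(2) by (meson not_le)
    have "(\<Prod>i<CARD('n). index (graded v i HB) (graded v i (flag v j))) = (\<Prod>i=j..<CARD('n). CARD('k) ^ ell D)"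
      unfolding split using i1 i2(1) by simp
    then show "index HB (flag v j) = CARD('k) ^ ((CARD('n) - j) * ell D)"
      using * by (simp add: power_mult[symmetric] mult.commute)
  qed
  have t: "index HB (flag v j) = index HB HG * index HG (flag v j)" "finite (cosets HG (flag v j))"
    using index_tower[OF sHG flag_subgroup sHB flagHG HGB] 2(2) by auto
  have "CARD('k) ^ ((CARD('n) - j) * ell D) \<le> CARD('k) ^ e * index HG (flag v j)"
    using 1(1) t(1) 2(1) by (metis mult_le_mono1)
  moreover have "int ((CARD('n) - j) * ell D) - int e = (\<Sum>i=j..<CARD('n). deg (gdiv v \<Lambda> i) + 1 - gg)"
  proof -
    have "int ((CARD('n) - j) * ell D) = (\<Sum>i=j..<CARD('n). int (ell D))" by simp
    then show ?thesis
      unfolding int_e by (simp only: sum_subtractf[symmetric] g_def riemann_equality[OF D]) (rule sum.cong, auto)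
  qed
  ultimately show ?thesis using t(2) unfolding HG_eq by blast
qed

text \<open>The graded pieces of the group of sections are contained in the spaces \<open>L\<close>
  of the graded divisors. These divisors dominate \<open>D0\<close>, so
  \<open>riemann_equality\<close> gives the exact dimensions of these spaces.\<close>

lemma card_sections_le:
  assumes ge: "\<And>i R. i < CARD('n) \<Longrightarrow> D0 R \<le> gdiv v \<Lambda> i R"
  shows "finite (\<Inter>R\<in>V. \<Lambda> R)"
    "\<exists>m. card (\<Inter>R\<in>V. \<Lambda> R) \<le> CARD('k) ^ m \<and> int m = (\<Sum>i<CARD('n). deg (gdiv v \<Lambda> i) + 1 - gg)"
proof -
  let ?H = "\<Inter>R\<in>V. \<Lambda> R"
  have sH: "add_subgroup ?H"
    using add_subgroupD(1,2)[OF \<Lambda>_subgroup] by (auto simp: add_subgroup_def)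
  have s0: "add_subgroup {0 :: 'a ^ 'n}" by (simp add: add_subgroup_def)
  have sub: "{0} \<subseteq> ?H" using add_subgroupD(1)[OF sH] by blast
  have g0: "graded v i {0} = {0}" if "i < CARD('n)" for i
    using add_subgroupD(1)[OF flag_subgroup, of "Suc i"] crd_0[OF that] by (auto simp: graded_def)
  have gH: "graded v i ?H \<subseteq> L (gdiv v \<Lambda> i)" if i: "i < CARD('n)" for i
  proof
    fix c assume "c \<in> graded v i ?H"
    then obtain x where x: "x \<in> ?H" "x \<in> flag v (Suc i)" "c = crd v x i" by (auto simp: graded_def)
    show "c \<in> L (gdiv v \<Lambda> i)"
      unfolding L_def
    proof (intro CollectI ballI)
      fix R assume R: "R \<in> V"
      then have "c \<in> graded v i (\<Lambda> R)" using x unfolding graded_def by blast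
      then show "c \<in> fideal R (- gdiv v \<Lambda> i R)" using graded_gdiv[OF R i] by simp
    qed
  qed
  have fin: "finite (graded v i ?H)" if "i < CARD('n)" for i
    using finite_subset[OF gH[OF that] finite_L[OF divisor_gdiv[OF that]]] .
  have *: "card ?H = (\<Prod>i<CARD('n). card (graded v i ?H)) \<and> (finite ?H \<longleftrightarrow> (\<forall>i<CARD('n). finite (graded v i ?H)))"
  proof -
    have "index ?H {0} = (\<Prod>i<CARD('n). index (graded v i ?H) (graded v i {0}))
        \<and> (finite (cosets ?H {0}) \<longleftrightarrow> (\<forall>i<CARD('n). finite (cosets (graded v i ?H) (graded v i {0}))))"
      using index_flag[OF sH s0 sub order_refl] by (simp only: flag_CARD Int_UNIV_right)
    then show ?thesis using g0 by (simp add: index_zero)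
  qed
  then show "finite ?H" using fin by blast
  have "card ?H \<le> (\<Prod>i<CARD('n). CARD('k) ^ ell (gdiv v \<Lambda> i))"
  proof -
    have "(\<Prod>i<CARD('n). card (graded v i ?H)) \<le> (\<Prod>i<CARD('n). CARD('k) ^ ell (gdiv v \<Lambda> i))"
    proof (rule prod_mono)
      fix i assume "i \<in> {..<CARD('n)}"
      then have i: "i < CARD('n)" by simp
      show "0 \<le> card (graded v i ?H) \<and> card (graded v i ?H) \<le> CARD('k) ^ ell (gdiv v \<Lambda> i)"
        using card_mono[OF finite_L[OF divisor_gdiv[OF i]] gH[OF i]] card_L[OF divisor_gdiv[OF i]] by simp
    qed
    then show ?thesis using * by simp
  qed
  then have "card ?H \<le> CARD('k) ^ (\<Sum>i<CARD('n). ell (gdiv v \<Lambda> i))" by (simp add: power_sum)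
  moreover have "int (\<Sum>i<CARD('n). ell (gdiv v \<Lambda> i)) = (\<Sum>i<CARD('n). deg (gdiv v \<Lambda> i) + 1 - gg)"
    unfolding of_nat_sum by (rule sum.cong) (use riemann_equality[OF divisor_gdiv ge] in auto)
  ultimately show "\<exists>m. card ?H \<le> CARD('k) ^ m \<and> int m = (\<Sum>i<CARD('n). deg (gdiv v \<Lambda> i) + 1 - gg)" by blast
qed

end

section \<open>Twists by ideles and the construction of the flag\<close>

context curve
begin

text \<open>An idele, equal to one at almost all places and outside \<open>V\<close>, in particular
  at the generic point. Multiplying the lattices by it amounts to tensoring with the line bundle of
  the divisor \<open>- cdiv c\<close>.\<close>

definition scaling :: "('a set \<Rightarrow> 'a) \<Rightarrow> bool" where
  "scaling c \<longleftrightarrow> (\<forall>R. c R \<noteq> 0) \<and> finite {R. c R \<noteq> 1} \<and> {R. c R \<noteq> 1} \<subseteq> V"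

definition twist :: "('a set \<Rightarrow> 'a) \<Rightarrow> ('a set \<Rightarrow> ('a ^ 'n::finite) set) \<Rightarrow> 'a set \<Rightarrow> ('a ^ 'n) set" where
  "twist c \<Lambda> R = (*s) (c R) ` \<Lambda> R"

definition cdiv :: "('a set \<Rightarrow> 'a) \<Rightarrow> 'a set \<Rightarrow> int" where
  "cdiv c R = (if R \<in> V then ord_at R (c R) else 0)"

lemma scaling_UNIV: "scaling c \<Longrightarrow> c UNIV = 1"
  using UNIV_notin_V by (auto simp: scaling_def)

lemma divisor_cdiv: "scaling c \<Longrightarrow> divisor (cdiv c)"
proof -
  assume c: "scaling c"
  have "{R. cdiv c R \<noteq> 0} \<subseteq> {R. c R \<noteq> 1}"
    using dvr.ord_1[OF dvr_locale] by (auto simp: cdiv_def)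
  then have "finite {R. cdiv c R \<noteq> 0}" using c finite_subset unfolding scaling_def by blast
  then show ?thesis unfolding divisor_def by (auto simp: cdiv_def)
qed

lemma lspan_scale_frame: "lspan S r (\<lambda>i. a *s b i) = (*s) a ` lspan S r b"
proof -
  have "(\<Sum>i<r. d i *s (a *s b i)) = a *s (\<Sum>i<r. d i *s b i)" for d
    by (simp add: vec.scale_sum_right vector_smult_assoc mult.commute)
  then show ?thesis unfolding lspan_def by auto
qed

lemma lin_indep_scale: "a \<noteq> 0 \<Longrightarrow> lin_indep r b \<Longrightarrow> lin_indep r (\<lambda>i. a *s b i)"
  unfolding lin_indep_def
proof (intro allI impI)
  fix d i assume a: "a \<noteq> 0" "\<forall>c. (\<Sum>i<r. c i *s b i) = 0 \<longrightarrow> (\<forall>i<r. c i = 0)" "(\<Sum>i<r. d i *s (a *s b i)) = 0" "i < r"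
  have "(\<Sum>i<r. (d i * a) *s b i) = 0" using a(3) by (simp add: vector_smult_assoc)
  then have "\<forall>i<r. d i * a = 0" by (rule spec[OF a(2), THEN mp])
  then show "d i = 0" using a(1,4) by simp
qed

lemma scale_image_UNIV:
  assumes "a \<noteq> 0" shows "(*s) a ` lspan UNIV r b = lspan UNIV r b"
proof -
  have "x \<in> (*s) a ` lspan UNIV r b" if "x \<in> lspan UNIV r b" for x
    using assms lspan_scale[OF is_subring_UNIV UNIV_I that, of "inverse a"]
    by (intro image_eqI[of _ _ "inverse a *s x"]) (simp_all add: vector_smult_assoc)
  then show ?thesis using lspan_scale[OF is_subring_UNIV UNIV_I] by auto
qed

lemma twist_frame:
  assumes "c R \<noteq> 0" "lin_indep r b" "\<Lambda> R = lspan R r b"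
  shows "lin_indep r (\<lambda>i. c R *s b i)" "twist c \<Lambda> R = lspan R r (\<lambda>i. c R *s b i)"
  using lin_indep_scale[OF assms(1,2)] assms(3) by (simp_all add: twist_def lspan_scale_frame)

lemma lattices_twist:
  assumes c: "scaling c" and \<Lambda>: "lattices r \<Lambda>"
  shows "lattices r (twist c \<Lambda>)"
  unfolding lattices_def
proof (intro conjI ballI)
  obtain U b where U: "U \<in> opens X" "lin_indep r b" "\<forall>R\<in>U. \<Lambda> R = lspan R r b"
    using \<Lambda> unfolding lattices_def by blast
  let ?W = "U - {R. c R \<noteq> 1}"
  have "X - ?W \<subseteq> (X - U) \<union> {R. c R \<noteq> 1}" by blast
  then have "finite (X - ?W)" using U(1) c finite_subset unfolding opens_iff scaling_def by (meson finite_UnI)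
  then have "?W \<in> opens X" using U(1) scaling_UNIV[OF c] by (auto simp: opens_iff)
  moreover have "twist c \<Lambda> R = lspan R r b" if "R \<in> ?W" for R
    using that U(3) by (simp add: twist_def image_def)
  ultimately show "\<exists>U\<in>opens X. \<exists>b. lin_indep r b \<and> (\<forall>R\<in>U. twist c \<Lambda> R = lspan R r b)"
    using U(2) by blast
  fix R assume "R \<in> X"
  then obtain b where b: "lin_indep r b" "\<Lambda> R = lspan R r b" "\<Lambda> UNIV = lspan UNIV r b"
    using \<Lambda> unfolding lattices_def by blast
  have c0: "c R \<noteq> 0" using c by (simp add: scaling_def)
  have "twist c \<Lambda> UNIV = lspan UNIV r (\<lambda>i. c R *s b i)"
    unfolding lspan_scale_frame scale_image_UNIV[OF c0] using scaling_UNIV[OF c] b(3) by (simp add: twist_def image_def)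
  then show "\<exists>b. lin_indep r b \<and> twist c \<Lambda> R = lspan R r b \<and> twist c \<Lambda> UNIV = lspan UNIV r b"
    using twist_frame[of c R r b \<Lambda>, OF c0 b(1,2)] by blast
qed

lemma lat_div_twist:
  assumes c: "scaling c" and \<Lambda>: "lattices r \<Lambda>" and e: "lin_indep r e" "\<Lambda> UNIV = lspan UNIV r e"
  shows "lat_div r (twist c \<Lambda>) e R = lat_div r \<Lambda> e R - int r * cdiv c R"
proof (cases "R \<in> V")
  case True
  interpret R: dvr R by (rule dvr_locale[OF True])
  have RX: "R \<in> X" using True V_subset by auto
  have c0: "c R \<noteq> 0" using c by (simp add: scaling_def)
  obtain b M where b: "lin_indep r b" "\<Lambda> R = lspan R r b" "change_matrix r e b M"
    using lattices_frame[OF \<Lambda> RX e(2)] by blast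
  note tf = twist_frame[of c R r b \<Lambda>, OF c0 b(1,2)]
  have M': "change_matrix r e (\<lambda>i. c R *s b i) (\<lambda>i j. inverse (c R) * M i j)"
  proof -
    have "(inverse (c R) * M i j) *s (c R *s b j) = M i j *s b j" for i j
      using c0 by (simp add: vector_smult_assoc)
    then show ?thesis using b(3) by (simp only: change_matrix_def)
  qed
  have M0: "leibniz_det r M \<noteq> 0" by (rule change_matrix_det_nonzero[OF b(1) e(1) b(3)])
  have "ord_at R (leibniz_det r (\<lambda>i j. inverse (c R) * M i j)) = ord_at R (leibniz_det r M) - int r * ord_at R (c R)"
    unfolding leibniz_det_scale using c0 M0 by (simp add: R.ord_mult R.ord_power R.ord_inverse)
  then show ?thesis
    using lat_ord_eq[OF True tf e(1) M'] lat_ord_eq[OF True b(1,2) e(1) b(3)] True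
    by (simp add: lat_div_def cdiv_def)
qed (simp add: lat_div_def cdiv_def)

lemma graded_twist:
  assumes v: "lin_indep CARD('n) (v :: nat \<Rightarrow> 'a ^ 'n::finite)" and i: "i < CARD('n)" and a: "a \<noteq> 0"
  shows "graded v i ((*s) a ` G) = (*) a ` graded v i G"
proof -
  interpret frame v by unfold_locales (rule v)
  have "a *s x \<in> flag v (Suc i) \<longleftrightarrow> x \<in> flag v (Suc i)" for x
    using a by (simp add: flag_def crd_scale)
  then have "(*s) a ` G \<inter> flag v (Suc i) = (*s) a ` (G \<inter> flag v (Suc i))" by auto
  then show ?thesis unfolding graded_def by (simp add: image_image crd_scale[OF i])
qed

lemma gdiv_twist:
  fixes v :: "nat \<Rightarrow> 'a ^ 'n::finite"
  assumes c: "scaling c" and \<Lambda>: "lattices CARD('n) \<Lambda>" and v: "lin_indep CARD('n) v" and i: "i < CARD('n)"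
  shows "gdiv v (twist c \<Lambda>) i R = gdiv v \<Lambda> i R - cdiv c R"
proof (cases "R \<in> V")
  case True
  interpret flagged_bundle \<iota> t N u V X v \<Lambda> by unfold_locales (rule v \<Lambda>)+
  interpret R: dvr R by (rule dvr_locale[OF True])
  have c0: "c R \<noteq> 0" using c by (simp add: scaling_def)
  have "graded v i (twist c \<Lambda> R) = fideal R (- (gdiv v \<Lambda> i R - cdiv c R))"
    unfolding twist_def graded_twist[OF v i c0] graded_gdiv[OF True i] R.fideal_scale[OF c0]
    using True by (simp add: cdiv_def)
  then show ?thesis by (rule gdiv_eqI[OF True])
qed (simp add: gdiv_def cdiv_def)

text \<open>An idele with divisor \<open>D0\<close>; the twist by it is the twist of a bundle by
  \<open>- D0\<close>.\<close>

definition c0 :: "'a set \<Rightarrow> 'a" where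
  "c0 R = (if R \<in> V then dvr.\<pi> R powi (D0 R) else 1)"

lemma scaling_c0: "scaling c0"
proof -
  have "c0 R \<noteq> 0" for R using dvr.\<pi>(2)[OF dvr_locale] by (simp add: c0_def)
  moreover have "{R. c0 R \<noteq> 1} \<subseteq> {R. D0 R \<noteq> 0}" by (auto simp: c0_def)
  ultimately show ?thesis using D0(1) finite_subset unfolding scaling_def divisor_def by blast
qed

lemma cdiv_c0: "cdiv c0 R = D0 R"
  using dvr.ord_\<pi>_powi[OF dvr_locale] D0(1) by (auto simp: cdiv_def c0_def divisor_def)

lemma bundle_degree_flag:
  fixes v :: "nat \<Rightarrow> 'a ^ 'n::finite"
  assumes E: "vector_bundle X CARD('n) (E :: ('a, 'n) subsheaf)" and v: "lin_indep CARD('n) v" and j: "j \<le> CARD('n)"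
    and F: "F = bundle_of (\<lambda>R. stalk X E R \<inter> flag v j)"
  shows "vector_bundle X j F" "U \<in> opens X \<Longrightarrow> F U \<subseteq> E U"
    "bundle_degree \<iota> X j F = (\<Sum>i<j. deg (gdiv v (stalk X E) i))"
proof -
  have L: "lattices CARD('n) (stalk X E)" by (rule lattices_stalk[OF E])
  interpret flagged_bundle \<iota> t N u V X v "stalk X E" by unfold_locales (rule v L)+
  note lf = lattices_flag[OF j]
  show FV: "vector_bundle X j F" unfolding F by (rule vector_bundle_of[OF lf])
  show "F U \<subseteq> E U" if U: "U \<in> opens X"
    using sections_eq_stalks[OF _ U, of E] E unfolding F bundle_of_def vector_bundle_def by blast
  have st: "stalk X F R = stalk X E R \<inter> flag v j" if "R \<in> X" for R
    unfolding F by (rule stalk_bundle_of[OF lf that])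
  have "bundle_degree \<iota> X j F = deg (lat_div j (stalk X F) v)"
  proof (rule bundle_degree_eq[OF FV lin_indep_take[OF v j]])
    show "stalk X F UNIV = lspan UNIV j v" using st[OF generic_point] generic_UNIV lspan_flag[OF j] by simp
  qed
  also have "lat_div j (stalk X F) v = lat_div j (\<lambda>R. stalk X E R \<inter> flag v j) v"
    using st V_subset by (auto simp: lat_div_def fun_eq_iff)
  finally show "bundle_degree \<iota> X j F = (\<Sum>i<j. deg (gdiv v (stalk X E) i))" by (simp add: deg_lat_div_flag[OF j])
qed

lemma bundle_degree_eq_sum_gdiv:
  fixes v :: "nat \<Rightarrow> 'a ^ 'n::finite"
  assumes E: "vector_bundle X CARD('n) (E :: ('a, 'n) subsheaf)" and v: "lin_indep CARD('n) v"
  shows "bundle_degree \<iota> X CARD('n) E = (\<Sum>i<CARD('n). deg (gdiv v (stalk X E) i))"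
proof -
  have L: "lattices CARD('n) (stalk X E)" by (rule lattices_stalk[OF E])
  interpret flagged_bundle \<iota> t N u V X v "stalk X E" by unfold_locales (rule v L)+
  have "bundle_degree \<iota> X CARD('n) E = deg (lat_div CARD('n) (stalk X E) v)"
    by (rule bundle_degree_eq[OF E v]) (simp add: generic_UNIV lspan_UNIV_full[OF v])
  then show ?thesis using deg_lat_div_flag[OF order_refl] by (simp add: flag_CARD)
qed

text \<open>By semistability, the twist by \<open>- D0\<close> of the quotient of \<open>E\<close> by the step \<open>j\<close> of the flag has a
  non-zero section; it is the next vector of the flag.\<close>

lemma extend_flag:
  fixes v :: "nat \<Rightarrow> 'a ^ 'n::finite"
  assumes E: "semistable \<iota> X CARD('n) (E :: ('a, 'n) subsheaf)"
    and d: "int CARD('n) * (deg D0 + gg - 1) < bundle_degree \<iota> X CARD('n) E"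
    and v: "lin_indep CARD('n) v" and j: "j < CARD('n)"
    and ge: "\<And>i R. i < j \<Longrightarrow> D0 R \<le> gdiv v (stalk X E) i R"
  shows "\<exists>v'. lin_indep CARD('n) v' \<and> (\<forall>i<Suc j. \<forall>R. D0 R \<le> gdiv v' (stalk X E) i R)"
proof -
  have VB: "vector_bundle X CARD('n) E" using E by (simp add: semistable_def)
  have L: "lattices CARD('n) (stalk X E)" by (rule lattices_stalk[OF VB])
  let ?L = "twist c0 (stalk X E)"
  have L': "lattices CARD('n) ?L" by (rule lattices_twist[OF scaling_c0 L])
  interpret A: flagged_bundle \<iota> t N u V X v "stalk X E" by unfold_locales (rule v L)+
  interpret B: flagged_bundle \<iota> t N u V X v ?L by unfold_locales (rule L')
  define g where "g i = deg (gdiv v (stalk X E) i)" for i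
  let ?d = "bundle_degree \<iota> X CARD('n) E"
  have d_eq: "?d = (\<Sum>i<CARD('n). g i)" unfolding g_def by (rule bundle_degree_eq_sum_gdiv[OF VB v])
  \<comment> \<open>Semistability for the subbundle cut out by the flag, with denominators cleared.
    The zero step is treated apart, because semistability speaks of subbundles of positive
    rank.\<close>
  have sub: "int CARD('n) * (\<Sum>i<j. g i) \<le> int j * ?d"
  proof (cases "j = 0")
    case False
    define F where "F = bundle_of (\<lambda>R. stalk X E R \<inter> flag v j)"
    have F: "vector_bundle X j F" "\<And>U. U \<in> opens X \<Longrightarrow> F U \<subseteq> E U" "bundle_degree \<iota> X j F = (\<Sum>i<j. g i)"
      using bundle_degree_flag[OF VB v less_imp_le[OF j] F_def] by (auto simp: g_def)
    have "real_of_int (bundle_degree \<iota> X j F) / real j \<le> real_of_int ?d / real CARD('n)"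
      using E F(1,2) False unfolding semistable_def by blast
    then have "real CARD('n) * real_of_int (\<Sum>i<j. g i) \<le> real j * real_of_int ?d"
      unfolding F(3) using False by (simp add: field_simps)
    then have "real_of_int (int CARD('n) * (\<Sum>i<j. g i)) \<le> real_of_int (int j * ?d)" by simp
    then show ?thesis by (simp only: of_int_le_iff)
  qed simp
  have "deg (gdiv v ?L i) = g i - deg D0" if "i < CARD('n)" for i
  proof -
    have "gdiv v ?L i = (\<lambda>R. gdiv v (stalk X E) i R - D0 R)"
      using gdiv_twist[OF scaling_c0 L v that] by (auto simp: cdiv_c0)
    then show ?thesis using deg_diff[OF A.divisor_gdiv[OF that] D0(1)] by (simp add: g_def)
  qed
  then have s: "(\<Sum>i=j..<CARD('n). deg (gdiv v ?L i) + 1 - gg) = (\<Sum>i=j..<CARD('n). g i - (deg D0 + gg - 1))"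
    by (intro sum.cong) auto
  also have "\<dots> = ?d - (\<Sum>i<j. g i) - int (CARD('n) - j) * (deg D0 + gg - 1)"
  proof -
    have "(\<Sum>i<CARD('n). g i) = (\<Sum>i<j. g i) + (\<Sum>i=j..<CARD('n). g i)"
      using sum.atLeastLessThan_concat[of 0 j "CARD('n)" g] j by (simp add: atLeast0LessThan)
    then show ?thesis by (simp add: d_eq sum_subtractf)
  qed
  finally have s: "(\<Sum>i=j..<CARD('n). deg (gdiv v ?L i) + 1 - gg)
      = ?d - (\<Sum>i<j. g i) - int (CARD('n) - j) * (deg D0 + gg - 1)" .
  \<comment> \<open>Multiplied by \<open>n\<close>, the degree \<open>?d - (\<Sum>i<j. g i)\<close>
    of the quotient is at least \<open>(n - j) * ?d\<close> by semistability, which exceeds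
    \<open>(n - j) * n * (deg D0 + gg - 1)\<close> by the assumption on the degree.\<close>
  have pos: "0 < (\<Sum>i=j..<CARD('n). deg (gdiv v ?L i) + 1 - gg)"
  proof -
    have "int (CARD('n) - j) * (int CARD('n) * (deg D0 + gg - 1)) < int (CARD('n) - j) * ?d"
      using d j by (intro mult_strict_left_mono) auto
    moreover have "int (CARD('n) - j) * ?d = int CARD('n) * ?d - int j * ?d" using j by (simp add: of_nat_diff left_diff_distrib)
    moreover have "k * (a * y) < k * x \<Longrightarrow> k * x = a * x - b * x \<Longrightarrow> a * s \<le> b * x \<Longrightarrow> 0 < a * (x - s - k * y)"
      for a b x s k y :: int by (simp add: algebra_simps)
    ultimately have "0 < int CARD('n) * (?d - (\<Sum>i<j. g i) - int (CARD('n) - j) * (deg D0 + gg - 1))"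
      using sub by blast
    then show ?thesis unfolding s by (simp add: zero_less_mult_iff)
  qed
  obtain m e where me: "CARD('k) ^ m \<le> CARD('k) ^ e * index (B.sections_mod j) (flag v j)"
    "int m - int e = (\<Sum>i=j..<CARD('n). deg (gdiv v ?L i) + 1 - gg)"
    using B.riemann_inequality_mod[OF less_imp_le[OF j]] by blast
  have "index (B.sections_mod j) (flag v j) \<noteq> 1"
  proof
    assume "index (B.sections_mod j) (flag v j) = 1"
    then have "CARD('k) ^ m \<le> CARD('k) ^ e" using me(1) by simp
    then have "m \<le> e" using q_gt_1 power_increasing_iff by blast
    then show False using pos me(2) by simp
  qed
  then have "B.sections_mod j \<noteq> flag v j" using index_self[OF A.flag_subgroup] by metis
  moreover have "flag v j \<subseteq> B.sections_mod j"
    unfolding B.sections_mod_def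
  proof (intro subsetI CollectI ballI)
    fix x R assume "x \<in> flag v j" "R \<in> V"
    then show "\<exists>y\<in>?L R. x - y \<in> flag v j" using add_subgroupD(1)[OF B.\<Lambda>_subgroup] by (intro bexI[of _ 0]) auto
  qed
  \<comment> \<open>A section of the twisted quotient that is non-zero modulo the flag; it is taken
    as the next basis vector.\<close>
  ultimately obtain x where x: "x \<in> B.sections_mod j" "x \<notin> flag v j" by blast
  have vj: "lin_indep j v" by (rule lin_indep_take[OF v less_imp_le[OF j]])
  have "x \<notin> lspan UNIV j v" using x(2) A.lspan_flag[OF less_imp_le[OF j]] by simp
  from lin_indep_extend[OF lin_indep_Suc[OF vj this]]
  obtain v' where v': "lin_indep CARD('n) v'" "\<And>i. i < Suc j \<Longrightarrow> v' i = (v(j := x)) i" by blast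
  interpret A': flagged_bundle \<iota> t N u V X v' "stalk X E" by unfold_locales (rule v'(1) L)+
  have vi: "v' i = v i" if "i < j" for i using v'(2)[of i] that by simp
  have vj': "v' j = x" using v'(2)[of j] by simp
  have fl: "flag v' j = flag v j"
    using A.lspan_flag[of j] A'.lspan_flag[of j] lspan_cong[of j v v' UNIV] vi j by auto
  have "D0 R \<le> gdiv v' (stalk X E) i R" if i: "i < Suc j" for i R
  proof (cases "i = j")
    case False
    then have "graded v i G = graded v' i G" for G
      by (intro graded_cong[OF v v'(1)]) (use i j vi in auto)
    then have "gdiv v' (stalk X E) i R = gdiv v (stalk X E) i R" by (simp add: gdiv_def)
    then show ?thesis using ge[of i R] i False by simp
  next
    case True
    show ?thesis
    proof (cases "R \<in> V")
      case R: True
      interpret R: dvr R by (rule dvr_locale[OF R])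
      \<comment> \<open>In the new basis \<open>x\<close> has coordinate one at \<open>j\<close>,
        and so has \<open>y\<close>. Dividing by \<open>c0 R\<close> gives an element of the stalk
        of \<open>E\<close> whose coordinate is a pole of order \<open>D0 R\<close>, or a zero when
        that is negative.\<close>
      obtain y where y: "y \<in> ?L R" "x - y \<in> flag v' j" using x(1) R unfolding B.sections_mod_def fl by blast
      then obtain z where z: "z \<in> stalk X E R" "y = c0 R *s z" unfolding twist_def by blast
      have c: "c0 R \<noteq> 0" using scaling_c0 by (simp add: scaling_def)
      have "x \<in> flag v' (Suc j)" unfolding vj'[symmetric] using j by (intro A'.flag_base) auto
      moreover have "x - y \<in> flag v' (Suc j)" using y(2) A'.flag_mono[of j "Suc j"] by auto
      ultimately have "x - (x - y) \<in> flag v' (Suc j)" using add_subgroupD(2)[OF A'.flag_subgroup] by blast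
      then have yf: "y \<in> flag v' (Suc j)" by simp
      have "crd v' x j = 1" unfolding vj'[symmetric] using j by (simp add: A'.crd_base)
      moreover have "crd v' (x - y) j = 0" using y(2) j by (simp add: flag_def)
      ultimately have yc: "crd v' y j = 1" using j by (simp add: A'.crd_diff)
      have zy: "z = inverse (c0 R) *s y" using c by (simp add: z(2) vector_smult_assoc)
      have "z \<in> flag v' (Suc j)" unfolding zy by (rule A'.flag_scale[OF yf])
      moreover have "crd v' z j = inverse (c0 R)" unfolding zy using j yc by (simp add: A'.crd_scale)
      ultimately have "inverse (c0 R) \<in> graded v' j (stalk X E R)" unfolding graded_def using z(1)
        by (intro image_eqI[of _ _ z]) auto
      then have "inverse (c0 R) \<in> fideal R (- gdiv v' (stalk X E) j R)" using A'.graded_gdiv[OF R j] by simp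
      then have "ord_at R (c0 R) \<le> gdiv v' (stalk X E) j R" using c by (simp add: fideal_def R.ord_inverse)
      then show ?thesis using cdiv_c0[of R] R True by (simp add: cdiv_def)
    next
      case False
      then have "D0 R = 0" using D0(1) by (auto simp: divisor_def)
      then show ?thesis using False by (simp add: gdiv_def)
    qed
  qed
  then show ?thesis using v'(1) by blast
qed

lemma (in embedding) vector_space_vec: "vector_space (\<lambda>c (x :: 'a ^ 'n::finite). \<iota> c *s x)"
  by unfold_locales (simp_all add: emb vec.scale_right_distrib vec.scale_left_distrib vector_smult_assoc)

text \<open>Iterating \<open>extend_flag\<close> yields a full flag all of whose graded divisors
  dominate \<open>D0\<close>. The upper bound \<open>card_sections_le\<close> and the lower bound
  \<open>riemann_inequality_mod\<close> for the zero step then coincide.\<close>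

theorem h0_semistable:
  assumes E: "semistable \<iota> X CARD('n) (E :: ('a, 'n::finite) subsheaf)"
    and d: "int CARD('n) * (deg D0 + gg - 1) < bundle_degree \<iota> X CARD('n) E"
  shows "int (h0 \<iota> X E) = bundle_degree \<iota> X CARD('n) E - int CARD('n) * (gg - 1)"
proof -
  interpret hv: vector_space "\<lambda>c (x :: 'a ^ 'n). \<iota> c *s x" by (rule vector_space_vec)
  have VB: "vector_bundle X CARD('n) E" using E by (simp add: semistable_def)
  have L: "lattices CARD('n) (stalk X E)" by (rule lattices_stalk[OF VB])
  have "\<exists>v :: nat \<Rightarrow> 'a ^ 'n. lin_indep CARD('n) v \<and> (\<forall>i<j. \<forall>R. D0 R \<le> gdiv v (stalk X E) i R)"
    if "j \<le> CARD('n)" for j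
    using that
  proof (induction j)
    case 0
    have "lin_indep 0 (\<lambda>_. 0 :: 'a ^ 'n)" by (simp add: lin_indep_def)
    then show ?case using lin_indep_extend by blast
  next
    case (Suc j)
    then obtain v :: "nat \<Rightarrow> 'a ^ 'n" where "lin_indep CARD('n) v" "\<forall>i<j. \<forall>R. D0 R \<le> gdiv v (stalk X E) i R" by auto
    then show ?case using extend_flag[OF E d, of v j] Suc.prems by auto
  qed
  from this[OF order_refl] obtain v :: "nat \<Rightarrow> 'a ^ 'n" where v: "lin_indep CARD('n) v"
    "\<And>i R. i < CARD('n) \<Longrightarrow> D0 R \<le> gdiv v (stalk X E) i R" by blast
  interpret A: flagged_bundle \<iota> t N u V X v "stalk X E" by unfold_locales (rule v L)+
  have EX: "E X = (\<Inter>R\<in>V. stalk X E R)"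
  proof -
    have "E X = (\<Inter>R\<in>X. stalk X E R)" using VB sections_eq_stalks[OF _ X_opens] unfolding vector_bundle_def by blast
    then show ?thesis using A.generic_UNIV by (auto simp: X_eq)
  qed
  have fin: "finite (E X)" using A.card_sections_le(1)[OF v(2)] by (simp add: EX)
  have sub: "hv.subspace (E X)"
    unfolding hv.subspace_def
  proof (intro conjI ballI allI)
    have E': "0 \<in> E X \<and> (\<forall>v\<in>E X. \<forall>w\<in>E X. v + w \<in> E X) \<and> (\<forall>a\<in>struct_sheaf X. \<forall>v\<in>E X. a *s v \<in> E X)"
      using VB X_opens unfolding vector_bundle_def module_subsheaf_def by blast
    then show "0 \<in> E X" "\<And>x y. x \<in> E X \<Longrightarrow> y \<in> E X \<Longrightarrow> x + y \<in> E X" by auto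
    have "\<iota> c \<in> struct_sheaf X" for c using scalars_V X_eq by (auto simp: struct_sheaf_def)
    then show "\<iota> c *s x \<in> E X" if "x \<in> E X" for c x using E' that by blast
  qed
  have card: "card (E X) = CARD('k) ^ h0 \<iota> X E"
    unfolding h0_def by (rule hv.card_subspace[OF finite sub fin])
  have deg: "(\<Sum>i<CARD('n). deg (gdiv v (stalk X E) i) + 1 - gg) = bundle_degree \<iota> X CARD('n) E - int CARD('n) * (gg - 1)"
  proof -
    have "(\<Sum>i<CARD('n). deg (gdiv v (stalk X E) i) + 1 - gg) = (\<Sum>i<CARD('n). deg (gdiv v (stalk X E) i) - (gg - 1))"
      by (rule sum.cong) auto
    then show ?thesis by (simp add: bundle_degree_eq_sum_gdiv[OF VB v(1)] sum_subtractf)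
  qed
  obtain m where m: "card (E X) \<le> CARD('k) ^ m" "int m = bundle_degree \<iota> X CARD('n) E - int CARD('n) * (gg - 1)"
    using A.card_sections_le(2)[OF v(2)] unfolding deg EX by blast
  have "h0 \<iota> X E \<le> m" using m(1) q_gt_1 power_increasing_iff unfolding card by blast
  moreover obtain m' e where me: "CARD('k) ^ m' \<le> CARD('k) ^ e * index (A.sections_mod 0) (flag v 0)"
    "int m' - int e = (\<Sum>i=0..<CARD('n). deg (gdiv v (stalk X E) i) + 1 - gg)"
    using A.riemann_inequality_mod[of 0] by blast
  have "A.sections_mod 0 = E X"
    unfolding A.sections_mod_def EX A.flag_0 by auto
  then have "CARD('k) ^ m' \<le> CARD('k) ^ (e + h0 \<iota> X E)"
    using me(1) by (simp add: A.flag_0 index_zero card power_add)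
  then have "m' \<le> e + h0 \<iota> X E" using q_gt_1 power_increasing_iff by blast
  moreover have "int m' - int e = int m" using me(2) deg m(2) by (simp add: atLeast0LessThan)
  ultimately show ?thesis using m(2) by linarith
qed

end

section \<open>Twisting by the poles of a function\<close>

context curve
begin

definition tw :: "('a set \<Rightarrow> 'a) \<Rightarrow> ('a, 'n::finite) subsheaf \<Rightarrow> ('a, 'n) subsheaf" where
  "tw c E = bundle_of (twist c (stalk X E))"

lemma
  assumes c: "scaling c" and E: "vector_bundle X r E"
  shows vector_bundle_tw: "vector_bundle X r (tw c E)"
    and stalk_tw: "R \<in> X \<Longrightarrow> stalk X (tw c E) R = (*s) (c R) ` stalk X E R"
    and bundle_degree_tw: "bundle_degree \<iota> X r (tw c E) = bundle_degree \<iota> X r E - int r * deg (cdiv c)"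
proof -
  have L: "lattices r (stalk X E)" by (rule lattices_stalk[OF E])
  note L' = lattices_twist[OF c L]
  show V: "vector_bundle X r (tw c E)" unfolding tw_def by (rule vector_bundle_of[OF L'])
  show st: "stalk X (tw c E) R = (*s) (c R) ` stalk X E R" if "R \<in> X" for R
    using stalk_bundle_of[OF L' that] by (simp add: tw_def twist_def)
  obtain e where e: "lin_indep r e" "stalk X E UNIV = lspan UNIV r e" using lattices_generic[OF L] by blast
  have e': "stalk X (tw c E) UNIV = lspan UNIV r e"
    using st[OF generic_point] e(2) scaling_UNIV[OF c] by (simp add: image_def)
  have "lat_div r (stalk X (tw c E)) e = (\<lambda>R. lat_div r (stalk X E) e R - int r * cdiv c R)"
  proof
    fix R
    have "lat_div r (stalk X (tw c E)) e R = lat_div r (twist c (stalk X E)) e R"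
      using st[of R] V_subset by (auto simp: lat_div_def twist_def)
    then show "lat_div r (stalk X (tw c E)) e R = lat_div r (stalk X E) e R - int r * cdiv c R"
      using lat_div_twist[OF c L e] by simp
  qed
  then show "bundle_degree \<iota> X r (tw c E) = bundle_degree \<iota> X r E - int r * deg (cdiv c)"
    using bundle_degree_eq[OF V e(1) e'] bundle_degree_eq[OF E e] divisor_lat_div[OF L e] divisor_cdiv[OF c]
      deg_diff[OF _ divisor_scale] deg_scale by simp
qed

lemma scaling_inverse: "scaling c \<Longrightarrow> scaling (\<lambda>R. inverse (c R))"
  by (simp add: scaling_def)

lemma stalk_subset:
  "(\<And>U. U \<in> opens X \<Longrightarrow> F U \<subseteq> E U) \<Longrightarrow> stalk X F R \<subseteq> stalk X E R"
  unfolding stalk_def by blast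

lemma cdiv_inverse: "scaling c \<Longrightarrow> deg (cdiv (\<lambda>R. inverse (c R))) = - deg (cdiv c)"
proof -
  assume c: "scaling c"
  have "cdiv (\<lambda>R. inverse (c R)) = (\<lambda>R. (-1) * cdiv c R)"
    using c dvr.ord_inverse[OF dvr_locale] by (auto simp: cdiv_def scaling_def fun_eq_iff)
  then show ?thesis using deg_scale[OF divisor_cdiv[OF c], of "-1"] by simp
qed

text \<open>Twisting back by the inverse idele turns subsheaves of the twist into subsheaves of
  \<open>E\<close>, and all slopes are shifted by the same amount
  \<open>deg (cdiv c)\<close>.\<close>

lemma semistable_tw:
  assumes c: "scaling c" and E: "semistable \<iota> X r E" and r: "0 < r"
  shows "semistable \<iota> X r (tw c E)"
  unfolding semistable_def
proof (intro conjI allI impI)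
  have VB: "vector_bundle X r E" using E by (simp add: semistable_def)
  show VB': "vector_bundle X r (tw c E)" by (rule vector_bundle_tw[OF c VB])
  fix s F assume F: "0 < s \<and> vector_bundle X s F \<and> (\<forall>U\<in>opens X. F U \<subseteq> tw c E U)"
  let ?F = "tw (\<lambda>R. inverse (c R)) F"
  note ci = scaling_inverse[OF c]
  have FV: "vector_bundle X s ?F" using vector_bundle_tw[OF ci] F by blast
  have "?F U \<subseteq> E U" if U: "U \<in> opens X" for U
  proof -
    have "stalk X ?F R \<subseteq> stalk X E R" if R: "R \<in> U" for R
    proof -
      have RX: "R \<in> X" using R opens_subset[OF U] by blast
      have "stalk X F R \<subseteq> stalk X (tw c E) R" by (rule stalk_subset) (use F in blast)
      then have "stalk X F R \<subseteq> (*s) (c R) ` stalk X E R" by (simp add: stalk_tw[OF c VB RX])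
      then have "(*s) (inverse (c R)) ` stalk X F R \<subseteq> (*s) (inverse (c R)) ` (*s) (c R) ` stalk X E R" by blast
      also have "\<dots> = stalk X E R" using c by (simp add: image_image vector_smult_assoc scaling_def)
      finally show ?thesis using stalk_tw[OF ci _ RX] F by blast
    qed
    moreover have "?F U = (\<Inter>R\<in>U. stalk X ?F R)" "E U = (\<Inter>R\<in>U. stalk X E R)"
      using sections_eq_stalks[OF _ U] FV VB unfolding vector_bundle_def by blast+
    ultimately show ?thesis by blast
  qed
  then have "real_of_int (bundle_degree \<iota> X s ?F) / real s \<le> real_of_int (bundle_degree \<iota> X r E) / real r"
    using E F FV unfolding semistable_def by blast
  moreover have "bundle_degree \<iota> X s ?F = bundle_degree \<iota> X s F + int s * deg (cdiv c)"
    using bundle_degree_tw[OF ci, of s F] F cdiv_inverse[OF c] by simp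
  moreover have "bundle_degree \<iota> X r (tw c E) = bundle_degree \<iota> X r E - int r * deg (cdiv c)"
    by (rule bundle_degree_tw[OF c VB])
  ultimately show "real_of_int (bundle_degree \<iota> X s F) / real s \<le> real_of_int (bundle_degree \<iota> X r (tw c E)) / real r"
    using F r by (simp add: add_divide_distrib diff_divide_distrib)
qed

section \<open>Isomorphism classes and their behaviour under twists\<close>

lemma stalk_UNIV_full: "vector_bundle X CARD('n) (E :: ('a, 'n::finite) subsheaf) \<Longrightarrow> stalk X E UNIV = UNIV"
  using lattices_generic[OF lattices_stalk] lspan_UNIV_full by metis

text \<open>The sections over all non-empty open sets exhaust \<open>K^n\<close>, so an isomorphism
  is one additive injective map on it. It is linear over the whole field because each scalar is
  regular on some non-empty open set. In this form only the stalks matter.\<close>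

lemma bundle_iso_iff:
  fixes E E' :: "('a, 'n::finite) subsheaf"
  assumes E: "vector_bundle X CARD('n) E" and E': "vector_bundle X CARD('n) E'"
  shows "bundle_iso X E E' \<phi> \<longleftrightarrow> (\<forall>v w. \<phi> (v + w) = \<phi> v + \<phi> w) \<and> (\<forall>a v. \<phi> (a *s v) = a *s \<phi> v) \<and> inj \<phi>
     \<and> (\<forall>R\<in>X. \<phi> ` stalk X E R = stalk X E' R)"
proof
  have Em: "module_subsheaf X E" "module_subsheaf X E'" using E E' by (auto simp: vector_bundle_def)
  {
    assume iso: "bundle_iso X E E' \<phi>"
    have iE: "\<phi> ` E U = E' U" "inj_on \<phi> (E U)" if "U \<in> opens X" for U
      using iso that unfolding bundle_iso_def bij_betw_def by blast+
    have ex: "\<exists>U\<in>opens X. v \<in> E U" for v using stalk_UNIV_full[OF E] unfolding stalk_def by blast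
    have ex2: "\<exists>U\<in>opens X. v \<in> E U \<and> w \<in> E U" for v w
    proof -
      obtain U U' where U: "U \<in> opens X" "v \<in> E U" "U' \<in> opens X" "w \<in> E U'" using ex by blast
      have W: "U \<inter> U' \<in> opens X" by (rule opens_Int[OF U(1,3)])
      show ?thesis using W restriction[OF Em(1) W U(1)] restriction[OF Em(1) W U(3)] U(2,4) by blast
    qed
    have "\<phi> (v + w) = \<phi> v + \<phi> w" for v w using ex2[of v w] iso unfolding bundle_iso_def by blast
    moreover have "\<phi> (a *s v) = a *s \<phi> v" for a v
    proof -
      obtain U where U: "U \<in> opens X" "v \<in> E U" using ex by blast
      let ?W = "{R\<in>U. {a} \<subseteq> R}"
      have W: "?W \<in> opens X" by (rule opens_regular[OF U(1)]) simp
      have "v \<in> E ?W" using restriction[OF Em(1) W U(1)] U(2) by blast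
      moreover have "a \<in> struct_sheaf ?W" by (auto simp: struct_sheaf_def)
      ultimately show ?thesis using iso W unfolding bundle_iso_def by blast
    qed
    moreover have "inj \<phi>" using ex2 iE(2) by (metis inj_def inj_onD)
    moreover have "\<phi> ` stalk X E R = stalk X E' R" for R
    proof -
      have "\<phi> ` stalk X E R = \<Union>{\<phi> ` E U | U. U \<in> opens X \<and> R \<in> U}" unfolding stalk_def by blast
      also have "\<dots> = \<Union>{E' U | U. U \<in> opens X \<and> R \<in> U}" using iE(1) by (metis (no_types, lifting))
      finally show ?thesis by (simp add: stalk_def)
    qed
    ultimately show "(\<forall>v w. \<phi> (v + w) = \<phi> v + \<phi> w) \<and> (\<forall>a v. \<phi> (a *s v) = a *s \<phi> v) \<and> inj \<phi>
     \<and> (\<forall>R\<in>X. \<phi> ` stalk X E R = stalk X E' R)" by blast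
  }
  assume l: "(\<forall>v w. \<phi> (v + w) = \<phi> v + \<phi> w) \<and> (\<forall>a v. \<phi> (a *s v) = a *s \<phi> v) \<and> inj \<phi>
     \<and> (\<forall>R\<in>X. \<phi> ` stalk X E R = stalk X E' R)"
  have "bij_betw \<phi> (E U) (E' U)" if U: "U \<in> opens X" for U
  proof -
    have ne: "UNIV \<in> U" by (rule opens_generic[OF U])
    have "\<phi> ` E U = \<phi> ` (\<Inter>R\<in>U. stalk X E R)" by (simp only: sections_eq_stalks[OF Em(1) U])
    also have "\<dots> = (\<Inter>R\<in>U. \<phi> ` stalk X E R)"
      by (rule image_INT[of \<phi> UNIV U _ UNIV]) (use l ne in \<open>auto intro: inj_on_subset\<close>)
    also have "\<dots> = (\<Inter>R\<in>U. stalk X E' R)" 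
    proof (rule INF_cong[OF refl])
      fix R assume "R \<in> U"
      then have "R \<in> X" using opens_subset[OF U] by blast
      then show "\<phi> ` stalk X E R = stalk X E' R" using l by blast
    qed
    also have "\<dots> = E' U" by (rule sections_eq_stalks[OF Em(2) U, symmetric])
    finally show ?thesis using l unfolding bij_betw_def by (meson inj_on_subset subset_UNIV)
  qed
  then show "bundle_iso X E E' \<phi>" using l unfolding bundle_iso_def by blast
qed

lemma image_scale_commute:
  assumes "\<forall>a v. \<phi> (a *s v) = a *s \<phi> v"
  shows "\<phi> ` (*s) a ` S = (*s) a ` \<phi> ` S"
  using assms by (auto simp: image_image)

text \<open>A linear map commutes with the multiplications by \<open>c R\<close>. The very same maps
  are therefore isomorphisms before and after the twist, and in particular the automorphism groups
  are equal as sets.\<close>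

lemma bundle_iso_tw:
  fixes E E' :: "('a, 'n::finite) subsheaf"
  assumes c: "scaling c" and E: "vector_bundle X CARD('n) E" and E': "vector_bundle X CARD('n) E'"
  shows "bundle_iso X (tw c E) (tw c E') \<phi> \<longleftrightarrow> bundle_iso X E E' \<phi>"
proof -
  have "\<phi> ` stalk X (tw c E) R = stalk X (tw c E') R \<longleftrightarrow> \<phi> ` stalk X E R = stalk X E' R"
    if l: "\<forall>a v. \<phi> (a *s v) = a *s \<phi> v" and R: "R \<in> X" for R
  proof -
    have "inj ((*s) (c R) :: 'a ^ 'n \<Rightarrow> _)" using c vec.injective_scale by (auto simp: scaling_def)
    then show ?thesis
      unfolding stalk_tw[OF c E R] stalk_tw[OF c E' R] image_scale_commute[OF l] by (rule inj_image_eq_iff)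
  qed
  then have "(\<forall>a v. \<phi> (a *s v) = a *s \<phi> v) \<Longrightarrow>
      (\<forall>R\<in>X. \<phi> ` stalk X (tw c E) R = stalk X (tw c E') R) \<longleftrightarrow> (\<forall>R\<in>X. \<phi> ` stalk X E R = stalk X E' R)"
    by simp
  then show ?thesis
    unfolding bundle_iso_iff[OF E E'] bundle_iso_iff[OF vector_bundle_tw[OF c E] vector_bundle_tw[OF c E']] by argo
qed

text \<open>Bundles with equal stalks may differ as functions, as their values at sets other than
  non-empty open ones are arbitrary. A twist followed by the inverse twist thus returns an
  isomorphic bundle, possibly not the same one.\<close>

lemma bundle_iso_refl:
  fixes E E' :: "('a, 'n::finite) subsheaf"
  assumes "vector_bundle X CARD('n) E" "vector_bundle X CARD('n) E'" "\<And>R. R \<in> X \<Longrightarrow> stalk X E R = stalk X E' R"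
  shows "bundle_iso X E E' id"
  unfolding bundle_iso_iff[OF assms(1,2)] using assms(3) by simp

lemma bundle_iso_sym:
  fixes E E' :: "('a, 'n::finite) subsheaf"
  assumes E: "vector_bundle X CARD('n) E" "vector_bundle X CARD('n) E'" and i: "bundle_iso X E E' \<phi>"
  shows "bundle_iso X E' E (inv_into UNIV \<phi>)" "bij \<phi>"
proof -
  note l = i[unfolded bundle_iso_iff[OF E]]
  have "\<phi> ` UNIV = UNIV" using l generic_point stalk_UNIV_full[OF E(1)] stalk_UNIV_full[OF E(2)] by metis
  then show b: "bij \<phi>" using l by (simp add: bij_def)
  have inv: "inv_into UNIV \<phi> x = y \<longleftrightarrow> x = \<phi> y" for x y using b by (metis bij_inv_eq_iff)
  have s: "\<phi> (inv_into UNIV \<phi> x) = x" for x using b by (meson bij_inv_eq_iff)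
  show "bundle_iso X E' E (inv_into UNIV \<phi>)"
    unfolding bundle_iso_iff[OF E(2,1)]
  proof (intro conjI allI ballI)
    show "inv_into UNIV \<phi> (v + w) = inv_into UNIV \<phi> v + inv_into UNIV \<phi> w" for v w unfolding inv using l s by simp
    show "inv_into UNIV \<phi> (a *s v) = a *s inv_into UNIV \<phi> v" for a v unfolding inv using l s by simp
    show "inj (inv_into UNIV \<phi>)" using b by (simp add: bij_imp_bij_inv bij_is_inj)
    fix R assume "R \<in> X"
    then have "stalk X E' R = \<phi> ` stalk X E R" using l by simp
    then show "inv_into UNIV \<phi> ` stalk X E' R = stalk X E R" using l by (simp add: image_inv_f_f)
  qed
qed

lemma bundle_iso_trans:
  fixes E E' E'' :: "('a, 'n::finite) subsheaf"
  assumes E: "vector_bundle X CARD('n) E" "vector_bundle X CARD('n) E'" "vector_bundle X CARD('n) E''"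
    and i: "bundle_iso X E E' \<phi>" "bundle_iso X E' E'' \<psi>"
  shows "bundle_iso X E E'' (\<psi> \<circ> \<phi>)"
  using i unfolding bundle_iso_iff[OF E(1,2)] bundle_iso_iff[OF E(2,3)] bundle_iso_iff[OF E(1,3)]
    image_comp[symmetric] by (simp add: inj_compose)

lemma card_Aut_iso:
  fixes E E' :: "('a, 'n::finite) subsheaf"
  assumes E: "vector_bundle X CARD('n) E" "vector_bundle X CARD('n) E'" and i: "bundle_iso X E E' \<phi>"
  shows "card (Aut X E) = card (Aut X E')"
proof -
  note i' = bundle_iso_sym(1)[OF E i] and b = bundle_iso_sym(2)[OF E i]
  have e: "inv_into UNIV \<phi> \<circ> \<phi> = id" "\<phi> \<circ> inv_into UNIV \<phi> = id" using b by (auto simp: bij_def fun_eq_iff surj_f_inv_f)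
  have "bij_betw (\<lambda>\<psi>. \<phi> \<circ> \<psi> \<circ> inv_into UNIV \<phi>) (Aut X E) (Aut X E')"
  proof (rule bij_betw_byWitness[where f' = "\<lambda>\<psi>. inv_into UNIV \<phi> \<circ> \<psi> \<circ> \<phi>"])
    have "inv_into UNIV \<phi> \<circ> (\<phi> \<circ> \<psi> \<circ> inv_into UNIV \<phi>) \<circ> \<phi> = (inv_into UNIV \<phi> \<circ> \<phi>) \<circ> \<psi> \<circ> (inv_into UNIV \<phi> \<circ> \<phi>)"
      "\<phi> \<circ> (inv_into UNIV \<phi> \<circ> \<psi> \<circ> \<phi>) \<circ> inv_into UNIV \<phi> = (\<phi> \<circ> inv_into UNIV \<phi>) \<circ> \<psi> \<circ> (\<phi> \<circ> inv_into UNIV \<phi>)" for \<psi> by (simp_all add: o_assoc)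
    then show "\<forall>\<psi>\<in>Aut X E. inv_into UNIV \<phi> \<circ> (\<phi> \<circ> \<psi> \<circ> inv_into UNIV \<phi>) \<circ> \<phi> = \<psi>"
      "\<forall>\<psi>\<in>Aut X E'. \<phi> \<circ> (inv_into UNIV \<phi> \<circ> \<psi> \<circ> \<phi>) \<circ> inv_into UNIV \<phi> = \<psi>" by (simp_all only: e id_comp o_id fun.map_id0 id_o) auto
    show "(\<lambda>\<psi>. \<phi> \<circ> \<psi> \<circ> inv_into UNIV \<phi>) ` Aut X E \<subseteq> Aut X E'"
      unfolding Aut_def using bundle_iso_trans[OF E(2,1,2) i' bundle_iso_trans[OF E(1,1,2) _ i]] by (auto simp: o_assoc)
    show "(\<lambda>\<psi>. inv_into UNIV \<phi> \<circ> \<psi> \<circ> \<phi>) ` Aut X E' \<subseteq> Aut X E"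
      unfolding Aut_def using bundle_iso_trans[OF E(1,2,1) i bundle_iso_trans[OF E(2,2,1) _ i']] by (auto simp: o_assoc)
  qed
  then show ?thesis by (rule bij_betw_same_card)
qed

definition iso_rel :: "int \<Rightarrow> (('a, 'n::finite) subsheaf \<times> ('a, 'n) subsheaf) set" where
  "iso_rel d = {(E, E'). E \<in> semistable_bundles \<iota> X d \<and> E' \<in> semistable_bundles \<iota> X d \<and> (\<exists>\<phi>. bundle_iso X E E' \<phi>)}"

lemma semistable_bundles_vb:
  "E \<in> (semistable_bundles \<iota> X d :: ('a, 'n::finite) subsheaf set) \<Longrightarrow> vector_bundle X CARD('n) E"
  by (simp add: semistable_bundles_def semistable_def)

lemma equiv_iso_rel: "equiv (semistable_bundles \<iota> X d :: ('a, 'n::finite) subsheaf set) (iso_rel d)"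
proof (rule equivI)
  show "iso_rel d \<subseteq> (semistable_bundles \<iota> X d :: ('a, 'n) subsheaf set) \<times> semistable_bundles \<iota> X d"
    by (auto simp: iso_rel_def)
  show "refl_on (semistable_bundles \<iota> X d :: ('a, 'n) subsheaf set) (iso_rel d)"
    unfolding refl_on_def iso_rel_def using bundle_iso_refl semistable_bundles_vb by blast
  show "sym (iso_rel d :: (('a, 'n) subsheaf \<times> ('a, 'n) subsheaf) set)"
    unfolding sym_def iso_rel_def using bundle_iso_sym(1) semistable_bundles_vb by blast
  show "trans (iso_rel d :: (('a, 'n) subsheaf \<times> ('a, 'n) subsheaf) set)"
    unfolding trans_def iso_rel_def using bundle_iso_trans semistable_bundles_vb by blast
qed

lemma semistable_classes_eq: "semistable_classes \<iota> X d = semistable_bundles \<iota> X d // iso_rel d"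
  by (simp add: semistable_classes_def iso_rel_def)

lemma some_class:
  fixes C :: "('a, 'n::finite) subsheaf set"
  assumes "C \<in> semistable_classes \<iota> X d"
  shows "(SOME E. E \<in> C) \<in> semistable_bundles \<iota> X d" "C = iso_rel d `` {SOME E. E \<in> C}"
proof -
  have C: "C \<in> semistable_bundles \<iota> X d // iso_rel d" using assms by (simp add: semistable_classes_eq)
  have "C \<noteq> {}" using in_quotient_imp_non_empty[OF equiv_iso_rel C] .
  then have s: "(SOME E. E \<in> C) \<in> C" by (simp add: some_in_eq)
  then show "(SOME E. E \<in> C) \<in> semistable_bundles \<iota> X d" using in_quotient_imp_subset[OF equiv_iso_rel C] by blast
  show "C = iso_rel d `` {SOME E. E \<in> C}"
    using quotient_eq_iff[OF equiv_iso_rel C C s] C s equiv_iso_rel[of d] unfolding quotient_def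
    by (metis (no_types, lifting) C Image_singleton_iff equiv_class_eq quotientE)
qed

lemma tw_semistable_bundles:
  assumes c: "scaling c" and E: "E \<in> (semistable_bundles \<iota> X d :: ('a, 'n::finite) subsheaf set)"
  shows "tw c E \<in> semistable_bundles \<iota> X (d - int CARD('n) * deg (cdiv c))"
  using E semistable_tw[OF c, of "CARD('n)" E] bundle_degree_tw[OF c semistable_bundles_vb[OF E]]
  by (simp add: semistable_bundles_def)

text \<open>Twists by \<open>c\<close> and by its inverse are mutually inverse on isomorphism
  classes and preserve automorphism groups, so the sum is merely reindexed.\<close>

lemma \<beta>_tw:
  assumes c: "scaling c"
  shows "\<beta> TYPE('n::finite) \<iota> X (d - int CARD('n) * deg (cdiv c)) = \<beta> TYPE('n) \<iota> X d"
proof -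
  let ?d = "d - int CARD('n) * deg (cdiv c)"
  let ?S = "semistable_bundles \<iota> X :: int \<Rightarrow> ('a, 'n) subsheaf set"
  let ?KK = "semistable_classes \<iota> X :: int \<Rightarrow> ('a, 'n) subsheaf set set"
  let ?e = "\<lambda>C :: ('a, 'n) subsheaf set. SOME E. E \<in> C"
  define h where "h C = iso_rel ?d `` {tw c (?e C)}" for C :: "('a, 'n) subsheaf set"
  have rel_tw: "(tw c E, tw c E') \<in> iso_rel ?d \<longleftrightarrow> (E, E') \<in> iso_rel d" if "E \<in> ?S d" "E' \<in> ?S d" for E E'
    using that bundle_iso_tw[OF c semistable_bundles_vb[OF that(1)] semistable_bundles_vb[OF that(2)]]
      tw_semistable_bundles[OF c that(1)] tw_semistable_bundles[OF c that(2)] unfolding iso_rel_def by blast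
  have bij: "bij_betw h (?KK d) (?KK ?d)"
    unfolding bij_betw_def
  proof
    show "inj_on h (?KK d)"
    proof (rule inj_onI)
      fix C C' assume C: "C \<in> ?KK d" "C' \<in> ?KK d" "h C = h C'"
      have "(tw c (?e C), tw c (?e C')) \<in> iso_rel ?d"
        using C(3) eq_equiv_class_iff[OF equiv_iso_rel tw_semistable_bundles[OF c some_class(1)[OF C(1)]]
            tw_semistable_bundles[OF c some_class(1)[OF C(2)]]] unfolding h_def by blast
      then have "(?e C, ?e C') \<in> iso_rel d" using rel_tw some_class(1)[OF C(1)] some_class(1)[OF C(2)] by blast
      then have "iso_rel d `` {?e C} = iso_rel d `` {?e C'}" by (rule equiv_class_eq[OF equiv_iso_rel])
      then show "C = C'" using some_class(2)[OF C(1)] some_class(2)[OF C(2)] by simp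
    qed
    show "h ` ?KK d = ?KK ?d"
    proof (intro equalityI subsetI)
      fix D assume "D \<in> h ` ?KK d"
      then obtain C where "C \<in> ?KK d" "D = h C" by blast
      then show "D \<in> ?KK ?d"
        unfolding semistable_classes_eq h_def using tw_semistable_bundles[OF c some_class(1)]
        by (auto simp: semistable_classes_eq intro!: quotientI)
    next
      fix D assume D: "D \<in> ?KK ?d"
      let ?E = "?e D" let ?ci = "\<lambda>R. inverse (c R)"
      note E = some_class(1)[OF D]
      have F: "tw ?ci ?E \<in> ?S d"
        using tw_semistable_bundles[OF scaling_inverse[OF c] E] cdiv_inverse[OF c] by simp
      let ?C0 = "iso_rel d `` {tw ?ci ?E}"
      have C0: "?C0 \<in> ?KK d" unfolding semistable_classes_eq by (rule quotientI[OF F])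
      have "(tw ?ci ?E, ?e ?C0) \<in> iso_rel d"
        using some_class(2)[OF C0] some_class(1)[OF C0] equiv_class_self[OF equiv_iso_rel] by (metis Image_singleton_iff)
      then have 1: "(tw c (tw ?ci ?E), tw c (?e ?C0)) \<in> iso_rel ?d" using rel_tw[OF F some_class(1)[OF C0]] by blast
      have st: "stalk X ?E R = stalk X (tw c (tw ?ci ?E)) R" if "R \<in> X" for R
        using that stalk_tw[OF c semistable_bundles_vb[OF F]] stalk_tw[OF scaling_inverse[OF c] semistable_bundles_vb[OF E]] c
        by (simp add: image_image vector_smult_assoc scaling_def)
      have "(?E, tw c (tw ?ci ?E)) \<in> iso_rel ?d"
        using bundle_iso_refl[OF semistable_bundles_vb[OF E] semistable_bundles_vb[OF tw_semistable_bundles[OF c F]] st]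
          E tw_semistable_bundles[OF c F] unfolding iso_rel_def by blast
      with 1 have "(?E, tw c (?e ?C0)) \<in> iso_rel ?d" using equiv_iso_rel[of ?d] unfolding equiv_def trans_def by blast
      then have "iso_rel ?d `` {?E} = h ?C0" unfolding h_def by (rule equiv_class_eq[OF equiv_iso_rel])
      then have "D = h ?C0" using some_class(2)[OF D] by simp
      then show "D \<in> h ` ?KK d" using C0 by blast
    qed
  qed
  have val: "card (Aut X (?e (h C))) = card (Aut X (?e C))" if C: "C \<in> ?KK d" for C
  proof -
    note E = some_class(1)[OF C]
    have hC: "h C \<in> ?KK ?d" using bij C by (auto simp: bij_betw_def)
    have "(tw c (?e C), ?e (h C)) \<in> iso_rel ?d"
      using some_class(1)[OF hC] some_class(2)[OF hC] equiv_class_self[OF equiv_iso_rel] unfolding h_def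
      by (metis Image_singleton_iff)
    then obtain \<phi> where "bundle_iso X (tw c (?e C)) (?e (h C)) \<phi>" unfolding iso_rel_def by blast
    then have "card (Aut X (tw c (?e C))) = card (Aut X (?e (h C)))"
      by (rule card_Aut_iso[OF semistable_bundles_vb[OF tw_semistable_bundles[OF c E]] semistable_bundles_vb[OF some_class(1)[OF hC]]])
    moreover have "Aut X (tw c (?e C)) = Aut X (?e C)"
      unfolding Aut_def using bundle_iso_tw[OF c] semistable_bundles_vb[OF E] by blast
    ultimately show ?thesis by simp
  qed
  have "\<beta> TYPE('n) \<iota> X ?d = (\<Sum>\<^sub>\<infinity>C\<in>?KK d. 1 / real (card (Aut X (?e (h C)))))"
    unfolding \<beta>_def Let_def by (rule infsum_reindex_bij_betw[OF bij, symmetric])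
  also have "\<dots> = \<beta> TYPE('n) \<iota> X d"
    unfolding \<beta>_def Let_def by (rule infsum_cong) (simp add: val)
  finally show ?thesis .
qed

text \<open>Above the threshold \<open>h0\<close> is the same number for all classes. The common
  factor leaves the infinite sum by \<open>infsum_cmult_right'\<close>, which holds for arbitrary
  summands.\<close>

lemma \<alpha>_eq:
  assumes d: "int CARD('n::finite) * (deg D0 + gg - 1) < d"
  shows "\<alpha> TYPE('n) \<iota> X d = (real CARD('k) ^ nat (d - int CARD('n) * (gg - 1)) - 1) * \<beta> TYPE('n) \<iota> X d"
proof -
  let ?C = "semistable_classes \<iota> X d :: ('a, 'n) subsheaf set set"
  let ?e = "\<lambda>C :: ('a, 'n) subsheaf set. SOME E. E \<in> C"
  let ?a = "real CARD('k) ^ nat (d - int CARD('n) * (gg - 1)) - 1"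
  have "h0 \<iota> X (?e C) = nat (d - int CARD('n) * (gg - 1))" if "C \<in> ?C" for C
  proof -
    have E: "semistable \<iota> X CARD('n) (?e C)" "bundle_degree \<iota> X CARD('n) (?e C) = d"
      using some_class(1)[OF that] by (auto simp: semistable_bundles_def)
    show ?thesis using h0_semistable[OF E(1)] d E(2) by simp
  qed
  then have "\<alpha> TYPE('n) \<iota> X d = (\<Sum>\<^sub>\<infinity>C\<in>?C. ?a * (1 / real (card (Aut X (?e C)))))"
    unfolding \<alpha>_def Let_def by (intro infsum_cong) simp
  also have "\<dots> = ?a * (\<Sum>\<^sub>\<infinity>C\<in>?C. 1 / real (card (Aut X (?e C))))"
    by (rule infsum_cmult_right')
  finally show ?thesis by (simp add: \<beta>_def Let_def)
qed

text \<open>Concentrated at the poles of \<open>t\<close>, where \<open>t ^ k\<close> has order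
  \<open>- k\<close> times the order of the pole. Its divisor is \<open>- k\<close> times the polar
  divisor, so the twist raises the degree.\<close>

definition ct :: "nat \<Rightarrow> 'a set \<Rightarrow> 'a" where
  "ct k R = (if R \<in> V \<and> t \<notin> R then t ^ k else 1)"

lemma scaling_ct: "scaling (ct k)" and deg_cdiv_ct: "deg (cdiv (ct k)) = - int k * deg (poles t)"
proof -
  have "{R. ct k R \<noteq> 1} \<subseteq> {R\<in>X. t \<notin> R}" using V_subset by (auto simp: ct_def)
  then have "finite {R. ct k R \<noteq> 1}" using finite_nonregular finite_subset by blast
  then show "scaling (ct k)" using t_nonzero by (auto simp: scaling_def ct_def)
  have "cdiv (ct k) = (\<lambda>R. (- int k) * poles t R)"
  proof
    fix R show "cdiv (ct k) R = (- int k) * poles t R"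
    proof (cases "R \<in> V")
      case True
      interpret R: dvr R by (rule dvr_locale[OF True])
      show ?thesis using True t_nonzero by (auto simp: cdiv_def ct_def poles_def R.mem_iff_ord R.ord_power)
    qed (simp add: cdiv_def poles_def)
  qed
  then show "deg (cdiv (ct k)) = - int k * deg (poles t)"
    by (simp only: deg_scale[OF divisor_poles[OF t_nonzero]])
qed

theorem \<alpha>_eventually:
  "\<exists>\<delta>::nat. 1 \<le> \<delta> \<and> (\<exists>k0. \<forall>k\<ge>k0. genus \<iota> X \<le> k * \<delta> \<and>
     \<alpha> TYPE('n::finite) \<iota> X (int (k * \<delta>) * int CARD('n))
       = ((real CARD('k) ^ CARD('n)) ^ (k * \<delta> + 1 - genus \<iota> X) - 1) * \<beta> TYPE('n) \<iota> X 0)"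
proof -
  define \<delta> where "\<delta> = nat (deg (poles t))"
  have \<delta>: "int \<delta> = deg (poles t)" "1 \<le> \<delta>" using deg_poles_pos by (auto simp: \<delta>_def)
  \<comment> \<open>Since \<open>\<delta> \<ge> 1\<close>, this bound guarantees both that the slope
    \<open>k * \<delta>\<close> exceeds \<open>deg D0 + gg - 1\<close> and that it is at least the
    genus, which keeps the subtraction in the exponent exact.\<close>
  define k0 where "k0 = nat (\<bar>deg D0\<bar> + gg + 1)"
  have "genus \<iota> X \<le> k * \<delta> \<and> \<alpha> TYPE('n) \<iota> X (int (k * \<delta>) * int CARD('n))
       = ((real CARD('k) ^ CARD('n)) ^ (k * \<delta> + 1 - genus \<iota> X) - 1) * \<beta> TYPE('n) \<iota> X 0" if k: "k0 \<le> k" for k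
  proof -
    have k': "\<bar>deg D0\<bar> + gg + 1 \<le> int k" using k gg_nonneg by (simp add: k0_def)
    have "k \<le> k * \<delta>" using \<delta>(2) by simp
    then have k\<delta>: "\<bar>deg D0\<bar> + gg + 1 \<le> int (k * \<delta>)" using k' by linarith
    have g: "int (genus \<iota> X) = gg" using gg_nonneg by (simp add: genus_eq)
    have le: "genus \<iota> X \<le> k * \<delta>" using k\<delta> g by linarith
    let ?d = "int (k * \<delta>) * int CARD('n)"
    have "deg D0 + gg - 1 < int (k * \<delta>)" using k\<delta> by linarith
    then have d: "int CARD('n) * (deg D0 + gg - 1) < ?d"
      by (subst mult.commute) (rule mult_strict_right_mono, simp_all)
    have "\<beta> TYPE('n) \<iota> X ?d = \<beta> TYPE('n) \<iota> X 0"
      using \<beta>_tw[OF scaling_ct[of k], where d = 0 and 'n = 'n] \<delta>(1) by (simp add: deg_cdiv_ct algebra_simps)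
    moreover have "nat (?d - int CARD('n) * (gg - 1)) = CARD('n) * (k * \<delta> + 1 - genus \<iota> X)"
    proof -
      have "?d - int CARD('n) * (gg - 1) = int (CARD('n) * (k * \<delta> + 1 - genus \<iota> X))"
      proof -
        have "int (k * \<delta> + 1 - genus \<iota> X) = int (k * \<delta>) - (gg - 1)" using le g by (simp add: of_nat_diff)
        then have "int (CARD('n) * (k * \<delta> + 1 - genus \<iota> X)) = int CARD('n) * (int (k * \<delta>) - (gg - 1))"
          by (simp only: of_nat_mult)
        then show ?thesis by (simp only: right_diff_distrib mult.commute)
      qed
      then show ?thesis by (simp only: nat_int)
    qed
    ultimately show ?thesis using \<alpha>_eq[OF d] le by (simp add: power_mult)
  qed
  then show ?thesis using \<delta>(2) by blast
qed

end

lemma \<alpha>_eventually_curve: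
  fixes \<iota> :: "'k::{field,finite} \<Rightarrow> 'a::field"
  assumes "regular_projective_curve \<iota> X" "struct_sheaf X = range \<iota>"
  shows "\<exists>\<delta>::nat. 1 \<le> \<delta> \<and> (\<exists>k0. \<forall>k\<ge>k0. genus \<iota> X \<le> k * \<delta> \<and>
     \<alpha> TYPE('n::finite) \<iota> X (int (k * \<delta>) * int CARD('n))
       = ((real CARD('k) ^ CARD('n)) ^ (k * \<delta> + 1 - genus \<iota> X) - 1) * \<beta> TYPE('n) \<iota> X 0)"
proof -
  obtain t N u where f: "function_field \<iota> t N u (closed_points X)" and X: "UNIV \<in> X"
    using function_field_closed_points[OF assms] by blast
  interpret f: function_field \<iota> t N u "closed_points X" by (rule f)
  interpret curve \<iota> t N u "closed_points X" X by unfold_locales (use X in auto)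
  show ?thesis by (rule \<alpha>_eventually)
qed

section \<open>Polynomials whose roots lie on a circle\<close>

text \<open>\<open>W\<close> collects the inverse roots with multiplicity, and the normalisation is
  by constant term one.\<close>

definition weil_poly :: "complex multiset \<Rightarrow> complex poly" where
  "weil_poly W = (\<Prod>w\<in>#W. [:1, - w:])"

lemma weil_poly_empty [simp]: "weil_poly {#} = 1"
  by (simp add: weil_poly_def)

lemma weil_poly_add_mset [simp]: "weil_poly (add_mset w W) = [:1, - w:] * weil_poly W"
  by (simp add: weil_poly_def)

lemma coeff_weil_poly_add_mset:
  "coeff (weil_poly (add_mset w W)) j
   = coeff (weil_poly W) j - w * (case j of 0 \<Rightarrow> 0 | Suc i \<Rightarrow> coeff (weil_poly W) i)"
  by (simp add: coeff_pCons split: nat.split)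

lemma coeff_weil_poly_0: "coeff (weil_poly W) 0 = 1"
  by (induction W) (simp_all add: coeff_weil_poly_add_mset del: weil_poly_add_mset)

text \<open>Newton's identity expressing the second elementary symmetric function by power sums. It
  is the source of a lower bound for the second coefficient that is linear in the number of
  roots.\<close>

lemma coeff_weil_poly_2:
  "2 * coeff (weil_poly W) 2 = (coeff (weil_poly W) 1)\<^sup>2 - (\<Sum>w\<in>#W. w\<^sup>2)"
proof (induction W)
  case empty
  have "coeff (1 :: complex poly) 2 = 0" "coeff (1 :: complex poly) 1 = 0"
    by (simp_all add: coeff_1)
  thus ?case by simp
next
  case (add w W)
  have 1: "coeff (weil_poly (add_mset w W)) 2 = coeff (weil_poly W) 2 - w * coeff (weil_poly W) 1"
    unfolding coeff_weil_poly_add_mset by (simp add: numeral_2_eq_2)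
  have 2: "coeff (weil_poly (add_mset w W)) 1 = coeff (weil_poly W) 1 - w"
    unfolding coeff_weil_poly_add_mset by (simp add: coeff_weil_poly_0)
  show ?case using add unfolding 1 2 by (simp add: power2_eq_square algebra_simps)
qed

lemma degree_weil_poly:
  assumes "\<forall>w\<in>#W. w \<noteq> 0"
  shows "degree (weil_poly W) = size W \<and> weil_poly W \<noteq> 0"
  using assms
proof (induction W)
  case (add w W)
  hence "weil_poly W \<noteq> 0" "[:1, - w:] \<noteq> 0" "degree [:1, - w:] = 1" by auto
  thus ?case using add by (auto simp add: degree_mult_eq simp del: mult_pCons_left)
qed simp

lemma norm_coeff_weil_poly_le:
  assumes "\<forall>w\<in>#W. cmod w = s" "0 \<le> s"
  shows "cmod (coeff (weil_poly W) j) \<le> real (size W choose j) * s ^ j"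
  using assms(1)
proof (induction W arbitrary: j)
  case empty
  show ?case by (cases j) (auto simp: coeff_1)
next
  case (add w W)
  show ?case
  proof (cases j)
    case 0
    thus ?thesis by (simp add: coeff_weil_poly_0 del: weil_poly_add_mset)
  next
    case (Suc i)
    have "cmod (coeff (weil_poly (add_mset w W)) j)
      \<le> cmod (coeff (weil_poly W) (Suc i)) + s * cmod (coeff (weil_poly W) i)"
      unfolding coeff_weil_poly_add_mset Suc using add.prems
      by (auto intro!: order_trans[OF norm_triangle_ineq4] simp: norm_mult)
    also have "\<dots> \<le> real (size W choose Suc i) * s ^ Suc i + s * (real (size W choose i) * s ^ i)"
      using add.prems assms(2) by (intro add_mono mult_left_mono add.IH) auto
    also have "\<dots> = real (size (add_mset w W) choose j) * s ^ j"
      using Suc by (simp add: algebra_simps)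
    finally show ?thesis .
  qed
qed

text \<open>Because of \<open>Q = w * cnj w\<close>, the reversed factor \<open>T - w\<close>,
  evaluated at \<open>Q T\<close>, is \<open>- w * (1 - cnj w * T)\<close>.\<close>

lemma reflect_weil_poly:
  assumes "\<forall>w\<in>#W. (cmod w)\<^sup>2 = Q" "0 < Q"
  shows "reflect_poly (weil_poly W) \<circ>\<^sub>p [:0, of_real Q:]
    = Polynomial.smult (\<Prod>w\<in>#W. - w) (weil_poly (image_mset cnj W))"
  using assms(1)
proof (induction W)
  case empty
  show ?case by (simp add: pcompose_1 flip: one_pCons)
next
  case (add w W)
  have "(cmod w)\<^sup>2 = Q" using add.prems by simp
  hence Q: "complex_of_real Q = w * cnj w" by (metis complex_norm_square)
  have w: "w \<noteq> 0" using assms(2) add.prems by auto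
  have "reflect_poly [:1, - w:] = [:- w, 1:]" using w by (simp add: reflect_poly_def)
  hence 1: "reflect_poly [:1, - w:] \<circ>\<^sub>p [:0, of_real Q:] = Polynomial.smult (- w) [:1, - cnj w:]"
    by (simp add: pcompose_pCons Q)
  have "reflect_poly (weil_poly (add_mset w W)) \<circ>\<^sub>p [:0, of_real Q:]
      = (reflect_poly [:1, - w:] \<circ>\<^sub>p [:0, of_real Q:]) * (reflect_poly (weil_poly W) \<circ>\<^sub>p [:0, of_real Q:])"
    by (simp only: weil_poly_add_mset reflect_poly_mult pcompose_mult)
  also have "\<dots> = Polynomial.smult (- w) [:1, - cnj w:]
      * Polynomial.smult (\<Prod>w\<in>#W. - w) (weil_poly (image_mset cnj W))"
    using add by (simp add: 1 del: mult_pCons_left smult_pCons)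
  finally show ?case by (simp add: mult.commute del: mult_pCons_left smult_pCons)
qed

lemma coeff_weil_poly_cnj:
  "coeff (weil_poly (image_mset cnj W)) j = cnj (coeff (weil_poly W) j)"
proof (induction W arbitrary: j)
  case empty
  show ?case by (simp add: coeff_1)
next
  case (add w W)
  thus ?case unfolding image_mset_add_mset coeff_weil_poly_add_mset by (cases j) auto
qed

lemma coeff_pcompose_scale:
  "coeff (p \<circ>\<^sub>p [:0, c:]) j = coeff p j * c ^ j" for c :: "'a::comm_ring_1"
proof (induction p arbitrary: j)
  case (pCons a p)
  thus ?case by (cases j) (simp_all add: pcompose_pCons coeff_pCons algebra_simps)
qed simp

lemma weil_poly_functional_equation:
  assumes "\<forall>w\<in>#W. (cmod w)\<^sup>2 = Q" "0 < Q" "j \<le> size W"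
  shows "coeff (weil_poly W) (size W - j) * of_real Q ^ j
    = (\<Prod>w\<in>#W. - w) * cnj (coeff (weil_poly W) j)"
proof -
  have "degree (weil_poly W) = size W" using assms(1,2) degree_weil_poly[of W] by force
  hence "coeff (reflect_poly (weil_poly W) \<circ>\<^sub>p [:0, of_real Q:]) j
    = coeff (weil_poly W) (size W - j) * of_real Q ^ j"
    using assms(3) by (simp add: coeff_pcompose_scale coeff_reflect_poly)
  thus ?thesis unfolding reflect_weil_poly[OF assms(1,2)] by (simp add: coeff_weil_poly_cnj)
qed

lemma complex_poly_eq_weil_poly:
  fixes p :: "complex poly"
  assumes "p \<noteq> 0" "\<And>z. poly p z = 0 \<Longrightarrow> cmod z = 1 / s" "0 < s"
  obtains W where "size W = degree p" "\<forall>w\<in>#W. cmod w = s" "p = Polynomial.smult (coeff p 0) (weil_poly W)"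
proof -
  obtain A where A: "size A = degree p" "p = Polynomial.smult (lead_coeff p) (\<Prod>x\<in>#A. [:-x, 1:])"
    using alg_closed_imp_factorization[OF assms(1)] by blast
  have root: "cmod z = 1 / s" if "z \<in># A" for z
  proof (rule assms(2))
    have "poly (\<Prod>x\<in>#add_mset z (A - {#z#}). [:-x, 1:]) z = 0" by simp
    hence "poly (\<Prod>x\<in>#A. [:-x, 1:]) z = 0" using that by simp
    thus "poly p z = 0" by (subst A(2)) simp
  qed
  define W where "W = image_mset inverse A"
  have "\<forall>z\<in>#A. cmod z = 1 / s \<Longrightarrow>
      (\<Prod>x\<in>#A. [:-x, 1:]) = Polynomial.smult (\<Prod>x\<in>#A. - x) (weil_poly (image_mset inverse A))" for A
  proof (induction A)
    case (add z A)
    hence "z \<noteq> 0" using assms(3) by auto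
    hence "[:-z, 1:] = Polynomial.smult (- z) [:1, - inverse z:]" by simp
    thus ?case using add by (simp add: mult.commute del: mult_pCons_left smult_pCons)
  qed simp
  hence "p = Polynomial.smult (lead_coeff p * (\<Prod>x\<in>#A. - x)) (weil_poly W)"
    using A(2) root unfolding W_def by (metis smult_smult)
  moreover from this have "coeff p 0 = lead_coeff p * (\<Prod>x\<in>#A. - x)"
    by (metis coeff_smult coeff_weil_poly_0 mult.right_neutral)
  ultimately have "p = Polynomial.smult (coeff p 0) (weil_poly W)" by metis
  moreover have "\<forall>w\<in>#W. cmod w = s" using root assms(3) by (auto simp: W_def norm_inverse)
  ultimately show thesis using A(1) by (intro that[of W]) (auto simp: W_def)
qed

lemma poly_functional_equation_coeffs:
  fixes P :: "real poly" and Q :: real and g :: nat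
  defines "x \<equiv> \<lambda>j. coeff P j / coeff P 0"
  assumes P: "P \<noteq> 0" and Q: "1 < Q"
    and roots: "\<And>z::complex. poly (map_poly complex_of_real P) z = 0 \<Longrightarrow> cmod z = 1 / sqrt Q"
    and eq: "poly P 1 = Q ^ g * poly P (1 / Q)"
  shows "degree P = 2 * g" and "coeff P 0 \<noteq> 0"
    and "\<bar>x j\<bar> \<le> real (2 * g choose j) * sqrt Q ^ j"
    and "j \<le> g \<Longrightarrow> x (2 * g - j) = Q ^ (g - j) * x j"
    and "- (real g * Q) \<le> x 2"
proof -
  define P' where "P' = map_poly complex_of_real P"
  define s where "s = sqrt Q"
  have s: "1 < s" "s\<^sup>2 = Q" using Q by (simp_all add: s_def)
  have coeff_P': "coeff P' j = of_real (coeff P j)" for j by (simp add: P'_def coeff_map_poly)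
  have deg_P': "degree P' = degree P" by (simp add: P'_def degree_map_poly)
  have "P' \<noteq> 0" using P by (simp add: P'_def map_poly_eq_0_iff)
  then obtain W where W: "size W = degree P'" "\<forall>w\<in>#W. cmod w = s"
      "P' = Polynomial.smult (coeff P' 0) (weil_poly W)"
    using complex_poly_eq_weil_poly[of P' s] roots s unfolding P'_def s_def by auto
  show p0: "coeff P 0 \<noteq> 0" using W(3) \<open>P' \<noteq> 0\<close> by (auto simp: coeff_P')
  have x: "complex_of_real (x j) = coeff (weil_poly W) j" for j
  proof -
    have "coeff P' j = coeff P' 0 * coeff (weil_poly W) j" by (subst W(3)) simp
    thus ?thesis using p0 by (simp add: coeff_P' x_def)
  qed
  define D where "D = degree P"
  have D: "size W = D" using W(1) deg_P' by (simp add: D_def)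
  have x0: "x 0 = 1" using p0 by (simp add: x_def)
  have W2: "\<forall>w\<in>#W. (cmod w)\<^sup>2 = Q" using W(2) s by simp
  \<comment> \<open>The coefficients are real, so conjugation disappears. The instance
    \<open>j = 0\<close> identifies the unknown constant, the product of all \<open>- w\<close>,
    with \<open>x D\<close>.\<close>
  have fe: "x (D - j) * Q ^ j = x D * x j" if "j \<le> D" for j
  proof -
    have *: "complex_of_real (x (D - j) * Q ^ j) = (\<Prod>w\<in>#W. - w) * of_real (x j)" if "j \<le> D" for j
      using weil_poly_functional_equation[OF W2, of j] Q that by (simp add: D flip: x)
    have "(\<Prod>w\<in>#W. - w) = of_real (x D)" using *[of 0] by (simp add: x0)
    hence "complex_of_real (x (D - j) * Q ^ j) = of_real (x D * x j)" using *[OF that] by simp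
    thus ?thesis by (simp only: of_real_eq_iff)
  qed
  have "(\<Prod>w\<in>#W. - w) = of_real (x D)"
    using weil_poly_functional_equation[OF W2, of 0] Q by (simp add: D x0 flip: x)
  moreover have "\<forall>w\<in>#W. cmod w = s \<Longrightarrow> cmod (\<Prod>w\<in>#W. - w) = s ^ size W" for W
    by (induction W) (auto simp: norm_mult)
  ultimately have absxD: "\<bar>x D\<bar> = s ^ D" using W(2) D by (metis norm_of_real)
  \<comment> \<open>As \<open>1 < Q\<close>, the point \<open>1\<close> is off the circle of roots.
    This allows \<open>poly P 1\<close> to be cancelled below.\<close>
  have p1: "poly P 1 \<noteq> 0"
  proof
    assume "poly P 1 = 0"
    moreover have "poly P' 1 = of_real (poly P 1)" by (simp add: poly_altdef deg_P' coeff_P')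
    ultimately have "poly P' 1 = 0" by simp
    from roots[OF this[unfolded P'_def]] s show False by (simp add: s_def)
  qed
  have "Q ^ D * (poly P (1 / Q) / coeff P 0) = (\<Sum>j\<le>D. x j * Q ^ (D - j))"
  proof -
    have "Q ^ D * (poly P (1 / Q) / coeff P 0) = (\<Sum>j\<le>D. Q ^ D * (coeff P j * (1 / Q) ^ j / coeff P 0))"
      by (simp add: poly_altdef D_def sum_distrib_left sum_divide_distrib)
    also have "\<dots> = (\<Sum>j\<le>D. x j * Q ^ (D - j))"
      using Q by (intro sum.cong) (auto simp: x_def power_diff field_simps)
    finally show ?thesis .
  qed
  also have "\<dots> = (\<Sum>j\<le>D. x (D - j) * Q ^ j)"
    by (rule sum.reindex_bij_witness[of _ "\<lambda>j. D - j" "\<lambda>j. D - j"]) auto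
  also have "\<dots> = x D * (\<Sum>j\<le>D. x j)"
    unfolding sum_distrib_left by (intro sum.cong refl fe) simp
  also have "(\<Sum>j\<le>D. x j) = poly P 1 / coeff P 0"
    by (simp add: poly_altdef D_def x_def sum_divide_distrib)
  finally have "Q ^ D * poly P (1 / Q) = x D * poly P 1" using p0 by (simp add: field_simps)
  hence "Q ^ D * poly P 1 = x D * Q ^ g * poly P 1" unfolding eq by (simp add: mult_ac)
  hence QD: "Q ^ D = x D * Q ^ g" using p1 by simp
  have "0 < Q ^ D" using Q by simp
  hence "0 < x D * Q ^ g" by (simp only: QD)
  hence "0 < x D" using Q by (simp add: zero_less_mult_iff)
  \<comment> \<open>This is \<open>Q ^ D = x D * Q ^ g\<close> in terms of \<open>s\<close>:
    positivity of \<open>x D\<close> turns its absolute value \<open>s ^ D\<close> into its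
    value.\<close>
  hence "s ^ (2 * D) = s ^ (D + 2 * g)"
    using QD absxD by (simp add: power_add power_mult flip: s(2))
  hence Dg: "D = 2 * g" using s power_inject_exp[of s "2 * D" "D + 2 * g"] by simp
  thus "degree P = 2 * g" by (simp add: D_def)
  have xD: "x D = Q ^ g" using \<open>0 < x D\<close> absxD by (simp add: Dg power_mult s)
  show bound: "\<bar>x j\<bar> \<le> real (2 * g choose j) * sqrt Q ^ j" for j
    using norm_coeff_weil_poly_le[OF W(2), of j] s D Dg by (simp add: s_def flip: x)
  show "x (2 * g - j) = Q ^ (g - j) * x j" if "j \<le> g" for j
  proof -
    have "x (2 * g - j) * Q ^ j = Q ^ (g - j) * x j * Q ^ j"
    proof -
      have "x (2 * g - j) * Q ^ j = Q ^ g * x j" using fe[of j] that unfolding xD unfolding Dg by simp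
      thus ?thesis using that by (simp add: mult_ac flip: power_add)
    qed
    thus ?thesis using Q by simp
  qed
  \<comment> \<open>The power sum of the squares has absolute value at most
    \<open>2 * g * Q\<close>, and the square of \<open>x 1\<close> can only help the lower
    bound.\<close>
  have "complex_of_real (2 * x 2 - (x 1)\<^sup>2) = - (\<Sum>w\<in>#W. w\<^sup>2)"
    using coeff_weil_poly_2[of W] by (simp flip: x)
  hence "\<bar>2 * x 2 - (x 1)\<^sup>2\<bar> = cmod (\<Sum>w\<in>#W. w\<^sup>2)" by (metis norm_minus_cancel norm_of_real)
  also have "\<forall>w\<in>#W. cmod w = s \<Longrightarrow> cmod (\<Sum>w\<in>#W. w\<^sup>2) \<le> real (size W) * s\<^sup>2" for W
  proof (induction W)
    case (add w W)
    thus ?case by (auto intro: order_trans[OF norm_triangle_ineq] simp: algebra_simps norm_power)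
  qed simp
  hence "cmod (\<Sum>w\<in>#W. w\<^sup>2) \<le> real (2 * g) * Q" using W(2) D Dg s by metis
  finally have "- (2 * (real g * Q)) \<le> 2 * x 2 - (x 1)\<^sup>2" by (simp add: abs_le_iff)
  thus "- (real g * Q) \<le> x 2" using zero_le_power2[of "x 1"] by linarith
qed

section \<open>Estimates for the coefficients\<close>

text \<open>The coefficients of \<open>1 / ((1 - T) (1 - Q T))\<close>, as shown in
  \<open>fps_geo\<close>.\<close>

definition geo :: "real \<Rightarrow> nat \<Rightarrow> real" where
  "geo Q m = (\<Sum>j=0..m. Q ^ j)"

lemma geo_0 [simp]: "geo Q 0 = 1" and geo_Suc: "geo Q (Suc m) = geo Q m + Q ^ Suc m"
  by (simp_all add: geo_def)

lemma geo_Suc': "geo Q (Suc m) = 1 + Q * geo Q m"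
proof (induction m)
  case (Suc m)
  show ?case by (subst geo_Suc, subst Suc) (simp add: geo_Suc algebra_simps)
qed (simp add: geo_Suc)

lemma geo_eq: "(Q - 1) * geo Q m = Q ^ Suc m - 1"
  by (induction m) (simp_all add: geo_Suc algebra_simps)

lemma one_le_geo: "0 \<le> Q \<Longrightarrow> 1 \<le> geo Q m"
  by (induction m) (simp_all add: geo_Suc add_increasing2)

lemma geo_ge: "0 \<le> Q \<Longrightarrow> 0 < m \<Longrightarrow> 1 + Q ^ m \<le> geo Q m"
  by (cases m) (use one_le_geo[of Q "m - 1"] in \<open>auto simp: geo_Suc\<close>)

lemma fps_geo: "(1 - fps_X) * (1 - fps_const Q * fps_X) * Abs_fps (geo Q) = 1"
proof -
  have 1: "(1 - fps_X) * Abs_fps (geo Q) = Abs_fps (\<lambda>i. Q ^ i)"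
  proof (rule fps_ext)
    fix i show "fps_nth ((1 - fps_X) * Abs_fps (geo Q)) i = fps_nth (Abs_fps (\<lambda>i. Q ^ i)) i"
      by (cases i) (simp_all add: left_diff_distrib geo_Suc)
  qed
  have 2: "(1 - fps_const Q * fps_X) * Abs_fps (\<lambda>i. Q ^ i) = 1"
  proof (rule fps_ext)
    fix i show "fps_nth ((1 - fps_const Q * fps_X) * Abs_fps (\<lambda>i. Q ^ i)) i = fps_nth 1 i"
      by (cases i) (simp_all add: left_diff_distrib mult.assoc)
  qed
  have "(1 - fps_X) * (1 - fps_const Q * fps_X) * Abs_fps (geo Q)
    = (1 - fps_const Q * fps_X) * ((1 - fps_X) * Abs_fps (geo Q))" by (simp add: mult_ac)
  thus ?thesis by (simp only: 1 2)
qed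

lemma coeff_eq_sum_geo:
  fixes a :: "nat \<Rightarrow> real"
  assumes "fps_of_poly P = (1 - fps_X) * (1 - fps_const Q * fps_X) * Abs_fps a"
  shows "a m = (\<Sum>i=0..m. coeff P i * geo Q (m - i))"
proof -
  have "fps_of_poly P * Abs_fps (geo Q)
    = Abs_fps a * ((1 - fps_X) * (1 - fps_const Q * fps_X) * Abs_fps (geo Q))"
    unfolding assms by (simp only: mult_ac)
  hence "Abs_fps a = fps_of_poly P * Abs_fps (geo Q)" by (simp only: fps_geo mult_1_right)
  hence "fps_nth (Abs_fps a) m = fps_nth (fps_of_poly P * Abs_fps (geo Q)) m" by simp
  thus ?thesis by (simp add: fps_mult_nth)
qed

text \<open>From the degree on, all coefficients of \<open>P\<close> take part in the convolution,
  so the two terms of \<open>geo_eq\<close> sum up to full values of \<open>P\<close>.\<close>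

lemma coeff_eventually_eq:
  fixes a :: "nat \<Rightarrow> real"
  assumes "fps_of_poly P = (1 - fps_X) * (1 - fps_const Q * fps_X) * Abs_fps a"
    and "degree P \<le> m" "Q \<noteq> 0"
  shows "(Q - 1) * a m = Q ^ Suc m * poly P (1 / Q) - poly P 1"
proof -
  have poly_eq: "(\<Sum>i=0..m. coeff P i * z ^ i) = poly P z" for z
    unfolding poly_altdef using assms(2)
    by (intro sum.mono_neutral_right) (auto simp: coeff_eq_0)
  have "(Q - 1) * a m = (\<Sum>i=0..m. coeff P i * ((Q - 1) * geo Q (m - i)))"
    unfolding coeff_eq_sum_geo[OF assms(1)] by (simp add: sum_distrib_left mult_ac)
  also have "\<dots> = (\<Sum>i=0..m. Q ^ Suc m * (coeff P i * (1 / Q) ^ i) - coeff P i)"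
    unfolding geo_eq using assms(3)
    by (intro sum.cong) (auto simp: Suc_diff_le[symmetric] power_diff field_simps)
  also have "\<dots> = Q ^ Suc m * (\<Sum>i=0..m. coeff P i * (1 / Q) ^ i) - (\<Sum>i=0..m. coeff P i * 1 ^ i)"
    by (simp add: sum_subtractf sum_distrib_left)
  finally show ?thesis unfolding poly_eq .
qed

lemma functional_equation:
  fixes a :: "nat \<Rightarrow> real"
  assumes P: "fps_of_poly P = (1 - fps_X) * (1 - fps_const Q * fps_X) * Abs_fps a"
    and Q: "1 < Q" and \<delta>: "1 \<le> \<delta>"
    and ev: "\<And>k. k0 \<le> k \<Longrightarrow> g \<le> k * \<delta> \<and> a (k * \<delta>) = (Q ^ (k * \<delta> + 1 - g) - 1) * b"
  shows "poly P 1 = (Q - 1) * b" and "poly P 1 = Q ^ g * poly P (1 / Q)"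
proof -
  define k where "k = max k0 (degree P)"
  define U where "U = Q ^ g * poly P (1 / Q)"
  define V where "V = (Q - 1) * b"
  define y where "y m = Q ^ (m + 1 - g)" for m
  have main: "(y (l * \<delta>) - 1) * V = y (l * \<delta>) * U - poly P 1" if "k \<le> l" for l
  proof -
    have l: "g \<le> l * \<delta>" "a (l * \<delta>) = (y (l * \<delta>) - 1) * b" "degree P \<le> l * \<delta>"
      using ev[of l] that \<delta> le_trans[of "degree P" l "l * \<delta>"] by (auto simp: k_def y_def)
    have "Q ^ Suc (l * \<delta>) = y (l * \<delta>) * Q ^ g" using l(1) by (simp add: y_def flip: power_add)
    thus ?thesis using coeff_eventually_eq[OF P l(3)] Q l(2) by (simp add: U_def V_def mult_ac)
  qed
  \<comment> \<open>The subtraction in the exponent is exact because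
    \<open>g \<le> k * \<delta>\<close>, so two consecutive admissible indices give different
    powers. Subtracting their equations isolates \<open>V - U\<close>.\<close>
  have "y (k * \<delta>) < y (Suc k * \<delta>)"
    unfolding y_def using Q \<delta> ev[of k] by (intro power_strict_increasing) (auto simp: k_def)
  moreover have "(y (Suc k * \<delta>) - y (k * \<delta>)) * (V - U) = 0"
    using main[of k] main[of "Suc k"] by (simp add: algebra_simps)
  ultimately have "V = U" by simp
  thus "poly P 1 = (Q - 1) * b" using main[of k] by (simp add: V_def algebra_simps)
  thus "poly P 1 = Q ^ g * poly P (1 / Q)" using \<open>V = U\<close> by (simp add: V_def U_def)
qed

text \<open>Brings the natural bound into the shape of the theorem. Each increase of
  \<open>m\<close> adds the new powers of \<open>Q\<close>; those belonging to
  \<open>j \<ge> 2\<close> have exponent at most \<open>m\<close>, which gives \<open>Q ^ m\<close>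
  times a partial sum of the \<open>b j\<close>. The term \<open>b 1 * Q ^ m\<close> of the
  preceding stage completes that partial sum, so only the newest term with \<open>b 1\<close>
  remains.\<close>

lemma sum_geo_le:
  assumes "\<And>j. 0 \<le> b j" "1 \<le> Q"
  shows "(\<Sum>j=1..Suc m. b j * geo Q (Suc m - j))
    \<le> (\<Sum>k=3..Suc m + 1. Q ^ (k - 3) * (\<Sum>i=1..k. b (i - 1))) + b 1 * Q ^ m"
proof (induction m)
  case 0
  show ?case by simp
next
  case (Suc m)
  have "(\<Sum>j=1..Suc (Suc m). b j * geo Q (Suc (Suc m) - j))
    = (\<Sum>j=1..Suc m. b j * geo Q (Suc m - j) + b j * Q ^ Suc (Suc m - j)) + b (Suc (Suc m))"
    by (simp add: Suc_diff_le geo_Suc algebra_simps)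
  also have "\<dots> = (\<Sum>j=1..Suc m. b j * geo Q (Suc m - j))
      + ((\<Sum>j=1..Suc m. b j * Q ^ Suc (Suc m - j)) + b (Suc (Suc m)))"
    by (simp add: sum.distrib)
  also have "(\<Sum>j=1..Suc m. b j * Q ^ Suc (Suc m - j)) + b (Suc (Suc m))
    = (\<Sum>j=1..Suc (Suc m). b j * Q ^ (Suc (Suc m) - j))"
    by (simp add: Suc_diff_le)
  also have "\<dots> = b 1 * Q ^ Suc m + (\<Sum>j=2..Suc (Suc m). b j * Q ^ (Suc (Suc m) - j))"
    by (subst sum.atLeast_Suc_atMost) (auto simp: numeral_2_eq_2)
  also have "(\<Sum>j=2..Suc (Suc m). b j * Q ^ (Suc (Suc m) - j)) \<le> (\<Sum>j=2..Suc (Suc m). b j * Q ^ m)"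
    using assms by (intro sum_mono mult_left_mono power_increasing) auto
  also have "\<dots> = Q ^ m * (\<Sum>j=2..Suc (Suc m). b j)"
    unfolding sum_distrib_left by (intro sum.cong refl mult.commute)
  also have "(\<Sum>j=2..Suc (Suc m). b j) = (\<Sum>i=3..Suc (Suc (Suc m)). b (i - 1))"
    by (rule sum.reindex_bij_witness[of _ "\<lambda>j. j - 1" Suc]) auto
  also have "\<dots> \<le> (\<Sum>i=1..Suc (Suc (Suc m)). b (i - 1)) - b 1"
  proof -
    have "(\<Sum>i=1..Suc (Suc (Suc m)). b (i - 1)) = b 0 + (b 1 + (\<Sum>i=3..Suc (Suc (Suc m)). b (i - 1)))"
      by (subst sum.atLeast_Suc_atMost, simp, subst sum.atLeast_Suc_atMost) (auto simp: numeral_3_eq_3)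
    thus ?thesis using assms(1)[of 0] by simp
  qed
  finally have "(\<Sum>j=1..Suc (Suc m). b j * geo Q (Suc (Suc m) - j))
    \<le> (\<Sum>j=1..Suc m. b j * geo Q (Suc m - j)) + (b 1 * Q ^ Suc m
      + Q ^ m * ((\<Sum>i=1..Suc (Suc (Suc m)). b (i - 1)) - b 1))"
    using assms(2) by (simp add: mult_left_mono)
  also have "\<dots> \<le> (\<Sum>k=3..Suc m + 1. Q ^ (k - 3) * (\<Sum>i=1..k. b (i - 1))) + b 1 * Q ^ m
     + (b 1 * Q ^ Suc m + Q ^ m * ((\<Sum>i=1..Suc (Suc (Suc m)). b (i - 1)) - b 1))"
    using Suc.IH by simp
  also have "\<dots> = (\<Sum>k=3..Suc m + 1. Q ^ (k - 3) * (\<Sum>i=1..k. b (i - 1)))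
     + Q ^ m * (\<Sum>i=1..Suc (Suc (Suc m)). b (i - 1)) + b 1 * Q ^ Suc m"
    by (simp only: right_diff_distrib) (simp only: mult_ac add_diff_eq)
  also have "(\<Sum>k=3..Suc m + 1. Q ^ (k - 3) * (\<Sum>i=1..k. b (i - 1)))
     + Q ^ m * (\<Sum>i=1..Suc (Suc (Suc m)). b (i - 1))
     = (\<Sum>k=3..Suc (Suc m) + 1. Q ^ (k - 3) * (\<Sum>i=1..k. b (i - 1)))"
    by (simp add: sum.cl_ivl_Suc)
  finally show ?case .
qed

text \<open>The functional equation folds the upper half of the coefficients onto the lower half;
  the middle coefficient is counted once.\<close>

lemma sum_functional_equation:
  fixes x :: "nat \<Rightarrow> real"
  assumes "\<And>j. j \<le> g \<Longrightarrow> x (2 * g - j) = Q ^ (g - j) * x j"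
  shows "(\<Sum>j=0..2*g. x j) = (\<Sum>j=0..g. x j * (if j = g then 1 else 1 + Q ^ (g - j)))"
proof -
  have "(\<Sum>j=0..2*g. x j) = (\<Sum>j=0..g. x j) + (\<Sum>j=Suc g..2*g. x j)"
    using sum.ub_add_nat[of 0 g x g] by (simp add: mult_2)
  also have "(\<Sum>j=Suc g..2*g. x j) = (\<Sum>j\<in>{0..<g}. x (2 * g - j))"
    by (rule sum.reindex_bij_witness[of _ "\<lambda>j. 2 * g - j" "\<lambda>j. 2 * g - j"]) auto
  also have "\<dots> = (\<Sum>j\<in>{0..<g}. Q ^ (g - j) * x j)" using assms by (intro sum.cong) auto
  also have "\<dots> = (\<Sum>j=0..g. if j = g then 0 else Q ^ (g - j) * x j)"
    by (intro sum.mono_neutral_cong_left) auto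
  finally have "(\<Sum>j=0..2*g. x j)
      = (\<Sum>j=0..g. x j + (if j = g then 0 else Q ^ (g - j) * x j))" by (simp only: sum.distrib)
  also have "\<dots> = (\<Sum>j=0..g. x j * (if j = g then 1 else 1 + Q ^ (g - j)))"
    by (intro sum.cong) (auto simp: algebra_simps)
  finally show ?thesis .
qed

text \<open>The terms with \<open>j \<noteq> 2\<close> are estimated by \<open>\<bar>x j\<bar> \<le> b j\<close>.  For the lower bound this does not
  suffice: \<open>Q + \<dots> + Q^(g - 1)\<close> has to be absorbed, and there is room for it in the term with
  \<open>j = 2\<close>, because \<open>x 2\<close> is bounded below by a linear, not a quadratic, function of \<open>g\<close>.\<close>

lemma abs_sum_functional_equation_le:
  fixes x :: "nat \<Rightarrow> real"
  assumes x: "\<And>j. j \<le> g \<Longrightarrow> x (2 * g - j) = Q ^ (g - j) * x j" "x 0 = 1"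
    and b: "\<And>j. \<bar>x j\<bar> \<le> b j" "b 2 = real (2 * g choose 2) * Q" and x2: "- (real g * Q) \<le> x 2"
    and Q: "1 \<le> Q" and g: "0 < g"
  shows "\<bar>(\<Sum>j=0..2*g. x j) - geo Q g\<bar> \<le> (\<Sum>j=1..g. b j * geo Q (g - j))"
proof -
  define c where "c j = (if j = g then 1 else 1 + Q ^ (g - j))" for j
  \<comment> \<open>\<open>G\<close> is \<open>Q + \<dots> + Q^(g - 1)\<close>, the part of
    \<open>geo Q g\<close> that does not come from the outermost coefficients \<open>x 0\<close> and
    \<open>x (2 * g)\<close>.\<close>
  define G where "G = geo Q g - 1 - Q ^ g"
  have G0: "0 \<le> G" using geo_ge[of Q g] Q g by (simp add: G_def)
  have G2: "G = Q * geo Q (g - 2)" if "2 \<le> g"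
  proof -
    define h where "h = g - 2"
    have h: "g = Suc (Suc h)" using that by (simp add: h_def)
    have "G = geo Q (Suc h) - 1" unfolding G_def h geo_Suc[of Q "Suc h"] by simp
    thus ?thesis unfolding geo_Suc' by (simp add: h)
  qed
  have c: "0 \<le> c j" "c j \<le> geo Q (g - j)" if "j \<le> g" for j
    using that Q geo_ge[of Q "g - j"] by (auto simp: c_def)
  have "(\<Sum>j=0..2*g. x j) = (\<Sum>j=0..g. x j * c j)"
    unfolding c_def by (rule sum_functional_equation[OF x(1)])
  also have "\<dots> = 1 + Q ^ g + (\<Sum>j=1..g. x j * c j)"
    by (subst sum.atLeast_Suc_atMost) (use g x(2) in \<open>auto simp: c_def\<close>)
  finally have eq: "(\<Sum>j=0..2*g. x j) - geo Q g = (\<Sum>j=1..g. x j * c j) - G"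
    by (simp add: G_def)
  have tm: "\<bar>x j * c j\<bar> \<le> b j * geo Q (g - j)" if "j \<le> g" for j
    unfolding abs_mult using c[OF that] b(1)[of j] by (intro mult_mono) auto
  have "(\<Sum>j=1..g. x j * c j) \<le> (\<Sum>j=1..g. b j * geo Q (g - j))"
    using tm by (intro sum_mono) (auto simp: abs_le_iff)
  moreover have "G - (\<Sum>j=1..g. b j * geo Q (g - j)) \<le> (\<Sum>j=1..g. x j * c j)"
  proof (cases "2 \<le> g")
    case True
    \<comment> \<open>The binomial coefficient equals \<open>g * (2 * g - 1)\<close>, at least
      \<open>1 + g\<close> for \<open>g \<ge> 2\<close>: one copy of
      \<open>Q * geo Q (g - 2)\<close> pays for \<open>G\<close>, and \<open>g\<close> copies pay
      for the lower bound on \<open>x 2 * c 2\<close>.\<close>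
    have "(1 + real g) * (Q * geo Q (g - 2)) \<le> real (2 * g choose 2) * (Q * geo Q (g - 2))"
    proof (rule mult_right_mono)
      have "2 * g choose 2 = g * (2 * g - 1)" by (simp add: choose_two)
      moreover have "1 + g \<le> g * (2 * g - 1)"
      proof -
        have "g * 3 \<le> g * (2 * g - 1)" using True by (intro mult_le_mono2) simp
        thus ?thesis using True by linarith
      qed
      ultimately have "1 + g \<le> 2 * g choose 2" by simp
      thus "1 + real g \<le> real (2 * g choose 2)" by (metis of_nat_1 of_nat_add of_nat_le_iff)
    qed (use Q one_le_geo[of Q "g - 2"] in simp)
    moreover have "real g * Q * c 2 \<le> real g * Q * geo Q (g - 2)"
      using c(2)[OF True] Q by (intro mult_left_mono) auto
    moreover have "- (real g * Q) * c 2 \<le> x 2 * c 2"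
      using c(1)[OF True] x2 by (rule mult_right_mono[rotated])
    ultimately have 2: "G - b 2 * geo Q (g - 2) \<le> x 2 * c 2"
      unfolding G2[OF True] b(2) by (simp add: algebra_simps)
    have "G - (\<Sum>j=1..g. b j * geo Q (g - j))
      = (\<Sum>j=1..g. (if j = 2 then G else 0) - b j * geo Q (g - j))"
      using True by (simp add: sum_subtractf)
    also have "\<dots> \<le> (\<Sum>j=1..g. x j * c j)"
    proof (rule sum_mono)
      fix j assume "j \<in> {1..g}"
      thus "(if j = 2 then G else 0) - b j * geo Q (g - j) \<le> x j * c j"
        using 2 tm[of j] by (auto simp: abs_le_iff)
    qed
    finally show ?thesis .
  next
    case False
    \<comment> \<open>In genus one \<open>G\<close> is zero and nothing has to be absorbed.\<close>
    hence "g = 1" using g by simp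
    thus ?thesis using tm[of 1] by (simp add: G_def geo_Suc abs_le_iff)
  qed
  ultimately show ?thesis unfolding eq using G0 by (simp add: abs_le_iff)
qed

lemma abs_sum_geo_le:
  fixes x :: "nat \<Rightarrow> real"
  assumes "x 0 = 1" "\<And>j. \<bar>x j\<bar> \<le> b j" "0 \<le> Q"
  shows "\<bar>(\<Sum>i=0..m. x i * geo Q (m - i)) - geo Q m\<bar> \<le> (\<Sum>j=1..m. b j * geo Q (m - j))"
proof -
  have "(\<Sum>i=0..m. x i * geo Q (m - i)) - geo Q m = (\<Sum>j=1..m. x j * geo Q (m - j))"
    by (subst sum.atLeast_Suc_atMost) (use assms(1) in auto)
  also have "\<bar>\<dots>\<bar> \<le> (\<Sum>j=1..m. \<bar>x j * geo Q (m - j)\<bar>)" by (rule sum_abs)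
  also have "\<dots> \<le> (\<Sum>j=1..m. b j * geo Q (m - j))"
  proof (rule sum_mono)
    fix j show "\<bar>x j * geo Q (m - j)\<bar> \<le> b j * geo Q (m - j)"
      unfolding abs_mult using assms(2)[of j] one_le_geo[OF assms(3), of "m - j"]
      by (intro mult_mono) auto
  qed
  finally show ?thesis .
qed

text \<open>The two shifts by \<open>T^(g - 1)\<close> cancel, so the Laurent series is an ordinary
  power series, also in genus zero.\<close>

lemma P_series_eq:
  "P_series n \<iota> X = fps_to_fls ((1 - fps_X) * (1 - fps_const (real CARD('k) ^ CARD('n)) * fps_X)
     * Abs_fps (\<lambda>m. \<alpha> (n :: 'n::finite itself) \<iota> X (int m * int CARD('n))))"
  for \<iota> :: "'k::{field,finite} \<Rightarrow> 'a::field"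
proof -
  let ?A = "fps_to_fls (Abs_fps (\<lambda>m. \<alpha> n \<iota> X (int m * int CARD('n))))"
  let ?B = "(1 - fls_X) * (1 - fls_const (real CARD('k) ^ CARD('n)) * fls_X)"
  have "P_series n \<iota> X = ?B * (fls_X_intpow (int (genus \<iota> X) - 1)
      * fls_shift (int (genus \<iota> X) - 1) ?A)"
    by (simp only: P_series_def Z_hat_def mult_ac)
  also have "\<dots> = ?B * ?A" unfolding fls_X_intpow_times_conv_shift by simp
  finally show ?thesis by (simp add: fls_times_fps_to_fls)
qed

theorem proposition3p1:
  fixes \<iota> :: "'k::{field,finite} \<Rightarrow> 'a::field" and X :: "'a set set"
    and n g :: nat and Q :: real
  assumes curve: "regular_projective_curve \<iota> X"
    and constants: "struct_sheaf X = range \<iota>"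
    and genus: "g = genus \<iota> X"
    and rank: "n = CARD('n::finite)"
    and Q: "Q = real CARD('k) ^ n"
    and RH: "rank_riemann_hypothesis TYPE('n) \<iota> X"
  shows
    "(Q + 1 - 2 * real g * sqrt Q \<le> \<alpha>' TYPE('n) \<iota> X (int n) \<and>
     \<alpha>' TYPE('n) \<iota> X (int n) \<le> Q + 1 + 2 * real g * sqrt Q) \<and>
     (\<forall>m::nat. 2 \<le> m \<and> int m \<le> int g - 1 \<longrightarrow>
       \<bar>\<alpha>' TYPE('n) \<iota> X (int (m * n)) - (\<Sum>j=0..m. Q ^ j)\<bar>
       \<le> (\<Sum>k=3..m+1. Q ^ (k - 3) *
             (\<Sum>i=1..k. real ((2 * g) choose (i - 1)) * Q powr (real (i - 1) / 2)))
          + 2 * real g * Q ^ (m - 1) * sqrt Q) \<and>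
     \<bar>(Q - 1) * \<beta>' TYPE('n) \<iota> X 0 - (\<Sum>j=0..g. Q ^ j)\<bar>
       \<le> (\<Sum>k=3..g+1. Q ^ (k - 3) *
             (\<Sum>i=1..k. real ((2 * g) choose (i - 1)) * Q powr (real (i - 1) / 2)))
          + 2 * real g * Q powi (int g - 1) * sqrt Q"
proof -
  have "card {0 :: 'k, 1} \<le> CARD('k)" by (rule card_mono) auto
  hence "1 < real CARD('k)" by simp
  hence Q1: "1 < Q" unfolding Q rank by (intro one_less_power) simp_all
  define a where "a m = \<alpha> TYPE('n) \<iota> X (int m * int n)" for m
  define b where "b j = real (2 * g choose j) * sqrt Q ^ j" for j
  obtain P where P: "fps_to_fls (fps_of_poly P) = P_series TYPE('n) \<iota> X"
      and roots: "\<And>z. poly (map_poly complex_of_real P) z = 0 \<Longrightarrow> cmod z = Q powr (- 1 / 2)"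
    using RH unfolding rank_riemann_hypothesis_def Q rank by auto
  have PA: "fps_of_poly P = (1 - fps_X) * (1 - fps_const Q * fps_X) * Abs_fps a"
    using P unfolding P_series_eq fps_to_fls_eq_iff a_def Q rank .
  have "Q powr (- 1 / 2) = 1 / sqrt Q"
    using Q1 by (simp add: powr_minus_divide powr_half_sqrt)
  hence roots': "cmod z = 1 / sqrt Q" if "poly (map_poly complex_of_real P) z = 0" for z
    using roots[OF that] by simp
  \<comment> \<open>The zero polynomial has the root \<open>0\<close>, which is not on the
    circle.\<close>
  have "P \<noteq> 0"
  proof
    assume "P = 0"
    hence "1 / sqrt Q = cmod 0" using roots'[of 0] by simp
    thus False using Q1 by simp
  qed
  obtain \<delta> k0 where \<delta>: "1 \<le> \<delta>" and ev: "\<And>k. k0 \<le> k \<Longrightarrow> g \<le> k * \<delta> \<and>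
      a (k * \<delta>) = (Q ^ (k * \<delta> + 1 - g) - 1) * \<beta> TYPE('n) \<iota> X 0"
    using \<alpha>_eventually_curve[OF curve constants, where 'n = 'n]
    unfolding a_def Q rank genus by blast
  have fe: "poly P 1 = (Q - 1) * \<beta> TYPE('n) \<iota> X 0" "poly P 1 = Q ^ g * poly P (1 / Q)"
    using functional_equation[OF PA Q1 \<delta>, of k0 g] ev by blast+
  note coeffs = poly_functional_equation_coeffs[OF \<open>P \<noteq> 0\<close> Q1 roots' fe(2)]
  define x where "x j = coeff P j / coeff P 0" for j
  have x: "\<bar>x j\<bar> \<le> b j" "x 0 = 1" "- (real g * Q) \<le> x 2" for j
    using coeffs(2,3,5) by (auto simp: x_def b_def)
  have x_refl: "x (2 * g - j) = Q ^ (g - j) * x j" if "j \<le> g" for j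
    using coeffs(4) that by (simp add: x_def)
  have b: "0 \<le> b j" "b 1 = 2 * real g * sqrt Q" "b 2 = real (2 * g choose 2) * Q" for j
    using Q1 by (simp_all add: b_def)
  have deg: "degree P = 2 * g" using coeffs(1) by blast
  \<comment> \<open>Dividing by \<open>\<alpha>(0)\<close> is the same as normalising
    \<open>P\<close> to constant term one; that this term is non-zero is part of
    \<open>coeffs\<close>.\<close>
  have a0: "a 0 = coeff P 0" using coeff_eq_sum_geo[OF PA, of 0] by simp
  have \<alpha>'_eq: "\<alpha>' TYPE('n) \<iota> X (int (m * n)) = (\<Sum>i=0..m. x i * geo Q (m - i))" for m
  proof -
    have "\<alpha>' TYPE('n) \<iota> X (int (m * n)) = a m / a 0" by (simp add: \<alpha>'_def a_def)
    thus ?thesis unfolding coeff_eq_sum_geo[OF PA, of m] a0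
      by (simp add: x_def sum_divide_distrib)
  qed
  have \<beta>'_eq: "(Q - 1) * \<beta>' TYPE('n) \<iota> X 0 = (\<Sum>j=0..2*g. x j)"
  proof -
    have "(Q - 1) * \<beta>' TYPE('n) \<iota> X 0 = poly P 1 / coeff P 0"
      by (simp add: \<beta>'_def fe(1) flip: a0) (simp add: a_def)
    thus ?thesis
      by (simp add: poly_altdef deg x_def sum_divide_distrib atLeast0AtMost)
  qed
  have b_powr: "real ((2 * g) choose (i - 1)) * Q powr (real (i - 1) / 2) = b (i - 1)" for i
    using Q1 by (simp add: b_def sqrt_def root_powr_inverse powr_powr flip: powr_realpow)
  have T: "(\<Sum>j=1..m. b j * geo Q (m - j))
      \<le> (\<Sum>k=3..m+1. Q ^ (k - 3) * (\<Sum>i=1..k. b (i - 1))) + 2 * real g * Q ^ (m - 1) * sqrt Q"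
    if "0 < m" for m
    using sum_geo_le[of b Q "m - 1"] b Q1 that by (simp add: mult_ac)
  have est: "\<bar>\<alpha>' TYPE('n) \<iota> X (int (m * n)) - (\<Sum>j=0..m. Q ^ j)\<bar>
      \<le> (\<Sum>j=1..m. b j * geo Q (m - j))" for m
    unfolding \<alpha>'_eq geo_def[symmetric] by (rule abs_sum_geo_le) (use x Q1 in auto)
  have 1: "\<bar>\<alpha>' TYPE('n) \<iota> X (int n) - (Q + 1)\<bar> \<le> 2 * real g * sqrt Q"
    using est[of 1] b(2) by (simp add: add.commute)
  have 3: "\<bar>(Q - 1) * \<beta>' TYPE('n) \<iota> X 0 - (\<Sum>j=0..g. Q ^ j)\<bar>
     \<le> (\<Sum>k=3..g+1. Q ^ (k - 3) * (\<Sum>i=1..k. b (i - 1))) + 2 * real g * Q powi (int g - 1) * sqrt Q"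
  \<comment> \<open>In genus zero the exponent of \<open>powi\<close> is \<open>- 1\<close>, but the
    term carries the factor \<open>g\<close>. Here \<open>P\<close> is constant, and both sides of
    the estimate are zero.\<close>
  proof (cases "g = 0")
    case True
    thus ?thesis unfolding \<beta>'_eq by (simp add: x(2))
  next
    case False
    hence "\<bar>(Q - 1) * \<beta>' TYPE('n) \<iota> X 0 - geo Q g\<bar> \<le> (\<Sum>j=1..g. b j * geo Q (g - j))"
      unfolding \<beta>'_eq using x x_refl b(3) Q1 by (intro abs_sum_functional_equation_le) auto
    moreover have "Q powi (int g - 1) = Q ^ (g - 1)"
      using False by (simp add: power_int_def nat_diff_distrib)
    ultimately show ?thesis using T[of g] False unfolding geo_def[of Q g] by simp
  qed
  have 2: "\<bar>\<alpha>' TYPE('n) \<iota> X (int (m * n)) - (\<Sum>j=0..m. Q ^ j)\<bar>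
      \<le> (\<Sum>k=3..m+1. Q ^ (k - 3) * (\<Sum>i=1..k. b (i - 1))) + 2 * real g * Q ^ (m - 1) * sqrt Q"
    if "2 \<le> m" for m
    using order_trans[OF est T, of m] that by simp
  have 1: "Q + 1 - 2 * real g * sqrt Q \<le> \<alpha>' TYPE('n) \<iota> X (int n) \<and>
      \<alpha>' TYPE('n) \<iota> X (int n) \<le> Q + 1 + 2 * real g * sqrt Q"
    using 1 by linarith
  show ?thesis unfolding b_powr by (intro conjI[OF 1] conjI[OF _ 3] allI impI 2) simp
qed

end
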